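(* Let $(W,S)$ be a Coxeter system whose Coxeter graph is a tree. Let $I\subseteq J\subseteq S$ and let $u,v\in W^J$ be boolean elements of $W$. Then $$P_{u,v}^{J,q}(q)\le P_{u,v}^{I,q}(q)$$ coefficientwise, i.e. for every $k\ge 0$ the coefficient of $q^k$ in $P^{J,q}_{u,v}(q)$ is at most the coefficient of $q^k$ in $P^{I,q}_{u,v}(q)$.
   Context: $l$ is the length function and $\le$ on $W$ is Bruhat order. The Coxeter graph has vertex set $S$ and an edge between $s,s'$ iff $ss'\neq s's$. For $J\subseteq S$, $W_J$ is the subgroup generated by $J$ and $W^J=\{u\in W: l(su)>l(u)\ \forall s\in J\}$ (so $W^J\subseteq W^I$ if $I\subseteq J$). $P_{x,y}(q)$ are the ordinary Kazhdan--Lusztig polynomials ($0$ if $x\not\le y$). The parabolic Kazhdan--Lusztig polynomials of type $q$ (Deodhar) satisfy, and may be defined by, $P^{J,q}_{u,v}(q)=\sum_{w\in W_J}(-1)^{l(w)}P_{wu,v}(q)$ for $u,v\in W^J$. A boolean reflection is a reflection having a reduced expression $s_1\cdots s_{n-1}s_ns_{n-1}\cdots s_1$ with $s_1,\dots,s_n\in S$ pairwise distinct; an element of $W$ is boolean if it is $\le$ some boolean reflection. *)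

theory Defs
  imports
    "HOL-Algebra.Generated_Groups"
    "HOL-Algebra.Multiplicative_Group"
    "HOL-Computational_Algebra.Polynomial"
begin

section \<open>Coxeter systems\<close>

definition word_prod :: "('a, 'b) monoid_scheme \<Rightarrow> 'a list \<Rightarrow> 'a" where
  "word_prod G ws = foldr (\<otimes>\<^bsub>G\<^esub>) ws \<one>\<^bsub>G\<^esub>"

text \<open>Deletion of one factor \<open>(st)\<^bsup>m(s,t)\<^esup>\<close>, where \<open>m(s,t)\<close> is the order of \<open>st\<close>. Since
  \<^const>\<open>group.ord\<close> is \<open>0\<close> for elements of infinite order, pairs with \<open>m(s,t) = \<infinity>\<close> give the
  empty relator; \<open>s = t\<close> gives the relator \<open>ss\<close>.\<close>
inductive relator_step :: "('a, 'b) monoid_scheme \<Rightarrow> 'a set \<Rightarrow> 'a list \<Rightarrow> 'a list \<Rightarrow> bool"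
  for G and S where
  "\<lbrakk>s \<in> S; t \<in> S; xs \<in> lists S; ys \<in> lists S\<rbrakk> \<Longrightarrow>
     relator_step G S
       (xs @ concat (replicate (group.ord G (s \<otimes>\<^bsub>G\<^esub> t)) [s, t]) @ ys) (xs @ ys)"

text \<open>The group is presented by the involutions \<open>S\<close> subject to the relations
  \<open>(st)\<^bsup>m(s,t)\<^esup> = 1\<close>. As \<open>ss\<close> is among the relators, words without formal inverses
  suffice. \<open>S\<close> may be infinite.\<close>
locale coxeter_system = group G for G (structure) +
  fixes S :: "'a set"
  assumes gens_closed: "S \<subseteq> carrier G"
    and gens_involution: "s \<in> S \<Longrightarrow> ord s = 2"
    and gens_generate: "generate G S = carrier G"
    and presentation: "ws \<in> lists S \<Longrightarrow> word_prod G ws = \<one> \<Longrightarrow> equivclp (relator_step G S) ws []"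

definition cox_length :: "('a, 'b) monoid_scheme \<Rightarrow> 'a set \<Rightarrow> 'a \<Rightarrow> nat" where
  "cox_length G S w = (LEAST n. \<exists>ws\<in>lists S. length ws = n \<and> word_prod G ws = w)"

definition reduced_expression :: "('a, 'b) monoid_scheme \<Rightarrow> 'a set \<Rightarrow> 'a list \<Rightarrow> 'a \<Rightarrow> bool" where
  "reduced_expression G S ws w \<longleftrightarrow>
     ws \<in> lists S \<and> word_prod G ws = w \<and> length ws = cox_length G S w"

definition reflections :: "('a, 'b) monoid_scheme \<Rightarrow> 'a set \<Rightarrow> 'a set" where
  "reflections G S = {w \<otimes>\<^bsub>G\<^esub> s \<otimes>\<^bsub>G\<^esub> inv\<^bsub>G\<^esub> w | w s. w \<in> carrier G \<and> s \<in> S}"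

definition bruhat_step :: "('a, 'b) monoid_scheme \<Rightarrow> 'a set \<Rightarrow> 'a \<Rightarrow> 'a \<Rightarrow> bool" where
  "bruhat_step G S u v \<longleftrightarrow>
     (\<exists>t\<in>reflections G S. v = u \<otimes>\<^bsub>G\<^esub> t) \<and> cox_length G S u < cox_length G S v"

definition bruhat_le :: "('a, 'b) monoid_scheme \<Rightarrow> 'a set \<Rightarrow> 'a \<Rightarrow> 'a \<Rightarrow> bool" where
  "bruhat_le G S u v \<longleftrightarrow> u \<in> carrier G \<and> v \<in> carrier G \<and> (bruhat_step G S)\<^sup>*\<^sup>* u v"

definition boolean_reflection :: "('a, 'b) monoid_scheme \<Rightarrow> 'a set \<Rightarrow> 'a \<Rightarrow> bool" where
  "boolean_reflection G S t \<longleftrightarrow> t \<in> reflections G S \<and>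
     (\<exists>xs s. distinct (xs @ [s]) \<and> reduced_expression G S (xs @ [s] @ rev xs) t)"

definition boolean_element :: "('a, 'b) monoid_scheme \<Rightarrow> 'a set \<Rightarrow> 'a \<Rightarrow> bool" where
  "boolean_element G S w \<longleftrightarrow> (\<exists>t. boolean_reflection G S t \<and> bruhat_le G S w t)"


section \<open>The Coxeter graph\<close>

definition cox_adj :: "('a, 'b) monoid_scheme \<Rightarrow> 'a set \<Rightarrow> 'a \<Rightarrow> 'a \<Rightarrow> bool" where
  "cox_adj G S s t \<longleftrightarrow> s \<in> S \<and> t \<in> S \<and> s \<otimes>\<^bsub>G\<^esub> t \<noteq> t \<otimes>\<^bsub>G\<^esub> s"

definition graph_tree :: "'a set \<Rightarrow> ('a \<Rightarrow> 'a \<Rightarrow> bool) \<Rightarrow> bool" where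
  "graph_tree V E \<longleftrightarrow>
     (\<forall>x\<in>V. \<forall>y\<in>V. E\<^sup>*\<^sup>* x y) \<and>
     \<not> (\<exists>c. set c \<subseteq> V \<and> length c \<ge> 3 \<and> distinct c \<and> successively E c \<and> E (last c) (hd c))"


section \<open>Kazhdan--Lusztig polynomials\<close>

abbreviation q_var :: "int poly" where
  "q_var \<equiv> [:0, 1:]"

text \<open>\<open>q\<^bsup>d\<^esup> p(q\<^bsup>-1\<^esup>)\<close>, provided the degree of \<open>p\<close> is at most \<open>d\<close>.\<close>
definition poly_flip :: "nat \<Rightarrow> int poly \<Rightarrow> int poly" where
  "poly_flip d p = (\<Sum>i\<le>d. Polynomial.monom (Polynomial.coeff p (d - i)) i)"

text \<open>The properties that characterise the families of \<open>R\<close>-polynomials and of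
  Kazhdan--Lusztig polynomials uniquely (Bjoerner and Brenti, Combinatorics of Coxeter groups,
  Theorems 5.1.1 and 5.1.4). Pairs outside the group are sent to \<open>0\<close>, because
  \<open>bruhat_le\<close> relates group elements only.\<close>
definition R_family :: "('a, 'b) monoid_scheme \<Rightarrow> 'a set \<Rightarrow> ('a \<Rightarrow> 'a \<Rightarrow> int poly) \<Rightarrow> bool" where
  "R_family G S R \<longleftrightarrow>
     (\<forall>u v. \<not> bruhat_le G S u v \<longrightarrow> R u v = 0) \<and>
     (\<forall>u\<in>carrier G. R u u = 1) \<and>
     (\<forall>u\<in>carrier G. \<forall>v\<in>carrier G. \<forall>s\<in>S.
        cox_length G S (v \<otimes>\<^bsub>G\<^esub> s) < cox_length G S v \<longrightarrow>
        R u v =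
          (if cox_length G S (u \<otimes>\<^bsub>G\<^esub> s) < cox_length G S u
           then R (u \<otimes>\<^bsub>G\<^esub> s) (v \<otimes>\<^bsub>G\<^esub> s)
           else q_var * R (u \<otimes>\<^bsub>G\<^esub> s) (v \<otimes>\<^bsub>G\<^esub> s) + (q_var - 1) * R u (v \<otimes>\<^bsub>G\<^esub> s)))"

definition R_poly :: "('a, 'b) monoid_scheme \<Rightarrow> 'a set \<Rightarrow> 'a \<Rightarrow> 'a \<Rightarrow> int poly" where
  "R_poly G S = (THE R. R_family G S R)"

definition KL_family :: "('a, 'b) monoid_scheme \<Rightarrow> 'a set \<Rightarrow> ('a \<Rightarrow> 'a \<Rightarrow> int poly) \<Rightarrow> bool" where
  "KL_family G S P \<longleftrightarrow>
     (\<forall>u v. \<not> bruhat_le G S u v \<longrightarrow> P u v = 0) \<and>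
     (\<forall>u\<in>carrier G. P u u = 1) \<and>
     (\<forall>u v. bruhat_le G S u v \<and> u \<noteq> v \<longrightarrow>
        2 * Polynomial.degree (P u v) + 1 \<le> cox_length G S v - cox_length G S u) \<and>
     (\<forall>u v. bruhat_le G S u v \<longrightarrow>
        poly_flip (cox_length G S v - cox_length G S u) (P u v) =
        (\<Sum>a | bruhat_le G S u a \<and> bruhat_le G S a v. R_poly G S u a * P a v))"

definition KL_poly :: "('a, 'b) monoid_scheme \<Rightarrow> 'a set \<Rightarrow> 'a \<Rightarrow> 'a \<Rightarrow> int poly" where
  "KL_poly G S = (THE P. KL_family G S P)"

text \<open>\<open>W\<^bsup>J\<^esup>\<close>, the minimal representatives of the cosets \<open>W\<^bsub>J\<^esub>u\<close>: the condition is on left multiplication.\<close>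
definition min_coset_reps :: "('a, 'b) monoid_scheme \<Rightarrow> 'a set \<Rightarrow> 'a set \<Rightarrow> 'a set" where
  "min_coset_reps G S J =
     {u \<in> carrier G. \<forall>s\<in>J. cox_length G S (s \<otimes>\<^bsub>G\<^esub> u) > cox_length G S u}"

text \<open>The parabolic polynomial of type \<open>q\<close>: the alternating sum of \<open>P\<^bsub>wu,v\<^esub>\<close> over
  \<open>w \<in> W\<^bsub>J\<^esub>\<close>. The subgroup may be infinite, but only the finitely many \<open>w\<close> with \<open>wu \<le> v\<close>
  have a nonzero term; the index set is restricted to these so that the sum is not
  trivially \<open>0\<close>.\<close>
definition parabolic_KL_poly_q ::
  "('a, 'b) monoid_scheme \<Rightarrow> 'a set \<Rightarrow> 'a set \<Rightarrow> 'a \<Rightarrow> 'a \<Rightarrow> int poly" where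
  "parabolic_KL_poly_q G S J u v =
     (\<Sum>w | w \<in> generate G J \<and> bruhat_le G S (w \<otimes>\<^bsub>G\<^esub> u) v.
        (- 1) ^ cox_length G S w * KL_poly G S (w \<otimes>\<^bsub>G\<^esub> u) v)"

end

(*
Up to a power of v, the polynomial P^{J,q}_{u,v} is the alternating sum over w in W_J of the
coefficients at w u of the Kazhdan-Lusztig basis element C_v of the Hecke algebra. If (W, S) is a
forest, a boolean v is obtained from 1 by successively adding letters s with at most one neighbour
among the letters already present, each time replacing x by s x, x s or s x s. The first two steps
are C_{sx} = C_s C_x and C_{xs} = C_x C_s. In the third step
  C_{sxs} = C_s C_x C_s - (sum over z of U_z[1] C_{sz}),
where U_z in v N[v] are the coefficients of the restriction of C_x to the parabolic subgroup without
the neighbour of s, expanded as (sum over z of U_z C_z); the positivity of U_z is an induction over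
the forest, in which a letter is replaced by a boolean element on letters commuting with the rest.
The statement "the alternating sums of C_v over W_J u are nonnegative and decrease with J" is
preserved by each step: at C_{sxs} they vanish, or they are v times those of C_{sx}, or they are
those of the s-free part v^2 C_x + (sum over z of (U_z - v U_z[1]) C_z), which has nonnegative
coefficients.
*)

theory Submission
  imports Defs "HOL-Library.Poly_Mapping" "HOL-Library.Function_Algebras" "HOL-Library.Sublist"
begin

section \<open>Laurent polynomials\<close>

text \<open>\<open>R_poly\<close> and \<open>KL_poly\<close> are definite descriptions, so both
  families need existence and uniqueness before anything can be said about them. The Hecke algebra
  enters only through functions on W on which the C_s act from the left and from the right;
  commutation of the two actions replaces associativity. In this normalisation C_s = H_s + v and q =
  v^-2, so C_v has the coefficient v^(l(v)-l(u)) P_{u,v}(v^-2) at u, and the weights (-v)^l(w) turn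
  a signed sum over a coset into a power of v times P^{J,q}. A left multiple h of C_s satisfies h(y)
  = v h(sy) for sy > y, which cancels weighted sums in pairs. The obstacle is that U_z is needed at
  the neighbour of s, which need not be the letter added last. Positivity is therefore proved for
  all letters at once. A letter p that cannot be moved to the outside has a neighbour c added after
  it; the forest is cut at c into a part carrying A = X c Y and a part carrying w, and c w c is
  inserted for c in A. Writing coefficients through quantum integers separates what is positive from
  what is bar invariant and has to be subtracted.\<close>

type_synonym lau = "int \<Rightarrow>\<^sub>0 int"

abbreviation cf :: "lau \<Rightarrow> int \<Rightarrow> int" where
  "cf \<equiv> Poly_Mapping.lookup"

definition vp :: "int \<Rightarrow> lau" where
  "vp n = Poly_Mapping.single n 1"

lemma cf_vp: "cf (vp n) k = (if n = k then 1 else 0)"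
  by (simp add: vp_def lookup_single when_def)

lemma vp_0 [simp]: "vp 0 = 1"
  by (simp add: vp_def)

lemma vp_add: "vp (m + n) = vp m * vp n"
  by (simp add: vp_def mult_single)

lemma vp_mult_vp [simp]: "vp m * vp n = vp (m + n)"
  by (simp add: vp_add)

lemma vp_mult_vp' [simp]: "vp m * (vp n * a) = vp (m + n) * a"
  by (simp flip: mult.assoc)

lemma vp_nonzero [simp]: "vp n \<noteq> 0"
  by (simp add: vp_def)

lemma lau_expand: "a = (\<Sum>k\<in>Poly_Mapping.keys a. of_int (cf a k) * vp k)"
proof (rule poly_mapping_eqI)
  fix j
  have *: "of_int c * vp k = Poly_Mapping.single k c" for c k
    using mult_single[of 0 c k 1] by (simp add: vp_def flip: single_of_int)
  show "cf a j = cf (\<Sum>k\<in>Poly_Mapping.keys a. of_int (cf a k) * vp k) j"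
    by (cases "j \<in> Poly_Mapping.keys a") (auto simp: * lookup_sum lookup_single when_def Poly_Mapping.in_keys_iff sum.delta)
qed

text \<open>Integer coefficients are built by adding or subtracting single powers of v, so an
  additive identity needs checking only at v^n.\<close>

lemma lau_induct [case_names zero vp_add vp_diff]:
  assumes "P 0" and "\<And>a n. P a \<Longrightarrow> P (a + vp n)" and "\<And>a n. P a \<Longrightarrow> P (a - vp n)"
  shows "P (a :: lau)"
proof -
  have step: "P (b + of_int c * vp n)" if "P b" for b c n
  proof (induction c rule: int_induct[where k = 0])
    case base
    then show ?case using that by simp
  next
    case (step1 i)
    from assms(2)[OF this(2), of n] show ?case by (simp add: algebra_simps)
  next
    case (step2 i)
    from assms(3)[OF this(2), of n] show ?case by (simp add: algebra_simps)
  qed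
  have "P (\<Sum>k\<in>K. of_int (cf a k) * vp k)" if "finite K" for K
    using that
  proof (induction K)
    case empty
    then show ?case using assms(1) by simp
  next
    case (insert x F)
    then show ?case using step[OF insert.IH] by (simp add: add.commute)
  qed
  then show ?thesis using lau_expand[of a] by (metis finite_keys)
qed

lemma cf_mult_vp: "cf (a * vp n) k = cf a (k - n)"
proof (induction a rule: lau_induct)
  case zero
  then show ?case by simp
next
  case (vp_add a m)
  then show ?case by (auto simp: algebra_simps lookup_add cf_vp)
next
  case (vp_diff a m)
  then show ?case by (auto simp: algebra_simps lookup_minus cf_vp)
qed

lemma cf_vp_mult: "cf (vp n * a) k = cf a (k - n)"
  using cf_mult_vp[of a n k] by (simp add: mult.commute)

section \<open>The bar involution v -> v^-1 on coefficients\<close>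

definition bar :: "lau \<Rightarrow> lau" where
  "bar a = Poly_Mapping.map_key uminus a"

lemma cf_bar: "cf (bar a) n = cf a (- n)"
  unfolding bar_def by (simp add: map_key.rep_eq)

lemma bar_add [simp]: "bar (a + b) = bar a + bar b"
  and bar_diff [simp]: "bar (a - b) = bar a - bar b"
  and bar_uminus [simp]: "bar (- a) = - bar a"
  and bar_0 [simp]: "bar 0 = 0"
  and bar_vp [simp]: "bar (vp n) = vp (- n)"
  and bar_bar [simp]: "bar (bar a) = a"
  by (rule poly_mapping_eqI; auto simp: cf_bar lookup_add lookup_minus cf_vp)+

lemma bar_1 [simp]: "bar 1 = 1"
  using bar_vp[of 0] by simp

lemma bar_vp_mult: "bar (vp n * a) = vp (- n) * bar a"
  by (rule poly_mapping_eqI) (simp add: cf_bar cf_vp_mult)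

lemma bar_mult [simp]: "bar (a * b) = bar a * bar b"
proof (induction a rule: lau_induct)
  case zero
  then show ?case by simp
next
  case (vp_add a n)
  then show ?case by (simp add: distrib_right bar_vp_mult)
next
  case (vp_diff a n)
  then show ?case by (simp add: left_diff_distrib bar_vp_mult)
qed

lemma bar_of_int [simp]: "bar (of_int c) = of_int c"
  by (rule poly_mapping_eqI) (auto simp: cf_bar lookup_of_int when_def)

lemma bar_sum: "bar (sum f A) = (\<Sum>x\<in>A. bar (f x))"
  by (induction A rule: infinite_finite_induct) auto

text \<open>The Laurent polynomials without pole, resp. without pole and constant term, at \<open>v = 0\<close>.\<close>
definition lau_int :: "lau \<Rightarrow> bool" where
  "lau_int a \<longleftrightarrow> (\<forall>n<0. cf a n = 0)"

definition lau_pos :: "lau \<Rightarrow> bool" where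
  "lau_pos a \<longleftrightarrow> (\<forall>n\<le>0. cf a n = 0)"

definition nonneg :: "lau \<Rightarrow> bool" where
  "nonneg a \<longleftrightarrow> (\<forall>n. 0 \<le> cf a n)"

lemma lau_pos_0 [simp]: "lau_pos 0"
  and lau_pos_add: "lau_pos a \<Longrightarrow> lau_pos b \<Longrightarrow> lau_pos (a + b)"
  and lau_pos_diff: "lau_pos a \<Longrightarrow> lau_pos b \<Longrightarrow> lau_pos (a - b)"
  and lau_pos_vp: "lau_pos (vp n) \<longleftrightarrow> n > 0"
  and lau_int_vp: "lau_int (vp n) \<longleftrightarrow> n \<ge> 0"
  and lau_int_0 [simp]: "lau_int 0"
  and lau_int_1 [simp]: "lau_int 1"
  and lau_int_add: "lau_int a \<Longrightarrow> lau_int b \<Longrightarrow> lau_int (a + b)"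
  and lau_pos_int: "lau_pos a \<Longrightarrow> lau_int a"
  by (auto simp: lau_pos_def lau_int_def lookup_add lookup_minus cf_vp lookup_one when_def)

lemma lau_pos_sum: "(\<And>x. x \<in> A \<Longrightarrow> lau_pos (f x)) \<Longrightarrow> lau_pos (sum f A)"
  by (induction A rule: infinite_finite_induct) (auto simp: lau_pos_add)

lemma lau_pos_vp_mult: "lau_int a \<Longrightarrow> n > 0 \<Longrightarrow> lau_pos (vp n * a)"
  and lau_int_vp_mult: "lau_int a \<Longrightarrow> n \<ge> 0 \<Longrightarrow> lau_int (vp n * a)"
  and lau_int_vp_mult_pos: "lau_pos a \<Longrightarrow> lau_int (vp (-1) * a)"
  by (auto simp: lau_pos_def lau_int_def cf_vp_mult)

lemma lau_int_of_int [simp]: "lau_int (of_int c)"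
  by (auto simp: lau_int_def lookup_of_int when_def)

lemma lau_pos_mult:
  assumes "lau_pos a" "lau_int b"
  shows "lau_pos (a * b)"
proof -
  have expand: "a * b = (\<Sum>k\<in>Poly_Mapping.keys a. of_int (cf a k) * (vp k * b))"
    by (subst lau_expand[of a]) (simp add: sum_distrib_right mult.assoc)
  have cf_of_int: "cf (of_int c * x) n = c * cf x n" for c x n
    by (induction c rule: int_induct[where k = 0])
      (auto simp: algebra_simps lookup_add lookup_minus)
  have pos: "0 < k" if "k \<in> Poly_Mapping.keys a" for k
    using assms(1) that unfolding lau_pos_def Poly_Mapping.in_keys_iff by (meson linorder_not_le)
  show ?thesis
    unfolding lau_pos_def expand lookup_sum cf_of_int cf_vp_mult
    using assms pos by (fastforce intro!: sum.neutral simp: lau_int_def)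
qed

text \<open>Bar invariance pairs the coefficients at n and -n, and one of these exponents is
  nonpositive. Uniqueness of the Kazhdan-Lusztig basis comes down to this.\<close>

lemma lau_pos_bar_eq_0: "lau_pos a \<Longrightarrow> bar a = a \<Longrightarrow> a = 0"
proof (rule poly_mapping_eqI)
  fix n assume "lau_pos a" "bar a = a"
  then have "cf a n = cf a (- n)" by (metis cf_bar)
  then show "cf a n = cf 0 n" using \<open>lau_pos a\<close> unfolding lau_pos_def
    by (cases "n \<le> 0") auto
qed

lemma lau_pos_diff_const: "lau_int a \<Longrightarrow> lau_pos (a - of_int (cf a 0))"
  by (auto simp: lau_int_def lau_pos_def lookup_minus lookup_of_int when_def)

lemma nonneg_0 [simp]: "nonneg 0"
  and nonneg_vp [simp]: "nonneg (vp n)"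
  and nonneg_add: "nonneg a \<Longrightarrow> nonneg b \<Longrightarrow> nonneg (a + b)"
  and nonneg_vp_mult [simp]: "nonneg (vp n * a) \<longleftrightarrow> nonneg a"
  unfolding nonneg_def by (auto simp: lookup_add cf_vp cf_vp_mult) (metis add_diff_cancel_right')

text \<open>The denominator of [n] = (v^n - v^-n) / (v - v^-1). It is cancelled in identities
  between quantum integers and when an equation is compared with its bar image.\<close>

definition vdiff :: lau where
  "vdiff = vp 1 - vp (-1)"

lemma vdiff_nonzero: "vdiff \<noteq> 0"
proof
  assume "vdiff = 0"
  then have "cf vdiff 1 = 0" by simp
  then show False by (simp add: vdiff_def lookup_minus cf_vp)
qed

text \<open>The quantum integer \<open>v\<^bsup>n-1\<^esup> + v\<^bsup>n-3\<^esup> + \<dots> + v\<^bsup>1-n\<^esup>\<close>.\<close>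
definition qn :: "nat \<Rightarrow> lau" where
  "qn n = (\<Sum>i<n. vp (int n - 1 - 2 * int i))"

lemma bar_qn [simp]: "bar (qn n) = qn n"
proof -
  have "bar (qn n) = (\<Sum>i<n. vp (- (int n - 1 - 2 * int i)))"
    by (simp add: qn_def bar_sum)
  also have "\<dots> = (\<Sum>i<n. vp (- (int n - 1 - 2 * int (n - Suc i))))"
    by (rule sum.nat_diff_reindex[symmetric])
  also have "\<dots> = qn n"
    unfolding qn_def by (intro sum.cong refl arg_cong[where f = vp]) (auto simp: of_nat_diff)
  finally show ?thesis .
qed

lemma vp_qn: "vp k * qn n = (\<Sum>i<n. vp (int n - 1 + k - 2 * int i))"
  unfolding qn_def sum_distrib_left by (intro sum.cong refl) (simp add: algebra_simps)

text \<open>The exponents of v^m [n] run from n+m-1 downwards in steps of 2. The first min(m,n) of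
  them are at least |n-m|+1, hence positive; the others are symmetric about 0 and form [n-m], which
  truncated subtraction makes 0 for n <= m.\<close>

lemma qn_mult_vp: 
  "vp (int m) * qn n = (\<Sum>i<min m n. vp (int n - 1 + int m - 2 * int i)) + qn (n - m)"
proof (cases "n \<le> m")
  case True
  then show ?thesis by (simp only: vp_qn min_absorb2) (simp add: qn_def)
next
  case False
  then have "{..<n} = {..<m} \<union> {m..<n}" "{..<m} \<inter> {m..<n} = {}" by auto
  then have "vp (int m) * qn n = (\<Sum>i<m. vp (int n - 1 + int m - 2 * int i))
    + (\<Sum>i\<in>{m..<n}. vp (int n - 1 + int m - 2 * int i))"
    unfolding vp_qn by (simp add: sum.union_disjoint)
  also have "(\<Sum>i\<in>{m..<n}. vp (int n - 1 + int m - 2 * int i)) = qn (n - m)"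
    unfolding qn_def using False
    by (intro sum.reindex_bij_witness[of _ "\<lambda>i. i + m" "\<lambda>i. i - m"])
      (auto simp: of_nat_diff algebra_simps)
  finally show ?thesis using False by (simp add: min_def)
qed

lemma qn_simps [simp]: "qn 0 = 0" "qn (Suc 0) = 1"
  by (simp_all add: qn_def)

lemma vdiff_qn: "vdiff * qn n = vp (int n) - vp (- int n)"
proof (cases n)
  case 0
  then show ?thesis by simp
next
  case (Suc k)
  have *: "vp 1 * qn (Suc k) = vp (int k + 1) + qn k"
    using qn_mult_vp[of 1 "Suc k"] by (simp add: add.commute)
  have "vp (-1) * qn (Suc k) = vp (- (int k + 1)) + qn k"
    using arg_cong[OF *, of bar] unfolding bar_mult bar_add bar_vp bar_qn .
  with * show ?thesis by (simp add: Suc vdiff_def left_diff_distrib add.commute)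
qed

text \<open>The rule [2][n+1] = [n+2] + [n], read off from the closed form \<open>vdiff_qn\<close>
  after multiplying by v - v^-1.\<close>

lemma qn_two_mult: "(vp 1 + vp (-1)) * qn (Suc n) = qn (Suc (Suc n)) + qn n"
proof -
  have "vdiff * ((vp 1 + vp (-1)) * qn (Suc n)) = (vp 1 + vp (-1)) * (vdiff * qn (Suc n))"
    by (simp only: ac_simps)
  also have "\<dots> = vdiff * (qn (Suc (Suc n)) + qn n)"
    unfolding distrib_left[of vdiff] vdiff_qn by (simp add: algebra_simps minus_diff_commute)
  finally show ?thesis using vdiff_nonzero by simp
qed

section \<open>Lengths, reflections and exchange\<close>

context coxeter_system
begin

abbreviation len :: "'a \<Rightarrow> nat" where
  "len \<equiv> cox_length G S"

abbreviation wp :: "'a list \<Rightarrow> 'a" where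
  "wp \<equiv> word_prod G"

declare in_listsD [rule del] in_listsI [rule del]

lemma rev_in_lists [simp]: "rev ws \<in> lists A \<longleftrightarrow> ws \<in> lists A"
  by (simp add: in_lists_conv_set)

lemma S_closed [simp, intro]: "s \<in> S \<Longrightarrow> s \<in> carrier G"
  using gens_closed by auto

lemma S_square [simp]: "s \<in> S \<Longrightarrow> s \<otimes> s = \<one>"
  using pow_ord_eq_1[of s] gens_involution[of s] by (simp add: numeral_2_eq_2)

lemma inv_S [simp]: "s \<in> S \<Longrightarrow> inv s = s"
  by (intro inv_equality) auto

lemma S_cancel [simp]:
  assumes "s \<in> S" "x \<in> carrier G"
  shows "s \<otimes> (s \<otimes> x) = x" "x \<otimes> s \<otimes> s = x"
proof -
  show "s \<otimes> (s \<otimes> x) = x" using assms m_assoc[of s s x] by simp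
  show "x \<otimes> s \<otimes> s = x" using assms by (simp add: m_assoc)
qed

lemma S_not_one: "s \<in> S \<Longrightarrow> s \<noteq> \<one>"
  using gens_involution[of s] ord_id by auto

lemma mult_eq_iff_conj:
  "x \<in> carrier G \<Longrightarrow> t \<in> carrier G \<Longrightarrow> s \<in> carrier G \<Longrightarrow>
    inv x \<otimes> t \<otimes> x = s \<longleftrightarrow> t \<otimes> x = x \<otimes> s"
  by (metis inv_closed inv_solve_left m_assoc m_closed)

lemma conj_eq_iff:
  "x \<in> carrier G \<Longrightarrow> t \<in> carrier G \<Longrightarrow> s \<in> carrier G \<Longrightarrow>
    inv x \<otimes> t \<otimes> x = s \<longleftrightarrow> t = x \<otimes> s \<otimes> inv x"
  by (metis inv_closed inv_solve_right m_closed mult_eq_iff_conj)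

lemma inv_cancel [simp]:
  assumes "x \<in> carrier G" "y \<in> carrier G"
  shows "inv x \<otimes> (x \<otimes> y) = y" "x \<otimes> (inv x \<otimes> y) = y" "y \<otimes> x \<otimes> inv x = y" "y \<otimes> inv x \<otimes> x = y"
proof -
  show "inv x \<otimes> (x \<otimes> y) = y" using assms m_assoc[of "inv x" x y] by simp
  show "x \<otimes> (inv x \<otimes> y) = y" using assms m_assoc[of x "inv x" y] by simp
  show "y \<otimes> x \<otimes> inv x = y" using assms by (simp add: m_assoc)
  show "y \<otimes> inv x \<otimes> x = y" using assms by (simp add: m_assoc)
qed

lemma wp_simps [simp]: "wp [] = \<one>" "wp (s # ws) = s \<otimes> wp ws"
  by (simp_all add: word_prod_def)

lemma wp_closed [simp, intro]: "ws \<in> lists S \<Longrightarrow> wp ws \<in> carrier G"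
  by (induction ws) auto

lemma wp_append: "xs \<in> lists S \<Longrightarrow> ys \<in> lists S \<Longrightarrow> wp (xs @ ys) = wp xs \<otimes> wp ys"
  by (induction xs) (auto simp: m_assoc)

lemma wp_rev: "ws \<in> lists S \<Longrightarrow> wp (rev ws) = inv (wp ws)"
proof (induction ws)
  case (Cons s ws)
  then have "rev ws \<in> lists S" by auto
  with Cons show ?case by (simp add: wp_append inv_mult_group)
qed simp

lemma generate_iff_word:
  assumes "J \<subseteq> S"
  shows "w \<in> generate G J \<longleftrightarrow> (\<exists>ws\<in>lists J. wp ws = w)"
proof
  assume "w \<in> generate G J"
  then show "\<exists>ws\<in>lists J. wp ws = w"
  proof (induction w rule: generate.induct)
    case one
    then show ?case by (intro bexI[of _ "[]"]) auto
  next
    case (incl h)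
    then show ?case using assms by (intro bexI[of _ "[h]"]) auto
  next
    case (inv h)
    then show ?case using assms by (intro bexI[of _ "[h]"]) auto
  next
    case (eng h1 h2)
    then obtain xs ys where *: "xs \<in> lists J" "ys \<in> lists J" "wp xs = h1" "wp ys = h2" by auto
    moreover have "xs \<in> lists S" "ys \<in> lists S" using * lists_mono[OF assms] by auto
    ultimately show ?case by (intro bexI[of _ "xs @ ys"]) (auto simp: wp_append)
  qed
next
  assume "\<exists>ws\<in>lists J. wp ws = w"
  then obtain ws where ws: "ws \<in> lists J" "wp ws = w" by auto
  then show "w \<in> generate G J"
  proof (induction ws arbitrary: w)
    case Nil
    then show ?case using generate.one by auto
  next
    case (Cons s ws)
    then show ?case using generate.incl[of s J G] generate.eng by auto
  qed
qed

lemma ex_word: "w \<in> carrier G \<Longrightarrow> \<exists>ws\<in>lists S. wp ws = w"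
  using generate_iff_word[of S w] gens_generate by auto

text \<open>The parity of the number of positions i in the word s_1 ... s_n with t = s_1 ... s_{i-1}
  s_i s_{i-1} ... s_1; the recursion conjugates t by the first letter. Parity, unlike the number
  itself, survives the relations of the presentation.\<close>

fun nref :: "'a list \<Rightarrow> 'a \<Rightarrow> bool" where
  "nref [] t = False"
| "nref (s # ws) t = ((t = s) \<noteq> nref ws (s \<otimes> t \<otimes> s))"

lemma nref_append:
  assumes "xs \<in> lists S" "t \<in> carrier G"
  shows "nref (xs @ ys) t = (nref xs t \<noteq> nref ys (inv (wp xs) \<otimes> t \<otimes> wp xs))"
  using assms
proof (induction xs arbitrary: t)
  case (Cons s xs)
  then have "inv (wp xs) \<otimes> (s \<otimes> t \<otimes> s) \<otimes> wp xs = inv (wp (s # xs)) \<otimes> t \<otimes> wp (s # xs)"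
    by (auto simp: inv_mult_group m_assoc)
  with Cons show ?case by auto
qed simp

text \<open>Since s inverts z = st, the factor z^-k on the right becomes z^k when it passes s. This
  identifies the reflections attached to the letters of (st)^k with the elements z^j s.\<close>

lemma dihedral_conj:
  assumes "s \<in> S" "t \<in> S"
  shows "(s \<otimes> t) [^] (k::nat) \<otimes> s \<otimes> inv ((s \<otimes> t) [^] k) = (s \<otimes> t) [^] (2 * k) \<otimes> s"
proof (induction k)
  case 0
  then show ?case using assms by simp
next
  case (Suc k)
  let ?z = "s \<otimes> t"
  have z: "?z \<in> carrier G" and zk: "?z [^] k \<in> carrier G" "?z [^] (2 * k) \<in> carrier G"
    using assms by auto
  have sz: "s \<otimes> inv ?z = ?z \<otimes> s"
    using assms by (simp add: inv_mult_group m_assoc)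
  have "?z [^] Suc k \<otimes> s \<otimes> inv (?z [^] Suc k) = ?z \<otimes> (?z [^] k \<otimes> s \<otimes> inv (?z [^] k)) \<otimes> inv ?z"
    using assms z zk nat_pow_Suc2[OF z, of k] by (simp add: inv_mult_group m_assoc del: nat_pow_Suc)
  also have "\<dots> = ?z \<otimes> ?z [^] (2 * k) \<otimes> (s \<otimes> inv ?z)"
    unfolding Suc.IH using assms z zk by (simp add: m_assoc del: inv_mult_group)
  also have "\<dots> = ?z [^] (2 * Suc k) \<otimes> s"
  proof -
    have "?z [^] (2 * Suc k) = ?z [^] Suc (2 * k) \<otimes> ?z" by simp
    also have "\<dots> = ?z \<otimes> ?z [^] (2 * k) \<otimes> ?z" using nat_pow_Suc2[OF z, of "2 * k"] by simp
    finally show ?thesis unfolding sz using assms z zk by (simp only: m_assoc m_closed S_closed)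
  qed
  finally show ?case .
qed

text \<open>The reflections attached to the letters of \<open>(st)\<^bsup>m\<^esup>\<close> are \<open>(st)\<^bsup>j\<^esup>s\<close> with \<open>j < 2m\<close>;
  if \<open>(st)\<^bsup>m\<^esup> = 1\<close> each of them occurs twice.\<close>
lemma nref_relator:
  assumes "s \<in> S" "t \<in> S" "r \<in> carrier G"
  shows "\<not> nref (concat (replicate (ord (s \<otimes> t)) [s, t])) r"
proof -
  let ?z = "s \<otimes> t"
  define N where "N n = card {j. j < n \<and> r = ?z [^] j \<otimes> s}" for n :: nat
  have z: "?z \<in> carrier G" using assms by auto
  have N_Suc: "odd (N (Suc n)) = (odd (N n) \<noteq> (r = ?z [^] n \<otimes> s))" for n
  proof -
    have "{j. j < Suc n \<and> r = ?z [^] j \<otimes> s} =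
      (if r = ?z [^] n \<otimes> s then insert n {j. j < n \<and> r = ?z [^] j \<otimes> s} else {j. j < n \<and> r = ?z [^] j \<otimes> s})"
      by (auto simp: less_Suc_eq)
    then show ?thesis unfolding N_def by auto
  qed
  have L: "concat (replicate k [s, t]) \<in> lists S" for k
    using assms by (induction k) auto
  have wpk: "wp (concat (replicate k [s, t])) = ?z [^] k" for k
  proof (induction k)
    case (Suc k)
    then show ?case using assms z nat_pow_Suc2[OF z, of k] by (simp add: m_assoc del: nat_pow_Suc)
  qed simp
  have "nref (concat (replicate k [s, t])) r = odd (N (2 * k))" for k
  proof (induction k)
    case 0
    then show ?case by (simp add: N_def)
  next
    case (Suc k)
    have zk: "?z [^] k \<in> carrier G" "?z [^] (2 * k) \<in> carrier G" using z by auto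
    let ?c = "inv (?z [^] k) \<otimes> r \<otimes> ?z [^] k"
    have c: "?c \<in> carrier G" using assms zk by auto
    have eq1: "?c = s \<longleftrightarrow> r = ?z [^] (2 * k) \<otimes> s"
      using conj_eq_iff[of "?z [^] k" r s] assms zk dihedral_conj[OF assms(1,2), of k] by simp
    have eq2: "s \<otimes> ?c \<otimes> s = t \<longleftrightarrow> r = ?z [^] (Suc (2 * k)) \<otimes> s"
    proof -
      have "s \<otimes> ?c \<otimes> s = t \<longleftrightarrow> ?c = s \<otimes> t \<otimes> s"
        using conj_eq_iff[of s ?c t] assms c by simp
      also have "\<dots> \<longleftrightarrow> r = ?z [^] k \<otimes> (?z \<otimes> s) \<otimes> inv (?z [^] k)"
        using conj_eq_iff[of "?z [^] k" r "?z \<otimes> s"] assms zk by (simp add: m_assoc)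
      also have "?z [^] k \<otimes> (?z \<otimes> s) \<otimes> inv (?z [^] k) = ?z \<otimes> (?z [^] k \<otimes> s \<otimes> inv (?z [^] k))"
      proof -
        have "?z [^] k \<otimes> ?z = ?z \<otimes> ?z [^] k" using nat_pow_Suc2[OF z, of k] by simp
        then have "?z [^] k \<otimes> ?z \<otimes> s \<otimes> inv (?z [^] k) = ?z \<otimes> ?z [^] k \<otimes> s \<otimes> inv (?z [^] k)" by simp
        moreover have "s \<in> carrier G" using assms by simp
        ultimately show ?thesis using z zk inv_closed[OF zk(1)] by (metis m_assoc m_closed)
      qed
      also have "\<dots> = ?z [^] (Suc (2 * k)) \<otimes> s"
        unfolding dihedral_conj[OF assms(1,2)] using assms z nat_pow_Suc2[OF z, of "2 * k"]
        by (simp add: m_assoc del: nat_pow_Suc)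
      finally show ?thesis .
    qed
    have "concat (replicate (Suc k) [s, t]) = concat (replicate k [s, t]) @ [s, t]"
      by (induction k) auto
    then have "nref (concat (replicate (Suc k) [s, t])) r =
      (nref (concat (replicate k [s, t])) r \<noteq> nref [s, t] ?c)"
      using nref_append[OF L assms(3), of k "[s, t]"] wpk by simp
    also have "\<dots> = odd (N (2 * Suc k))"
      using Suc.IH N_Suc[of "2 * k"] N_Suc[of "Suc (2 * k)"] eq1 eq2 by auto
    finally show ?case .
  qed
  moreover have "even (N (2 * ord ?z))"
  proof -
    let ?m = "ord ?z"
    let ?A = "{j. j < ?m \<and> r = ?z [^] j \<otimes> s}"
    let ?B = "{j. ?m \<le> j \<and> j < 2 * ?m \<and> r = ?z [^] j \<otimes> s}"
    have per: "?z [^] (j + ?m) = ?z [^] j" for j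
      using nat_pow_mult[OF z, of j ?m, symmetric] z by simp
    have B: "?B = (\<lambda>j. j + ?m) ` ?A"
    proof (intro equalityI subsetI)
      fix j assume "j \<in> ?B"
      then have "j - ?m \<in> ?A" "j = (j - ?m) + ?m" using per[of "j - ?m"] by auto
      then show "j \<in> (\<lambda>j. j + ?m) ` ?A" by blast
    qed (auto simp: per)
    have "{j. j < 2 * ?m \<and> r = ?z [^] j \<otimes> s} = ?A \<union> ?B" by auto
    moreover have "card (?A \<union> ?B) = card ?A + card ?B" by (rule card_Un_disjoint) auto
    moreover have "card ?B = card ?A" unfolding B by (rule card_image) auto
    ultimately show ?thesis unfolding N_def by simp
  qed
  ultimately show ?thesis by simp
qed

text \<open>A relator has product 1, so the letters after it see t conjugated as before, and its own
  letters contribute an even number.\<close>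

lemma nref_step:
  assumes "relator_step G S a b" "t \<in> carrier G"
  shows "nref a t = nref b t"
  using assms(1)
proof cases
  case (1 s s' xs ys)
  let ?r = "concat (replicate (ord (s \<otimes> s')) [s, s'])"
  have r: "concat (replicate k [s, s']) \<in> lists S" for k using 1 by (induction k) auto
  have z: "s \<otimes> s' \<in> carrier G" using 1 by auto
  have "wp (concat (replicate k [s, s'])) = (s \<otimes> s') [^] k" for k
    by (induction k) (use 1 z nat_pow_Suc2[OF z] in \<open>simp_all add: m_assoc del: nat_pow_Suc\<close>)
  then have "wp ?r = \<one>" using z by simp
  moreover have "inv (wp xs) \<otimes> t \<otimes> wp xs \<in> carrier G" using 1 assms by auto
  ultimately show ?thesis
    using 1 assms nref_relator[of s s' "inv (wp xs) \<otimes> t \<otimes> wp xs"]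
    by (simp add: nref_append[OF r] nref_append)
qed

lemma nref_trivial:
  assumes "ws \<in> lists S" "wp ws = \<one>" "t \<in> carrier G"
  shows "\<not> nref ws t"
proof -
  have "equivclp (relator_step G S) ws []" using presentation assms by auto
  then have "nref ws t = nref [] t"
    by (induction rule: equivclp_induct) (use nref_step[OF _ assms(3)] in auto)
  then show ?thesis by simp
qed

text \<open>Appending \<open>rev ys\<close> makes both words trivial, and the appended part
  contributes equally because \<open>wp xs\<close> and \<open>wp ys\<close> conjugate t in the same
  way.\<close>

lemma nref_cong:
  assumes "xs \<in> lists S" "ys \<in> lists S" "wp xs = wp ys" "t \<in> carrier G"
  shows "nref xs t = nref ys t"
proof -
  have r: "rev ys \<in> lists S" using assms by auto
  have "\<not> nref (zs @ rev ys) t" if "zs \<in> lists S" "wp zs = wp ys" for zs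
    using assms r that by (intro nref_trivial) (simp_all add: wp_append wp_rev)
  from this[of xs] this[of ys] assms have "\<not> nref (xs @ rev ys) t" "\<not> nref (ys @ rev ys) t" by auto
  then show ?thesis using assms by (simp add: nref_append)
qed

text \<open>The reflection cocycle: for a reflection t it says that t is a left inversion of w. The
  choice of the word is immaterial by \<open>nref_cong\<close>.\<close>

definition eta :: "'a \<Rightarrow> 'a \<Rightarrow> bool" where
  "eta w t = nref (SOME ws. ws \<in> lists S \<and> wp ws = w) t"

lemma eta_word: "ws \<in> lists S \<Longrightarrow> t \<in> carrier G \<Longrightarrow> eta (wp ws) t = nref ws t"
  unfolding eta_def by (rule someI2[of _ ws]) (simp, metis nref_cong)

lemma eta_mult:
  assumes "x \<in> carrier G" "y \<in> carrier G" "t \<in> carrier G"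
  shows "eta (x \<otimes> y) t = (eta x t \<noteq> eta y (inv x \<otimes> t \<otimes> x))"
proof -
  obtain xs ys where *: "xs \<in> lists S" "wp xs = x" "ys \<in> lists S" "wp ys = y"
    using ex_word assms by metis
  then have "eta (x \<otimes> y) t = nref (xs @ ys) t"
    using eta_word[of "xs @ ys" t] assms by (auto simp: wp_append)
  then show ?thesis
    using * assms eta_word[of xs t] eta_word[of ys "inv x \<otimes> t \<otimes> x"] by (simp add: nref_append)
qed

lemma eta_S [simp]: "s \<in> S \<Longrightarrow> t \<in> carrier G \<Longrightarrow> eta s t \<longleftrightarrow> t = s"
  using eta_word[of "[s]" t] by simp

lemma eta_one [simp]: "t \<in> carrier G \<Longrightarrow> \<not> eta \<one> t"
  using eta_word[of "[]" t] by simp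

text \<open>The strong exchange condition, for words that need not be reduced: an odd number of
  positions with reflection t is not zero, and multiplication by t deletes the letter at such a
  position.\<close>

lemma nref_exchange:
  assumes "ws \<in> lists S" "t \<in> carrier G" "nref ws t"
  shows "\<exists>xs s ys. ws = xs @ s # ys \<and> t \<otimes> wp ws = wp (xs @ ys) \<and> t = wp xs \<otimes> s \<otimes> inv (wp xs)"
  using assms
proof (induction ws arbitrary: t rule: list.induct)
  case (Cons s ws)
  show ?case
  proof (cases "t = s")
    case True
    then show ?thesis using Cons by (intro exI[of _ "[]"] exI[of _ s] exI[of _ ws]) auto
  next
    case False
    have sts: "ws \<in> lists S" "s \<otimes> t \<otimes> s \<in> carrier G" "nref ws (s \<otimes> t \<otimes> s)"
      using Cons False by simp_all
    obtain xs r ys where *: "ws = xs @ r # ys" "s \<otimes> t \<otimes> s \<otimes> wp ws = wp (xs @ ys)"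
      "s \<otimes> t \<otimes> s = wp xs \<otimes> r \<otimes> inv (wp xs)"
      using Cons.IH[OF sts] by blast
    have cl: "s \<in> S" "xs \<in> lists S" "r \<in> S" "ys \<in> lists S" using Cons.prems * by auto
    have "t \<otimes> wp (s # ws) = s \<otimes> (s \<otimes> t \<otimes> s \<otimes> wp ws)" using Cons.prems by (simp add: m_assoc)
    also have "\<dots> = wp ((s # xs) @ ys)" unfolding *(2) by simp
    finally have A: "t \<otimes> wp (s # ws) = wp ((s # xs) @ ys)" .
    have "t = s \<otimes> (s \<otimes> t \<otimes> s) \<otimes> s" using Cons.prems by (simp add: m_assoc)
    also have "\<dots> = wp (s # xs) \<otimes> r \<otimes> inv (wp (s # xs))"
      unfolding *(3) using cl by (simp add: inv_mult_group m_assoc)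
    finally show ?thesis using A *(1)
      by (intro exI[of _ "s # xs"] exI[of _ r] exI[of _ ys]) auto
  qed
qed simp

lemma len_le: "ws \<in> lists S \<Longrightarrow> len (wp ws) \<le> length ws"
  unfolding cox_length_def by (rule Least_le) auto

lemma ex_reduced: "w \<in> carrier G \<Longrightarrow> \<exists>ws\<in>lists S. wp ws = w \<and> length ws = len w"
proof -
  assume "w \<in> carrier G"
  then obtain ws where ws: "ws \<in> lists S" "wp ws = w" using ex_word by auto
  have "\<exists>n. \<exists>ws\<in>lists S. length ws = n \<and> wp ws = w" using ws by auto
  from LeastI_ex[OF this] show ?thesis unfolding cox_length_def by auto
qed

lemma eta_len_less:
  assumes "w \<in> carrier G" "t \<in> carrier G" "eta w t"
  shows "len (t \<otimes> w) < len w"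
proof -
  obtain ws where ws: "ws \<in> lists S" "wp ws = w" "length ws = len w"
    using ex_reduced assms by blast
  then obtain xs s ys where *: "ws = xs @ s # ys" "t \<otimes> w = wp (xs @ ys)"
    using nref_exchange[of ws t] eta_word[of ws t] assms by auto
  then have "len (t \<otimes> w) \<le> length (xs @ ys)" using ws len_le[of "xs @ ys"] by auto
  then show ?thesis using ws * by simp
qed

abbreviation refs :: "'a set" where
  "refs \<equiv> reflections G S"

lemma refs_closed [simp, intro]: "t \<in> refs \<Longrightarrow> t \<in> carrier G"
  unfolding reflections_def by auto

lemma S_refs [intro]: "s \<in> S \<Longrightarrow> s \<in> refs"
  unfolding reflections_def by (rule CollectI, rule exI[of _ \<one>], rule exI[of _ s]) auto

lemma refs_conj:
  assumes "t \<in> refs" "x \<in> carrier G"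
  shows "x \<otimes> t \<otimes> inv x \<in> refs" "inv x \<otimes> t \<otimes> x \<in> refs"
proof -
  obtain w s where t: "t = w \<otimes> s \<otimes> inv w" "w \<in> carrier G" "s \<in> S"
    using assms unfolding reflections_def by auto
  have *: "x \<otimes> t \<otimes> inv x \<in> refs" if "x \<in> carrier G" for x
    unfolding reflections_def
    by (rule CollectI, rule exI[of _ "x \<otimes> w"], rule exI[of _ s])
      (use t that in \<open>auto simp: inv_mult_group m_assoc\<close>)
  from *[of x] *[of "inv x"] assms show "x \<otimes> t \<otimes> inv x \<in> refs" "inv x \<otimes> t \<otimes> x \<in> refs" by auto
qed

lemma refs_square: "t \<in> refs \<Longrightarrow> t \<otimes> t = \<one>"
  unfolding reflections_def by (auto simp: m_assoc)

lemma inv_refs: "t \<in> refs \<Longrightarrow> inv t = t"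
  by (intro inv_equality) (auto simp: refs_square)

text \<open>For t = w s w^-1 the contributions of w and w^-1 to the cocycle agree, as the trivial
  product w w^-1 shows, and cancel; the middle letter s contributes exactly once.\<close>

lemma eta_refs_self: "t \<in> refs \<Longrightarrow> eta t t"
proof -
  assume t: "t \<in> refs"
  then obtain w s where w: "t = w \<otimes> s \<otimes> inv w" "w \<in> carrier G" "s \<in> S"
    unfolding reflections_def by auto
  have c: "inv w \<otimes> t \<otimes> w = s" using w by (simp add: m_assoc)
  have "eta \<one> t = (eta w t \<noteq> eta (inv w) s)"
    using eta_mult[of w "inv w" t] w t c by simp
  then have A: "eta (inv w) s = eta w t" using t by auto
  have "eta t t = (eta w t \<noteq> eta (s \<otimes> inv w) s)"
    using eta_mult[of w "s \<otimes> inv w" t] w t c by (simp add: m_assoc)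
  also have "eta (s \<otimes> inv w) s = (\<not> eta (inv w) s)"
    using eta_mult[of s "inv w" s] w by simp
  finally show ?thesis using A by simp
qed

text \<open>If t is not an inversion of w, it is one of tw, and then the length drops from tw to w
  instead.\<close>

lemma eta_iff_len:
  assumes "t \<in> refs" "w \<in> carrier G"
  shows "eta w t \<longleftrightarrow> len (t \<otimes> w) < len w"
proof
  assume "len (t \<otimes> w) < len w"
  show "eta w t"
  proof (rule ccontr)
    assume "\<not> eta w t"
    then have "eta (t \<otimes> w) t"
      using assms eta_mult[of t w t] eta_refs_self[of t] by (simp add: inv_refs refs_square)
    from eta_len_less[OF _ _ this] have "len w < len (t \<otimes> w)"
      using assms by (simp add: refs_square flip: m_assoc)
    with \<open>len (t \<otimes> w) < len w\<close> show False by simp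
  qed
qed (use assms eta_len_less in auto)

lemma eta_mult_refs:
  assumes "t \<in> refs" "w \<in> carrier G"
  shows "eta (t \<otimes> w) t \<longleftrightarrow> \<not> eta w t"
  using assms eta_mult[of t w t] eta_refs_self[of t] by (simp add: inv_refs refs_square)

lemma not_eta_len:
  assumes "t \<in> refs" "w \<in> carrier G" "\<not> eta w t"
  shows "len w < len (t \<otimes> w)"
proof -
  have "eta (t \<otimes> w) t" using eta_mult_refs assms by auto
  from eta_len_less[OF _ _ this] show ?thesis
    using assms by (simp add: refs_square flip: m_assoc)
qed

lemma len_one [simp]: "len \<one> = 0"
  using len_le[of "[]"] by simp

lemma len_eq_0: "w \<in> carrier G \<Longrightarrow> len w = 0 \<longleftrightarrow> w = \<one>"
  using ex_reduced[of w] by auto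

lemma len_inv [simp]: "w \<in> carrier G \<Longrightarrow> len (inv w) = len w"
proof -
  have "len (inv w) \<le> len w" if w: "w \<in> carrier G" for w
  proof -
    obtain ws where ws: "ws \<in> lists S" "wp ws = w" "length ws = len w"
      using ex_reduced[OF w] by blast
    moreover from ws have "rev ws \<in> lists S" by auto
    ultimately show ?thesis using len_le[of "rev ws"] by (simp add: wp_rev)
  qed
  from this[of w] this[of "inv w"] show "w \<in> carrier G \<Longrightarrow> len (inv w) = len w" by auto
qed

lemma len_mult_le: "x \<in> carrier G \<Longrightarrow> y \<in> carrier G \<Longrightarrow> len (x \<otimes> y) \<le> len x + len y"
proof -
  assume xy: "x \<in> carrier G" "y \<in> carrier G"
  obtain xs where xs: "xs \<in> lists S" "wp xs = x" "length xs = len x"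
    using ex_reduced[OF xy(1)] by blast
  obtain ys where ys: "ys \<in> lists S" "wp ys = y" "length ys = len y"
    using ex_reduced[OF xy(2)] by blast
  note * = xs ys
  then have "xs @ ys \<in> lists S" by auto
  from len_le[OF this] * show ?thesis by (simp add: wp_append)
qed

lemma len_S [simp]: "s \<in> S \<Longrightarrow> len s = 1"
  using len_le[of "[s]"] len_eq_0[of s] S_not_one[of s] by fastforce

section \<open>Left and right descents\<close>

abbreviation dl :: "'a \<Rightarrow> 'a \<Rightarrow> bool" where
  "dl s w \<equiv> len (s \<otimes> w) < len w"

abbreviation dr :: "'a \<Rightarrow> 'a \<Rightarrow> bool" where
  "dr w s \<equiv> len (w \<otimes> s) < len w"

lemma dl_eta: "s \<in> S \<Longrightarrow> w \<in> carrier G \<Longrightarrow> dl s w \<longleftrightarrow> eta w s"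
  using eta_iff_len[of s w] by auto

lemma len_inv_swap: "s \<in> S \<Longrightarrow> w \<in> carrier G \<Longrightarrow> len (s \<otimes> inv w) = len (w \<otimes> s)"
  using len_inv[of "w \<otimes> s"] by (simp add: inv_mult_group)

lemma dr_eta: "s \<in> S \<Longrightarrow> w \<in> carrier G \<Longrightarrow> dr w s \<longleftrightarrow> eta (inv w) s"
  using dl_eta[of s "inv w"] len_inv_swap[of s w] by simp

lemma len_mult_left:
  assumes "s \<in> S" "w \<in> carrier G"
  shows "dl s w \<Longrightarrow> Suc (len (s \<otimes> w)) = len w"
    and "\<not> dl s w \<Longrightarrow> len (s \<otimes> w) = Suc (len w)"
proof -
  have 1: "len (s \<otimes> w) \<le> Suc (len w)" using len_mult_le[of s w] assms by simp
  have 2: "len w \<le> Suc (len (s \<otimes> w))" using len_mult_le[of s "s \<otimes> w"] assms by simp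
  show "dl s w \<Longrightarrow> Suc (len (s \<otimes> w)) = len w" using 2 by simp
  show "\<not> dl s w \<Longrightarrow> len (s \<otimes> w) = Suc (len w)"
    using 1 not_eta_len[of s w] assms dl_eta[of s w] S_refs[of s] by auto
qed

lemma len_mult_right:
  assumes "s \<in> S" "w \<in> carrier G"
  shows "dr w s \<Longrightarrow> Suc (len (w \<otimes> s)) = len w"
    and "\<not> dr w s \<Longrightarrow> len (w \<otimes> s) = Suc (len w)"
  using len_mult_left[of s "inv w"] len_inv_swap[of s w] assms by auto

lemma dl_flip: "s \<in> S \<Longrightarrow> w \<in> carrier G \<Longrightarrow> dl s (s \<otimes> w) \<longleftrightarrow> \<not> dl s w"
  using len_mult_left[of s w] by (cases "dl s w") auto

lemma dr_flip: "s \<in> S \<Longrightarrow> w \<in> carrier G \<Longrightarrow> dr (w \<otimes> s) s \<longleftrightarrow> \<not> dr w s"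
  using len_mult_right[of s w] by (cases "dr w s") auto

lemma eta_mult_S:
  assumes "s \<in> S" "t \<in> carrier G" "w \<in> carrier G"
  shows "eta (w \<otimes> s) t = (eta w t \<noteq> (t \<otimes> w = w \<otimes> s))"
  using assms eta_mult[of w s t] mult_eq_iff_conj[of w t s] by simp

text \<open>Passing from w to ws changes the left inversion set only at w s w^-1, so the status of t
  can change only if tw = ws.\<close>

lemma dl_mult_right:
  assumes "s \<in> S" "t \<in> S" "w \<in> carrier G" "t \<otimes> w \<noteq> w \<otimes> s"
  shows "dl t (w \<otimes> s) \<longleftrightarrow> dl t w"
  using assms eta_mult_S[of s t w] by (simp add: dl_eta m_assoc)

lemma dr_mult_left:
  assumes "s \<in> S" "t \<in> S" "w \<in> carrier G" "t \<otimes> w \<noteq> w \<otimes> s"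
  shows "dr (t \<otimes> w) s \<longleftrightarrow> dr w s"
proof -
  have "s \<otimes> inv w \<noteq> inv w \<otimes> t"
  proof
    assume "s \<otimes> inv w = inv w \<otimes> t"
    then have "inv (s \<otimes> inv w) = inv (inv w \<otimes> t)" by simp
    then show False using assms by (simp add: inv_mult_group)
  qed
  then have "dl s (inv w \<otimes> t) \<longleftrightarrow> dl s (inv w)" using assms by (intro dl_mult_right) auto
  moreover have "inv (t \<otimes> w) = inv w \<otimes> t" using assms by (simp add: inv_mult_group)
  ultimately show ?thesis
    using assms len_inv_swap[of s w] len_inv_swap[of s "t \<otimes> w"] len_inv[of "t \<otimes> w"] by simp
qed

lemma ex_descent_left: "w \<in> carrier G \<Longrightarrow> w \<noteq> \<one> \<Longrightarrow> \<exists>s\<in>S. dl s w"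
proof -
  assume w: "w \<in> carrier G" "w \<noteq> \<one>"
  then obtain ws where ws: "ws \<in> lists S" "wp ws = w" "length ws = len w"
    using ex_reduced by blast
  with w obtain s ys where "ws = s # ys" by (cases ws) auto
  then show ?thesis using ws len_le[of ys] by (intro bexI[of _ s]) (auto simp: less_Suc_eq_le)
qed

lemma ex_descent_right: "w \<in> carrier G \<Longrightarrow> w \<noteq> \<one> \<Longrightarrow> \<exists>s\<in>S. dr w s"
  using ex_descent_left[of "inv w"] len_inv_swap[of _ w] by (metis inv_closed inv_inv inv_one len_inv)

lemma right_induct [consumes 1, case_names one step]:
  assumes "w \<in> carrier G"
    and "P \<one>"
    and "\<And>w s. w \<in> carrier G \<Longrightarrow> s \<in> S \<Longrightarrow> \<not> dr w s \<Longrightarrow> P w \<Longrightarrow> P (w \<otimes> s)"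
  shows "P w"
  using assms(1)
proof (induction "len w" arbitrary: w)
  case 0
  then show ?case using len_eq_0 assms by auto
next
  case (Suc n)
  then have "w \<noteq> \<one>" by auto
  then obtain s where s: "s \<in> S" "dr w s" using ex_descent_right Suc by auto
  then have "P (w \<otimes> s)" using Suc len_mult_right[of s w] by simp
  then show ?case using assms(3)[of "w \<otimes> s" s] s Suc.prems dr_flip[of s w] by simp
qed

lemma left_induct [consumes 1, case_names one step]:
  assumes "w \<in> carrier G"
    and "P \<one>"
    and "\<And>w s. w \<in> carrier G \<Longrightarrow> s \<in> S \<Longrightarrow> \<not> dl s w \<Longrightarrow> P w \<Longrightarrow> P (s \<otimes> w)"
  shows "P w"
  using assms(1)
proof (induction "len w" arbitrary: w)
  case 0
  then show ?case using len_eq_0 assms by auto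
next
  case (Suc n)
  then have "w \<noteq> \<one>" by auto
  then obtain s where s: "s \<in> S" "dl s w" using ex_descent_left Suc by auto
  then have "P (s \<otimes> w)" using Suc len_mult_left[of s w] by simp
  then show ?case using assms(3)[of "s \<otimes> w" s] s Suc.prems dl_flip[of s w] by simp
qed

end

section \<open>Parabolic subgroups and Bruhat order\<close>

context coxeter_system
begin

section \<open>Standard parabolic subgroups\<close>

lemma parab_closed [simp]: "J \<subseteq> S \<Longrightarrow> w \<in> generate G J \<Longrightarrow> w \<in> carrier G"
  using generate_in_carrier[of J w] gens_closed by blast

lemma parab_mult: "x \<in> generate G J \<Longrightarrow> y \<in> generate G J \<Longrightarrow> x \<otimes> y \<in> generate G J"
  by (rule generate.eng)

lemma parab_inv: "J \<subseteq> S \<Longrightarrow> x \<in> generate G J \<Longrightarrow> inv x \<in> generate G J"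
  using generate_m_inv_closed[of J x] gens_closed by blast

lemma parab_inv_iff: "J \<subseteq> S \<Longrightarrow> x \<in> carrier G \<Longrightarrow> inv x \<in> generate G J \<longleftrightarrow> x \<in> generate G J"
  using parab_inv[of J x] parab_inv[of J "inv x"] by auto

lemma parab_S: "s \<in> J \<Longrightarrow> s \<in> generate G J"
  by (rule generate.incl)

lemma parab_one [simp]: "\<one> \<in> generate G J"
  by (rule generate.one)

lemma parab_mono: "J \<subseteq> K \<Longrightarrow> w \<in> generate G J \<Longrightarrow> w \<in> generate G K"
  using mono_generate by blast

lemma parab_mult_left_iff:
  assumes "J \<subseteq> S" "x \<in> generate G J" "y \<in> carrier G"
  shows "x \<otimes> y \<in> generate G J \<longleftrightarrow> y \<in> generate G J"
proof
  assume "x \<otimes> y \<in> generate G J"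
  then have "inv x \<otimes> (x \<otimes> y) \<in> generate G J" by (rule parab_mult[OF parab_inv[OF assms(1,2)]])
  then show "y \<in> generate G J" using assms by simp
qed (use assms parab_mult in auto)

lemma parab_mult_right_iff:
  assumes "J \<subseteq> S" "x \<in> generate G J" "y \<in> carrier G"
  shows "y \<otimes> x \<in> generate G J \<longleftrightarrow> y \<in> generate G J"
proof
  assume "y \<otimes> x \<in> generate G J"
  then have "y \<otimes> x \<otimes> inv x \<in> generate G J" by (rule parab_mult[OF _ parab_inv[OF assms(1,2)]])
  then show "y \<in> generate G J" using assms by simp
qed (use assms parab_mult in auto)

text \<open>Applied to a word in J, the exchange condition exhibits t as a letter of J conjugated by
  a prefix of that word.\<close>

lemma eta_parab:
  assumes "J \<subseteq> S" "w \<in> generate G J" "t \<in> carrier G" "eta w t"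
  shows "t \<in> generate G J"
proof -
  obtain ws where ws: "ws \<in> lists J" "wp ws = w"
    using assms generate_iff_word by blast
  have wsS: "ws \<in> lists S" using ws lists_mono[OF assms(1)] by auto
  then have "nref ws t" using assms eta_word ws by auto
  then obtain xs s ys where *: "ws = xs @ s # ys" "t = wp xs \<otimes> s \<otimes> inv (wp xs)"
    using nref_exchange[OF wsS assms(3)] by blast
  have "wp xs \<in> generate G J" "s \<in> generate G J"
    using * ws generate_iff_word[OF assms(1)] parab_S[of s J] by auto
  then show ?thesis unfolding *(2) using assms(1) by (intro parab_mult parab_inv)
qed

text \<open>Prepending a letter of J to a reduced word in J either lengthens it or, by exchange,
  deletes one of its letters; in both cases the word stays in J.\<close>

lemma parab_reduced:
  assumes "J \<subseteq> S" "w \<in> generate G J"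
  shows "\<exists>ws\<in>lists J. wp ws = w \<and> length ws = len w"
proof -
  obtain ws where "ws \<in> lists J" "wp ws = w" using assms generate_iff_word by blast
  then show ?thesis
  proof (induction ws arbitrary: w rule: list.induct)
    case Nil
    then show ?case by (intro bexI[of _ "[]"]) auto
  next
    case (Cons s ws)
    then obtain ys where ys: "ys \<in> lists J" "wp ys = wp ws" "length ys = len (wp ws)" by auto
    have S: "s \<in> S" "ys \<in> lists S" "s \<in> J" "wp ys \<in> carrier G"
      using Cons ys lists_mono[OF assms(1)] assms(1) by auto
    show ?case
    proof (cases "dl s (wp ys)")
      case False
      then show ?thesis using S ys Cons.prems len_mult_left(2)[of s "wp ys"]
        by (intro bexI[of _ "s # ys"]) auto
    next
      case True
      then have "nref ys s" using S by (simp add: dl_eta eta_word)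
      then obtain xs r zs where *: "ys = xs @ r # zs" "s \<otimes> wp ys = wp (xs @ zs)"
        using nref_exchange[of ys s] S by blast
      then show ?thesis using S ys Cons.prems len_mult_left(1)[OF S(1,4) True]
        by (intro bexI[of _ "xs @ zs"]) auto
    qed
  qed
qed

lemma S_parab_iff: "J \<subseteq> S \<Longrightarrow> s \<in> S \<Longrightarrow> s \<in> generate G J \<longleftrightarrow> s \<in> J"
proof
  assume "J \<subseteq> S" "s \<in> S" "s \<in> generate G J"
  then obtain ws where ws: "ws \<in> lists J" "wp ws = s" "length ws = Suc 0"
    using parab_reduced[of J s] by auto
  then obtain r where "ws = [r]" by (cases ws) auto
  then show "s \<in> J" using ws \<open>J \<subseteq> S\<close> by auto
qed (rule parab_S)

lemma descent_parab: "J \<subseteq> S \<Longrightarrow> w \<in> generate G J \<Longrightarrow> s \<in> S \<Longrightarrow> dl s w \<Longrightarrow> s \<in> J"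
  using eta_parab[of J w s] S_parab_iff[of J s] by (simp add: dl_eta)

lemma descent_parab_right: "J \<subseteq> S \<Longrightarrow> w \<in> generate G J \<Longrightarrow> s \<in> S \<Longrightarrow> dr w s \<Longrightarrow> s \<in> J"
  using descent_parab[of J "inv w" s] parab_inv[of J w] len_inv_swap[of s w] by simp

lemma parab_left_induct [consumes 2, case_names one step]:
  assumes "J \<subseteq> S" "w \<in> generate G J"
    and "P \<one>"
    and "\<And>w s. w \<in> generate G J \<Longrightarrow> s \<in> J \<Longrightarrow> \<not> dl s w \<Longrightarrow> P w \<Longrightarrow> P (s \<otimes> w)"
  shows "P w"
  using assms(2)
proof (induction "len w" arbitrary: w)
  case 0
  then show ?case using len_eq_0[of w] assms(1,3) by simp
next
  case (Suc n)
  have w: "w \<in> carrier G" using Suc assms by simp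
  moreover have "w \<noteq> \<one>" using Suc by auto
  ultimately obtain s where s: "s \<in> S" "dl s w" using ex_descent_left by auto
  then have sJ: "s \<in> J" using descent_parab Suc assms by auto
  then have sw: "s \<otimes> w \<in> generate G J" using Suc parab_mult parab_S by auto
  then have "P (s \<otimes> w)" using Suc len_mult_left[of s w] s w by auto
  then show ?case using assms(4)[OF sw sJ] s w dl_flip[of s w] by simp
qed

text \<open>A left descent of an element of W_J and W_K lies in J and in K, so it can be stripped
  off inside both subgroups.\<close>

lemma parab_Int:
  assumes "J \<subseteq> S" "K \<subseteq> S" "w \<in> generate G J" "w \<in> generate G K"
  shows "w \<in> generate G (J \<inter> K)"
  using assms(1,3,4)
proof (induction w rule: parab_left_induct)
  case (step w s)
  have c: "w \<in> carrier G" "s \<in> S" using step assms by auto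
  then have "dl s (s \<otimes> w)" using step dl_flip by simp
  then have "s \<in> K" using descent_parab[OF assms(2) step.prems] c by simp
  moreover from this have "w \<in> generate G K"
    using parab_mult_left_iff[OF assms(2) parab_S[of s K], of w] step c by simp
  ultimately show ?case using step by (intro parab_mult[OF parab_S]) auto
qed simp

lemma parab_empty: "w \<in> generate G {} \<Longrightarrow> w = \<one>"
  using generate_empty by simp

lemma parab_disjoint: "J \<subseteq> S \<Longrightarrow> K \<subseteq> S \<Longrightarrow> J \<inter> K = {} \<Longrightarrow> w \<in> generate G J \<Longrightarrow> w \<in> generate G K \<Longrightarrow> w = \<one>"
  using parab_Int parab_empty by metis

section \<open>Minimal coset representatives\<close>

abbreviation mcr :: "'a set \<Rightarrow> 'a set" where
  "mcr \<equiv> min_coset_reps G S"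

lemma mcr_iff: "J \<subseteq> S \<Longrightarrow> u \<in> mcr J \<longleftrightarrow> u \<in> carrier G \<and> (\<forall>s\<in>J. \<not> dl s u)"
proof -
  assume J: "J \<subseteq> S"
  have "len (s \<otimes> u) > len u \<longleftrightarrow> \<not> dl s u" if "s \<in> J" "u \<in> carrier G" for s
    using len_mult_left[of s u] J that by (cases "dl s u") auto
  then show ?thesis unfolding min_coset_reps_def by auto
qed

lemma mcr_closed [simp]: "u \<in> mcr J \<Longrightarrow> u \<in> carrier G"
  unfolding min_coset_reps_def by auto

lemma mcr_antimono: "I \<subseteq> J \<Longrightarrow> u \<in> mcr J \<Longrightarrow> u \<in> mcr I"
  unfolding min_coset_reps_def by auto

lemma ex_decomp:
  assumes "J \<subseteq> S" "x \<in> carrier G"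
  shows "\<exists>w\<in>generate G J. \<exists>u\<in>mcr J. x = w \<otimes> u"
  using assms(2)
proof (induction "len x" arbitrary: x rule: less_induct)
  case less
  show ?case
  proof (cases "x \<in> mcr J")
    case True
    then show ?thesis by (intro bexI[of _ \<one>] bexI[of _ x]) auto
  next
    case False
    then obtain s where s: "s \<in> J" "dl s x" "s \<in> S" using mcr_iff[OF assms(1)] less assms by auto
    then obtain w u where *: "w \<in> generate G J" "u \<in> mcr J" "s \<otimes> x = w \<otimes> u"
      using less.hyps[of "s \<otimes> x"] less.prems by auto
    then have "x = s \<otimes> w \<otimes> u" using s less.prems assms
      by (metis S_cancel(1) S_closed m_assoc mcr_closed parab_closed)
    then show ?thesis using * s parab_mult parab_S by metis
  qed
qed

text \<open>Having no left descent in J is only a local condition. An element u0 = w0 u of least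
  length in W_J u has no inversion in W_J, so lengths add over u0; if w0 were not 1, a first letter
  of w0^-1 would then be a descent of u in J. Hence u = u0 has both properties.\<close>

lemma mcr_props:
  assumes J: "J \<subseteq> S" and u: "u \<in> mcr J"
  shows "t \<in> refs \<Longrightarrow> t \<in> generate G J \<Longrightarrow> \<not> eta u t"
    and "w \<in> generate G J \<Longrightarrow> len (w \<otimes> u) = len w + len u"
proof -
  define w0 where "w0 = arg_min (\<lambda>w. len (w \<otimes> u)) (\<lambda>w. w \<in> generate G J)"
  define u0 where "u0 = w0 \<otimes> u"
  have "w0 \<in> generate G J \<and> (\<forall>w. w \<in> generate G J \<longrightarrow> len (w0 \<otimes> u) \<le> len (w \<otimes> u))"
    unfolding w0_def by (rule arg_min_nat_lemma[of _ \<one>]) simp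
  then have w0: "w0 \<in> generate G J" and min: "\<And>w. w \<in> generate G J \<Longrightarrow> len u0 \<le> len (w \<otimes> u)"
    unfolding u0_def by auto
  have uc: "u \<in> carrier G" "w0 \<in> carrier G" "u0 \<in> carrier G" using u w0 J by (auto simp: u0_def)
  have ne: "\<not> eta u0 t" if "t \<in> refs" "t \<in> generate G J" for t
    using min[of "t \<otimes> w0"] that w0 uc eta_iff_len[of t u0] by (auto simp: u0_def m_assoc parab_mult)
  have add: "len (w \<otimes> u0) = len w + len u0" if "w \<in> generate G J" for w
    using J that
  proof (induction w rule: parab_left_induct)
    case one
    then show ?case using uc by simp
  next
    case (step w s)
    have s: "s \<in> S" "w \<in> carrier G" using J step by auto
    have "inv w \<otimes> s \<otimes> w \<in> generate G J" using step by (intro parab_mult[OF parab_mult[OF parab_inv[OF J] parab_S]])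
    then have "\<not> eta u0 (inv w \<otimes> s \<otimes> w)" using ne s refs_conj(2)[of s w] by auto
    moreover have "\<not> eta w s" using step s by (simp add: dl_eta)
    ultimately have "\<not> eta (w \<otimes> u0) s" using s uc eta_mult by simp
    then have "\<not> dl s (w \<otimes> u0)" using s uc dl_eta by simp
    then show ?case using step s uc len_mult_left(2)[of s "w \<otimes> u0"] len_mult_left(2)[of s w]
      by (simp add: m_assoc)
  qed
  have "inv w0 = \<one>"
  proof (rule ccontr)
    assume "inv w0 \<noteq> \<one>"
    then obtain s where s: "s \<in> S" "dl s (inv w0)"
      using ex_descent_left[OF inv_closed[OF uc(2)]] by blast
    then have sJ: "s \<in> J" using descent_parab[OF J parab_inv[OF J w0]] by auto
    have eq: "inv w0 \<otimes> u0 = u" using uc by (simp add: u0_def)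
    have "s \<otimes> u = s \<otimes> inv w0 \<otimes> u0" using eq s uc by (simp add: m_assoc)
    then have "len (s \<otimes> u) = len (s \<otimes> inv w0) + len u0"
      using add[of "s \<otimes> inv w0"] sJ w0 J by (auto intro: parab_mult[OF parab_S] parab_inv)
    also have "\<dots> < len (inv w0) + len u0" using s by simp
    also have "\<dots> = len u" using add[of "inv w0"] parab_inv[OF J w0] eq by simp
    finally show False using sJ u J mcr_iff by auto
  qed
  then have "u0 = u" using uc inv_eq_1_iff[of w0] by (simp add: u0_def)
  then show "t \<in> refs \<Longrightarrow> t \<in> generate G J \<Longrightarrow> \<not> eta u t"
    and "w \<in> generate G J \<Longrightarrow> len (w \<otimes> u) = len w + len u"
    using ne add by auto
qed

lemmas len_mcr = mcr_props(2)

text \<open>With x = w'^-1 w one has xu = u' and x^-1 u' = u; additivity of lengths in both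
  directions gives l(x) = 0.\<close>

lemma decomp_unique:
  assumes "J \<subseteq> S" "w \<in> generate G J" "w' \<in> generate G J" "u \<in> mcr J" "u' \<in> mcr J"
    and "w \<otimes> u = w' \<otimes> u'"
  shows "w = w'" "u = u'"
proof -
  have c: "w \<in> carrier G" "w' \<in> carrier G" "u \<in> carrier G" "u' \<in> carrier G" using assms by auto
  let ?x = "inv w' \<otimes> w"
  have x: "?x \<in> generate G J" using assms by (intro parab_mult parab_inv) auto
  have eq: "?x \<otimes> u = u'" using assms c by (simp add: m_assoc)
  have "inv ?x \<otimes> (?x \<otimes> u) = u" using c by (intro inv_cancel(1)) auto
  then have eq': "inv ?x \<otimes> u' = u" by (simp only: eq)
  have "len u' = len ?x + len u" using len_mcr[OF assms(1,4) x] eq by simp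
  moreover have "len u = len ?x + len u'"
    using len_mcr[OF assms(1,5) parab_inv[OF assms(1) x]] eq' c len_inv[of ?x] by simp
  ultimately have "len ?x = 0" by simp
  then have "?x = \<one>" using c len_eq_0[of ?x] by simp
  then show "u = u'" using eq c by simp
  have "w' \<otimes> ?x = w'" using \<open>?x = \<one>\<close> c by simp
  then show "w = w'" using c by simp
qed

text \<open>Deodhar's lemma: right multiplication by s either preserves minimality or acts as left
  multiplication by a letter of J, because a new left descent t of us must satisfy tu = us.\<close>

lemma mcr_right:
  assumes "J \<subseteq> S" "u \<in> mcr J" "s \<in> S" "u \<otimes> s \<notin> mcr J"
  shows "\<exists>t\<in>J. t \<otimes> u = u \<otimes> s"
proof -
  have u: "u \<in> carrier G" using assms by simp
  obtain t where t: "t \<in> J" "dl t (u \<otimes> s)"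
    using assms u mcr_iff[OF assms(1), of "u \<otimes> s"] by auto
  have "\<not> dl t u" using t assms mcr_iff by auto
  then show ?thesis using t dl_mult_right[of s t u] assms u by auto
qed

lemma mcr_right_descent:
  assumes "J \<subseteq> S" "u \<in> mcr J" "s \<in> S" "dr u s"
  shows "u \<otimes> s \<in> mcr J"
  using mcr_right[OF assms(1-3)] assms mcr_iff by fastforce

lemma dr_mcr:
  assumes "J \<subseteq> S" "u \<in> mcr J" "s \<in> S" "u \<otimes> s \<in> mcr J" "w \<in> generate G J"
  shows "dr (w \<otimes> u) s \<longleftrightarrow> dr u s"
  using assms len_mcr[OF assms(1,2,5)] len_mcr[OF assms(1,4,5)] by (simp add: m_assoc)

lemma mcr_parab_disjoint:
  assumes "J \<subseteq> S" "K \<subseteq> S" "J \<inter> K = {}" "u \<in> generate G K"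
  shows "u \<in> mcr J"
  using assms descent_parab[OF assms(2,4)] by (subst mcr_iff) auto

section \<open>Commutation with a generator outside the support\<close>

lemma commute_generate:
  assumes "K \<subseteq> S" "s \<in> carrier G" "\<And>r. r \<in> K \<Longrightarrow> s \<otimes> r = r \<otimes> s" "w \<in> generate G K"
  shows "s \<otimes> w = w \<otimes> s"
  using assms(1,4)
proof (induction w rule: parab_left_induct)
  case (step w r)
  then have c: "w \<in> carrier G" "r \<in> carrier G" using assms by auto
  have "s \<otimes> (r \<otimes> w) = s \<otimes> r \<otimes> w" using c assms by (simp add: m_assoc)
  also have "\<dots> = r \<otimes> (s \<otimes> w)" using c assms step by (simp add: m_assoc)
  also have "\<dots> = r \<otimes> w \<otimes> s" using c assms step by (simp add: m_assoc)
  finally show ?case .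
qed (use assms in simp)

text \<open>The reflection s is an inversion of sw = w's but not of w', since it lies outside W_R.
  Right multiplication by s can only have created it through sw' = w's.\<close>

lemma commute_parab:
  assumes "R \<subseteq> S" "s \<in> S" "s \<notin> R" "w \<in> generate G R" "w' \<in> generate G R" "s \<otimes> w = w' \<otimes> s"
  shows "w' = w" "s \<otimes> w = w \<otimes> s"
proof -
  have c: "w \<in> carrier G" "w' \<in> carrier G" using assms by auto
  have n: "\<not> eta x s" if "x \<in> generate G R" for x
    using eta_parab[OF assms(1) that, of s] S_parab_iff[of R s] assms by auto
  have "eta (s \<otimes> w) s" using n[OF assms(4)] eta_mult_refs[of s w] assms(2) c by auto
  then have "s \<otimes> w' = w' \<otimes> s" using assms c n[OF assms(5)] eta_mult_S[of s s w'] by simp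
  then have "s \<otimes> w' = s \<otimes> w" using assms(6) by simp
  then show "w' = w" using S_cancel(1)[OF assms(2) c(1)] S_cancel(1)[OF assms(2) c(2)] by metis
  then show "s \<otimes> w = w \<otimes> s" using assms by simp
qed

text \<open>If \<open>w = w'r\<close> is reduced, \<open>sw = ws\<close> and \<open>sr \<noteq> rs\<close>, then \<open>sr\<close> is a minimal representative for
  \<open>W\<^sub>R\<close>, so that \<open>sw' = wsr\<close> would be too long.\<close>
lemma commute_support:
  assumes R: "R \<subseteq> S" and s: "s \<in> S" "s \<notin> R" and "w \<in> generate G R" "s \<otimes> w = w \<otimes> s"
  shows "w \<in> generate G {r \<in> R. s \<otimes> r = r \<otimes> s}"
  using assms(4,5)
proof (induction "len w" arbitrary: w)
  case 0
  then show ?case using len_eq_0[of w] R by simp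
next
  case (Suc n)
  have w: "w \<in> carrier G" using Suc R by simp
  moreover have "w \<noteq> \<one>" using Suc by auto
  ultimately obtain r where r: "r \<in> S" "dr w r" using ex_descent_right by auto
  then have rR: "r \<in> R" using descent_parab_right Suc R by auto
  define w' where "w' = w \<otimes> r"
  have w': "w' \<in> generate G R" "w' \<in> carrier G" "w = w' \<otimes> r" "len w = Suc (len w')"
    using Suc rR r w len_mult_right(1)[of r w] by (auto simp: w'_def intro: parab_mult parab_S)
  have eq: "s \<otimes> w' = w \<otimes> (s \<otimes> r)"
  proof -
    have "s \<otimes> w' = s \<otimes> w \<otimes> r" unfolding w'_def using s r w by (simp add: m_assoc)
    then show ?thesis using Suc.prems s r w by (simp add: m_assoc)
  qed
  have comm: "s \<otimes> r = r \<otimes> s"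
  proof (rule ccontr)
    assume nc: "s \<otimes> r \<noteq> r \<otimes> s"
    have "s \<otimes> r \<in> mcr R"
    proof (subst mcr_iff[OF R], intro conjI ballI)
      fix t assume t: "t \<in> R"
      have "t \<otimes> s \<noteq> s \<otimes> r"
        using commute_parab(2)[OF R s parab_S[OF rR] parab_S[OF t]] nc by auto
      then have "dl t (s \<otimes> r) \<longleftrightarrow> dl t s" using dl_mult_right[of r t s] r s t R by auto
      also have "\<dots> \<longleftrightarrow> False" using t s R by (auto simp: dl_eta simp del: len_S)
      finally show "\<not> dl t (s \<otimes> r)" by simp
    qed (use r s in simp)
    then have "len (s \<otimes> w') = len w + len (s \<otimes> r)"
      using eq len_mcr[OF R _ Suc.prems(1)] by simp
    moreover have "len (s \<otimes> w') = Suc (len w')"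
      using len_mult_left(2)[of s w'] descent_parab[OF R w'(1), of s] s w' by auto
    moreover have "s \<otimes> r \<noteq> \<one>"
      using nc r s S_square[of s] S_cancel(1)[of s r] by (metis S_closed r_one)
    ultimately show False using w' len_eq_0[of "s \<otimes> r"] r s by auto
  qed
  then have sw': "s \<otimes> w' = w' \<otimes> s" using eq w r s by (simp add: m_assoc w'_def)
  have "n = len w'" using Suc.hyps(2) w'(4) by simp
  then have "w' \<in> generate G {r \<in> R. s \<otimes> r = r \<otimes> s}"
    using Suc.hyps(1) w'(1) sw' by blast
  moreover have "r \<in> generate G {r \<in> R. s \<otimes> r = r \<otimes> s}" using comm rR by (intro parab_S) auto
  ultimately show ?case unfolding w'(3) by (rule parab_mult)
qed

section \<open>Bruhat order\<close>

abbreviation bl :: "'a \<Rightarrow> 'a \<Rightarrow> bool" where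
  "bl \<equiv> bruhat_le G S"

lemma bruhat_refl [simp]: "bl u u \<longleftrightarrow> u \<in> carrier G"
  by (auto simp: bruhat_le_def)

lemma bruhat_trans: "bl u v \<Longrightarrow> bl v w \<Longrightarrow> bl u w"
  by (auto simp: bruhat_le_def)

lemma bruhat_closed: "bl u v \<Longrightarrow> u \<in> carrier G" "bl u v \<Longrightarrow> v \<in> carrier G"
  by (auto simp: bruhat_le_def)

lemma bruhat_len: "bl u v \<Longrightarrow> u = v \<or> len u < len v"
proof -
  assume "bl u v"
  then have "(bruhat_step G S)\<^sup>*\<^sup>* u v" by (auto simp: bruhat_le_def)
  then show ?thesis
    by (induction rule: rtranclp_induct) (auto simp: bruhat_step_def)
qed

lemma bruhat_stepI:
  assumes "u \<in> carrier G" "t \<in> refs" "len u < len (u \<otimes> t)"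
  shows "bl u (u \<otimes> t)"
  using assms by (auto simp: bruhat_le_def bruhat_step_def intro!: r_into_rtranclp)

lemma bruhat_up: "w \<in> carrier G \<Longrightarrow> s \<in> S \<Longrightarrow> \<not> dr w s \<Longrightarrow> bl w (w \<otimes> s)"
  using bruhat_stepI[of w s] len_mult_right(2)[of s w] by auto

lemma len_right_eta: "t \<in> refs \<Longrightarrow> w \<in> carrier G \<Longrightarrow> len (w \<otimes> t) < len w \<longleftrightarrow> eta (inv w) t"
  using eta_iff_len[of t "inv w"] len_inv[of "w \<otimes> t"] by (simp add: inv_mult_group inv_refs)

lemma len_right_not_eta: "t \<in> refs \<Longrightarrow> w \<in> carrier G \<Longrightarrow> len w < len (w \<otimes> t) \<longleftrightarrow> \<not> eta (inv w) t"
  using not_eta_len[of t "inv w"] len_right_eta[of t w] len_inv[of "w \<otimes> t"]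
  by (auto simp: inv_mult_group inv_refs)

text \<open>Induction along the chain. For a step from y to yt with t different from s, the
  reflection sts leads upwards from ys to yts, because it is different from s and so inherits from t
  that it raises length. For t = s the step merely exchanges y and ys.\<close>

lemma bruhat_mult_S:
  assumes "bl x y" "s \<in> S"
  shows "bl (x \<otimes> s) y \<or> bl (x \<otimes> s) (y \<otimes> s)"
proof -
  have x: "x \<in> carrier G" and chain: "(bruhat_step G S)\<^sup>*\<^sup>* x y" using assms by (auto simp: bruhat_le_def)
  from chain have "y \<in> carrier G \<and> (bl (x \<otimes> s) y \<or> bl (x \<otimes> s) (y \<otimes> s))"
  proof (induction rule: rtranclp_induct)
    case base
    then show ?case using assms x by simp
  next
    case (step y z)
    then obtain t where t: "t \<in> refs" "z = y \<otimes> t" "len y < len z" and y: "y \<in> carrier G"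
      by (auto simp: bruhat_step_def)
    have yz: "bl y z" using bruhat_stepI t y by auto
    show ?case
    proof (cases "bl (x \<otimes> s) y")
      case True
      then show ?thesis using bruhat_trans yz t y by blast
    next
      case False
      then have *: "bl (x \<otimes> s) (y \<otimes> s)" using step by auto
      show ?thesis
      proof (cases "t = s")
        case True
        then show ?thesis using * t y assms by auto
      next
        case False
        have sts: "s \<otimes> t \<otimes> s \<in> refs" using refs_conj[of t s] t assms by auto
        have ne: "s \<otimes> t \<otimes> s \<noteq> s"
          using False conj_eq_iff[of s t s] t assms by auto
        have "\<not> eta (inv y) t" using len_right_not_eta[of t y] t y by simp
        then have "\<not> eta (inv (y \<otimes> s)) (s \<otimes> t \<otimes> s)"
          using assms y t ne sts eta_mult[of s "inv y" "s \<otimes> t \<otimes> s"] by (simp add: inv_mult_group m_assoc)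
        then have "bl (y \<otimes> s) (y \<otimes> s \<otimes> (s \<otimes> t \<otimes> s))"
          using bruhat_stepI[OF _ sts] len_right_not_eta[OF sts] assms y by auto
        then have "bl (y \<otimes> s) (z \<otimes> s)" using t y assms by (simp add: m_assoc)
        then show ?thesis using * bruhat_trans t y by auto
      qed
    qed
  qed
  then show ?thesis by simp
qed

lemma bruhat_lift:
  assumes "bl x y" "s \<in> S" "\<not> dr y s"
  shows "bl (x \<otimes> s) (y \<otimes> s)"
  using bruhat_mult_S[OF assms(1,2)] bruhat_trans bruhat_up[OF _ assms(2,3)] bruhat_closed[OF assms(1)] by blast

lemma subseq_lists: "subseq us ws \<Longrightarrow> ws \<in> lists A \<Longrightarrow> us \<in> lists A"
  by (induction rule: list_emb.induct) auto

text \<open>Every step down the chain deletes one letter. Strong exchange holds for arbitrary words,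
  so the intermediate subwords need not be reduced.\<close>

lemma bruhat_subword:
  assumes "bl u v" "ws \<in> lists S" "wp ws = v"
  shows "\<exists>us. subseq us ws \<and> wp us = u"
proof -
  have "(bruhat_step G S)\<^sup>*\<^sup>* u v" "v \<in> carrier G" "u \<in> carrier G" using assms by (auto simp: bruhat_le_def)
  then show ?thesis
  proof (induction rule: converse_rtranclp_induct)
    case base
    then show ?case using assms by auto
  next
    case (step x y)
    then obtain t where t: "t \<in> refs" "y = x \<otimes> t" "len x < len y" and x: "x \<in> carrier G"
      by (auto simp: bruhat_step_def)
    have y: "y \<in> carrier G" using t x by auto
    then obtain us where us: "subseq us ws" "wp us = y" using step by auto
    have usS: "us \<in> lists S" using us assms subseq_lists by blast
    define t' where "t' = y \<otimes> t \<otimes> inv y"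
    have t': "t' \<in> refs" "t' \<otimes> y = x" using refs_conj[OF t(1) y] t x y
      by (auto simp: t'_def m_assoc refs_square)
    then have "eta y t'" using eta_iff_len[of t' y] t y by simp
    then have "nref us t'" using eta_word[OF usS] us t' by auto
    then obtain xs s ys where *: "us = xs @ s # ys" "t' \<otimes> wp us = wp (xs @ ys)"
      using nref_exchange[OF usS] t' by blast
    have "subseq (xs @ ys) us" unfolding *(1) by (intro list_emb_append_mono) auto
    then show ?case using us * t' subseq_order.order_trans by (intro exI[of _ "xs @ ys"]) auto
  qed
qed

lemma bruhat_parab: "bl u v \<Longrightarrow> J \<subseteq> S \<Longrightarrow> v \<in> generate G J \<Longrightarrow> u \<in> generate G J"
proof -
  assume *: "bl u v" "J \<subseteq> S" "v \<in> generate G J"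
  obtain ws where ws: "ws \<in> lists J" "wp ws = v" using * generate_iff_word by blast
  then have "ws \<in> lists S" using lists_mono[OF *(2)] by auto
  then obtain us where "subseq us ws" "wp us = u" using bruhat_subword[OF *(1) _ ws(2)] by auto
  then show ?thesis using subseq_lists ws generate_iff_word[OF *(2)] by blast
qed

lemma finite_bruhat: "finite {u. bl u v}"
proof (cases "v \<in> carrier G")
  case True
  then obtain ws where ws: "ws \<in> lists S" "wp ws = v" using ex_word by auto
  have "{u. bl u v} \<subseteq> wp ` set (subseqs ws)"
    using bruhat_subword[OF _ ws] by (auto simp: image_iff Bex_def) metis
  then show ?thesis using finite_subset by blast
next
  case False
  then have "{u. bl u v} = {}" using bruhat_closed by auto
  then show ?thesis by simp
qed

end

section \<open>The Hecke algebra as a module of functions\<close>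

definition scale :: "lau \<Rightarrow> ('x \<Rightarrow> lau) \<Rightarrow> 'x \<Rightarrow> lau" where
  "scale a h = (\<lambda>u. a * h u)"

lemma scale_apply [simp]: "scale a h u = a * h u"
  by (simp add: scale_def)

lemma scale_scale [simp]: "scale a (scale b h) = scale (a * b) h"
  and scale_1 [simp]: "scale 1 h = h"
  and scale_0 [simp]: "scale 0 h = 0"
  and scale_zero [simp]: "scale a 0 = 0"
  and scale_add: "scale a (h + k) = scale a h + scale a k"
  and scale_diff: "scale a (h - k) = scale a h - scale a k"
  and scale_add_left: "scale (a + b) h = scale a h + scale b h"
  and scale_diff_left: "scale (a - b) h = scale a h - scale b h"
  by (auto simp: fun_eq_iff algebra_simps)

lemma sum_fun_apply: "(\<Sum>x\<in>A. f x) u = (\<Sum>x\<in>A. f x u)" for f :: "'b \<Rightarrow> 'c \<Rightarrow> lau"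
  by (induction A rule: infinite_finite_induct) auto

lemma sum_list_fun_apply: "(\<Sum>x\<leftarrow>xs. f x) u = (\<Sum>x\<leftarrow>xs. f x u)" for f :: "'b \<Rightarrow> 'c \<Rightarrow> lau"
  by (induction xs) auto

definition lin :: "(('x \<Rightarrow> lau) \<Rightarrow> 'x \<Rightarrow> lau) \<Rightarrow> bool" where
  "lin F \<longleftrightarrow> (\<forall>h k. F (h + k) = F h + F k) \<and> (\<forall>a h. F (scale a h) = scale a (F h))"

lemma lin_add: "lin F \<Longrightarrow> F (h + k) = F h + F k"
  and lin_scale: "lin F \<Longrightarrow> F (scale a h) = scale a (F h)"
  by (auto simp: lin_def)

lemma lin_0: "lin F \<Longrightarrow> F 0 = 0"
  using lin_scale[of F 0 0] by simp

lemma lin_diff: "lin F \<Longrightarrow> F (h - k) = F h - F k"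
  using lin_add[of F "h - k" k] by (simp add: algebra_simps)

lemma lin_sum: "lin F \<Longrightarrow> F (\<Sum>x\<in>A. f x) = (\<Sum>x\<in>A. F (f x))"
  by (induction A rule: infinite_finite_induct) (auto simp: lin_0 lin_add)

lemma lin_sum_list: "lin F \<Longrightarrow> F (\<Sum>x\<leftarrow>xs. f x) = (\<Sum>x\<leftarrow>xs. F (f x))"
  by (induction xs) (auto simp: lin_0 lin_add)

lemma lin_scale_op: "lin (scale a)"
  by (auto simp: lin_def scale_add mult.commute)

lemma lin_compose: "lin F \<Longrightarrow> lin F' \<Longrightarrow> lin (\<lambda>h. F (F' h))"
  by (simp add: lin_def)

lemma lin_minus: "lin F \<Longrightarrow> lin F' \<Longrightarrow> lin (\<lambda>h. F h - F' h)"
  by (simp add: lin_def scale_diff)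

definition del :: "'x \<Rightarrow> 'x \<Rightarrow> lau" where
  "del w = (\<lambda>u. if u = w then 1 else 0)"

context coxeter_system
begin

text \<open>The Hecke algebra encoded by coefficient functions: h u is the coefficient of the
  standard basis element H_u, and \<open>del w\<close> is H_w.\<close>

definition Hm :: "('a \<Rightarrow> lau) set" where
  "Hm = {h. finite {u. h u \<noteq> 0} \<and> (\<forall>u. h u \<noteq> 0 \<longrightarrow> u \<in> carrier G)}"

text \<open>Right multiplication by C_s = H_s + v, where H_s^2 = 1 + (v^-1 - v) H_s. Subtracting v
  or v^-1 gives multiplication by H_s (\<open>Rs\<close>) or by its inverse (\<open>Ri\<close>);
  \<open>Lc\<close>, \<open>Ls\<close> and \<open>Li\<close> are the left versions.\<close>

definition Rc :: "'a \<Rightarrow> ('a \<Rightarrow> lau) \<Rightarrow> 'a \<Rightarrow> lau" where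
  "Rc s h = (\<lambda>u. if u \<in> carrier G then h (u \<otimes> s) + vp (if dr u s then -1 else 1) * h u else 0)"

definition Lc :: "'a \<Rightarrow> ('a \<Rightarrow> lau) \<Rightarrow> 'a \<Rightarrow> lau" where
  "Lc s h = (\<lambda>u. if u \<in> carrier G then h (s \<otimes> u) + vp (if dl s u then -1 else 1) * h u else 0)"

definition Rs :: "'a \<Rightarrow> ('a \<Rightarrow> lau) \<Rightarrow> 'a \<Rightarrow> lau" where
  "Rs s h = Rc s h - scale (vp 1) h"

definition Ri :: "'a \<Rightarrow> ('a \<Rightarrow> lau) \<Rightarrow> 'a \<Rightarrow> lau" where
  "Ri s h = Rc s h - scale (vp (-1)) h"

definition Ls :: "'a \<Rightarrow> ('a \<Rightarrow> lau) \<Rightarrow> 'a \<Rightarrow> lau" where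
  "Ls s h = Lc s h - scale (vp 1) h"

definition Li :: "'a \<Rightarrow> ('a \<Rightarrow> lau) \<Rightarrow> 'a \<Rightarrow> lau" where
  "Li s h = Lc s h - scale (vp (-1)) h"

lemma Hm_closed: "h \<in> Hm \<Longrightarrow> h u \<noteq> 0 \<Longrightarrow> u \<in> carrier G"
  by (auto simp: Hm_def)

lemma Hm_finite: "h \<in> Hm \<Longrightarrow> finite {u. h u \<noteq> 0}"
  by (auto simp: Hm_def)

lemma Hm_subset: "finite A \<Longrightarrow> A \<subseteq> carrier G \<Longrightarrow> (\<And>u. h u \<noteq> 0 \<Longrightarrow> u \<in> A) \<Longrightarrow> h \<in> Hm"
  unfolding Hm_def by (auto intro: finite_subset[of _ A])

lemma Hm_0 [simp]: "0 \<in> Hm"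
  by (simp add: Hm_def)

lemma Hm_add [intro]: "h \<in> Hm \<Longrightarrow> k \<in> Hm \<Longrightarrow> h + k \<in> Hm"
  by (rule Hm_subset[of "{u. h u \<noteq> 0} \<union> {u. k u \<noteq> 0}"]) (auto simp: Hm_finite intro: Hm_closed)

lemma Hm_diff [intro]: "h \<in> Hm \<Longrightarrow> k \<in> Hm \<Longrightarrow> h - k \<in> Hm"
  by (rule Hm_subset[of "{u. h u \<noteq> 0} \<union> {u. k u \<noteq> 0}"]) (auto simp: Hm_finite intro: Hm_closed)

lemma Hm_scale [intro]: "h \<in> Hm \<Longrightarrow> scale a h \<in> Hm"
  by (rule Hm_subset[of "{u. h u \<noteq> 0}"]) (auto simp: Hm_finite intro: Hm_closed)

lemma Hm_sum: "(\<And>x. x \<in> A \<Longrightarrow> f x \<in> Hm) \<Longrightarrow> (\<Sum>x\<in>A. f x) \<in> Hm"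
  by (induction A rule: infinite_finite_induct) auto

lemma Hm_sum_list: "(\<And>x. x \<in> set xs \<Longrightarrow> f x \<in> Hm) \<Longrightarrow> (\<Sum>x\<leftarrow>xs. f x) \<in> Hm"
  by (induction xs) auto

lemma Hm_del [simp, intro]: "w \<in> carrier G \<Longrightarrow> del w \<in> Hm"
  by (rule Hm_subset[of "{w}"]) (auto simp: del_def split: if_splits)

lemma Hm_Rc [intro]: "h \<in> Hm \<Longrightarrow> s \<in> S \<Longrightarrow> Rc s h \<in> Hm"
proof (rule Hm_subset[of "{u. h u \<noteq> 0} \<union> (\<lambda>u. u \<otimes> s) ` {u. h u \<noteq> 0}"])
  fix u assume h: "h \<in> Hm" "s \<in> S" "Rc s h u \<noteq> 0"
  then have "u \<in> carrier G" "h (u \<otimes> s) \<noteq> 0 \<or> h u \<noteq> 0" by (auto simp: Rc_def split: if_splits)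
  moreover from this have "u = (u \<otimes> s) \<otimes> s" using h by simp
  ultimately show "u \<in> {u. h u \<noteq> 0} \<union> (\<lambda>u. u \<otimes> s) ` {u. h u \<noteq> 0}" by blast
qed (auto simp: Hm_finite intro: Hm_closed)

lemma Hm_Lc [intro]: "h \<in> Hm \<Longrightarrow> s \<in> S \<Longrightarrow> Lc s h \<in> Hm"
proof (rule Hm_subset[of "{u. h u \<noteq> 0} \<union> (\<lambda>u. s \<otimes> u) ` {u. h u \<noteq> 0}"])
  fix u assume h: "h \<in> Hm" "s \<in> S" "Lc s h u \<noteq> 0"
  then have "u \<in> carrier G" "h (s \<otimes> u) \<noteq> 0 \<or> h u \<noteq> 0" by (auto simp: Lc_def split: if_splits)
  moreover from this have "u = s \<otimes> (s \<otimes> u)" using h by simp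
  ultimately show "u \<in> {u. h u \<noteq> 0} \<union> (\<lambda>u. s \<otimes> u) ` {u. h u \<noteq> 0}" by blast
qed (auto simp: Hm_finite intro: Hm_closed)

lemma lin_Rc: "lin (Rc s)" and lin_Lc: "lin (Lc s)"
  by (auto simp: lin_def Rc_def Lc_def fun_eq_iff algebra_simps)

lemma lin_Rs: "lin (Rs s)" and lin_Ri: "lin (Ri s)" and lin_Ls: "lin (Ls s)" and lin_Li: "lin (Li s)"
  unfolding Rs_def Ri_def Ls_def Li_def
  using lin_minus[OF lin_Rc lin_scale_op] lin_minus[OF lin_Lc lin_scale_op] by auto

lemma Hm_ops [intro]:
  "h \<in> Hm \<Longrightarrow> s \<in> S \<Longrightarrow> Rs s h \<in> Hm" "h \<in> Hm \<Longrightarrow> s \<in> S \<Longrightarrow> Ri s h \<in> Hm"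
  "h \<in> Hm \<Longrightarrow> s \<in> S \<Longrightarrow> Ls s h \<in> Hm" "h \<in> Hm \<Longrightarrow> s \<in> S \<Longrightarrow> Li s h \<in> Hm"
  unfolding Rs_def Ri_def Ls_def Li_def by auto

text \<open>The substitute for associativity. If su = ut, only the points u and su are involved and
  the two sides are compared directly; otherwise left multiplication by s does not affect the right
  descent at t, nor conversely.\<close>

lemma Lc_Rc:
  assumes "s \<in> S" "t \<in> S"
  shows "Lc s (Rc t h) = Rc t (Lc s h)"
proof
  fix u
  show "Lc s (Rc t h) u = Rc t (Lc s h) u"
  proof (cases "u \<in> carrier G")
    case u: True
    show ?thesis
    proof (cases "s \<otimes> u = u \<otimes> t")
      case True
      moreover have "s \<otimes> (u \<otimes> t) = u" "s \<otimes> u \<otimes> t = u"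
        using u assms by (simp_all add: True[symmetric]) (simp add: True)
      ultimately show ?thesis using u assms by (simp add: Lc_def Rc_def algebra_simps)
    next
      case False
      then have "dl s (u \<otimes> t) = dl s u" "dr (s \<otimes> u) t = dr u t"
        using dl_mult_right[of t s u] dr_mult_left[of t s u] u assms by auto
      then show ?thesis using u assms by (simp add: Lc_def Rc_def m_assoc algebra_simps)
    qed
  qed (simp add: Lc_def Rc_def)
qed

lemma dl_mult_commute:
  assumes "s \<in> S" "t \<in> S" "s \<otimes> t = t \<otimes> s" "s \<noteq> t" "u \<in> carrier G"
  shows "dl t (s \<otimes> u) \<longleftrightarrow> dl t u"
proof -
  have "s \<otimes> t \<otimes> s = t" using assms by simp
  then show ?thesis using assms eta_mult[of s u t] by (simp add: dl_eta)
qed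

lemma Lc_commute:
  assumes "s \<in> S" "t \<in> S" "s \<otimes> t = t \<otimes> s"
  shows "Lc s (Lc t h) = Lc t (Lc s h)"
proof (cases "s = t")
  case False
  show ?thesis
  proof
    fix u
    have "dl t (s \<otimes> u) \<longleftrightarrow> dl t u" "dl s (t \<otimes> u) \<longleftrightarrow> dl s u" if "u \<in> carrier G"
      using dl_mult_commute[of s t u] dl_mult_commute[of t s u] assms False that by auto
    moreover have "s \<otimes> (t \<otimes> u) = t \<otimes> (s \<otimes> u)" if "u \<in> carrier G"
      using assms that by (simp flip: m_assoc)
    ultimately show "Lc s (Lc t h) u = Lc t (Lc s h) u"
      using assms by (auto simp: Lc_def algebra_simps)
  qed
qed simp

lemma len_neq: "s \<in> S \<Longrightarrow> w \<in> carrier G \<Longrightarrow> len w \<noteq> len (w \<otimes> s)"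
  "s \<in> S \<Longrightarrow> w \<in> carrier G \<Longrightarrow> len w \<noteq> len (s \<otimes> w)"
  using len_mult_right[of s w] len_mult_left[of s w] by linarith+

lemma Rc_Rc: "s \<in> S \<Longrightarrow> Rc s (Rc s h) = scale (vp 1 + vp (-1)) (Rc s h)"
  by (intro ext) (auto simp: Rc_def algebra_simps not_less le_less, (metis len_neq(1))+)

lemma Lc_Lc: "s \<in> S \<Longrightarrow> Lc s (Lc s h) = scale (vp 1 + vp (-1)) (Lc s h)"
  by (intro ext) (auto simp: Lc_def algebra_simps not_less le_less, (metis len_neq(2))+)

lemma Ri_Rs: "s \<in> S \<Longrightarrow> Ri s (Rs s h) = h" and Rs_Ri: "s \<in> S \<Longrightarrow> Rs s (Ri s h) = h"
  unfolding Ri_def Rs_def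
  by (simp_all add: lin_diff[OF lin_Rc] lin_scale[OF lin_Rc] Rc_Rc scale_diff scale_add_left)

lemma Ls_Rs: "s \<in> S \<Longrightarrow> t \<in> S \<Longrightarrow> Ls s (Rs t h) = Rs t (Ls s h)"
  and Li_Ri: "s \<in> S \<Longrightarrow> t \<in> S \<Longrightarrow> Li s (Ri t h) = Ri t (Li s h)"
  unfolding Ls_def Rs_def Li_def Ri_def
  by (simp_all add: Lc_Rc lin_diff[OF lin_Rc] lin_diff[OF lin_Lc] lin_scale[OF lin_Rc] lin_scale[OF lin_Lc] scale_diff)

lemma Rc_del:
  assumes "s \<in> S" "w \<in> carrier G"
  shows "Rc s (del w) = del (w \<otimes> s) + scale (vp (if dr w s then -1 else 1)) (del w)"
proof
  fix u
  have "u \<otimes> s = w \<longleftrightarrow> u = w \<otimes> s" if "u \<in> carrier G" using assms that by auto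
  then show "Rc s (del w) u = (del (w \<otimes> s) + scale (vp (if dr w s then -1 else 1)) (del w)) u"
    using assms by (auto simp: Rc_def del_def)
qed

lemma Lc_del:
  assumes "s \<in> S" "w \<in> carrier G"
  shows "Lc s (del w) = del (s \<otimes> w) + scale (vp (if dl s w then -1 else 1)) (del w)"
proof
  fix u
  have "s \<otimes> u = w \<longleftrightarrow> u = s \<otimes> w" if "u \<in> carrier G" using assms that by auto
  then show "Lc s (del w) u = (del (s \<otimes> w) + scale (vp (if dl s w then -1 else 1)) (del w)) u"
    using assms by (auto simp: Lc_def del_def)
qed

lemma Rs_del: "s \<in> S \<Longrightarrow> w \<in> carrier G \<Longrightarrow> \<not> dr w s \<Longrightarrow> Rs s (del w) = del (w \<otimes> s)"
  by (simp add: Rs_def Rc_del)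

lemma Ls_del: "s \<in> S \<Longrightarrow> w \<in> carrier G \<Longrightarrow> \<not> dl s w \<Longrightarrow> Ls s (del w) = del (s \<otimes> w)"
  by (simp add: Ls_def Lc_del)

lemma Lc_del_one: "s \<in> S \<Longrightarrow> Lc s (del \<one>) = Rc s (del \<one>)"
  by (simp add: Lc_del Rc_del)

lemma Hm_expand:
  assumes "h \<in> Hm" "finite A" "\<And>u. h u \<noteq> 0 \<Longrightarrow> u \<in> A"
  shows "h = (\<Sum>w\<in>A. scale (h w) (del w))"
proof
  fix u
  have "(\<Sum>w\<in>A. h w * del w u) = (\<Sum>w\<in>A. if w = u then h w else 0)"
    by (intro sum.cong) (auto simp: del_def)
  then show "h u = (\<Sum>w\<in>A. scale (h w) (del w)) u"
    using assms by (auto simp: sum_fun_apply)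
qed

lemma Hm_induct [consumes 1, case_names zero step]:
  assumes "h \<in> Hm" "P 0"
    and "\<And>h a w. h \<in> Hm \<Longrightarrow> P h \<Longrightarrow> w \<in> carrier G \<Longrightarrow> P (h + scale a (del w))"
  shows "P h"
proof -
  have "(\<Sum>w\<in>A. scale (h w) (del w)) \<in> Hm \<and> P (\<Sum>w\<in>A. scale (h w) (del w))"
    if "finite A" "A \<subseteq> {u. h u \<noteq> 0}" for A
    using that
  proof (induction A)
    case (insert x F)
    then have x: "x \<in> carrier G" using assms Hm_closed by auto
    have eq: "(\<Sum>w\<in>insert x F. scale (h w) (del w)) = (\<Sum>w\<in>F. scale (h w) (del w)) + scale (h x) (del x)"
      using insert by (simp add: add.commute)
    have IH: "(\<Sum>w\<in>F. scale (h w) (del w)) \<in> Hm" "P (\<Sum>w\<in>F. scale (h w) (del w))"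
      using insert by blast+
    show ?case unfolding eq using IH(1) x assms(3)[OF IH x] by (intro conjI Hm_add Hm_scale Hm_del)
  next
    case empty
    show ?case unfolding sum.empty using assms(2) by (intro conjI Hm_0)
  qed
  then have "P (\<Sum>w | h w \<noteq> 0. scale (h w) (del w))"
    using Hm_finite[OF assms(1)] by blast
  moreover have "(\<Sum>w | h w \<noteq> 0. scale (h w) (del w)) = h"
    by (rule Hm_expand[OF assms(1) Hm_finite[OF assms(1)], symmetric]) simp
  ultimately show ?thesis by (rule back_subst[of P])
qed

lemma lin_eq_on_Hm:
  assumes "lin F" "lin F'" "\<And>w. w \<in> carrier G \<Longrightarrow> F (del w) = F' (del w)" "h \<in> Hm"
  shows "F h = F' h"
  using assms(4)
  by (induction rule: Hm_induct)
    (use assms(3) in \<open>simp_all only: lin_0[OF assms(1)] lin_0[OF assms(2)] lin_add[OF assms(1)]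
      lin_add[OF assms(2)] lin_scale[OF assms(1)] lin_scale[OF assms(2)]\<close>)

section \<open>The bar involution\<close>

abbreviation RW :: "'a list \<Rightarrow> ('a \<Rightarrow> lau) \<Rightarrow> 'a \<Rightarrow> lau" where
  "RW ws h \<equiv> foldl (\<lambda>h s. Rs s h) h ws"

abbreviation RiW :: "'a list \<Rightarrow> ('a \<Rightarrow> lau) \<Rightarrow> 'a \<Rightarrow> lau" where
  "RiW ws h \<equiv> foldl (\<lambda>h s. Ri s h) h ws"

definition redw :: "'a list \<Rightarrow> bool" where
  "redw ws \<longleftrightarrow> ws \<in> lists S \<and> length ws = len (wp ws)"

lemma redw_rev: "redw ws \<Longrightarrow> redw (rev ws)"
  unfolding redw_def by (simp add: wp_rev)

lemma redw_snoc:
  assumes "redw (ws @ [s])"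
  shows "redw ws" "s \<in> S" "\<not> dr (wp ws) s"
proof -
  have ws: "ws \<in> lists S" "s \<in> S" using assms by (auto simp: redw_def)
  have eq: "wp (ws @ [s]) = wp ws \<otimes> s" using ws by (simp add: wp_append)
  then have "Suc (length ws) = len (wp ws \<otimes> s)" using assms by (simp add: redw_def)
  moreover have "len (wp ws) \<le> length ws" using ws len_le by simp
  moreover have "len (wp ws \<otimes> s) \<le> Suc (len (wp ws))" using len_mult_le[of "wp ws" s] ws by simp
  ultimately show "redw ws" "s \<in> S" "\<not> dr (wp ws) s" using ws by (auto simp: redw_def)
qed

lemma RW_del_one: "redw ws \<Longrightarrow> RW ws (del \<one>) = del (wp ws)"
proof (induction ws rule: rev_induct)
  case (snoc s ws)
  then show ?case using redw_snoc[OF snoc.prems] by (simp add: Rs_del redw_def wp_append)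
qed simp

lemma lin_RW: "lin (RW ws)"
  by (induction ws rule: rev_induct) (simp_all add: lin_def lin_add[OF lin_Rs] lin_scale[OF lin_Rs])

lemma Ls_RW: "s \<in> S \<Longrightarrow> ws \<in> lists S \<Longrightarrow> Ls s (RW ws h) = RW ws (Ls s h)"
  by (induction ws rule: rev_induct) (simp_all add: Ls_Rs)

lemma Li_RiW: "s \<in> S \<Longrightarrow> ws \<in> lists S \<Longrightarrow> Li s (RiW ws h) = RiW ws (Li s h)"
  by (induction ws rule: rev_induct) (simp_all add: Li_Ri)

lemma RW_cong:
  assumes "redw ws" "redw ws'" "wp ws = wp ws'" "h \<in> Hm"
  shows "RW ws h = RW ws' h"
proof (rule lin_eq_on_Hm[OF lin_RW lin_RW _ assms(4)])
  fix x assume "x \<in> carrier G"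
  then show "RW ws (del x) = RW ws' (del x)"
  proof (induction x rule: left_induct)
    case one
    then show ?case using assms by (simp add: RW_del_one)
  next
    case (step x s)
    have "ws \<in> lists S" "ws' \<in> lists S" using assms by (auto simp: redw_def)
    then show ?case using step Ls_RW[of s ws "del x"] Ls_RW[of s ws' "del x"] by (simp add: Ls_del)
  qed
qed

lemma RW_RiW: "ws \<in> lists S \<Longrightarrow> RW (rev ws) (RiW ws h) = h"
  and RiW_RW: "ws \<in> lists S \<Longrightarrow> RiW ws (RW (rev ws) h) = h"
  by (induction ws arbitrary: h rule: list.induct) (simp_all add: Rs_Ri Ri_Rs)

lemma Hm_RiW [intro]: "h \<in> Hm \<Longrightarrow> ws \<in> lists S \<Longrightarrow> RiW ws h \<in> Hm"
  by (induction ws rule: rev_induct) auto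

text \<open>Left multiplications commute with right ones, so that a word of right multiplications is
  determined by its value at \<open>1\<close>; hence its inverse depends only on the element represented.\<close>
lemma RiW_cong:
  assumes "redw ws" "redw ws'" "wp ws = wp ws'"
  shows "RiW ws (del \<one>) = RiW ws' (del \<one>)"
proof -
  have l: "ws \<in> lists S" "ws' \<in> lists S" using assms by (auto simp: redw_def)
  have *: "RW (rev ws') (RiW ws' (del \<one>)) = del \<one>" using l RW_RiW by blast
  have "RW (rev ws) (RiW ws' (del \<one>)) = RW (rev ws') (RiW ws' (del \<one>))"
    using assms l by (intro RW_cong redw_rev) (auto simp: wp_rev)
  then have "RiW ws (RW (rev ws) (RiW ws' (del \<one>))) = RiW ws (del \<one>)" using * by simp
  then show ?thesis using RiW_RW[OF l(1)] by simp
qed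

text \<open>The bar image of H_w, namely the inverse of H_{w^-1}: the elements H_s^-1 are multiplied
  onto H_1 along a reduced word of w.\<close>

definition barH :: "'a \<Rightarrow> 'a \<Rightarrow> lau" where
  "barH w = RiW (SOME ws. redw ws \<and> wp ws = w) (del \<one>)"

lemma barH_word: "redw ws \<Longrightarrow> barH (wp ws) = RiW ws (del \<one>)"
  unfolding barH_def by (rule someI2[of _ ws]) (auto intro: RiW_cong)

lemma ex_redw: "w \<in> carrier G \<Longrightarrow> \<exists>ws. redw ws \<and> wp ws = w"
  using ex_reduced[of w] by (auto simp: redw_def)

lemma barH_one [simp]: "barH \<one> = del \<one>"
  using barH_word[of "[]"] by (simp add: redw_def)

lemma barH_right:
  assumes "w \<in> carrier G" "s \<in> S" "\<not> dr w s"
  shows "barH (w \<otimes> s) = Ri s (barH w)"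
proof -
  obtain ws where ws: "redw ws" "wp ws = w" using ex_redw assms by blast
  then have l: "ws \<in> lists S" by (auto simp: redw_def)
  have "redw (ws @ [s])" using ws l assms len_mult_right(2)[of s w] by (auto simp: redw_def wp_append)
  from barH_word[OF this] barH_word[OF ws(1)] show ?thesis using ws l assms by (simp add: wp_append)
qed

text \<open>A new first letter acts on H_1 equally from the left and from the right; as a left
  operator it moves past all the right multiplications.\<close>

lemma barH_left:
  assumes "w \<in> carrier G" "s \<in> S" "\<not> dl s w"
  shows "barH (s \<otimes> w) = Li s (barH w)"
proof -
  obtain ws where ws: "redw ws" "wp ws = w" using ex_redw assms by blast
  then have l: "ws \<in> lists S" by (auto simp: redw_def)
  have r: "redw (s # ws)" using ws l assms len_mult_left(2)[of s w] by (auto simp: redw_def)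
  have "Ri s (del \<one>) = Li s (del \<one>)" using assms by (simp add: Ri_def Li_def Lc_del_one)
  then show ?thesis using barH_word[OF r] barH_word[OF ws(1)] ws l assms Li_RiW[of s ws] by simp
qed

lemma barH_Hm [simp, intro]: "w \<in> carrier G \<Longrightarrow> barH w \<in> Hm"
  by (induction w rule: right_induct) (auto simp: barH_right)

lemma barH_triangular:
  assumes "w \<in> carrier G"
  shows "(\<forall>u. barH w u \<noteq> 0 \<longrightarrow> bl u w) \<and> barH w w = 1"
  using assms
proof (induction w rule: right_induct)
  case one
  then show ?case by (auto simp: del_def split: if_splits)
next
  case (step w s)
  have up: "bl w (w \<otimes> s)" using step bruhat_up by auto
  have ws: "\<not> bl (w \<otimes> s) w"
    using bruhat_len[of "w \<otimes> s" w] len_mult_right(2)[of s w] step by auto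
  have "bl u (w \<otimes> s)" if nz: "barH (w \<otimes> s) u \<noteq> 0" for u
  proof -
    have u: "u \<in> carrier G" using Hm_closed[OF barH_Hm nz] step by auto
    have "barH w (u \<otimes> s) \<noteq> 0 \<or> barH w u \<noteq> 0"
      using nz step u by (auto simp: barH_right Ri_def Rc_def)
    then show ?thesis
    proof
      assume "barH w (u \<otimes> s) \<noteq> 0"
      then have "bl (u \<otimes> s \<otimes> s) (w \<otimes> s)" using step by (intro bruhat_lift) auto
      then show ?thesis using u step by simp
    next
      assume "barH w u \<noteq> 0"
      then show ?thesis using step up bruhat_trans by blast
    qed
  qed
  moreover have "barH (w \<otimes> s) (w \<otimes> s) = 1"
    using step ws by (auto simp: barH_right Ri_def Rc_def)
  ultimately show ?case by blast
qed

definition Bar :: "('a \<Rightarrow> lau) \<Rightarrow> 'a \<Rightarrow> lau" where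
  "Bar h = (\<Sum>w | h w \<noteq> 0. scale (bar (h w)) (barH w))"

lemma Bar_superset:
  assumes "finite A" "\<And>u. h u \<noteq> 0 \<Longrightarrow> u \<in> A"
  shows "Bar h = (\<Sum>w\<in>A. scale (bar (h w)) (barH w))"
  unfolding Bar_def using assms by (intro sum.mono_neutral_left) auto

lemma Bar_add: "h \<in> Hm \<Longrightarrow> k \<in> Hm \<Longrightarrow> Bar (h + k) = Bar h + Bar k"
proof -
  assume *: "h \<in> Hm" "k \<in> Hm"
  let ?A = "{u. h u \<noteq> 0} \<union> {u. k u \<noteq> 0}"
  have A: "finite ?A" using * Hm_finite by auto
  have "Bar h = (\<Sum>w\<in>?A. scale (bar (h w)) (barH w))" "Bar k = (\<Sum>w\<in>?A. scale (bar (k w)) (barH w))"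
    "Bar (h + k) = (\<Sum>w\<in>?A. scale (bar ((h + k) w)) (barH w))"
    by (rule Bar_superset[OF A]; fastforce)+
  then show ?thesis by (simp add: scale_add_left sum.distrib)
qed

lemma Bar_scale: "h \<in> Hm \<Longrightarrow> Bar (scale a h) = scale (bar a) (Bar h)"
proof -
  assume *: "h \<in> Hm"
  have "Bar (scale a h) = (\<Sum>w | h w \<noteq> 0. scale (bar (scale a h w)) (barH w))"
    using * Hm_finite by (intro Bar_superset) auto
  then show ?thesis by (simp add: Bar_def lin_sum[OF lin_scale_op])
qed

lemma Bar_0 [simp]: "Bar 0 = 0"
  by (simp add: Bar_def)

lemma Bar_del: "Bar (del w) = barH w"
proof -
  have "Bar (del w) = (\<Sum>x\<in>{w}. scale (bar (del w x)) (barH x))"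
    by (rule Bar_superset) (simp_all add: del_def split: if_splits)
  then show ?thesis by (simp add: del_def)
qed

lemma Bar_diff: "h \<in> Hm \<Longrightarrow> k \<in> Hm \<Longrightarrow> Bar (h - k) = Bar h - Bar k"
  using Bar_add[of "h - k" k] Hm_diff[of h k] by (simp add: eq_diff_eq)

lemma Bar_sum: "(\<And>x. x \<in> A \<Longrightarrow> f x \<in> Hm) \<Longrightarrow> Bar (\<Sum>x\<in>A. f x) = (\<Sum>x\<in>A. Bar (f x))"
  by (induction A rule: infinite_finite_induct) (auto simp: Bar_add Hm_sum)

lemma Bar_sum_list: "(\<And>x. x \<in> set xs \<Longrightarrow> f x \<in> Hm) \<Longrightarrow> Bar (\<Sum>x\<leftarrow>xs. f x) = (\<Sum>x\<leftarrow>xs. Bar (f x))"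
  by (induction xs) (auto simp: Bar_add Hm_sum_list)

text \<open>C_s is bar invariant, and this commutation is the form in which multiplicativity of the
  bar involution is used. If ws < w, the identity H_w C_s = v^-1 H_{ws} C_s reduces the claim to the
  ascending case.\<close>

lemma Bar_Rc_del:
  assumes "s \<in> S" "w \<in> carrier G"
  shows "Bar (Rc s (del w)) = Rc s (barH w)"
proof (cases "dr w s")
  case False
  then have "Bar (Rc s (del w)) = barH (w \<otimes> s) + scale (vp (-1)) (barH w)"
    using assms by (simp add: Rc_del Bar_add Bar_scale Bar_del Hm_scale)
  then show ?thesis using False assms by (simp add: barH_right Ri_def)
next
  case True
  define w' where "w' = w \<otimes> s"
  have w': "w' \<in> carrier G" "\<not> dr w' s" "w = w' \<otimes> s" using True assms dr_flip by (auto simp: w'_def)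
  have "Rc s (del w) = scale (vp (-1)) (Rc s (del w'))"
    using True w' assms by (simp add: Rc_del scale_add add.commute)
  moreover have "Rc s (del w') \<in> Hm" using w' assms by auto
  moreover have "Bar (Rc s (del w')) = Rc s (barH w')"
    using w' assms by (simp add: Rc_del Bar_add Bar_scale Bar_del Hm_scale barH_right Ri_def)
  ultimately have "Bar (Rc s (del w)) = scale (vp 1) (Rc s (barH w'))" by (simp add: Bar_scale)
  also have "\<dots> = Rc s (barH w)"
    using w' assms by (simp add: barH_right Ri_def lin_diff[OF lin_Rc] lin_scale[OF lin_Rc] Rc_Rc scale_add_left)
  finally show ?thesis .
qed

lemma Bar_Lc_del:
  assumes "s \<in> S" "w \<in> carrier G"
  shows "Bar (Lc s (del w)) = Lc s (barH w)"
proof (cases "dl s w")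
  case False
  then have "Bar (Lc s (del w)) = barH (s \<otimes> w) + scale (vp (-1)) (barH w)"
    using assms by (simp add: Lc_del Bar_add Bar_scale Bar_del Hm_scale)
  then show ?thesis using False assms by (simp add: barH_left Li_def)
next
  case True
  define w' where "w' = s \<otimes> w"
  have w': "w' \<in> carrier G" "\<not> dl s w'" "w = s \<otimes> w'" using True assms dl_flip by (auto simp: w'_def)
  have "Lc s (del w) = scale (vp (-1)) (Lc s (del w'))"
    using True w' assms by (simp add: Lc_del scale_add add.commute)
  moreover have "Lc s (del w') \<in> Hm" using w' assms by auto
  moreover have "Bar (Lc s (del w')) = Lc s (barH w')"
    using w' assms by (simp add: Lc_del Bar_add Bar_scale Bar_del Hm_scale barH_left Li_def)
  ultimately have "Bar (Lc s (del w)) = scale (vp 1) (Lc s (barH w'))" by (simp add: Bar_scale)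
  also have "\<dots> = Lc s (barH w)"
    using w' assms by (simp add: barH_left Li_def lin_diff[OF lin_Lc] lin_scale[OF lin_Lc] Lc_Lc scale_add_left)
  finally show ?thesis .
qed

lemma Bar_Rc: "h \<in> Hm \<Longrightarrow> s \<in> S \<Longrightarrow> Bar (Rc s h) = Rc s (Bar h)"
proof (induction rule: Hm_induct)
  case zero
  then show ?case by (simp only: lin_0[OF lin_Rc] Bar_0)
next
  case (step h a w)
  then have "Rc s (del w) \<in> Hm" "Rc s h \<in> Hm" by auto
  then show "Bar (Rc s (h + scale a (del w))) = Rc s (Bar (h + scale a (del w)))" using step
    by (simp add: lin_add[OF lin_Rc] lin_scale[OF lin_Rc] Bar_add Bar_scale Hm_scale Bar_Rc_del Bar_del)
qed

lemma Bar_Lc: "h \<in> Hm \<Longrightarrow> s \<in> S \<Longrightarrow> Bar (Lc s h) = Lc s (Bar h)"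
proof (induction rule: Hm_induct)
  case zero
  then show ?case by (simp only: lin_0[OF lin_Lc] Bar_0)
next
  case (step h a w)
  then have "Lc s (del w) \<in> Hm" "Lc s h \<in> Hm" by auto
  then show "Bar (Lc s (h + scale a (del w))) = Lc s (Bar (h + scale a (del w)))" using step
    by (simp add: lin_add[OF lin_Lc] lin_scale[OF lin_Lc] Bar_add Bar_scale Hm_scale Bar_Lc_del Bar_del)
qed

text \<open>At an element of maximal length in the support, triangularity leaves only the bar
  conjugate of its own coefficient, which is therefore bar invariant and in vZ[v], hence 0.\<close>

lemma Bar_pos_eq_0:
  assumes "h \<in> Hm" "Bar h = h" "\<And>u. lau_pos (h u)"
  shows "h = 0"
proof (rule ccontr)
  assume "h \<noteq> 0"
  let ?A = "{u. h u \<noteq> 0}"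
  have A: "finite ?A" "?A \<noteq> {}" using Hm_finite assms \<open>h \<noteq> 0\<close> by (auto simp: fun_eq_iff)
  have "finite (len ` ?A)" "len ` ?A \<noteq> {}" using A by auto
  then have "Max (len ` ?A) \<in> len ` ?A" by (rule Max_in)
  then obtain w where "w \<in> ?A" and w: "Max (len ` ?A) = len w" by (rule imageE) simp
  have max: "len u \<le> len w" if "u \<in> ?A" for u
    unfolding w[symmetric] using that A(1) by (intro Max_ge) auto
  have wc: "w \<in> carrier G" using \<open>w \<in> ?A\<close> Hm_closed assms by auto
  have "h w = Bar h w" by (simp only: assms(2))
  also have "\<dots> = (\<Sum>x\<in>?A. bar (h x) * barH x w)"
    unfolding Bar_def by (simp only: sum_fun_apply scale_apply)
  also have "\<dots> = (\<Sum>x\<in>?A. if x = w then bar (h w) else 0)"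
  proof (intro sum.cong refl)
    fix x assume x: "x \<in> ?A"
    then have "x \<in> carrier G" using Hm_closed assms by auto
    from barH_triangular[OF this] bruhat_len[of w x] max[OF x]
    show "bar (h x) * barH x w = (if x = w then bar (h w) else 0)" by fastforce
  qed
  also have "\<dots> = bar (h w)" using A \<open>w \<in> ?A\<close> by simp
  finally have "h w = 0" using lau_pos_bar_eq_0 assms(3)[of w] by simp
  then show False using \<open>w \<in> ?A\<close> by simp
qed

end

section \<open>The Kazhdan--Lusztig basis\<close>

context coxeter_system
begin

definition isKL :: "'a \<Rightarrow> ('a \<Rightarrow> lau) \<Rightarrow> bool" where
  "isKL w h \<longleftrightarrow> h \<in> Hm \<and> Bar h = h \<and> h w = 1 \<and> (\<forall>u. u \<noteq> w \<longrightarrow> lau_pos (h u))"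

lemma isKL_unique: "isKL w h \<Longrightarrow> isKL w k \<Longrightarrow> h = k"
proof -
  assume *: "isKL w h" "isKL w k"
  have "lau_pos ((h - k) u)" for u
    using * by (cases "u = w") (auto simp: isKL_def intro: lau_pos_diff)
  then have "h - k = 0" using * by (intro Bar_pos_eq_0) (auto simp: isKL_def Bar_diff)
  then show ?thesis by simp
qed

lemma Bar_of_int_combination:
  assumes "\<And>z. z \<in> Z \<Longrightarrow> isKL z (C z)"
  shows "(\<Sum>z\<in>Z. scale (of_int (c z)) (C z)) \<in> Hm"
    and "Bar (\<Sum>z\<in>Z. scale (of_int (c z)) (C z)) = (\<Sum>z\<in>Z. scale (of_int (c z)) (C z))"
proof -
  have C: "C z \<in> Hm" "Bar (C z) = C z" if "z \<in> Z" for z using assms[OF that] by (auto simp: isKL_def)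
  show "(\<Sum>z\<in>Z. scale (of_int (c z)) (C z)) \<in> Hm" using C by (intro Hm_sum) auto
  have "Bar (\<Sum>z\<in>Z. scale (of_int (c z)) (C z)) = (\<Sum>z\<in>Z. Bar (scale (of_int (c z)) (C z)))"
    using C by (intro Bar_sum) auto
  also have "\<dots> = (\<Sum>z\<in>Z. scale (of_int (c z)) (C z))"
    using C by (intro sum.cong) (auto simp: Bar_scale)
  finally show "Bar (\<Sum>z\<in>Z. scale (of_int (c z)) (C z)) = (\<Sum>z\<in>Z. scale (of_int (c z)) (C z))" .
qed

text \<open>C_z is 1 at z and lies in vZ[v] elsewhere, so subtracting the constant coefficients on Z
  removes precisely the constant terms; Z has to contain every point that may have one.\<close>

lemma lau_pos_remainder:
  assumes "finite Z" "\<And>z. z \<in> Z \<Longrightarrow> isKL z (C z)"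
    and "u \<in> Z \<and> lau_int (h u) \<or> u \<notin> Z \<and> lau_pos (h u)"
  shows "lau_pos ((h - (\<Sum>z\<in>Z. scale (of_int (cf (h z) 0)) (C z))) u)"
proof -
  have *: "lau_pos (of_int c * C z u)" if "z \<in> Z" "z \<noteq> u" for z c
    using assms(2)[OF that(1)] that lau_pos_mult[of "C z u" "of_int c"]
    by (auto simp: isKL_def mult.commute)
  show ?thesis
  proof (cases "u \<in> Z")
    case True
    then have "(\<Sum>z\<in>Z. of_int (cf (h z) 0) * C z u) =
      of_int (cf (h u) 0) * C u u + (\<Sum>z\<in>Z - {u}. of_int (cf (h z) 0) * C z u)"
      using assms by (simp add: sum.remove)
    moreover have "C u u = 1" using assms True by (auto simp: isKL_def)
    ultimately have eq: "(h - (\<Sum>z\<in>Z. scale (of_int (cf (h z) 0)) (C z))) u =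
      (h u - of_int (cf (h u) 0)) - (\<Sum>z\<in>Z - {u}. of_int (cf (h z) 0) * C z u)"
      by (simp add: sum_fun_apply)
    show ?thesis unfolding eq
      by (intro lau_pos_diff lau_pos_sum lau_pos_diff_const) (use assms True * in auto)
  next
    case False
    then show ?thesis using assms * by (auto simp: sum_fun_apply intro!: lau_pos_diff lau_pos_sum)
  qed
qed

end

section \<open>Polynomials in q as Laurent polynomials through q = v^-2\<close>

lemma vp_mult_vp_commute [simp]: "vp m * (a * vp n) = a * vp (m + n)"
  by (simp add: mult.left_commute)

definition evl :: "int poly \<Rightarrow> lau" where
  "evl p = poly (map_poly of_int p) (vp (-2))"

lemma evl_0 [simp]: "evl 0 = 0"
  by (simp add: evl_def)

lemma evl_pCons [simp]: "evl (pCons a p) = of_int a + vp (-2) * evl p"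
  by (simp add: evl_def map_poly_pCons)

lemma cf_of_int: "cf (of_int a) n = (if n = 0 then a else 0)"
  by (simp add: lookup_of_int when_def)

lemma cf_evl: "cf (evl p) n = (if n \<le> 0 \<and> even n then Polynomial.coeff p (nat (- n div 2)) else 0)"
proof (induction p arbitrary: n)
  case (pCons a p)
  have "cf (evl (pCons a p)) n = (if n = 0 then a else 0) + cf (evl p) (n + 2)"
    by (simp add: evl_pCons lookup_add cf_of_int cf_vp_mult)
  also have "\<dots> = (if n \<le> 0 \<and> even n then Polynomial.coeff (pCons a p) (nat (- n div 2)) else 0)"
  proof (cases "n < 0 \<and> even n")
    case True
    then obtain m where m: "n = 2 * m" by (meson evenE)
    then have "n + 2 \<le> 0" "nat (- n div 2) = Suc (nat (- (n + 2) div 2))" using True by auto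
    then show ?thesis using True pCons.IH[of "n + 2"] by simp
  next
    case False
    then have "\<not> (n + 2 \<le> 0 \<and> even (n + 2))" by presburger
    then show ?thesis using False pCons.IH[of "n + 2"] by auto
  qed
  finally show ?case .
qed simp

lemma evl_inj: "evl p = evl q \<longleftrightarrow> p = q"
proof
  assume "evl p = evl q"
  then have "cf (evl p) (- 2 * int k) = cf (evl q) (- 2 * int k)" for k by simp
  then show "p = q" by (simp add: cf_evl poly_eq_iff)
qed simp

lemma evl_add [simp]: "evl (p + q) = evl p + evl q"
  and evl_diff [simp]: "evl (p - q) = evl p - evl q"
  by (rule poly_mapping_eqI; simp add: cf_evl lookup_add lookup_minus)+

lemma evl_1 [simp]: "evl 1 = 1"
  by (simp add: one_pCons evl_pCons)

lemma evl_smult: "evl (Polynomial.smult a p) = of_int a * evl p"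
  by (induction p) (simp_all add: evl_pCons algebra_simps)

lemma evl_mult [simp]: "evl (p * q) = evl p * evl q"
  by (induction p) (simp_all add: evl_pCons evl_smult algebra_simps)

lemma evl_sum: "evl (sum f A) = (\<Sum>x\<in>A. evl (f x))"
  by (induction A rule: infinite_finite_induct) auto

lemma evl_poly_flip:
  assumes "Polynomial.degree p \<le> d"
  shows "evl (poly_flip d p) = vp (- 2 * int d) * bar (evl p)"
proof (rule poly_mapping_eqI)
  fix n
  have c: "Polynomial.coeff (poly_flip d p) i = (if i \<le> d then Polynomial.coeff p (d - i) else 0)" for i
    unfolding poly_flip_def by (auto simp: Polynomial.coeff_sum)
  have d0: "Polynomial.coeff p i = 0" if "i > d" for i
    using assms that by (intro coeff_eq_0) simp
  show "cf (evl (poly_flip d p)) n = cf (vp (- 2 * int d) * bar (evl p)) n"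
  proof (cases "even n")
    case True
    then obtain m where m: "n = - 2 * m" by (metis dvd_def minus_mult_minus mult_minus_right)
    have "cf (vp (- 2 * int d) * bar (evl p)) n = cf (evl p) (- 2 * (int d - m))"
      by (simp only: m cf_vp_mult cf_bar) (simp add: algebra_simps)
    then show ?thesis
      using d0[of "nat (int d - m)"]
      by (cases "m \<ge> 0"; cases "m \<le> int d") (auto simp: m cf_evl c nat_diff_distrib')
  next
    case False
    then show ?thesis by (simp add: cf_evl cf_vp_mult cf_bar)
  qed
qed

context coxeter_system
begin

text \<open>For n = l(w) this says that the coefficient of C_w at u is v^(l(w)-l(u)) times a
  polynomial in q = v^-2. The general n lets the condition be followed through the construction of
  C_w.\<close>

definition KL_shape :: "int \<Rightarrow> ('a \<Rightarrow> lau) \<Rightarrow> bool" where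
  "KL_shape n h \<longleftrightarrow> (\<forall>u\<in>carrier G. \<exists>P. h u = vp (n - int (len u)) * evl P)"

lemma KL_shape_Rc:
  assumes "KL_shape n h" "s \<in> S"
  shows "KL_shape (n + 1) (Rc s h)"
  unfolding KL_shape_def
proof
  fix u assume u: "u \<in> carrier G"
  then obtain P Q where P: "h (u \<otimes> s) = vp (n - int (len (u \<otimes> s))) * evl P"
    and Q: "h u = vp (n - int (len u)) * evl Q"
    using assms unfolding KL_shape_def by (metis S_closed m_closed)
  show "\<exists>P. Rc s h u = vp (n + 1 - int (len u)) * evl P"
  proof (cases "dr u s")
    case True
    then have "int (len u) = int (len (u \<otimes> s)) + 1" using len_mult_right[of s u] assms u by simp
    then have "Rc s h u = vp (n + 1 - int (len u)) * evl (P + q_var * Q)"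
      using True u P Q by (simp add: Rc_def distrib_left algebra_simps)
    then show ?thesis by blast
  next
    case False
    then have "int (len (u \<otimes> s)) = int (len u) + 1" using len_mult_right[of s u] assms u by simp
    then have "Rc s h u = vp (n + 1 - int (len u)) * evl (q_var * P + Q)"
      using False u P Q by (simp add: Rc_def distrib_left algebra_simps)
    then show ?thesis by blast
  qed
qed

lemma KL_shape_diff: "KL_shape n h \<Longrightarrow> KL_shape n k \<Longrightarrow> KL_shape n (h - k)"
  unfolding KL_shape_def
proof
  fix u assume *: "\<forall>u\<in>carrier G. \<exists>P. h u = vp (n - int (len u)) * evl P"
    "\<forall>u\<in>carrier G. \<exists>P. k u = vp (n - int (len u)) * evl P" "u \<in> carrier G"
  then obtain P Q where "h u = vp (n - int (len u)) * evl P" "k u = vp (n - int (len u)) * evl Q" by blast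
  then have "(h - k) u = vp (n - int (len u)) * evl (P - Q)" by (simp add: right_diff_distrib)
  then show "\<exists>P. (h - k) u = vp (n - int (len u)) * evl P" by blast
qed

lemma KL_shape_0: "KL_shape n 0"
  unfolding KL_shape_def by (auto intro!: exI[of _ 0])

lemma KL_shape_sum:
  assumes "\<And>z. z \<in> Z \<Longrightarrow> KL_shape n (f z)"
  shows "KL_shape n (\<Sum>z\<in>Z. f z)"
  using assms
proof (induction Z rule: infinite_finite_induct)
  case (insert x F)
  \<comment> \<open>Addition is written as a double subtraction so that closure under differences
    suffices.\<close>
  then have "KL_shape n (f x - (0 - (\<Sum>z\<in>F. f z)))" by (intro KL_shape_diff KL_shape_0) auto
  moreover have "f x - (0 - (\<Sum>z\<in>F. f z)) = (\<Sum>z\<in>insert x F. f z)"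
    using insert.hyps by (simp only: sum.insert diff_0 diff_minus_eq_add not_False_eq_True if_False)
  ultimately show ?case by simp
qed (simp_all add: KL_shape_0)

lemma KL_shape_scale:
  assumes "KL_shape m h" "m \<le> n" "even (n - m)"
  shows "KL_shape n (scale (of_int c) h)"
  unfolding KL_shape_def
proof
  fix u assume "u \<in> carrier G"
  then obtain P where P: "h u = vp (m - int (len u)) * evl P" using assms unfolding KL_shape_def by blast
  define k where "k = nat ((n - m) div 2)"
  have k: "n - m = 2 * int k" using assms by (auto simp: k_def)
  have "evl (Polynomial.monom 1 k) = vp (- 2 * int k)" for k
    by (induction k) (simp_all add: monom_Suc monom_0 algebra_simps)
  moreover have "vp (m - int (len u)) = vp (n - int (len u)) * vp (- 2 * int k)"
    using k by (simp add: algebra_simps)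
  ultimately have "scale (of_int c) h u = vp (n - int (len u)) * evl (Polynomial.smult c (Polynomial.monom 1 k * P))"
    by (simp add: P evl_smult algebra_simps)
  then show "\<exists>P. scale (of_int c) h u = vp (n - int (len u)) * evl P" by blast
qed

text \<open>A polynomial in v^-2 reaches exponent 0 from v^(n-l(u)) only in even steps downwards.
  Thus a correction term with nonzero constant coefficient fits into the shape for n.\<close>

lemma KL_shape_parity:
  assumes "KL_shape n h" "u \<in> carrier G" "cf (h u) 0 \<noteq> 0"
  shows "even (n - int (len u))" "int (len u) \<le> n"
proof -
  obtain P where "h u = vp (n - int (len u)) * evl P" using assms unfolding KL_shape_def by blast
  then have "cf (evl P) (- (n - int (len u))) \<noteq> 0" using assms by (simp add: cf_vp_mult)
  then show "even (n - int (len u))" "int (len u) \<le> n" by (auto simp: cf_evl split: if_splits)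
qed

text \<open>For w = w's > w' the product C_{w'} C_s is bar invariant with coefficients in Z[v];
  subtracting its lower constant terms times basis elements gives C_w. Bruhat support and shape go
  through the same induction and yield the conditions on the polynomials later.\<close>

lemma ex_isKL:
  assumes "w \<in> carrier G"
  shows "\<exists>h. isKL w h \<and> (\<forall>u. h u \<noteq> 0 \<longrightarrow> bl u w) \<and> KL_shape (int (len w)) h"
  using assms
proof (induction "len w" arbitrary: w rule: less_induct)
  case less
  show ?case
  proof (cases "w = \<one>")
    case True
    have "KL_shape 0 (del \<one>)" unfolding KL_shape_def
    proof
      fix u assume "u \<in> carrier G"
      show "\<exists>P. del \<one> u = vp (0 - int (len u)) * evl P"
      proof (cases "u = \<one>")
        case True
        then show ?thesis by (intro exI[of _ 1]) (simp add: del_def)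
      next
        case False
        then show ?thesis by (intro exI[of _ 0]) (simp add: del_def)
      qed
    qed
    moreover have "isKL \<one> (del \<one>)" by (auto simp: isKL_def Bar_del) (simp_all add: del_def)
    ultimately show ?thesis using True by (intro exI[of _ "del \<one>"]) (auto simp: del_def)
  next
    case False
    then obtain s where s: "s \<in> S" "dr w s" using ex_descent_right[OF less.prems] by blast
    define w' where "w' = w \<otimes> s"
    have w': "w' \<in> carrier G" "\<not> dr w' s" "w = w' \<otimes> s" "len w = Suc (len w')"
      using s less dr_flip len_mult_right(1)[of s w] by (auto simp: w'_def)
    then obtain h' where h': "isKL w' h'" "\<And>u. h' u \<noteq> 0 \<Longrightarrow> bl u w'" "KL_shape (int (len w')) h'"
      using less.hyps[of w'] by auto
    have h'H: "h' \<in> Hm" "Bar h' = h'" "h' w' = 1" "\<And>u. u \<noteq> w' \<Longrightarrow> lau_pos (h' u)"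
      using h' by (auto simp: isKL_def)
    define k where "k = Rc s h'"
    have k: "k \<in> Hm" "Bar k = k" "KL_shape (int (len w)) k"
      using h'H s Bar_Rc[of h' s] KL_shape_Rc[OF h'(3) s(1)] w'(4) by (auto simp: k_def add.commute)
    have up: "bl w' w" using bruhat_up w' s by simp
    have nbl: "\<not> bl w w'" using bruhat_len[of w w'] w'(4) by auto
    have ksupp: "bl u w" if "k u \<noteq> 0" for u
    proof -
      have u: "u \<in> carrier G" using Hm_closed[OF k(1) that] .
      then have "h' (u \<otimes> s) \<noteq> 0 \<or> h' u \<noteq> 0" using that by (auto simp: k_def Rc_def)
      then show ?thesis
      proof
        assume "h' (u \<otimes> s) \<noteq> 0"
        then have "bl (u \<otimes> s \<otimes> s) (w' \<otimes> s)" using h' s w' by (intro bruhat_lift) auto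
        then show ?thesis using u s w' by simp
      next
        assume "h' u \<noteq> 0"
        then show ?thesis using h'(2) up bruhat_trans by blast
      qed
    qed
    have wc: "w \<in> carrier G" using less by simp
    have h'w: "h' w = 0" using h'(2) nbl by blast
    have kw: "k w = 1" using h'H(3) h'w wc s by (simp add: k_def Rc_def flip: w'_def)
    have kint: "lau_int (k u)" if "u \<noteq> w" for u
    proof (cases "u \<in> carrier G")
      case True
      have "u \<otimes> s \<noteq> w'" using that True wc s by (metis S_cancel(2) w'_def)
      then have "lau_pos (h' (u \<otimes> s))" using h'H by auto
      moreover have "lau_int (vp (if dr u s then -1 else 1) * h' u)"
      proof (cases "u = w'")
        case True
        then show ?thesis using w' h'H by (simp add: lau_int_vp)
      next
        case False
        then show ?thesis using h'H(4)[OF False]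
          by (auto intro: lau_int_vp_mult_pos lau_int_vp_mult lau_pos_int)
      qed
      ultimately show ?thesis using True by (simp add: k_def Rc_def lau_int_add lau_pos_int)
    qed (auto simp: k_def Rc_def)
    \<comment> \<open>The point w is left out because its coefficient 1 is the leading one and has
      to survive.\<close>
    define Z where "Z = {z. k z \<noteq> 0 \<and> z \<noteq> w}"
    have Z1: "finite Z" using Hm_finite[OF k(1)] by (simp add: Z_def)
    have Z2: "bl z w \<and> z \<in> carrier G \<and> len z < len w" if "z \<in> Z" for z
      using ksupp[of z] bruhat_len[of z w] bruhat_closed(1)[of z w] that by (auto simp: Z_def)
    note Z = Z1 Z2
    have "\<forall>z\<in>Z. \<exists>h. isKL z h \<and> (\<forall>u. h u \<noteq> 0 \<longrightarrow> bl u z) \<and> KL_shape (int (len z)) h"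
      using less.hyps Z by blast
    then obtain C where C: "\<And>z. z \<in> Z \<Longrightarrow> isKL z (C z)" "\<And>z u. z \<in> Z \<Longrightarrow> C z u \<noteq> 0 \<Longrightarrow> bl u z"
      "\<And>z. z \<in> Z \<Longrightarrow> KL_shape (int (len z)) (C z)" by metis
    define Y where "Y = (\<Sum>z\<in>Z. scale (of_int (cf (k z) 0)) (C z))"
    have Y: "Y \<in> Hm" "Bar Y = Y" unfolding Y_def using Bar_of_int_combination[of Z C "\<lambda>z. cf (k z) 0", OF C(1)] by auto
    have Ysupp: "\<exists>z\<in>Z. bl u z" if "Y u \<noteq> 0" for u
    proof -
      have "(\<Sum>z\<in>Z. of_int (cf (k z) 0) * C z u) \<noteq> 0" using that by (simp add: Y_def sum_fun_apply)
      then obtain z where "z \<in> Z" "of_int (cf (k z) 0) * C z u \<noteq> 0" by (meson sum.neutral)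
      then show ?thesis using C(2)[of z u] by auto
    qed
    have Yw: "Y w = 0"
    proof (rule ccontr)
      assume "Y w \<noteq> 0"
      then obtain z where "z \<in> Z" "bl w z" using Ysupp by blast
      then show False using Z(2)[of z] bruhat_len[of w z] by auto
    qed
    have "lau_pos ((k - Y) u)" if "u \<noteq> w" for u
      unfolding Y_def using that kint[OF that] by (intro lau_pos_remainder Z(1) C(1)) (auto simp: Z_def)
    then have "isKL w (k - Y)" using k Y Bar_diff[of k Y] kw Yw by (auto simp: isKL_def)
    moreover have "bl u w" if "(k - Y) u \<noteq> 0" for u
    proof -
      have "k u \<noteq> 0 \<or> Y u \<noteq> 0" using that by auto
      then show ?thesis using ksupp Ysupp Z(2) bruhat_trans by blast
    qed
    moreover have "KL_shape (int (len w)) (k - Y)" unfolding Y_def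
    proof (intro KL_shape_diff KL_shape_sum k(3))
      fix z assume z: "z \<in> Z"
      show "KL_shape (int (len w)) (scale (of_int (cf (k z) 0)) (C z))"
      proof (cases "cf (k z) 0 = 0")
        case True
        then show ?thesis by (simp add: KL_shape_0)
      next
        case False
        then show ?thesis using z C(3)[OF z] Z(2)[OF z] KL_shape_parity[OF k(3), of z]
          by (intro KL_shape_scale) auto
      qed
    qed
    ultimately show ?thesis by blast
  qed
qed

section \<open>The basis elements C_w and expansions in them\<close>

definition Cb :: "'a \<Rightarrow> 'a \<Rightarrow> lau" where
  "Cb w = (THE h. isKL w h)"

lemma Cb_eqI: "isKL w h \<Longrightarrow> Cb w = h"
  unfolding Cb_def using isKL_unique by (intro the_equality) auto

lemma Cb_all:
  assumes "w \<in> carrier G"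
  shows isKL_Cb: "isKL w (Cb w)"
    and Cb_bruhat: "Cb w u \<noteq> 0 \<Longrightarrow> bl u w"
    and Cb_shape: "KL_shape (int (len w)) (Cb w)"
  using ex_isKL[OF assms] Cb_eqI by auto

lemma Cb_props [simp]:
  assumes "w \<in> carrier G"
  shows Cb_Hm: "Cb w \<in> Hm" and Bar_Cb: "Bar (Cb w) = Cb w" and Cb_self: "Cb w w = 1"
  using isKL_Cb[OF assms] by (auto simp: isKL_def)

lemma Cb_pos: "w \<in> carrier G \<Longrightarrow> u \<noteq> w \<Longrightarrow> lau_pos (Cb w u)"
  using isKL_Cb by (auto simp: isKL_def)

lemma Cb_parab: "J \<subseteq> S \<Longrightarrow> w \<in> generate G J \<Longrightarrow> Cb w u \<noteq> 0 \<Longrightarrow> u \<in> generate G J"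
  using Cb_bruhat[of w u] bruhat_parab[of u w J] by simp

lemma Cb_one [simp]: "Cb \<one> = del \<one>"
  by (rule Cb_eqI) (auto simp: isKL_def Bar_del, simp_all add: del_def)

text \<open>The constant terms give the integral coefficients: the difference of both sides is bar
  invariant without constant terms, hence 0.\<close>

lemma Cb_expand:
  assumes "h \<in> Hm" "Bar h = h" "\<And>u. lau_int (h u)"
  shows "h = (\<Sum>z | h z \<noteq> 0. scale (of_int (cf (h z) 0)) (Cb z))"
proof -
  let ?Z = "{z. h z \<noteq> 0}"
  let ?Y = "\<Sum>z\<in>?Z. scale (of_int (cf (h z) 0)) (Cb z)"
  have Z: "finite ?Z" "\<And>z. z \<in> ?Z \<Longrightarrow> isKL z (Cb z)"
    using Hm_finite Hm_closed isKL_Cb assms by auto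
  have Y: "?Y \<in> Hm" "Bar ?Y = ?Y" using Bar_of_int_combination[of ?Z Cb "\<lambda>z. cf (h z) 0", OF Z(2)] by auto
  have "h - ?Y = 0"
  proof (rule Bar_pos_eq_0)
    show "h - ?Y \<in> Hm" using assms Y by auto
    show "Bar (h - ?Y) = h - ?Y" using assms Y by (simp add: Bar_diff)
    show "lau_pos ((h - ?Y) u)" for u
      using assms by (intro lau_pos_remainder[OF Z]) auto
  qed
  then show ?thesis by simp
qed

section \<open>Comparison with the Kazhdan--Lusztig polynomials\<close>

text \<open>Up to powers of v and the bar map, right multiplication by H_s^-1 has the same recursion
  as the R-polynomials; for us > u the witness is the right-hand side of that recursion.\<close>

lemma ex_R:
  assumes "a \<in> carrier G" "u \<in> carrier G"
  shows "\<exists>P. evl P = vp (int (len u) - int (len a)) * bar (barH a u)"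
  using assms
proof (induction a arbitrary: u rule: right_induct)
  case one
  show ?case
  proof (cases "u = \<one>")
    case True
    then show ?thesis by (intro exI[of _ 1]) (simp add: del_def)
  next
    case False
    then show ?thesis by (intro exI[of _ 0]) (simp add: del_def)
  qed
next
  case (step w s)
  have us: "u \<otimes> s \<in> carrier G" using step by auto
  obtain P where P: "evl P = vp (int (len (u \<otimes> s)) - int (len w)) * bar (barH w (u \<otimes> s))"
    using step.IH[OF us] by blast
  obtain Q where Q: "evl Q = vp (int (len u) - int (len w)) * bar (barH w u)"
    using step.IH step.prems by blast
  have lw: "int (len (w \<otimes> s)) = int (len w) + 1" using step len_mult_right(2)[of s w] by simp
  show ?case
  proof (cases "dr u s")
    case True
    then have "int (len u) = int (len (u \<otimes> s)) + 1" using len_mult_right[of s u] step by simp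
    then show ?thesis using P True step lw by (intro exI[of _ P]) (simp add: barH_right Ri_def Rc_def)
  next
    case False
    then have "int (len (u \<otimes> s)) = int (len u) + 1" using len_mult_right[of s u] step by simp
    then show ?thesis using P Q False step lw
      by (intro exI[of _ "q_var * P + (q_var - 1) * Q"])
        (simp add: barH_right Ri_def Rc_def distrib_left left_diff_distrib, simp add: algebra_simps)
  qed
qed

definition Rp :: "'a \<Rightarrow> 'a \<Rightarrow> int poly" where
  "Rp u a = (if u \<in> carrier G \<and> a \<in> carrier G
    then SOME P. evl P = vp (int (len u) - int (len a)) * bar (barH a u) else 0)"

lemma evl_Rp:
  "u \<in> carrier G \<Longrightarrow> a \<in> carrier G \<Longrightarrow> evl (Rp u a) = vp (int (len u) - int (len a)) * bar (barH a u)"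
  unfolding Rp_def using someI_ex[OF ex_R] by auto

lemma bar_eq_0_iff [simp]: "bar a = 0 \<longleftrightarrow> a = 0"
  by (metis bar_0 bar_bar)

lemma R_family_Rp: "R_family G S Rp"
  unfolding R_family_def
proof (intro conjI allI ballI impI)
  fix u v assume "\<not> bl u v"
  then have "evl (Rp u v) = 0" if "u \<in> carrier G" "v \<in> carrier G"
    using evl_Rp[OF that] barH_triangular[OF that(2)] by auto
  then show "Rp u v = 0" using evl_inj[of "Rp u v" 0] by (auto simp: Rp_def)
next
  fix u assume "u \<in> carrier G"
  then have "evl (Rp u u) = evl 1" using barH_triangular[of u] by (simp add: evl_Rp)
  then show "Rp u u = 1" by (simp only: evl_inj)
next
  fix u v s assume u: "u \<in> carrier G" and v: "v \<in> carrier G" and s: "s \<in> S" and d: "dr v s"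
  define w where "w = v \<otimes> s"
  have w: "w \<in> carrier G" "v = w \<otimes> s" "\<not> dr w s" "int (len v) = int (len w) + 1"
    using v s d dr_flip len_mult_right(1)[of s v] by (auto simp: w_def)
  have B: "barH v = Ri s (barH w)" using w s by (simp add: barH_right)
  show "Rp u v = (if dr u s then Rp (u \<otimes> s) (v \<otimes> s)
    else q_var * Rp (u \<otimes> s) (v \<otimes> s) + (q_var - 1) * Rp u (v \<otimes> s))"
  proof (cases "dr u s")
    case True
    then have "int (len u) = int (len (u \<otimes> s)) + 1" using len_mult_right[of s u] s u by simp
    then have "evl (Rp u v) = evl (Rp (u \<otimes> s) w)"
      using True u v w(1,3,4) s by (simp add: evl_Rp B Ri_def Rc_def)
    then show ?thesis using True by (simp add: evl_inj w_def)
  next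
    case False
    then have "int (len (u \<otimes> s)) = int (len u) + 1" using len_mult_right[of s u] s u by simp
    then have "evl (Rp u v) = evl (q_var * Rp (u \<otimes> s) w + (q_var - 1) * Rp u w)"
      using False u v w(1,3,4) s by (simp add: evl_Rp B Ri_def Rc_def distrib_left left_diff_distrib, simp add: algebra_simps)
    then show ?thesis using False by (simp only: evl_inj w_def if_False)
  qed
qed

lemma R_family_unique:
  assumes "R_family G S R" "R_family G S R'"
  shows "R = R'"
proof -
  have "\<forall>u. R u v = R' u v" if "v \<in> carrier G" for v
    using that
  proof (induction v rule: right_induct)
    case one
    have "\<not> bl u \<one>" if "u \<noteq> \<one>" for u using bruhat_len[of u \<one>] that by auto
    then show ?case using assms unfolding R_family_def by (metis one_closed)
  next
    case (step w s)
    have d: "dr (w \<otimes> s) s" "w \<otimes> s \<in> carrier G" "w \<otimes> s \<otimes> s = w" using step dr_flip by auto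
    show ?case
    proof
      fix u
      show "R u (w \<otimes> s) = R' u (w \<otimes> s)"
      proof (cases "u \<in> carrier G")
        case True
        have rec: "T u (w \<otimes> s) = (if dr u s then T (u \<otimes> s) w
          else q_var * T (u \<otimes> s) w + (q_var - 1) * T u w)" if "R_family G S T" for T
          using that True d step(2) unfolding R_family_def by metis
        show ?thesis using rec[OF assms(1)] rec[OF assms(2)] step.IH by simp
      next
        case False
        then show ?thesis using assms bruhat_closed unfolding R_family_def by metis
      qed
    qed
  qed
  moreover have "R u v = R' u v" if "v \<notin> carrier G" for u v
    using that assms bruhat_closed unfolding R_family_def by metis
  ultimately show ?thesis by blast
qed

lemma R_poly_eq: "R_poly G S = Rp"
  unfolding R_poly_def by (intro the_equality R_family_Rp) (rule R_family_unique[OF _ R_family_Rp])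

text \<open>Under q = v^-2 the reversed polynomial becomes the bar conjugate of h u, and the sum
  over the interval that of \<open>Bar h u\<close>, both times v^-(l(v)-l(u)). The identity at u is
  thus bar invariance of h at u.\<close>

lemma KL_identity_iff:
  assumes "bl u v" "h \<in> Hm" "\<And>a. h a \<noteq> 0 \<Longrightarrow> bl a v"
    and h: "\<And>a. a \<in> carrier G \<Longrightarrow> h a = vp (int (len v) - int (len a)) * evl (P a)"
    and "Polynomial.degree (P u) \<le> len v - len u"
  shows "poly_flip (len v - len u) (P u) = (\<Sum>a | bl u a \<and> bl a v. Rp u a * P a) \<longleftrightarrow> Bar h u = h u"
proof -
  let ?d = "int (len v) - int (len u)"
  let ?A = "{a. bl u a \<and> bl a v}"
  have c: "u \<in> carrier G" "v \<in> carrier G" using bruhat_closed assms(1) by auto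
  have d: "?d = int (len v - len u)" using bruhat_len[OF assms(1)] by auto
  have "evl (poly_flip (len v - len u) (P u)) = vp (- 2 * ?d) * bar (evl (P u))"
    using evl_poly_flip[OF assms(5)] by (simp only: d)
  also have "\<dots> = vp (- ?d) * bar (h u)" using h[OF c(1)] by simp
  finally have L: "evl (poly_flip (len v - len u) (P u)) = vp (- ?d) * bar (h u)" .
  have fin: "finite ?A" by (rule finite_subset[OF _ finite_bruhat[of v]]) auto
  have "Bar h u = (\<Sum>a | h a \<noteq> 0. bar (h a) * barH a u)" by (simp add: Bar_def sum_fun_apply)
  also have "\<dots> = (\<Sum>a\<in>?A. bar (h a) * barH a u)"
  proof (rule sum.mono_neutral_cong)
    show "finite {a. h a \<noteq> 0}" using Hm_finite assms by auto
    show "bar (h a) * barH a u = 0" if "a \<in> {a. h a \<noteq> 0} - ?A" for a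
    proof -
      have "bl a v" "a \<in> carrier G" using that assms(3) bruhat_closed by blast+
      then have "\<not> bl u a" using that by auto
      then show ?thesis using barH_triangular[OF \<open>a \<in> carrier G\<close>] by auto
    qed
  qed (use fin in auto)
  finally have "bar (Bar h u) = (\<Sum>a\<in>?A. h a * bar (barH a u))" by (simp add: bar_sum)
  then have "vp (- ?d) * bar (Bar h u) = (\<Sum>a\<in>?A. vp (- ?d) * (h a * bar (barH a u)))"
    by (simp add: sum_distrib_left)
  also have "\<dots> = (\<Sum>a\<in>?A. evl (Rp u a * P a))"
  proof (intro sum.cong refl)
    fix a assume "a \<in> ?A"
    then have "a \<in> carrier G" using bruhat_closed by auto
    then show "vp (- ?d) * (h a * bar (barH a u)) = evl (Rp u a * P a)"
      using h c by (simp add: evl_Rp algebra_simps)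
  qed
  finally have R: "evl (\<Sum>a\<in>?A. Rp u a * P a) = vp (- ?d) * bar (Bar h u)" by (simp add: evl_sum)
  have "poly_flip (len v - len u) (P u) = (\<Sum>a\<in>?A. Rp u a * P a) \<longleftrightarrow>
    vp (- ?d) * bar (h u) = vp (- ?d) * bar (Bar h u)"
    unfolding L[symmetric] R[symmetric] by (simp only: evl_inj)
  also have "\<dots> \<longleftrightarrow> bar (h u) = bar (Bar h u)" by simp
  also have "\<dots> \<longleftrightarrow> Bar h u = h u" by (metis bar_bar)
  finally show ?thesis .
qed

section \<open>Existence and uniqueness of the family of Kazhdan-Lusztig polynomials\<close>

definition Pp :: "'a \<Rightarrow> 'a \<Rightarrow> int poly" where
  "Pp u v = (if u \<in> carrier G \<and> v \<in> carrier G
    then SOME P. Cb v u = vp (int (len v) - int (len u)) * evl P else 0)"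

lemma Cb_Pp: "u \<in> carrier G \<Longrightarrow> v \<in> carrier G \<Longrightarrow> Cb v u = vp (int (len v) - int (len u)) * evl (Pp u v)"
  unfolding Pp_def using Cb_shape[of v] someI_ex[of "\<lambda>P. Cb v u = vp (int (len v) - int (len u)) * evl P"]
  by (auto simp: KL_shape_def)

lemma Pp_eq_0: "\<not> bl u v \<Longrightarrow> Pp u v = 0"
proof (cases "u \<in> carrier G \<and> v \<in> carrier G")
  case True
  assume "\<not> bl u v"
  then have "Cb v u = 0" using True Cb_bruhat by blast
  then have "evl (Pp u v) = evl 0" using Cb_Pp[of u v] True by simp
  then show ?thesis by (simp only: evl_inj)
qed (auto simp: Pp_def)

lemma Pp_self: "u \<in> carrier G \<Longrightarrow> Pp u u = 1"
proof -
  assume "u \<in> carrier G"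
  then have "evl (Pp u u) = evl 1" using Cb_Pp[of u u] by simp
  then show ?thesis by (simp only: evl_inj)
qed

text \<open>The top coefficient of P sits at the exponent l(v) - l(u) - 2 deg P of v, which has to
  be positive.\<close>

lemma Pp_degree:
  assumes "bl u v" "u \<noteq> v"
  shows "2 * Polynomial.degree (Pp u v) + 1 \<le> len v - len u"
proof (cases "Pp u v = 0")
  case True
  then show ?thesis using bruhat_len[OF assms(1)] assms(2) by auto
next
  case False
  let ?k = "Polynomial.degree (Pp u v)"
  have c: "u \<in> carrier G" "v \<in> carrier G" using bruhat_closed assms(1) by auto
  have "cf (evl (Pp u v)) (- 2 * int ?k) \<noteq> 0" using False by (simp add: cf_evl)
  then have "cf (Cb v u) (int (len v) - int (len u) - 2 * int ?k) \<noteq> 0"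
    using Cb_Pp[OF c] by (simp add: cf_vp_mult)
  then have "int (len v) - int (len u) - 2 * int ?k > 0"
    using Cb_pos[OF c(2) assms(2)] unfolding lau_pos_def by (meson not_le_imp_less)
  then show ?thesis by simp
qed

lemma KL_family_Pp: "KL_family G S Pp"
  unfolding KL_family_def
proof (intro conjI allI ballI impI)
  fix u v assume uv: "bl u v"
  have c: "u \<in> carrier G" "v \<in> carrier G" using bruhat_closed uv by auto
  have "Polynomial.degree (Pp u v) \<le> len v - len u"
  proof (cases "u = v")
    case True
    then show ?thesis using Pp_self c by simp
  next
    case False
    then show ?thesis using Pp_degree[OF uv] by simp
  qed
  then show "poly_flip (len v - len u) (Pp u v) = (\<Sum>a | bl u a \<and> bl a v. R_poly G S u a * Pp a v)"
    unfolding R_poly_eq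
    using KL_identity_iff[OF uv, of "Cb v" "\<lambda>a. Pp a v"] c Cb_bruhat[OF c(2)] Cb_Pp by simp
qed (auto simp: Pp_eq_0 Pp_self dest!: Pp_degree)

text \<open>The column of P at v defines a function h. The identities make h bar invariant and the
  degree bound places its lower coefficients in vZ[v], so h is C_v.\<close>

lemma KL_family_unique:
  assumes "KL_family G S P"
  shows "P = Pp"
proof (intro ext)
  fix u v
  have P0: "\<And>u v. \<not> bl u v \<Longrightarrow> P u v = 0" and P1: "\<And>u. u \<in> carrier G \<Longrightarrow> P u u = 1"
    and Pd: "\<And>u v. bl u v \<Longrightarrow> u \<noteq> v \<Longrightarrow> 2 * Polynomial.degree (P u v) + 1 \<le> len v - len u"
    and Pi: "\<And>u v. bl u v \<Longrightarrow> poly_flip (len v - len u) (P u v) = (\<Sum>a | bl u a \<and> bl a v. Rp u a * P a v)"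
    using assms unfolding KL_family_def R_poly_eq by blast+
  show "P u v = Pp u v"
  proof (cases "u \<in> carrier G \<and> v \<in> carrier G")
    case True
    define h where "h a = (if a \<in> carrier G then vp (int (len v) - int (len a)) * evl (P a v) else 0)" for a
    have supp: "bl a v" if "h a \<noteq> 0" for a using that P0[of a v] by (cases "bl a v") (auto simp: h_def split: if_splits)
    have H: "h \<in> Hm" using supp bruhat_closed
      by (intro Hm_subset[OF finite_bruhat[of v]]) auto
    have "Bar h = h"
    proof
      fix a
      show "Bar h a = h a"
      proof (cases "bl a v")
        case bl: True
        have "Polynomial.degree (P a v) \<le> len v - len a"
          using Pd[OF bl] P1[of a] bruhat_closed[OF bl] by (cases "a = v") auto
        then show ?thesis using KL_identity_iff[OF bl H supp, of "\<lambda>a. P a v"] Pi[OF bl] by (simp add: h_def)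
      next
        case False
        have "Bar h a = (\<Sum>x | h x \<noteq> 0. bar (h x) * barH x a)" by (simp add: Bar_def sum_fun_apply)
        also have "\<dots> = 0"
        proof (intro sum.neutral ballI)
          fix x assume "x \<in> {x. h x \<noteq> 0}"
          then have "bl x v" using supp by simp
          then have "\<not> bl a x" "x \<in> carrier G" using False bruhat_trans bruhat_closed by blast+
          then show "bar (h x) * barH x a = 0" using barH_triangular by auto
        qed
        finally show ?thesis using False supp by metis
      qed
    qed
    moreover have "lau_pos (h a)" if "a \<noteq> v" for a
    proof (cases "bl a v")
      case bl: True
      have "cf (h a) n = 0" if "n \<le> 0" for n
      proof (rule ccontr)
        assume "cf (h a) n \<noteq> 0"
        then have "cf (evl (P a v)) (n - (int (len v) - int (len a))) \<noteq> 0"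
          using bruhat_closed[OF bl] by (simp add: h_def cf_vp_mult)
        then have "Polynomial.coeff (P a v) (nat (- (n - (int (len v) - int (len a))) div 2)) \<noteq> 0"
          "even (n - (int (len v) - int (len a)))"
          by (auto simp: cf_evl split: if_splits)
        then have "nat (- (n - (int (len v) - int (len a))) div 2) \<le> Polynomial.degree (P a v)"
          by (intro le_degree)
        moreover obtain m where m: "n - (int (len v) - int (len a)) = 2 * m"
          using \<open>even (n - _)\<close> by (rule evenE)
        ultimately have "nat (- m) \<le> Polynomial.degree (P a v)" by simp
        moreover have "2 * int (Polynomial.degree (P a v)) + 1 \<le> int (len v) - int (len a)"
          using Pd[OF bl \<open>a \<noteq> v\<close>] by linarith
        ultimately show False using m \<open>n \<le> 0\<close> by linarith
      qed
      then show ?thesis by (simp add: lau_pos_def)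
    next
      case False
      then have "h a = 0" using supp by blast
      then show ?thesis by simp
    qed
    moreover have "h v = 1" using True P1[of v] by (simp add: h_def)
    ultimately have "Cb v = h" using H by (intro Cb_eqI) (simp add: isKL_def)
    then have "evl (P u v) = evl (Pp u v)" using Cb_Pp[of u v] True by (simp add: h_def)
    then show ?thesis by (simp only: evl_inj)
  next
    case False
    then have "\<not> bl u v" using bruhat_closed by blast
    then show ?thesis using P0 Pp_eq_0 by simp
  qed
qed

lemma KL_poly_eq: "KL_poly G S = Pp"
  unfolding KL_poly_def by (intro the_equality KL_family_Pp KL_family_unique)

end

section \<open>Products with disjoint supports and substitution\<close>

context coxeter_system
begin

text \<open>Expressions in left C_c for c in E and right C_c for c in F with bar invariant scalars.
  They are kept as operators so that one expression can be evaluated at H_1, H_p, C_p and C_w;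
  replacing a letter by an element is such a change of argument. Sums are covered since -b is bar
  invariant whenever b is.\<close>

inductive_set ops :: "'a set \<Rightarrow> 'a set \<Rightarrow> (('a \<Rightarrow> lau) \<Rightarrow> 'a \<Rightarrow> lau) set" for E F where
  ops_id: "(\<lambda>h. h) \<in> ops E F"
| ops_L: "O1 \<in> ops E F \<Longrightarrow> c \<in> E \<Longrightarrow> (\<lambda>h. Lc c (O1 h)) \<in> ops E F"
| ops_R: "O1 \<in> ops E F \<Longrightarrow> c \<in> F \<Longrightarrow> (\<lambda>h. Rc c (O1 h)) \<in> ops E F"
| ops_diff: "O1 \<in> ops E F \<Longrightarrow> O2 \<in> ops E F \<Longrightarrow> bar b = b \<Longrightarrow> (\<lambda>h. O1 h - scale b (O2 h)) \<in> ops E F"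

lemma ops_lin: "O1 \<in> ops E F \<Longrightarrow> lin O1"
proof (induction rule: ops.induct)
  case (ops_diff O1 O2 b)
  then show ?case using lin_minus[OF _ lin_compose[OF lin_scale_op]] by blast
qed (auto simp: lin_def lin_add[OF lin_Lc] lin_add[OF lin_Rc] lin_scale[OF lin_Lc] lin_scale[OF lin_Rc])

lemma ops_Hm: "O1 \<in> ops E F \<Longrightarrow> E \<subseteq> S \<Longrightarrow> F \<subseteq> S \<Longrightarrow> h \<in> Hm \<Longrightarrow> O1 h \<in> Hm"
  by (induction rule: ops.induct) auto

lemma ops_Bar:
  assumes "E \<subseteq> S" "F \<subseteq> S" "h \<in> Hm"
  shows "O1 \<in> ops E F \<Longrightarrow> Bar (O1 h) = O1 (Bar h)"
proof (induction rule: ops.induct)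
  case (ops_L O1 c)
  then have "O1 h \<in> Hm" "c \<in> S" using ops_Hm assms by auto
  then show ?case using ops_L Bar_Lc by simp
next
  case (ops_R O1 c)
  then have "O1 h \<in> Hm" "c \<in> S" using ops_Hm assms by auto
  then show ?case using ops_R Bar_Rc by simp
next
  case (ops_diff O1 O2 b)
  then have "O1 h \<in> Hm" "O2 h \<in> Hm" using ops_Hm assms by auto
  then show "Bar (O1 h - scale b (O2 h)) = O1 (Bar h) - scale b (O2 (Bar h))"
    using ops_diff by (simp add: Bar_diff Bar_scale Hm_scale)
qed simp

lemma ops_diff_sum:
  assumes "finite Z" "O1 \<in> ops E F" "\<And>z. z \<in> Z \<Longrightarrow> Q z \<in> ops E F"
  shows "(\<lambda>h. O1 h - (\<Sum>z\<in>Z. scale (of_int (c z)) (Q z h))) \<in> ops E F"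
  using assms
proof (induction Z)
  case (insert x Z)
  have IH: "(\<lambda>h. O1 h - (\<Sum>z\<in>Z. scale (of_int (c z)) (Q z h))) \<in> ops E F"
    using insert.IH insert.prems by blast
  have "(\<lambda>h. (O1 h - (\<Sum>z\<in>Z. scale (of_int (c z)) (Q z h))) - scale (of_int (c x)) (Q x h)) \<in> ops E F"
    by (rule ops_diff[OF IH]) (use insert.prems in auto)
  moreover have eq: "(O1 h - (\<Sum>z\<in>Z. scale (of_int (c z)) (Q z h))) - scale (of_int (c x)) (Q x h) =
    O1 h - (\<Sum>z\<in>insert x Z. scale (of_int (c z)) (Q z h))" for h
    using insert.hyps by (simp add: diff_diff_eq add.commute)
  ultimately show "(\<lambda>h. O1 h - (\<Sum>z\<in>insert x Z. scale (of_int (c z)) (Q z h))) \<in> ops E F"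
    by (simp only: eq)
qed simp

text \<open>At a point of W_K an operator with letters in K reads values in W_K only, so this
  restriction commutes with it. With K = S - {p} it extracts the p-free part.\<close>

definition rho :: "'a set \<Rightarrow> ('a \<Rightarrow> lau) \<Rightarrow> 'a \<Rightarrow> lau" where
  "rho K h = (\<lambda>u. if u \<in> generate G K then h u else 0)"

lemma lin_rho: "lin (rho K)"
  by (auto simp: lin_def rho_def fun_eq_iff)

lemma rho_id: "(\<And>u. h u \<noteq> 0 \<Longrightarrow> u \<in> generate G K) \<Longrightarrow> rho K h = h"
  by (auto simp: rho_def fun_eq_iff)

lemma rho_Lc: "K \<subseteq> S \<Longrightarrow> c \<in> K \<Longrightarrow> rho K (Lc c h) = Lc c (rho K h)"
  by (rule ext) (auto simp: rho_def Lc_def parab_mult_left_iff parab_S)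

lemma rho_Rc: "K \<subseteq> S \<Longrightarrow> c \<in> K \<Longrightarrow> rho K (Rc c h) = Rc c (rho K h)"
  by (rule ext) (auto simp: rho_def Rc_def parab_mult_right_iff parab_S)

lemma ops_rho:
  assumes "K \<subseteq> S" "E \<subseteq> K" "F \<subseteq> K"
  shows "O1 \<in> ops E F \<Longrightarrow> rho K (O1 h) = O1 (rho K h)"
proof (induction rule: ops.induct)
  case (ops_L O1 c)
  then show ?case using rho_Lc[of K c "O1 h"] assms by auto
next
  case (ops_R O1 c)
  then show ?case using rho_Rc[of K c "O1 h"] assms by auto
next
  case (ops_diff O1 O2 b)
  then show "rho K (O1 h - scale b (O2 h)) = O1 (rho K h) - scale b (O2 (rho K h))"
    by (simp add: lin_diff[OF lin_rho] lin_scale[OF lin_rho])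
qed simp

lemma ops_Lc_commute:
  assumes "E \<subseteq> S" "F \<subseteq> S" "r \<in> S" "\<And>c. c \<in> E \<Longrightarrow> r \<otimes> c = c \<otimes> r"
  shows "O1 \<in> ops E F \<Longrightarrow> Lc r (O1 h) = O1 (Lc r h)"
proof (induction rule: ops.induct)
  case (ops_L O1 c)
  then show ?case using Lc_commute[of r c "O1 h"] assms by auto
next
  case (ops_R O1 c)
  then show ?case using Lc_Rc[of r c "O1 h"] assms by auto
next
  case (ops_diff O1 O2 b)
  then show "Lc r (O1 h - scale b (O2 h)) = O1 (Lc r h) - scale b (O2 (Lc r h))"
    by (simp add: lin_diff[OF lin_Lc] lin_scale[OF lin_Lc])
qed simp

lemma ops_Rc_commute:
  assumes "E \<subseteq> S" "r \<in> S"
  shows "O1 \<in> ops E {} \<Longrightarrow> Rc r (O1 h) = O1 (Rc r h)"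
proof (induction rule: ops.induct)
  case (ops_L O1 c)
  then show ?case using Lc_Rc[of c r "O1 h"] assms by auto
next
  case (ops_diff O1 O2 b)
  then show "Rc r (O1 h - scale b (O2 h)) = O1 (Rc r h) - scale b (O2 (Rc r h))"
    by (simp add: lin_diff[OF lin_Rc] lin_scale[OF lin_Rc])
qed auto

lemma ops_ops_commute:
  assumes "E \<subseteq> S" "F \<subseteq> S" "K \<subseteq> S" "\<And>r c. r \<in> K \<Longrightarrow> c \<in> E \<Longrightarrow> r \<otimes> c = c \<otimes> r"
    and "O1 \<in> ops E F"
  shows "Q \<in> ops K {} \<Longrightarrow> Q (O1 h) = O1 (Q h)"
proof (induction rule: ops.induct)
  case (ops_L Q c)
  then show ?case using ops_Lc_commute[of E F c O1 "Q h"] assms by auto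
next
  case (ops_diff Q Q' b)
  then show "Q (O1 h) - scale b (Q' (O1 h)) = O1 (Q h - scale b (Q' h))"
    by (simp add: lin_diff[OF ops_lin[OF assms(5)]] lin_scale[OF ops_lin[OF assms(5)]])
qed auto

section \<open>Expansion of products of basis elements with generators\<close>

lemma Lc_Cb:
  assumes "w \<in> carrier G" "s \<in> S" "\<not> dl s w"
  shows "\<exists>Z c. finite Z \<and> Lc s (Cb w) = Cb (s \<otimes> w) + (\<Sum>z\<in>Z. scale (of_int (c z)) (Cb z)) \<and>
    (\<forall>z\<in>Z. len z < len (s \<otimes> w) \<and> z \<in> carrier G \<and> Lc s (Cb w) z \<noteq> 0)"
proof -
  let ?h = "Lc s (Cb w)"
  have h: "?h \<in> Hm" "Bar ?h = ?h" using assms Bar_Lc[of "Cb w" s] by auto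
  have sw: "len (s \<otimes> w) = Suc (len w)" using len_mult_left assms by simp
  have supp: "u = s \<otimes> w \<or> len u < len (s \<otimes> w)" "u \<in> carrier G" if "?h u \<noteq> 0" for u
  proof -
    show u: "u \<in> carrier G" using Hm_closed h that by auto
    have "Cb w (s \<otimes> u) \<noteq> 0 \<or> Cb w u \<noteq> 0" using that by (auto simp: Lc_def split: if_splits)
    then have "bl (s \<otimes> u) w \<or> bl u w" using Cb_bruhat assms by blast
    then show "u = s \<otimes> w \<or> len u < len (s \<otimes> w)"
    proof
      assume "bl (s \<otimes> u) w"
      then have "s \<otimes> u = w \<or> len (s \<otimes> u) < len w" using bruhat_len by blast
      moreover have "len u \<le> Suc (len (s \<otimes> u))" using len_mult_left[of s u] u assms by linarith
      ultimately show ?thesis using sw u assms by auto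
    next
      assume "bl u w"
      then show ?thesis using bruhat_len[of u w] sw by auto
    qed
  qed
  have w0: "Cb w (s \<otimes> w) = 0" using Cb_bruhat[of w "s \<otimes> w"] bruhat_len[of "s \<otimes> w" w] sw assms S_not_one[of s] by auto
  have "lau_int (?h u)" for u
  proof (cases "u \<in> carrier G")
    case True
    have "lau_int (Cb w (s \<otimes> u))" using Cb_pos[of w "s \<otimes> u"] assms by (cases "s \<otimes> u = w") (auto simp: lau_pos_int)
    moreover have "lau_int (vp (if dl s u then -1 else 1) * Cb w u)"
    proof (cases "u = w")
      case True
      then show ?thesis using assms by (simp add: lau_int_vp)
    next
      case False
      then show ?thesis using Cb_pos[of w u] assms
        by (auto intro: lau_int_vp_mult_pos lau_int_vp_mult lau_pos_int)
    qed
    ultimately show ?thesis using True by (simp add: Lc_def lau_int_add)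
  qed (simp add: Lc_def)
  then have exp: "?h = (\<Sum>z | ?h z \<noteq> 0. scale (of_int (cf (?h z) 0)) (Cb z))"
    using Cb_expand h by blast
  have one: "?h (s \<otimes> w) = 1" using assms w0 by (simp add: Lc_def)
  have fin: "finite {z. ?h z \<noteq> 0}" using Hm_finite h by auto
  have "(\<Sum>z | ?h z \<noteq> 0. scale (of_int (cf (?h z) 0)) (Cb z)) =
    scale (of_int (cf (?h (s \<otimes> w)) 0)) (Cb (s \<otimes> w)) +
    (\<Sum>z\<in>{z. ?h z \<noteq> 0} - {s \<otimes> w}. scale (of_int (cf (?h z) 0)) (Cb z))"
    by (rule sum.remove) (use fin one in simp_all)
  then have "?h = Cb (s \<otimes> w) + (\<Sum>z\<in>{z. ?h z \<noteq> 0} - {s \<otimes> w}. scale (of_int (cf (?h z) 0)) (Cb z))"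
    using exp one by simp
  then show ?thesis using fin supp
    by (intro exI[of _ "{z. ?h z \<noteq> 0} - {s \<otimes> w}"] exI[of _ "\<lambda>z. cf (?h z) 0"]) auto
qed

lemma Rc_Cb:
  assumes "w \<in> carrier G" "s \<in> S" "\<not> dr w s"
  shows "\<exists>Z c. finite Z \<and> Rc s (Cb w) = Cb (w \<otimes> s) + (\<Sum>z\<in>Z. scale (of_int (c z)) (Cb z)) \<and>
    (\<forall>z\<in>Z. len z < len (w \<otimes> s) \<and> z \<in> carrier G \<and> Rc s (Cb w) z \<noteq> 0)"
proof -
  let ?h = "Rc s (Cb w)"
  have h: "?h \<in> Hm" "Bar ?h = ?h" using assms Bar_Rc[of "Cb w" s] by auto
  have sw: "len (w \<otimes> s) = Suc (len w)" using len_mult_right assms by simp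
  have supp: "u = w \<otimes> s \<or> len u < len (w \<otimes> s)" "u \<in> carrier G" if "?h u \<noteq> 0" for u
  proof -
    show u: "u \<in> carrier G" using Hm_closed h that by auto
    have "Cb w (u \<otimes> s) \<noteq> 0 \<or> Cb w u \<noteq> 0" using that by (auto simp: Rc_def split: if_splits)
    then have "bl (u \<otimes> s) w \<or> bl u w" using Cb_bruhat assms by blast
    then show "u = w \<otimes> s \<or> len u < len (w \<otimes> s)"
    proof
      assume "bl (u \<otimes> s) w"
      then have "u \<otimes> s = w \<or> len (u \<otimes> s) < len w" using bruhat_len by blast
      moreover have "len u \<le> Suc (len (u \<otimes> s))" using len_mult_right[of s u] u assms by linarith
      ultimately show ?thesis using sw u assms by auto
    next
      assume "bl u w"
      then show ?thesis using bruhat_len[of u w] sw by auto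
    qed
  qed
  have w0: "Cb w (w \<otimes> s) = 0" using Cb_bruhat[of w "w \<otimes> s"] bruhat_len[of "w \<otimes> s" w] sw assms S_not_one[of s] by auto
  have "lau_int (?h u)" for u
  proof (cases "u \<in> carrier G")
    case True
    have "lau_int (Cb w (u \<otimes> s))" using Cb_pos[of w "u \<otimes> s"] assms by (cases "u \<otimes> s = w") (auto simp: lau_pos_int)
    moreover have "lau_int (vp (if dr u s then -1 else 1) * Cb w u)"
    proof (cases "u = w")
      case True
      then show ?thesis using assms by (simp add: lau_int_vp)
    next
      case False
      then show ?thesis using Cb_pos[of w u] assms
        by (auto intro: lau_int_vp_mult_pos lau_int_vp_mult lau_pos_int)
    qed
    ultimately show ?thesis using True by (simp add: Rc_def lau_int_add)
  qed (simp add: Rc_def)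
  then have exp: "?h = (\<Sum>z | ?h z \<noteq> 0. scale (of_int (cf (?h z) 0)) (Cb z))"
    using Cb_expand h by blast
  have one: "?h (w \<otimes> s) = 1" using assms w0 by (simp add: Rc_def)
  have fin: "finite {z. ?h z \<noteq> 0}" using Hm_finite h by auto
  have "(\<Sum>z | ?h z \<noteq> 0. scale (of_int (cf (?h z) 0)) (Cb z)) =
    scale (of_int (cf (?h (w \<otimes> s)) 0)) (Cb (w \<otimes> s)) +
    (\<Sum>z\<in>{z. ?h z \<noteq> 0} - {w \<otimes> s}. scale (of_int (cf (?h z) 0)) (Cb z))"
    by (rule sum.remove) (use fin one in simp_all)
  then have "?h = Cb (w \<otimes> s) + (\<Sum>z\<in>{z. ?h z \<noteq> 0} - {w \<otimes> s}. scale (of_int (cf (?h z) 0)) (Cb z))"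
    using exp one by simp
  then show ?thesis using fin supp
    by (intro exI[of _ "{z. ?h z \<noteq> 0} - {w \<otimes> s}"] exI[of _ "\<lambda>z. cf (?h z) 0"]) auto
qed

text \<open>Left multiplication by C_x as an operator: peel off a left descent of x and subtract the
  corrections, which belong to shorter elements of W_D.\<close>

lemma ex_ops_Cb:
  assumes "D \<subseteq> S" "x \<in> generate G D"
  shows "\<exists>Q\<in>ops D {}. Q (del \<one>) = Cb x"
  using assms(2)
proof (induction "len x" arbitrary: x rule: less_induct)
  case less
  show ?case
  proof (cases "x = \<one>")
    case True
    then show ?thesis using ops_id by (intro bexI[of _ "\<lambda>h. h"]) auto
  next
    case False
    have x: "x \<in> carrier G" using less.prems assms by simp
    then obtain c where c: "c \<in> S" "dl c x" using ex_descent_left False by blast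
    then have cD: "c \<in> D" using descent_parab[OF assms(1) less.prems] by simp
    define x' where "x' = c \<otimes> x"
    have x': "x' \<in> generate G D" "x' \<in> carrier G" "\<not> dl c x'" "x = c \<otimes> x'" "len x' < len x"
      using x c cD less.prems dl_flip by (auto simp: x'_def intro: parab_mult parab_S)
    obtain Q where Q: "Q \<in> ops D {}" "Q (del \<one>) = Cb x'" using less.hyps[OF x'(5,1)] by blast
    obtain Z n where Z: "finite Z" "Lc c (Cb x') = Cb x + (\<Sum>z\<in>Z. scale (of_int (n z)) (Cb z))"
      "\<And>z. z \<in> Z \<Longrightarrow> len z < len x \<and> Lc c (Cb x') z \<noteq> 0"
      using Lc_Cb[OF x'(2) c(1) x'(3)] x'(4) by auto
    have "z \<in> generate G D" if "z \<in> Z" for z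
    proof -
      have nz: "Lc c (Cb x') z \<noteq> 0" using Z that by blast
      then have "z \<in> carrier G" by (auto simp: Lc_def split: if_splits)
      moreover have "Cb x' (c \<otimes> z) \<noteq> 0 \<or> Cb x' z \<noteq> 0" using nz by (auto simp: Lc_def split: if_splits)
      ultimately show ?thesis
        using Cb_parab[OF assms(1) x'(1)] parab_mult_left_iff[OF assms(1) parab_S[OF cD], of z] by blast
    qed
    then have "\<forall>z\<in>Z. \<exists>Q\<in>ops D {}. Q (del \<one>) = Cb z" using less.hyps Z(3) by blast
    then obtain P where P: "\<And>z. z \<in> Z \<Longrightarrow> P z \<in> ops D {}" "\<And>z. z \<in> Z \<Longrightarrow> P z (del \<one>) = Cb z" by metis
    have "(\<lambda>h. Lc c (Q h) - (\<Sum>z\<in>Z. scale (of_int (n z)) (P z h))) \<in> ops D {}"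
      using Z(1) P(1) ops_L[OF Q(1) cD] by (intro ops_diff_sum)
    moreover have "(\<Sum>z\<in>Z. scale (of_int (n z)) (P z (del \<one>))) = (\<Sum>z\<in>Z. scale (of_int (n z)) (Cb z))"
      using P(2) by (intro sum.cong) auto
    ultimately show ?thesis using Z(2) Q(2)
      by (intro bexI[of _ "\<lambda>h. Lc c (Q h) - (\<Sum>z\<in>Z. scale (of_int (n z)) (P z h))"]) simp_all
  qed
qed

text \<open>The condition under which x g b -> x g' b is a well defined bijection between the double
  cosets of g and g'.\<close>

definition compat :: "'a set \<Rightarrow> 'a set \<Rightarrow> 'a \<Rightarrow> 'a \<Rightarrow> bool" where
  "compat E F g g' \<longleftrightarrow> (\<forall>a\<in>generate G E. \<forall>b\<in>generate G F. a \<otimes> g = g \<otimes> b \<longleftrightarrow> a \<otimes> g' = g' \<otimes> b)"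

definition dc_rel :: "'a set \<Rightarrow> 'a set \<Rightarrow> 'a \<Rightarrow> 'a \<Rightarrow> ('a \<Rightarrow> lau) \<Rightarrow> ('a \<Rightarrow> lau) \<Rightarrow> bool" where
  "dc_rel E F g g' h h' \<longleftrightarrow>
     (\<forall>y. h y \<noteq> 0 \<longrightarrow> (\<exists>x\<in>generate G E. \<exists>b\<in>generate G F. y = x \<otimes> g \<otimes> b)) \<and>
     (\<forall>x\<in>generate G E. \<forall>b\<in>generate G F. h (x \<otimes> g \<otimes> b) = h' (x \<otimes> g' \<otimes> b))"

lemma refs_not_one: "t \<in> refs \<Longrightarrow> t \<noteq> \<one>"
  using eta_refs_self eta_one by fastforce

text \<open>The reflection t = x^-1 c x lies in W_E, which meets W_R only in 1, so g contributes
  nothing; b contributes only if g conjugates t into W_F. Left descents in E of x g b therefore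
  depend on g only through relations t g = g d.\<close>

lemma eta_double_coset:
  assumes "E \<subseteq> S" "F \<subseteq> S" "R \<subseteq> S" "E \<inter> R = {}" "g \<in> generate G R"
    and "x \<in> generate G E" "b \<in> generate G F" "c \<in> E"
  shows "eta (x \<otimes> g \<otimes> b) c = (eta x c \<noteq> (\<exists>d\<in>generate G F. (inv x \<otimes> c \<otimes> x) \<otimes> g = g \<otimes> d \<and> eta b d))"
proof -
  have cl: "x \<in> carrier G" "g \<in> carrier G" "b \<in> carrier G" "c \<in> S" "c \<in> carrier G" using assms by auto
  let ?t = "inv x \<otimes> c \<otimes> x"
  have t: "?t \<in> generate G E" "?t \<in> refs" "?t \<in> carrier G"
    using assms cl refs_conj(2)[of c x] by (auto intro!: parab_mult[OF parab_mult[OF parab_inv parab_S]])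
  have "\<not> eta g ?t"
    using eta_parab[OF assms(3,5) t(3)] parab_disjoint[OF assms(1,3,4) t(1)] refs_not_one[OF t(2)] by blast
  then have "eta (x \<otimes> g \<otimes> b) c = (eta x c \<noteq> eta b (inv g \<otimes> ?t \<otimes> g))"
    using cl t eta_mult[of x "g \<otimes> b" c] eta_mult[of g b ?t] by (simp add: m_assoc)
  moreover have "eta b (inv g \<otimes> ?t \<otimes> g) \<longleftrightarrow> (\<exists>d\<in>generate G F. ?t \<otimes> g = g \<otimes> d \<and> eta b d)"
  proof
    assume e: "eta b (inv g \<otimes> ?t \<otimes> g)"
    then have "inv g \<otimes> ?t \<otimes> g \<in> generate G F" using eta_parab[OF assms(2,7)] cl t by auto
    moreover have "?t \<otimes> g = g \<otimes> (inv g \<otimes> ?t \<otimes> g)" using cl t by (simp add: m_assoc)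
    ultimately show "\<exists>d\<in>generate G F. ?t \<otimes> g = g \<otimes> d \<and> eta b d" using e by blast
  next
    assume "\<exists>d\<in>generate G F. ?t \<otimes> g = g \<otimes> d \<and> eta b d"
    then obtain d where d: "d \<in> generate G F" "?t \<otimes> g = g \<otimes> d" "eta b d" by blast
    then have "inv g \<otimes> ?t \<otimes> g = d" using mult_eq_iff_conj[of g ?t d] cl t assms(2) by simp
    then show "eta b (inv g \<otimes> ?t \<otimes> g)" using d by simp
  qed
  ultimately show ?thesis by simp
qed

lemma dl_double_coset:
  assumes "E \<subseteq> S" "F \<subseteq> S" "R \<subseteq> S" "E \<inter> R = {}" "g \<in> generate G R" "g' \<in> generate G R"
    and "x \<in> generate G E" "b \<in> generate G F" "c \<in> E" "compat E F g g'"
  shows "dl c (x \<otimes> g \<otimes> b) \<longleftrightarrow> dl c (x \<otimes> g' \<otimes> b)"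
proof -
  have "inv x \<otimes> c \<otimes> x \<in> generate G E"
    using assms by (auto intro!: parab_mult[OF parab_mult[OF parab_inv parab_S]])
  then have "(inv x \<otimes> c \<otimes> x) \<otimes> g = g \<otimes> d \<longleftrightarrow> (inv x \<otimes> c \<otimes> x) \<otimes> g' = g' \<otimes> d" if "d \<in> generate G F" for d
    using assms(10) that unfolding compat_def by blast
  then have "eta (x \<otimes> g \<otimes> b) c = eta (x \<otimes> g' \<otimes> b) c"
    using eta_double_coset[OF assms(1-4)] assms(5-9) by metis
  moreover have "c \<in> S" "x \<otimes> g \<otimes> b \<in> carrier G" "x \<otimes> g' \<otimes> b \<in> carrier G"
    using assms parab_closed[OF assms(1)] parab_closed[OF assms(2)] parab_closed[OF assms(3)] by auto
  ultimately show ?thesis using dl_eta by simp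
qed

lemma compat_inv:
  assumes "E \<subseteq> S" "F \<subseteq> S" "g \<in> carrier G" "g' \<in> carrier G" "compat E F g g'"
  shows "compat F E (inv g) (inv g')"
  unfolding compat_def
proof (intro ballI)
  fix b a assume b: "b \<in> generate G F" and a: "a \<in> generate G E"
  have c: "a \<in> carrier G" "b \<in> carrier G" using a b assms by auto
  have "b \<otimes> inv k = inv k \<otimes> a \<longleftrightarrow> a \<otimes> k = k \<otimes> b" if "k \<in> carrier G" for k
  proof
    assume "b \<otimes> inv k = inv k \<otimes> a"
    then have "k \<otimes> (b \<otimes> inv k) \<otimes> k = k \<otimes> (inv k \<otimes> a) \<otimes> k" by simp
    then show "a \<otimes> k = k \<otimes> b" using that c by (simp add: m_assoc)
  next
    assume "a \<otimes> k = k \<otimes> b"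
    then have "inv k \<otimes> (a \<otimes> k) \<otimes> inv k = inv k \<otimes> (k \<otimes> b) \<otimes> inv k" by simp
    then show "b \<otimes> inv k = inv k \<otimes> a" using that c by (simp add: m_assoc)
  qed
  then show "b \<otimes> inv g = inv g \<otimes> a \<longleftrightarrow> b \<otimes> inv g' = inv g' \<otimes> a"
    using assms a b unfolding compat_def by auto
qed

lemma dr_double_coset:
  assumes "E \<subseteq> S" "F \<subseteq> S" "R \<subseteq> S" "F \<inter> R = {}" "g \<in> generate G R" "g' \<in> generate G R"
    and "x \<in> generate G E" "b \<in> generate G F" "c \<in> F" "compat E F g g'"
  shows "dr (x \<otimes> g \<otimes> b) c \<longleftrightarrow> dr (x \<otimes> g' \<otimes> b) c"
proof -
  have cl: "x \<in> carrier G" "g \<in> carrier G" "g' \<in> carrier G" "b \<in> carrier G" "c \<in> S"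
    using assms parab_closed[OF assms(1)] parab_closed[OF assms(2)] parab_closed[OF assms(3)] by auto
  have "dl c (inv b \<otimes> inv g \<otimes> inv x) \<longleftrightarrow> dl c (inv b \<otimes> inv g' \<otimes> inv x)"
    using assms compat_inv[OF assms(1,2) cl(2,3) assms(10)]
    by (intro dl_double_coset[of F E R]) (auto intro: parab_inv)
  moreover have "inv (x \<otimes> k \<otimes> b) = inv b \<otimes> inv k \<otimes> inv x" if "k \<in> carrier G" for k
    using cl that by (simp add: inv_mult_group m_assoc)
  ultimately show ?thesis
    using cl len_inv_swap[of c "x \<otimes> g \<otimes> b"] len_inv_swap[of c "x \<otimes> g' \<otimes> b"]
      len_inv[of "x \<otimes> g \<otimes> b"] len_inv[of "x \<otimes> g' \<otimes> b"] by simp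
qed

text \<open>An operator sees the group only through products with letters of E and F and through
  descents at these letters. Both correspond under x g b -> x g' b.\<close>

lemma ops_dc_rel:
  assumes EF: "E \<subseteq> S" "F \<subseteq> S" and R: "R \<subseteq> S" "E \<inter> R = {}" "F \<inter> R = {}"
    and g: "g \<in> generate G R" "g' \<in> generate G R" and com: "compat E F g g'"
  shows "O1 \<in> ops E F \<Longrightarrow> dc_rel E F g g' (O1 (del g)) (O1 (del g'))"
proof (induction rule: ops.induct)
  have gc: "g \<in> carrier G" "g' \<in> carrier G" using g R by auto
  have xc: "x \<in> carrier G" if "x \<in> generate G E" for x using that EF by auto
  have bc: "b \<in> carrier G" if "b \<in> generate G F" for b using that EF by auto
  {
    case ops_id
    show ?case unfolding dc_rel_def
    proof (intro conjI allI impI ballI)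
      fix y assume "del g y \<noteq> 0"
      then have "y = \<one> \<otimes> g \<otimes> \<one>" using gc by (auto simp: del_def split: if_splits)
      then show "\<exists>x\<in>generate G E. \<exists>b\<in>generate G F. y = x \<otimes> g \<otimes> b" using parab_one by blast
    next
      fix x b assume x: "x \<in> generate G E" and b: "b \<in> generate G F"
      have eq: "x \<otimes> k \<otimes> b = k \<longleftrightarrow> x \<otimes> k = k \<otimes> inv b" if "k \<in> carrier G" for k
      proof
        assume "x \<otimes> k \<otimes> b = k"
        then have "x \<otimes> k \<otimes> b \<otimes> inv b = k \<otimes> inv b" by simp
        then show "x \<otimes> k = k \<otimes> inv b" using that xc[OF x] bc[OF b] by simp
      next
        assume "x \<otimes> k = k \<otimes> inv b"
        then show "x \<otimes> k \<otimes> b = k" using that xc[OF x] bc[OF b] by simp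
      qed
      have "x \<otimes> g = g \<otimes> inv b \<longleftrightarrow> x \<otimes> g' = g' \<otimes> inv b"
        using com x parab_inv[OF EF(2) b] unfolding compat_def by blast
      then show "del g (x \<otimes> g \<otimes> b) = del g' (x \<otimes> g' \<otimes> b)"
        using eq gc by (simp add: del_def)
    qed
  next
    case (ops_L O1 c)
    have c: "c \<in> S" using ops_L EF by auto
    show ?case unfolding dc_rel_def
    proof (intro conjI allI impI ballI)
      fix y assume y: "Lc c (O1 (del g)) y \<noteq> 0"
      then have yc: "y \<in> carrier G" by (auto simp: Lc_def split: if_splits)
      have "O1 (del g) y \<noteq> 0 \<or> O1 (del g) (c \<otimes> y) \<noteq> 0" using y by (auto simp: Lc_def split: if_splits)
      then show "\<exists>x\<in>generate G E. \<exists>b\<in>generate G F. y = x \<otimes> g \<otimes> b"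
      proof
        assume "O1 (del g) (c \<otimes> y) \<noteq> 0"
        then obtain x b where *: "x \<in> generate G E" "b \<in> generate G F" "c \<otimes> y = x \<otimes> g \<otimes> b"
          using ops_L unfolding dc_rel_def by blast
        have "y = c \<otimes> (c \<otimes> y)" using c yc by simp
        also have "\<dots> = (c \<otimes> x) \<otimes> g \<otimes> b" unfolding *(3) using c xc bc gc * by (simp add: m_assoc)
        finally show ?thesis using * parab_mult[OF parab_S[OF ops_L(2)]] by blast
      qed (use ops_L in \<open>auto simp: dc_rel_def\<close>)
    next
      fix x b assume x: "x \<in> generate G E" and b: "b \<in> generate G F"
      have cx: "c \<otimes> x \<in> generate G E" using parab_mult[OF parab_S[OF ops_L(2)] x] .
      have "c \<otimes> (x \<otimes> k \<otimes> b) = (c \<otimes> x) \<otimes> k \<otimes> b" if "k \<in> carrier G" for k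
        using that xc[OF x] bc[OF b] c by (simp add: m_assoc)
      then show "Lc c (O1 (del g)) (x \<otimes> g \<otimes> b) = Lc c (O1 (del g')) (x \<otimes> g' \<otimes> b)"
        using dl_double_coset[OF EF R(1,2) g x b ops_L(2) com] ops_L cx x b gc xc[OF x] bc[OF b]
        by (simp add: Lc_def dc_rel_def)
    qed
  next
    case (ops_R O1 c)
    have c: "c \<in> S" using ops_R EF by auto
    show ?case unfolding dc_rel_def
    proof (intro conjI allI impI ballI)
      fix y assume y: "Rc c (O1 (del g)) y \<noteq> 0"
      then have yc: "y \<in> carrier G" by (auto simp: Rc_def split: if_splits)
      have "O1 (del g) y \<noteq> 0 \<or> O1 (del g) (y \<otimes> c) \<noteq> 0" using y by (auto simp: Rc_def split: if_splits)
      then show "\<exists>x\<in>generate G E. \<exists>b\<in>generate G F. y = x \<otimes> g \<otimes> b"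
      proof
        assume "O1 (del g) (y \<otimes> c) \<noteq> 0"
        then obtain x b where *: "x \<in> generate G E" "b \<in> generate G F" "y \<otimes> c = x \<otimes> g \<otimes> b"
          using ops_R unfolding dc_rel_def by blast
        have "y = (y \<otimes> c) \<otimes> c" using c yc by simp
        also have "\<dots> = x \<otimes> g \<otimes> (b \<otimes> c)" unfolding *(3) using c xc bc gc * by (simp add: m_assoc)
        finally show ?thesis using * parab_mult[OF _ parab_S[OF ops_R(2)]] by blast
      qed (use ops_R in \<open>auto simp: dc_rel_def\<close>)
    next
      fix x b assume x: "x \<in> generate G E" and b: "b \<in> generate G F"
      have cx: "b \<otimes> c \<in> generate G F" using parab_mult[OF b parab_S[OF ops_R(2)]] .
      have "x \<otimes> k \<otimes> b \<otimes> c = x \<otimes> k \<otimes> (b \<otimes> c)" if "k \<in> carrier G" for k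
        using that xc[OF x] bc[OF b] c by (simp add: m_assoc)
      then show "Rc c (O1 (del g)) (x \<otimes> g \<otimes> b) = Rc c (O1 (del g')) (x \<otimes> g' \<otimes> b)"
        using dr_double_coset[OF EF R(1,3) g x b ops_R(2) com] ops_R cx x b gc xc[OF x] bc[OF b]
        by (simp add: Rc_def dc_rel_def)
    qed
  next
    case (ops_diff O1 O2 b)
    have "O1 (del g) y \<noteq> 0 \<or> O2 (del g) y \<noteq> 0" if "(O1 (del g) - scale b (O2 (del g))) y \<noteq> 0" for y
      using that by auto
    then show ?case using ops_diff unfolding dc_rel_def by (simp, meson)
  }
qed

text \<open>A left descent c of a is an inversion of k d, which forces ck = kf with f in W_F and
  turns the equation into (ca) g = k (fd). Once a = 1, the element d lies in both W_R and W_F and is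
  1.\<close>

lemma double_coset_unique:
  assumes "E \<subseteq> S" "F \<subseteq> S" "R \<subseteq> S" "E \<inter> R = {}" "F \<inter> R = {}"
    and "g \<in> generate G R" "k \<in> generate G R" "a \<in> generate G E" "d \<in> generate G F" "a \<otimes> g = k \<otimes> d"
  shows "g = k"
  using assms(8-10)
proof (induction "len a" arbitrary: a d rule: less_induct)
  case less
  have cl: "a \<in> carrier G" "g \<in> carrier G" "k \<in> carrier G" "d \<in> carrier G"
    using less assms by auto
  show ?case
  proof (cases "a = \<one>")
    case True
    then have "k \<otimes> d \<in> generate G R" using less cl assms by simp
    then have "d \<in> generate G R" using parab_mult_left_iff[OF assms(3,7)] cl by simp
    then have "d = \<one>" using parab_disjoint[OF assms(2,3,5)] less by blast
    then show ?thesis using True less cl by simp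
  next
    case False
    then obtain c where c: "c \<in> S" "dl c a" using ex_descent_left cl by blast
    then have cE: "c \<in> E" using descent_parab assms less by blast
    have "eta (a \<otimes> g \<otimes> \<one>) c = (eta a c \<noteq> (\<exists>d\<in>generate G {}. inv a \<otimes> c \<otimes> a \<otimes> g = g \<otimes> d \<and> eta \<one> d))"
      using less cE by (intro eta_double_coset[OF assms(1) _ assms(3,4,6)]) auto
    moreover have "\<not> eta \<one> d" if "d \<in> generate G {}" for d
      using parab_empty[OF that] by simp
    ultimately have "eta (a \<otimes> g) c" using c cl by (simp add: dl_eta)
    moreover have "eta (\<one> \<otimes> k \<otimes> d) c = (eta \<one> c \<noteq> (\<exists>f\<in>generate G F. inv \<one> \<otimes> c \<otimes> \<one> \<otimes> k = k \<otimes> f \<and> eta d f))"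
      using less cE by (intro eta_double_coset[OF assms(1-4,7)]) auto
    ultimately obtain f where f: "f \<in> generate G F" "c \<otimes> k = k \<otimes> f"
      using c cl less.prems by auto
    have fc: "f \<in> carrier G" using f assms by auto
    have "(c \<otimes> a) \<otimes> g = c \<otimes> (k \<otimes> d)" using c cl less.prems by (simp add: m_assoc)
    also have "\<dots> = c \<otimes> k \<otimes> d" using c cl by (simp add: m_assoc)
    also have "\<dots> = k \<otimes> (f \<otimes> d)" using f fc cl by (simp add: m_assoc)
    finally show ?thesis
      using less.hyps[of "c \<otimes> a" "f \<otimes> d"] c f less.prems
      by (auto intro: parab_mult parab_mult[OF parab_S[OF cE]])
  qed
qed

lemma ops_expand:
  assumes "O1 \<in> ops E F" "h \<in> Hm"
  shows "O1 h y = (\<Sum>k | h k \<noteq> 0. h k * O1 (del k) y)"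
proof -
  have "O1 h = O1 (\<Sum>k | h k \<noteq> 0. scale (h k) (del k))"
    by (rule arg_cong[where f = O1], rule Hm_expand[OF assms(2) Hm_finite[OF assms(2)]]) simp
  also have "\<dots> = (\<Sum>k | h k \<noteq> 0. scale (h k) (O1 (del k)))"
    by (simp add: lin_sum[OF ops_lin[OF assms(1)]] lin_scale[OF ops_lin[OF assms(1)]])
  finally show ?thesis by (simp add: sum_fun_apply)
qed

lemma ops_support:
  assumes "E \<subseteq> S" "F \<subseteq> S" "R \<subseteq> S" "E \<inter> R = {}" "F \<inter> R = {}" "O1 \<in> ops E F" "h \<in> Hm"
    and "\<And>u. h u \<noteq> 0 \<Longrightarrow> u \<in> generate G R" "O1 h y \<noteq> 0"
  shows "\<exists>x\<in>generate G E. \<exists>k\<in>generate G R. \<exists>b\<in>generate G F. y = x \<otimes> k \<otimes> b \<and> h k \<noteq> 0"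
proof -
  have "(\<Sum>k | h k \<noteq> 0. h k * O1 (del k) y) \<noteq> 0" using assms(9) ops_expand[OF assms(6,7)] by simp
  then obtain k where k: "h k \<noteq> 0" "O1 (del k) y \<noteq> 0"
    by (metis (mono_tags, lifting) mem_Collect_eq mult_zero_right sum.neutral)
  have kR: "k \<in> generate G R" using assms(8) k by blast
  have "dc_rel E F k k (O1 (del k)) (O1 (del k))"
    using ops_dc_rel[OF assms(1-5) kR kR _ assms(6)] by (simp add: compat_def)
  then show ?thesis using k kR unfolding dc_rel_def by blast
qed

text \<open>Distinct elements of W_R lie in distinct double cosets, so only the term of h at g
  reaches x g b, and that term may be computed with g' in place of g.\<close>

lemma ops_value:
  assumes "E \<subseteq> S" "F \<subseteq> S" "R \<subseteq> S" "E \<inter> R = {}" "F \<inter> R = {}" "O1 \<in> ops E F" "h \<in> Hm"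
    and "\<And>u. h u \<noteq> 0 \<Longrightarrow> u \<in> generate G R"
    and "g \<in> generate G R" "g' \<in> generate G R" "compat E F g g'" "x \<in> generate G E" "b \<in> generate G F"
  shows "O1 h (x \<otimes> g \<otimes> b) = h g * O1 (del g') (x \<otimes> g' \<otimes> b)"
proof -
  have cl: "x \<in> carrier G" "g \<in> carrier G" "b \<in> carrier G"
    using parab_closed[OF assms(1,12)] parab_closed[OF assms(3,9)] parab_closed[OF assms(2,13)] by auto
  have z: "O1 (del k) (x \<otimes> g \<otimes> b) = 0" if "h k \<noteq> 0" "k \<noteq> g" for k
  proof (rule ccontr)
    assume nz: "O1 (del k) (x \<otimes> g \<otimes> b) \<noteq> 0"
    have kR: "k \<in> generate G R" using assms(8) that by blast
    have "dc_rel E F k k (O1 (del k)) (O1 (del k))"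
      using ops_dc_rel[OF assms(1-5) kR kR _ assms(6)] by (simp add: compat_def)
    then obtain x' b' where *: "x' \<in> generate G E" "b' \<in> generate G F" "x \<otimes> g \<otimes> b = x' \<otimes> k \<otimes> b'"
      using nz unfolding dc_rel_def by blast
    have cl': "x' \<in> carrier G" "b' \<in> carrier G" "k \<in> carrier G"
      using parab_closed[OF assms(1) *(1)] parab_closed[OF assms(2) *(2)] parab_closed[OF assms(3) kR] by auto
    have "inv x' \<otimes> x \<otimes> g = inv x' \<otimes> (x \<otimes> g \<otimes> b) \<otimes> inv b" using cl cl' by (simp add: m_assoc)
    also have "\<dots> = k \<otimes> (b' \<otimes> inv b)" unfolding *(3) using cl cl' by (simp add: m_assoc)
    finally have "g = k"
      by (rule double_coset_unique[OF assms(1-5) assms(9) kR parab_mult[OF parab_inv[OF assms(1) *(1)] assms(12)]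
        parab_mult[OF *(2) parab_inv[OF assms(2,13)]]])
    with that show False by simp
  qed
  have "O1 h (x \<otimes> g \<otimes> b) = (\<Sum>k | h k \<noteq> 0. h k * O1 (del k) (x \<otimes> g \<otimes> b))"
    by (rule ops_expand[OF assms(6,7)])
  also have "\<dots> = (\<Sum>k | h k \<noteq> 0. if k = g then h g * O1 (del g) (x \<otimes> g \<otimes> b) else 0)"
    using z by (intro sum.cong) auto
  also have "\<dots> = h g * O1 (del g) (x \<otimes> g \<otimes> b)" using Hm_finite[OF assms(7)] by simp
  also have "O1 (del g) (x \<otimes> g \<otimes> b) = O1 (del g') (x \<otimes> g' \<otimes> b)"
    using ops_dc_rel[OF assms(1-5,9,10,11,6)] assms(12,13) unfolding dc_rel_def by blast
  finally show ?thesis .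
qed

lemma lau_int_Cb: "w \<in> carrier G \<Longrightarrow> lau_int (Cb w u)"
  using Cb_pos[of w u] by (cases "u = w") (auto simp: lau_pos_int)

text \<open>C_x C_w = C_{xw} for disjoint supports: the coefficient of the product at a g is the
  product of those of C_x at a and C_w at g, so positivity away from xw is inherited.\<close>

lemma Cb_disjoint:
  assumes "D \<subseteq> S" "R \<subseteq> S" "D \<inter> R = {}" "x \<in> generate G D" "w \<in> generate G R"
    and Q: "Q \<in> ops D {}" "Q (del \<one>) = Cb x"
  shows "Q (Cb w) = Cb (x \<otimes> w)"
proof -
  have cl: "x \<in> carrier G" "w \<in> carrier G" using assms by auto
  have supp: "u \<in> generate G R" if "Cb w u \<noteq> 0" for u using Cb_parab[OF assms(2,5) that] .
  have val: "Q (Cb w) (a \<otimes> g) = Cb w g * Cb x a" if a: "a \<in> generate G D" and g: "g \<in> generate G R" for a g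
  proof -
    have c: "a \<in> carrier G" "g \<in> carrier G" using that assms by auto
    have "a' = \<one>" if "a' \<in> carrier G" "a' \<otimes> g = g" for a'
      using that c by (metis l_one one_closed right_cancel)
    \<comment> \<open>With trivial right factor the only relation is 1 g = g 1, so every g can be
      exchanged for 1.\<close>
    then have "compat D {} g \<one>" unfolding compat_def
      using c parab_closed[OF assms(1)] by (auto simp: generate_empty)
    then have "Q (Cb w) (a \<otimes> g \<otimes> \<one>) = Cb w g * Q (del \<one>) (a \<otimes> \<one> \<otimes> \<one>)"
      using supp cl a g by (intro ops_value[OF assms(1) _ assms(2,3) _ Q(1)]) auto
    then show ?thesis using Q c by simp
  qed
  have "isKL (x \<otimes> w) (Q (Cb w))" unfolding isKL_def
  proof (intro conjI allI impI)
    show "Q (Cb w) \<in> Hm" using ops_Hm[OF Q(1) assms(1)] cl by simp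
    show "Bar (Q (Cb w)) = Q (Cb w)" using ops_Bar[OF assms(1) _ _ Q(1), of "Cb w"] cl by simp
    show "Q (Cb w) (x \<otimes> w) = 1" using val[OF assms(4,5)] cl by simp
    fix u assume u: "u \<noteq> x \<otimes> w"
    show "lau_pos (Q (Cb w) u)"
    proof (cases "Q (Cb w) u = 0")
      case False
      have "Cb w \<in> Hm" using cl by simp
      then obtain a g where *: "a \<in> generate G D" "g \<in> generate G R" "u = a \<otimes> g \<otimes> \<one>"
        using ops_support[OF assms(1) _ assms(2,3) _ Q(1) _ supp False] parab_empty by (metis Int_empty_left empty_subsetI)
      then have "u = a \<otimes> g" using parab_closed[OF assms(1) *(1)] parab_closed[OF assms(2) *(2)] by simp
      moreover have "g \<noteq> w \<or> a \<noteq> x" using u calculation by auto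
      ultimately show ?thesis
        using val[OF *(1,2)] Cb_pos[of w g] Cb_pos[of x a] lau_int_Cb[of w g] lau_int_Cb[of x a] cl
          lau_pos_mult[of "Cb w g" "Cb x a"] lau_pos_mult[of "Cb x a" "Cb w g"] by (auto simp: mult.commute)
    qed simp
  qed
  then show ?thesis by (rule Cb_eqI[symmetric])
qed

lemma Cb_S: "s \<in> S \<Longrightarrow> Cb s = del s + scale (vp 1) (del \<one>)"
proof (rule Cb_eqI)
  assume s: "s \<in> S"
  have "Lc s (del \<one>) = del s + scale (vp 1) (del \<one>)" using s by (simp add: Lc_del)
  moreover have "Bar (Lc s (del \<one>)) = Lc s (del \<one>)" using Bar_Lc[of "del \<one>" s] s by (simp add: Bar_del)
  moreover have "Lc s (del \<one>) \<in> Hm" using s by auto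
  ultimately show "isKL s (del s + scale (vp 1) (del \<one>))"
    using S_not_one[OF s] by (auto simp: isKL_def) (auto simp: del_def lau_pos_vp)
qed

lemma Lc_Cb_one: "s \<in> S \<Longrightarrow> Lc s (del \<one>) = Cb s"
  by (simp add: Cb_S Lc_del)

lemma Cb_left:
  assumes "R \<subseteq> S" "s \<in> S" "s \<notin> R" "w \<in> generate G R"
  shows "Cb (s \<otimes> w) = Lc s (Cb w)"
  using Cb_disjoint[of "{s}" R s w "\<lambda>h. Lc s h"] assms ops_L[OF ops_id, of s "{s}" "{}"]
  by (auto simp: Lc_Cb_one parab_S)

text \<open>C_w arises from H_1 by left operators, which commute with right multiplication by C_s;
  this reduces the claim to C_s itself.\<close>

lemma Cb_right:
  assumes "R \<subseteq> S" "s \<in> S" "s \<notin> R" "w \<in> generate G R"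
  shows "Cb (w \<otimes> s) = Rc s (Cb w)"
proof -
  obtain Q where Q: "Q \<in> ops R {}" "Q (del \<one>) = Cb w" using ex_ops_Cb[OF assms(1,4)] by blast
  have "Cb (w \<otimes> s) = Q (Cb s)"
    using Cb_disjoint[OF assms(1) _ _ assms(4) _ Q, of "{s}" s] assms by (auto simp: parab_S)
  also have "Cb s = Rc s (del \<one>)" using assms by (simp add: Lc_Cb_one[symmetric] Lc_del_one)
  also have "Q (Rc s (del \<one>)) = Rc s (Q (del \<one>))" using ops_Rc_commute[OF assms(1,2) Q(1)] by simp
  finally show ?thesis using Q by simp
qed

text \<open>A left descent c of a is an inversion of g d, so cg = gf with f in W_E. Additivity of
  lengths makes f a letter, and comparing supports gives f = c. Then c commutes with the letters of
  g, among them p, and with the rest of R by hypothesis; strip c and repeat.\<close>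

lemma double_coset_commute:
  assumes E: "E \<subseteq> S" and R: "R \<subseteq> S" "E \<inter> R = {}" "p \<in> R"
    and com: "\<forall>c\<in>E. \<forall>r\<in>R. r \<noteq> p \<longrightarrow> c \<otimes> r = r \<otimes> c"
    and g: "g \<in> generate G R" "g \<notin> generate G (R - {p})"
    and "a \<in> generate G E" "d \<in> generate G E" "a \<otimes> g = g \<otimes> d"
  shows "a \<in> generate G {c \<in> E. \<forall>r\<in>R. c \<otimes> r = r \<otimes> c}"
  using assms(8-10)
proof (induction "len a" arbitrary: a d rule: less_induct)
  case less
  have cl: "a \<in> carrier G" "g \<in> carrier G" "d \<in> carrier G" using less assms by auto
  show ?case
  proof (cases "a = \<one>")
    case False
    then obtain c where c: "c \<in> S" "dl c a" using ex_descent_left cl by blast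
    then have cE: "c \<in> E" using descent_parab assms less by blast
    have "eta (a \<otimes> g \<otimes> \<one>) c = (eta a c \<noteq> (\<exists>d\<in>generate G {}. inv a \<otimes> c \<otimes> a \<otimes> g = g \<otimes> d \<and> eta \<one> d))"
      using less cE g by (intro eta_double_coset[OF E _ R(1,2)]) auto
    moreover have "\<not> eta \<one> d" if "d \<in> generate G {}" for d
      using parab_empty[OF that] by simp
    ultimately have "eta (a \<otimes> g) c" using c cl by (simp add: dl_eta)
    moreover have "eta (\<one> \<otimes> g \<otimes> d) c = (eta \<one> c \<noteq> (\<exists>f\<in>generate G E. inv \<one> \<otimes> c \<otimes> \<one> \<otimes> g = g \<otimes> f \<and> eta d f))"
      using less cE g by (intro eta_double_coset[OF E E R(1,2)]) auto
    ultimately obtain f where f: "f \<in> generate G E" "c \<otimes> g = g \<otimes> f"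
      using c cl less.prems by auto
    have fc: "f \<in> carrier G" using f assms by auto
    have "g \<in> mcr E" using mcr_parab_disjoint[OF E R(1,2) g(1)] .
    have "inv g \<in> mcr E" using mcr_parab_disjoint[OF E R(1,2) parab_inv[OF R(1) g(1)]] .
    have "len (c \<otimes> g) = 1 + len g" using len_mcr[OF E \<open>g \<in> mcr E\<close> parab_S[OF cE]] c by simp
    moreover have "len (inv f \<otimes> inv g) = len f + len g"
      using len_mcr[OF E \<open>inv g \<in> mcr E\<close> parab_inv[OF E f(1)]] cl fc by simp
    moreover have "len (inv f \<otimes> inv g) = len (g \<otimes> f)"
      using cl fc len_inv[of "g \<otimes> f"] by (simp add: inv_mult_group)
    ultimately have "len f = 1" using f by simp
    then obtain ws where ws: "ws \<in> lists E" "wp ws = f" "length ws = Suc 0"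
      using parab_reduced[OF E f(1)] by auto
    then obtain e where "ws = [e]" by (cases ws) auto
    then have fE: "f \<in> E" using ws E by auto
    have "f = c"
    proof (rule ccontr)
      assume ne: "f \<noteq> c"
      have K: "insert c R \<subseteq> S" "insert f R \<subseteq> S" using c R fE E by auto
      have "c \<otimes> g \<in> generate G (insert c R)"
        using parab_mono[OF _ g(1), of "insert c R"] by (intro parab_mult[OF parab_S]) auto
      moreover have "c \<otimes> g \<in> generate G (insert f R)"
        unfolding f(2) using parab_mono[OF _ g(1), of "insert f R"] parab_S[of f "insert f R"]
        by (intro parab_mult) auto
      ultimately have "c \<otimes> g \<in> generate G (insert c R \<inter> insert f R)" using parab_Int K by blast
      moreover have "insert c R \<inter> insert f R = R" using ne cE fE R by auto
      ultimately have "c \<in> generate G R" using parab_mult_right_iff[OF R(1) g(1)] c by auto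
      then show False using S_parab_iff[OF R(1) c(1)] cE R by auto
    qed
    then have cg: "c \<otimes> g = g \<otimes> c" using f by simp
    have "c \<notin> R" using cE R by auto
    then have supp: "g \<in> generate G {r \<in> R. c \<otimes> r = r \<otimes> c}"
      using commute_support[OF R(1) c(1) _ g(1) cg] by simp
    have "c \<otimes> p = p \<otimes> c"
    proof (rule ccontr)
      assume "c \<otimes> p \<noteq> p \<otimes> c"
      then have "{r \<in> R. c \<otimes> r = r \<otimes> c} \<subseteq> R - {p}" by auto
      then show False using parab_mono[OF _ supp] g by blast
    qed
    then have "c \<otimes> r = r \<otimes> c" if "r \<in> R" for r
      using com cE that by (cases "r = p") auto
    then have c0: "c \<in> {c \<in> E. \<forall>r\<in>R. c \<otimes> r = r \<otimes> c}" using cE by blast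
    have "(c \<otimes> a) \<otimes> g = c \<otimes> (g \<otimes> d)" using c cl less.prems by (simp add: m_assoc)
    also have "\<dots> = c \<otimes> g \<otimes> d" using c cl by (simp add: m_assoc)
    also have "\<dots> = g \<otimes> (c \<otimes> d)" unfolding cg using c cl by (simp add: m_assoc)
    finally have "c \<otimes> a \<in> generate G {c \<in> E. \<forall>r\<in>R. c \<otimes> r = r \<otimes> c}"
      using less.hyps[of "c \<otimes> a" "c \<otimes> d"] c less.prems
      by (auto intro: parab_mult[OF parab_S[OF cE]])
    then have "c \<otimes> (c \<otimes> a) \<in> generate G {c \<in> E. \<forall>r\<in>R. c \<otimes> r = r \<otimes> c}"
      by (rule parab_mult[OF parab_S[OF c0]])
    then show ?thesis using c cl by simp
  qed simp
qed

text \<open>All letters of a commute with R, so a passes through every element of W_R. This makes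
  any g involving p exchangeable with p itself.\<close>

lemma double_coset_commute_eq:
  assumes E: "E \<subseteq> S" and R: "R \<subseteq> S" "E \<inter> R = {}" "p \<in> R"
    and com: "\<forall>c\<in>E. \<forall>r\<in>R. r \<noteq> p \<longrightarrow> c \<otimes> r = r \<otimes> c"
    and g: "g \<in> generate G R" "g \<notin> generate G (R - {p})"
    and ad: "a \<in> generate G E" "d \<in> generate G E" "a \<otimes> g = g \<otimes> d"
  shows "d = a" "k \<in> generate G R \<Longrightarrow> a \<otimes> k = k \<otimes> a"
proof -
  let ?E0 = "{c \<in> E. \<forall>r\<in>R. c \<otimes> r = r \<otimes> c}"
  have cl: "a \<in> carrier G" "g \<in> carrier G" "d \<in> carrier G" using ad g E R by auto
  have a0: "a \<in> generate G ?E0" using double_coset_commute[OF assms] .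
  have E0: "?E0 \<subseteq> S" using E by blast
  have ra: "a \<otimes> r = r \<otimes> a" if "r \<in> R" for r
  proof (rule commute_generate[OF E0 _ _ a0, symmetric])
    show "r \<in> carrier G" using that R by blast
    show "r \<otimes> c = c \<otimes> r" if "c \<in> ?E0" for c using that \<open>r \<in> R\<close> by force
  qed
  have k: "a \<otimes> k = k \<otimes> a" if "k \<in> generate G R" for k
    by (rule commute_generate[OF R(1) cl(1) ra that])
  then show "k \<in> generate G R \<Longrightarrow> a \<otimes> k = k \<otimes> a" by simp
  have "g \<otimes> d = g \<otimes> a" using k[OF g(1)] ad by simp
  then show "d = a" using cl by simp
qed

lemma compat_commuting:
  assumes E: "E \<subseteq> S" and R: "R \<subseteq> S" "E \<inter> R = {}" "p \<in> R"
    and com: "\<forall>c\<in>E. \<forall>r\<in>R. r \<noteq> p \<longrightarrow> c \<otimes> r = r \<otimes> c"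
    and g: "g \<in> generate G R" "g \<notin> generate G (R - {p})"
  shows "compat E E g p"
proof -
  have p: "p \<in> generate G R" "p \<notin> generate G (R - {p})"
    using R S_parab_iff[of "R - {p}" p] by (auto intro: parab_S)
  note G = double_coset_commute_eq[OF E R com g] and P = double_coset_commute_eq[OF E R com p]
  show ?thesis unfolding compat_def
  proof (intro ballI iffI)
    fix a b assume ab: "a \<in> generate G E" "b \<in> generate G E"
    show "a \<otimes> p = p \<otimes> b" if "a \<otimes> g = g \<otimes> b" using G[OF ab that] p(1) by simp
    show "a \<otimes> g = g \<otimes> b" if "a \<otimes> p = p \<otimes> b" using P[OF ab that] g(1) by simp
  qed
qed

text \<open>Substituting \<open>w\<close> for the letter \<open>p\<close> in \<open>V = x\<^sub>0 p b\<^sub>0\<close>: an operator that produces the leading part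
  of \<open>C\<^sub>V\<close> from \<open>p\<close> produces that of \<open>C\<close> at \<open>x\<^sub>0 w b\<^sub>0\<close> from \<open>C\<^sub>w\<close>, and only \<open>p\<close>-free corrections remain.\<close>
lemma Cb_substitute:
  assumes E: "E \<subseteq> S" and R: "R \<subseteq> S" "E \<inter> R = {}" "p \<in> R"
    and com: "\<forall>c\<in>E. \<forall>r\<in>R. r \<noteq> p \<longrightarrow> c \<otimes> r = r \<otimes> c"
    and O1: "O1 \<in> ops E E"
    and x0: "x0 \<in> generate G E" and b0: "b0 \<in> generate G E"
    and V: "O1 (del p) (x0 \<otimes> p \<otimes> b0) = 1" "\<And>y. y \<noteq> x0 \<otimes> p \<otimes> b0 \<Longrightarrow> lau_pos (O1 (del p) y)"
    and w: "w \<in> generate G R" "w \<notin> generate G (R - {p})"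
    and T: "T \<in> Hm" "Bar T = T" "\<And>y. T y \<noteq> 0 \<Longrightarrow> y \<in> generate G (S - {p})"
    and pos: "\<And>y. y \<in> generate G (S - {p}) \<Longrightarrow> lau_pos (O1 (Cb w) y - T y)"
  shows "Cb (x0 \<otimes> w \<otimes> b0) = O1 (Cb w) - T"
proof (rule Cb_eqI)
  have cl: "x0 \<in> carrier G" "w \<in> carrier G" "b0 \<in> carrier G" "p \<in> carrier G"
    using parab_closed[OF E x0] parab_closed[OF E b0] parab_closed[OF R(1) w(1)] R by auto
  have Sp: "S - {p} \<subseteq> S" "E \<subseteq> S - {p}" using E R by auto
  have supp: "u \<in> generate G R" if "Cb w u \<noteq> 0" for u using Cb_parab[OF R(1) w(1) that] .
  have pfree: "g \<in> generate G (R - {p})" if "g \<in> generate G R" "x \<in> generate G E" "b \<in> generate G E"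
    "x \<otimes> g \<otimes> b \<in> generate G (S - {p})" for x g b
  proof -
    have c: "x \<in> carrier G" "g \<in> carrier G" "b \<in> carrier G"
      using parab_closed[OF E that(2)] parab_closed[OF E that(3)] parab_closed[OF R(1) that(1)] by auto
    have "x \<otimes> g \<in> generate G (S - {p})"
      using that(4) parab_mult_right_iff[OF Sp(1) parab_mono[OF Sp(2) that(3)]] c by simp
    then have "g \<in> generate G (S - {p})"
      using parab_mult_left_iff[OF Sp(1) parab_mono[OF Sp(2) that(2)]] c by simp
    then have "g \<in> generate G (R \<inter> (S - {p}))" using parab_Int[OF R(1) Sp(1) that(1)] by simp
    moreover have "R \<inter> (S - {p}) = R - {p}" using R by auto
    ultimately show ?thesis by simp
  qed
  have p: "p \<in> generate G R" "p \<notin> generate G (R - {p})"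
    using R S_parab_iff[of "R - {p}" p] by (auto intro: parab_S)
  have val: "O1 (Cb w) (x \<otimes> g \<otimes> b) = Cb w g * O1 (del p) (x \<otimes> p \<otimes> b)"
    if "g \<in> generate G R" "g \<notin> generate G (R - {p})" "x \<in> generate G E" "b \<in> generate G E" for x g b
    using compat_commuting[OF E R com that(1,2)] that supp cl p
    by (intro ops_value[OF E E R(1,2,2) O1]) auto
  have notp: "x0 \<otimes> w \<otimes> b0 \<notin> generate G (S - {p})" using pfree[OF w(1) x0 b0] w by blast
  have T0: "T y = 0" if "y \<notin> generate G (S - {p})" for y using T that by blast
  have "lau_pos ((O1 (Cb w) - T) y)" if y: "y \<noteq> x0 \<otimes> w \<otimes> b0" for y
  proof (cases "y \<in> generate G (S - {p}) \<or> O1 (Cb w) y = 0")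
    case True
    then show ?thesis using pos T0[of y] by (cases "y \<in> generate G (S - {p})") auto
  next
    case False
    moreover have "Cb w \<in> Hm" using cl by simp
    ultimately obtain x g b where *: "x \<in> generate G E" "g \<in> generate G R" "b \<in> generate G E"
      "y = x \<otimes> g \<otimes> b" "Cb w g \<noteq> 0"
      using ops_support[OF E E R(1,2,2) O1 _ supp] by blast
    have c: "x \<in> carrier G" "g \<in> carrier G" "b \<in> carrier G"
      using parab_closed[OF E *(1)] parab_closed[OF E *(3)] parab_closed[OF R(1) *(2)] by auto
    have gp: "g \<notin> generate G (R - {p})"
    proof
      assume "g \<in> generate G (R - {p})"
      then have "g \<in> generate G (S - {p})" using parab_mono[of "R - {p}" "S - {p}"] R by auto
      then have "y \<in> generate G (S - {p})" unfolding *(4)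
        using parab_mono[OF Sp(2) *(1)] parab_mono[OF Sp(2) *(3)] by (intro parab_mult)
      then show False using False by simp
    qed
    have "(O1 (Cb w) - T) y = Cb w g * O1 (del p) (x \<otimes> p \<otimes> b)"
      using val[OF *(2) gp *(1,3)] T0[of y] False *(4) by simp
    moreover have "lau_pos (Cb w g * O1 (del p) (x \<otimes> p \<otimes> b))"
    proof (cases "x \<otimes> p \<otimes> b = x0 \<otimes> p \<otimes> b0")
      case True
      have "inv x0 \<otimes> x \<otimes> p = inv x0 \<otimes> (x \<otimes> p \<otimes> b) \<otimes> inv b" using c cl by (simp add: m_assoc)
      also have "\<dots> = p \<otimes> (b0 \<otimes> inv b)" unfolding True using c cl by (simp add: m_assoc)
      finally have e: "inv x0 \<otimes> x \<otimes> p = p \<otimes> (b0 \<otimes> inv b)" .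
      \<comment> \<open>The equality of x p b and x0 p b0 is a relation in the double coset of p.
        Such relations centralise W_R, so x g b = x0 g b0, and since y is another element, g differs
        from w.\<close>
      note dc = double_coset_commute_eq[OF E R com p parab_mult[OF parab_inv[OF E x0] *(1)]
          parab_mult[OF b0 parab_inv[OF E *(3)]] e]
      have "x \<otimes> g \<otimes> b = x0 \<otimes> (inv x0 \<otimes> x \<otimes> g) \<otimes> b" using c cl by (simp add: m_assoc)
      also have "\<dots> = x0 \<otimes> (g \<otimes> (b0 \<otimes> inv b)) \<otimes> b" using dc(1) dc(2)[OF *(2)] by simp
      also have "\<dots> = x0 \<otimes> g \<otimes> b0" using c cl by (simp add: m_assoc)
      finally have "g \<noteq> w" using y *(4) by auto
      then show ?thesis using True V cl Cb_pos[of w g] by simp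
    next
      case False
      then show ?thesis using V(2)[OF False] lau_int_Cb[OF cl(2), of g]
          lau_pos_mult[of "O1 (del p) (x \<otimes> p \<otimes> b)" "Cb w g"] by (simp add: mult.commute)
    qed
    ultimately show ?thesis by simp
  qed
  moreover have "(O1 (Cb w) - T) (x0 \<otimes> w \<otimes> b0) = 1"
    using val[OF w x0 b0] V T0[OF notp] cl by simp
  moreover have "O1 (Cb w) \<in> Hm" "Bar (O1 (Cb w)) = O1 (Cb w)"
    using ops_Hm[OF O1 E E] ops_Bar[OF E E _ O1, of "Cb w"] cl by auto
  ultimately show "isKL (x0 \<otimes> w \<otimes> b0) (O1 (Cb w) - T)"
    using T by (auto simp: isKL_def Bar_diff)
qed

end

section \<open>Restrictions of basis elements\<close>

lemma sum_list_swap: "(\<Sum>x\<leftarrow>xs. \<Sum>y\<leftarrow>ys. f x y) = (\<Sum>y\<leftarrow>ys. \<Sum>x\<leftarrow>xs. f x y)"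
  for f :: "'b \<Rightarrow> 'c \<Rightarrow> 'd :: comm_monoid_add"
  by (induction xs) (simp_all add: sum_list_addf)

context coxeter_system
begin

text \<open>In an expression y c d of V with l(y) + l(d) minimal, an outer letter is a genuine
  descent of V.\<close>

lemma double_coset_descent:
  assumes E: "E \<subseteq> S" and c: "c \<in> S" "c \<notin> E"
    and V: "x \<in> generate G E" "b \<in> generate G E" "V = x \<otimes> c \<otimes> b" "V \<noteq> c"
  shows "\<exists>e\<in>E. dl e V \<or> dr V e"
proof -
  let ?P = "\<lambda>(x, b). x \<in> generate G E \<and> b \<in> generate G E \<and> V = x \<otimes> c \<otimes> b"
  have "?P (x, b)" using V by simp
  then have "\<exists>q. ?P q \<and> (\<forall>q'. ?P q' \<longrightarrow> len (fst q) + len (snd q) \<le> len (fst q') + len (snd q'))"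
    by (rule ex_has_least_nat)
  then obtain q where "?P q \<and> (\<forall>q'. ?P q' \<longrightarrow> len (fst q) + len (snd q) \<le> len (fst q') + len (snd q'))"
    by (rule exE)
  note * = this
  note q = conjunct1[OF *] conjunct2[OF *, rule_format]
  obtain y d where yd: "q = (y, d)" by (cases q)
  have y: "y \<in> generate G E" "d \<in> generate G E" "V = y \<otimes> c \<otimes> d"
    using q(1) unfolding yd by simp_all
  have min: "len y + len d \<le> len y' + len d'"
    if "y' \<in> generate G E" "d' \<in> generate G E" "V = y' \<otimes> c \<otimes> d'" for y' d'
    using q(2)[of "(y', d')"] that yd by simp
  have cl: "y \<in> carrier G" "d \<in> carrier G" "c \<in> carrier G" using y E c by auto
  have cS: "{c} \<subseteq> S" "E \<inter> {c} = {}" "c \<in> generate G {c}" using c by (auto intro: parab_S)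
  show ?thesis
  proof (cases "y = \<one>")
    case False
    then obtain e where e: "e \<in> S" "dl e y" using ex_descent_left cl by blast
    then have eE: "e \<in> E" using descent_parab E y by blast
    have "eta V e = (eta y e \<noteq> (\<exists>f\<in>generate G E. (inv y \<otimes> e \<otimes> y) \<otimes> c = c \<otimes> f \<and> eta d f))"
      unfolding y(3) by (rule eta_double_coset[OF E E cS y(1,2) eE])
    moreover have "\<not> (\<exists>f\<in>generate G E. (inv y \<otimes> e \<otimes> y) \<otimes> c = c \<otimes> f \<and> eta d f)"
    \<comment> \<open>Such a relation would carry the reflection y^-1 e y across c to f, giving V =
      (ey) c (fd) with both outer factors shorter.\<close>
    proof
      assume "\<exists>f\<in>generate G E. (inv y \<otimes> e \<otimes> y) \<otimes> c = c \<otimes> f \<and> eta d f"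
      then obtain f where f: "f \<in> generate G E" "(inv y \<otimes> e \<otimes> y) \<otimes> c = c \<otimes> f" "eta d f" by blast
      have fc: "f \<in> carrier G" using f E by simp
      have "f = c \<otimes> (inv y \<otimes> e \<otimes> y) \<otimes> c" using f fc c cl e by (simp add: m_assoc)
      then have fr: "f \<in> refs" using refs_conj(2)[OF refs_conj(2)[of e y], of c] c cl e by (auto simp: m_assoc)
      have "V = (e \<otimes> y) \<otimes> c \<otimes> (f \<otimes> d)"
      proof -
        have "(e \<otimes> y) \<otimes> c \<otimes> (f \<otimes> d) = (e \<otimes> y) \<otimes> (c \<otimes> f) \<otimes> d" using e cl fc by (simp add: m_assoc)
        also have "\<dots> = y \<otimes> c \<otimes> d" unfolding f(2)[symmetric] using e cl by (simp add: m_assoc)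
        finally show ?thesis using y by simp
      qed
      then have "len y + len d \<le> len (e \<otimes> y) + len (f \<otimes> d)"
        using y f by (intro min parab_mult[OF parab_S[OF eE]] parab_mult) auto
      moreover have "len (f \<otimes> d) < len d" using eta_iff_len[OF fr cl(2)] f by simp
      ultimately show False using e by simp
    qed
    moreover have "eta y e" using e cl by (simp add: dl_eta)
    ultimately have "dl e V" using e cl y by (simp add: dl_eta)
    then show ?thesis using eE by blast
  next
    case True
    then have "d \<noteq> \<one>" using V(4) y cl by auto
    then obtain e where e: "e \<in> S" "dr d e" using ex_descent_right cl by blast
    then have eE: "e \<in> E" using descent_parab_right E y by blast
    have "c \<in> mcr E" using cS by (intro mcr_parab_disjoint[OF E cS(1,2,3)])
    then have ci: "len (k \<otimes> c) = len k + 1" if "k \<in> generate G E" for k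
      using len_mcr[OF E _ that] c by simp
    have lk: "len (c \<otimes> k) = len k + 1" if "k \<in> generate G E" for k
    proof -
      have kc: "k \<in> carrier G" using that E by simp
      have "inv (c \<otimes> k) = inv k \<otimes> c" using kc c by (simp add: inv_mult_group)
      then have "len (c \<otimes> k) = len (inv k \<otimes> c)" using len_inv[of "c \<otimes> k"] kc c by simp
      then show ?thesis using ci[OF parab_inv[OF E that]] kc by simp
    qed
    have "d \<otimes> e \<in> generate G E" using y parab_S[OF eE] by (rule_tac parab_mult)
    then have "dr V e" using lk[OF y(2)] lk[of "d \<otimes> e"] e True y cl by (simp add: m_assoc)
    then show ?thesis using eE by blast
  qed
qed

text \<open>Induction over the double coset of c, multiplying by one descent at a time. Expansions
  may also contain C_z with z in W_E; these vanish off W_E, which is why the equality is claimed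
  only there.\<close>

lemma ex_ops_pivot:
  assumes E: "E \<subseteq> S" and c: "c \<in> S" "c \<notin> E"
    and "x \<in> generate G E" "b \<in> generate G E"
  shows "\<exists>Q\<in>ops E E. \<forall>y. y \<notin> generate G E \<longrightarrow> Cb (x \<otimes> c \<otimes> b) y = Q (Cb c) y"
proof -
  define DC where "DC = {x \<otimes> c \<otimes> b | x b. x \<in> generate G E \<and> b \<in> generate G E}"
  have cS: "{c} \<subseteq> S" "E \<inter> {c} = {}" "c \<in> generate G {c}" using c by (auto intro: parab_S)
  have cc: "c \<in> carrier G" using c by simp
  have W: "x \<in> carrier G" if "x \<in> generate G E" for x using that E by simp
  have DCc: "V \<in> carrier G" if "V \<in> DC" for V using that W cc by (auto simp: DC_def)
  have DC_L: "e \<otimes> V \<in> DC" if VD: "V \<in> DC" and eE: "e \<in> E" for V e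
  proof -
    obtain x b where *: "x \<in> generate G E" "b \<in> generate G E" "V = x \<otimes> c \<otimes> b" using VD unfolding DC_def by blast
    have "e \<otimes> V = (e \<otimes> x) \<otimes> c \<otimes> b" using *(3) W[OF *(1)] W[OF *(2)] cc subsetD[OF E eE] by (simp add: m_assoc)
    then show ?thesis using * parab_mult[OF parab_S[OF eE] *(1)] unfolding DC_def by blast
  qed
  have DC_R: "V \<otimes> e \<in> DC" if VD: "V \<in> DC" and eE: "e \<in> E" for V e
  proof -
    obtain x b where *: "x \<in> generate G E" "b \<in> generate G E" "V = x \<otimes> c \<otimes> b" using VD unfolding DC_def by blast
    have "V \<otimes> e = x \<otimes> c \<otimes> (b \<otimes> e)" using *(3) W[OF *(1)] W[OF *(2)] cc subsetD[OF E eE] by (simp add: m_assoc)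
    then show ?thesis using * parab_mult[OF *(2) parab_S[OF eE]] unfolding DC_def by blast
  qed
  have supp: "y \<in> DC \<union> generate G E" if QE: "Q \<in> ops E E" and nz: "Q (Cb c) y \<noteq> 0" for Q y
  proof -
    have "Cb c \<in> Hm" "\<And>u. Cb c u \<noteq> 0 \<Longrightarrow> u \<in> generate G {c}"
      using cc Cb_parab[OF cS(1,3)] by auto
    then obtain x k b where *: "x \<in> generate G E" "k \<in> generate G {c}" "b \<in> generate G E" "y = x \<otimes> k \<otimes> b" "Cb c k \<noteq> 0"
      using ops_support[OF E E cS(1,2,2) QE _ _ nz] by blast
    have "k = c \<or> k = \<one>" using *(5) c by (auto simp: Cb_S del_def split: if_splits)
    then show ?thesis
    proof
      assume "k = \<one>"
      then have "y \<in> generate G E" using * W by (auto intro: parab_mult)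
      then show ?thesis by simp
    qed (use * in \<open>auto simp: DC_def\<close>)
  qed
  have "\<exists>Q\<in>ops E E. \<forall>y. y \<notin> generate G E \<longrightarrow> Cb V y = Q (Cb c) y" if "V \<in> DC" for V
    using that
  proof (induction "len V" arbitrary: V rule: less_induct)
    case less
    show ?case
    proof (cases "V = c")
      case True
      then show ?thesis using ops_id by (intro bexI[of _ "\<lambda>h. h"]) auto
    next
      case False
      have Vc: "V \<in> carrier G" using DCc less by blast
      obtain x b where "x \<in> generate G E" "b \<in> generate G E" "V = x \<otimes> c \<otimes> b"
        using less.prems unfolding DC_def by blast
      then obtain e where e: "e \<in> E" "dl e V \<or> dr V e" using double_coset_descent[OF E c _ _ _ False] by blast
      have eS: "e \<in> S" using e E by auto
      define F where "F = (if dl e V then Lc e else Rc e)"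
      define V' where "V' = (if dl e V then e \<otimes> V else V \<otimes> e)"
      have V': "V' \<in> DC" "V' \<in> carrier G" "len V' < len V"
        using e eS Vc DC_L[OF less.prems e(1)] DC_R[OF less.prems e(1)] DCc by (auto simp: V'_def)
      obtain Q where Q: "Q \<in> ops E E" "\<And>y. y \<notin> generate G E \<Longrightarrow> Cb V' y = Q (Cb c) y"
        using less.hyps[OF V'(3,1)] by blast
      have FQ: "(\<lambda>h. F (Q h)) \<in> ops E E" unfolding F_def using ops_L[OF Q(1) e(1)] ops_R[OF Q(1) e(1)] by auto
      have "\<exists>Z n. finite Z \<and> F (Cb V') = Cb V + (\<Sum>z\<in>Z. scale (of_int (n z)) (Cb z)) \<and>
        (\<forall>z\<in>Z. len z < len V \<and> z \<in> carrier G \<and> F (Cb V') z \<noteq> 0)"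
      proof (cases "dl e V")
        case True
        then show ?thesis using Lc_Cb[OF V'(2) eS] eS Vc by (simp add: F_def V'_def)
      next
        case False
        then have "dr V e" using e by simp
        then show ?thesis using Rc_Cb[OF V'(2) eS] eS Vc False by (simp add: F_def V'_def)
      qed
      then obtain Z n where Z: "finite Z" "F (Cb V') = Cb V + (\<Sum>z\<in>Z. scale (of_int (n z)) (Cb z))"
        "\<And>z. z \<in> Z \<Longrightarrow> len z < len V \<and> z \<in> carrier G \<and> F (Cb V') z \<noteq> 0" by blast
      have Fy: "F (Cb V') y = F (Q (Cb c)) y" if "y \<notin> generate G E" for y
      proof (cases "y \<in> carrier G")
        case True
        then have "e \<otimes> y \<notin> generate G E" "y \<otimes> e \<notin> generate G E"
          using that parab_mult_left_iff[OF E parab_S[OF e(1)]] parab_mult_right_iff[OF E parab_S[OF e(1)]] by auto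
        then show ?thesis using that Q(2) by (simp add: F_def Lc_def Rc_def)
      qed (simp add: F_def Lc_def Rc_def)
      \<comment> \<open>Off W_E the product equals an operator applied to C_c, whose support lies in
        the double coset of c or in W_E.\<close>
      have "z \<in> DC \<union> generate G E" if "z \<in> Z" for z
      proof (cases "z \<in> generate G E")
        case False
        then have "F (Q (Cb c)) z \<noteq> 0" using Z(3)[OF that] Fy by simp
        then show ?thesis using supp[OF FQ] by blast
      qed simp
      then have "\<forall>z\<in>Z \<inter> DC. \<exists>Q\<in>ops E E. \<forall>y. y \<notin> generate G E \<longrightarrow> Cb z y = Q (Cb c) y"
        and Zsplit: "\<And>z. z \<in> Z - DC \<Longrightarrow> z \<in> generate G E"
        using less.hyps Z(3) by blast+
      then obtain P where P: "\<And>z. z \<in> Z \<inter> DC \<Longrightarrow> P z \<in> ops E E"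
        "\<And>z y. z \<in> Z \<inter> DC \<Longrightarrow> y \<notin> generate G E \<Longrightarrow> Cb z y = P z (Cb c) y" by metis
      have "(\<lambda>h. F (Q h) - (\<Sum>z\<in>Z \<inter> DC. scale (of_int (n z)) (P z h))) \<in> ops E E"
        using Z(1) P(1) FQ by (intro ops_diff_sum) auto
      moreover have "Cb V y = (F (Q (Cb c)) - (\<Sum>z\<in>Z \<inter> DC. scale (of_int (n z)) (P z (Cb c)))) y"
        if y: "y \<notin> generate G E" for y
      proof -
        have "(\<Sum>z\<in>Z. of_int (n z) * Cb z y) = (\<Sum>z\<in>Z \<inter> DC. of_int (n z) * P z (Cb c) y)"
        proof (rule sum.mono_neutral_cong_right)
          show "\<forall>z\<in>Z - Z \<inter> DC. of_int (n z) * Cb z y = 0"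
            using Cb_parab[OF E Zsplit] y by auto
          show "finite Z" by (rule Z(1))
          show "of_int (n z) * Cb z y = of_int (n z) * P z (Cb c) y" if "z \<in> Z \<inter> DC" for z
            using P(2)[OF that y] by simp
        qed simp
        then have "F (Cb V') y = Cb V y + (\<Sum>z\<in>Z \<inter> DC. of_int (n z) * P z (Cb c) y)"
          unfolding Z(2) by (simp add: sum_fun_apply)
        then show ?thesis using Fy[OF y] by (simp add: sum_fun_apply)
      qed
      ultimately show ?thesis by (intro bexI[of _ "\<lambda>h. F (Q h) - (\<Sum>z\<in>Z \<inter> DC. scale (of_int (n z)) (P z h))"] allI impI)
    qed
  qed
  moreover have "x \<otimes> c \<otimes> b \<in> DC" using assms by (auto simp: DC_def)
  ultimately show ?thesis by blast
qed

text \<open>An entry (n, z) stands for v^n C_z, with repetitions allowed: a list is a combination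
  whose coefficients visibly have nonnegative coefficients.\<close>

definition comb :: "(nat \<times> 'a) list \<Rightarrow> 'a \<Rightarrow> lau" where
  "comb L = (\<Sum>q\<leftarrow>L. scale (vp (int (fst q))) (Cb (snd q)))"

lemma comb_Nil [simp]: "comb [] = 0"
  and comb_Cons [simp]: "comb (q # L) = scale (vp (int (fst q))) (Cb (snd q)) + comb L"
  and comb_append: "comb (L @ L') = comb L + comb L'"
  by (simp_all add: comb_def)

lemma comb_concat: "comb (concat xss) = (\<Sum>xs\<leftarrow>xss. comb xs)"
  by (induction xss) (simp_all add: comb_append)

lemma lin_comb: "lin F \<Longrightarrow> F (comb L) = (\<Sum>q\<leftarrow>L. scale (vp (int (fst q))) (F (Cb (snd q))))"
proof -
  assume F: "lin F"
  show ?thesis unfolding comb_def lin_sum_list[OF F] lin_scale[OF F] ..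
qed

lemma comb_pos: "(\<And>q. q \<in> set L \<Longrightarrow> fst q \<ge> 1 \<and> snd q \<in> carrier G) \<Longrightarrow> lau_pos (comb L y)"
proof (induction L)
  case (Cons q L)
  have "fst q \<ge> 1" "snd q \<in> carrier G" using Cons.prems[of q] by auto
  then have "lau_pos (vp (int (fst q)) * Cb (snd q) y)" by (intro lau_pos_vp_mult lau_int_Cb) auto
  then show ?case using Cons by (auto intro: lau_pos_add)
qed simp

lemma Bar_sum_list_Cb:
  assumes "\<And>q. q \<in> set L \<Longrightarrow> bar (a q) = a q \<and> f q \<in> carrier G"
  shows "(\<Sum>q\<leftarrow>L. scale (a q) (Cb (f q))) \<in> Hm"
    and "Bar (\<Sum>q\<leftarrow>L. scale (a q) (Cb (f q))) = (\<Sum>q\<leftarrow>L. scale (a q) (Cb (f q)))"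
proof -
  show "(\<Sum>q\<leftarrow>L. scale (a q) (Cb (f q))) \<in> Hm" using assms by (intro Hm_sum_list Hm_scale) auto
  have "Bar (\<Sum>q\<leftarrow>L. scale (a q) (Cb (f q))) = (\<Sum>q\<leftarrow>L. Bar (scale (a q) (Cb (f q))))"
    using assms by (intro Bar_sum_list Hm_scale) auto
  also have "\<dots> = (\<Sum>q\<leftarrow>L. scale (a q) (Cb (f q)))"
    using assms by (intro arg_cong[where f = sum_list] map_cong) (auto simp: Bar_scale)
  finally show "Bar (\<Sum>q\<leftarrow>L. scale (a q) (Cb (f q))) = (\<Sum>q\<leftarrow>L. scale (a q) (Cb (f q)))" .
qed

lemma sum_list_Cb_support:
  assumes "J \<subseteq> S" "\<And>q. q \<in> set L \<Longrightarrow> f q \<in> generate G J" "(\<Sum>q\<leftarrow>L. scale (a q) (Cb (f q))) y \<noteq> 0"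
  shows "y \<in> generate G J"
proof (rule ccontr)
  assume "y \<notin> generate G J"
  then have "Cb (f q) y = 0" if "q \<in> set L" for q using Cb_parab[OF assms(1) assms(2)[OF that]] by blast
  then have "(\<Sum>q\<leftarrow>L. a q * Cb (f q) y) = (\<Sum>q\<leftarrow>L. 0)"
    by (intro arg_cong[where f = sum_list] map_cong) auto
  then show False using assms(3) by (simp add: sum_list_fun_apply)
qed

lemma not_parab_mult_S:
  assumes "s \<in> S" "u \<in> generate G (S - {s})"
  shows "s \<otimes> u \<notin> generate G (S - {s})" "u \<otimes> s \<notin> generate G (S - {s})"
proof -
  have K: "S - {s} \<subseteq> S" by auto
  then have "s \<notin> generate G (S - {s})" using S_parab_iff[of "S - {s}" s] assms by simp
  then show "s \<otimes> u \<notin> generate G (S - {s})" "u \<otimes> s \<notin> generate G (S - {s})"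
    using parab_mult_right_iff[OF K assms(2)] parab_mult_left_iff[OF K assms(2)] assms by auto
qed

lemma rho_Lc_free:
  assumes "s \<in> S" "\<And>u. h u \<noteq> 0 \<Longrightarrow> u \<in> generate G (S - {s})"
  shows "rho (S - {s}) (Lc s h) = scale (vp 1) h"
proof
  fix u
  have K: "S - {s} \<subseteq> S" by auto
  show "rho (S - {s}) (Lc s h) u = scale (vp 1) h u"
  proof (cases "u \<in> generate G (S - {s})")
    case True
    then have "h (s \<otimes> u) = 0" "\<not> dl s u" "u \<in> carrier G"
      using not_parab_mult_S(1)[OF assms(1) True] assms descent_parab[OF K True] parab_closed[OF K] by auto
    then show ?thesis using True by (simp add: rho_def Lc_def)
  next
    case False
    then show ?thesis using assms(2) by (auto simp: rho_def)
  qed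
qed

text \<open>At an s-free u only h(u), with factor v^2, and h(sus) contribute, since su and us
  involve s. If sus is again s-free, then su = us, and for u in W_R this holds exactly when u is
  p-free.\<close>

lemma rho_Lc_Rc_free:
  assumes R: "R \<subseteq> S" and s: "s \<in> S" "s \<notin> R" and p: "p \<in> R" "s \<otimes> p \<noteq> p \<otimes> s"
    and com: "\<And>r. r \<in> R \<Longrightarrow> r \<noteq> p \<Longrightarrow> s \<otimes> r = r \<otimes> s"
    and h: "\<And>u. h u \<noteq> 0 \<Longrightarrow> u \<in> generate G R"
  shows "rho (S - {s}) (Lc s (Rc s h)) = scale (vp 2) h + rho (S - {p}) h"
proof
  fix u
  have K: "S - {s} \<subseteq> S" "R \<subseteq> S - {s}" "S - {p} \<subseteq> S" using R s by auto
  have hK: "h u = 0" if "u \<notin> generate G (S - {s})" for u using h that parab_mono[OF K(2)] by blast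
  show "rho (S - {s}) (Lc s (Rc s h)) u = (scale (vp 2) h + rho (S - {p}) h) u"
  proof (cases "u \<in> generate G (S - {s})")
    case True
    have u: "u \<in> carrier G" "\<not> dl s u" "\<not> dr u s"
      using descent_parab[OF K(1) True] descent_parab_right[OF K(1) True] parab_closed[OF K(1) True] s by auto
    have "h (s \<otimes> u \<otimes> s) = rho (S - {p}) h u"
    proof (cases "s \<otimes> u = u \<otimes> s")
      case comm: True
      have "u \<in> generate G (S - {p})" if "h u \<noteq> 0"
      proof -
        have "u \<in> generate G {r \<in> R. s \<otimes> r = r \<otimes> s}" using commute_support[OF R s h[OF that] comm] .
        moreover have "{r \<in> R. s \<otimes> r = r \<otimes> s} \<subseteq> S - {p}" using R p by auto
        ultimately show ?thesis using parab_mono by blast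
      qed
      then show ?thesis using comm u s by (auto simp: rho_def)
    next
      case False
      have "h (s \<otimes> u \<otimes> s) = 0"
      proof (rule ccontr)
        assume "h (s \<otimes> u \<otimes> s) \<noteq> 0"
        then have "s \<otimes> u \<otimes> s \<in> generate G (S - {s})" using hK by blast
        moreover have "s \<otimes> u = (s \<otimes> u \<otimes> s) \<otimes> s" using s u by simp
        ultimately have "s \<otimes> u = u \<otimes> s" using commute_parab(2)[OF K(1) s(1) _ True] by blast
        then show False using False by simp
      qed
      moreover have "u \<notin> generate G (S - {p})" if "h u \<noteq> 0"
      proof
        assume "u \<in> generate G (S - {p})"
        then have "u \<in> generate G (R \<inter> (S - {p}))" using parab_Int[OF R K(3) h[OF that]] by simp
        then have "s \<otimes> u = u \<otimes> s" by (rule commute_generate[of "R \<inter> (S - {p})" s, rotated 3]) (use R s com in blast)+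
        then show False using False by simp
      qed
      ultimately show ?thesis by (auto simp: rho_def)
    qed
    moreover have "h (s \<otimes> u) = 0" "h (u \<otimes> s) = 0" using hK not_parab_mult_S[OF s(1) True] by auto
    ultimately show ?thesis using True u s by (simp add: rho_def Lc_def Rc_def)
  next
    case False
    then show ?thesis using hK by (auto simp: rho_def)
  qed
qed

text \<open>The exponents in v^m [2] = v^(m+1) + v^(m-1); for m = 1 the constant term v^0 is removed
  by the correction to the basis element. \<open>leaf_coeff\<close> is the resulting
  coefficient.\<close>

definition leaf_list :: "'a \<Rightarrow> (nat \<times> 'a) list \<Rightarrow> (nat \<times> 'a) list" where
  "leaf_list y L = concat (map (\<lambda>q. if fst q = 1 then [(2, y \<otimes> snd q)]
     else [(Suc (fst q), y \<otimes> snd q), (fst q - 1, y \<otimes> snd q)]) L)"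

definition leaf_coeff :: "nat \<Rightarrow> lau" where
  "leaf_coeff m = vp (int m) * (vp 1 + vp (-1)) - (if m = 1 then 1 else 0)"

lemma comb_leaf_list:
  "(\<And>q. q \<in> set L \<Longrightarrow> fst q \<ge> 1) \<Longrightarrow> comb (leaf_list y L) = (\<Sum>q\<leftarrow>L. scale (leaf_coeff (fst q)) (Cb (y \<otimes> snd q)))"
proof (induction L)
  case (Cons q L)
  have "comb (if fst q = 1 then [(2, y \<otimes> snd q)] else [(Suc (fst q), y \<otimes> snd q), (fst q - 1, y \<otimes> snd q)]) =
    scale (leaf_coeff (fst q)) (Cb (y \<otimes> snd q))"
    using Cons.prems[of q]
    by (simp add: leaf_coeff_def distrib_left of_nat_diff add.commute[of 1 "int (fst q)"] scale_add_left split: if_splits)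
  then show ?case using Cons by (simp add: leaf_list_def comb_append)
qed (simp add: leaf_list_def)

lemma leaf_list_elems:
  assumes "\<And>q. q \<in> set L \<Longrightarrow> fst q \<ge> 1" "k \<in> set (leaf_list y L)"
  shows "fst k \<ge> 1" "\<exists>q\<in>set L. snd k = y \<otimes> snd q"
proof -
  obtain q where q: "q \<in> set L" "k \<in> set (if fst q = 1 then [(2, y \<otimes> snd q)]
     else [(Suc (fst q), y \<otimes> snd q), (fst q - 1, y \<otimes> snd q)])"
    using assms(2) unfolding leaf_list_def by auto
  then show "fst k \<ge> 1" "\<exists>q\<in>set L. snd k = y \<otimes> snd q"
    using assms(1)[OF q(1)] by (auto split: if_splits)
qed

text \<open>The substitution lemma with E = {s} and the operator C_s _ C_s. On p-free z this
  operator gives [2] C_{sz}, and v^m [2] has a constant term only for m = 1, so exactly those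
  entries of L need a correction.\<close>

lemma Cb_leaf:
  assumes R: "R \<subseteq> S" and s: "s \<in> S" "s \<notin> R" and p: "p \<in> R" "s \<otimes> p \<noteq> p \<otimes> s"
    and com: "\<And>r. r \<in> R \<Longrightarrow> r \<noteq> p \<Longrightarrow> s \<otimes> r = r \<otimes> s"
    and w: "w \<in> generate G R" "w \<notin> generate G (R - {p})"
    and L: "rho (S - {p}) (Cb w) = comb L" "\<And>q. q \<in> set L \<Longrightarrow> fst q \<ge> 1 \<and> snd q \<in> generate G (R - {p})"
  shows "Cb (s \<otimes> w \<otimes> s) = Lc s (Rc s (Cb w)) - (\<Sum>q\<leftarrow>L. scale (if fst q = 1 then 1 else 0) (Cb (s \<otimes> snd q)))" (is "_ = ?O - ?T")
    and "rho (S - {p}) (Cb (s \<otimes> w \<otimes> s)) = comb (leaf_list s L)"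
    and "rho (S - {s}) (Cb (s \<otimes> w \<otimes> s)) = comb ((2, w) # filter (\<lambda>q. fst q \<noteq> 1) L)"
proof -
  define O1 where "O1 = (\<lambda>h. Lc s (Rc s h))"
  have O1: "O1 \<in> ops {s} {s}" unfolding O1_def by (intro ops_L ops_R ops_id) auto
  have cl: "w \<in> carrier G" "p \<in> carrier G" "p \<in> S" using w R p by auto
  have K: "R - {p} \<subseteq> S" "R - {p} \<subseteq> S - {p}" "s \<in> S - {p}" "S - {p} \<subseteq> S" using R s p by auto
  have sp: "\<not> dr p s" "\<not> dl s p" "\<not> dl s (p \<otimes> s)"
  proof -
    show "\<not> dl s p" using cl s p by (auto simp: dl_eta simp del: len_S)
    then show "\<not> dl s (p \<otimes> s)" using dl_mult_right[of s s p] p cl s by simp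
    show "\<not> dr p s" using cl s p by (auto simp: dr_eta simp del: len_S)
  qed
  have Op: "O1 (del p) = del (s \<otimes> p \<otimes> s) + scale (vp 1) (del (p \<otimes> s)) + scale (vp 1) (del (s \<otimes> p)) + scale (vp 2) (del p)"
    using sp cl s unfolding O1_def
    by (simp add: Rc_del lin_add[OF lin_Lc] lin_scale[OF lin_Lc] Lc_del scale_add m_assoc add.assoc)
  have z: "s \<otimes> snd q = snd q \<otimes> s" "snd q \<in> carrier G" "s \<otimes> snd q \<in> carrier G" "s \<otimes> snd q \<in> generate G (S - {p})"
    "Cb (s \<otimes> snd q) = Lc s (Cb (snd q))" "snd q \<in> generate G (S - {s})"
    "O1 (Cb (snd q)) = scale (vp 1 + vp (-1)) (Cb (s \<otimes> snd q))" if "q \<in> set L" for q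
  proof -
    have q: "snd q \<in> generate G (R - {p})" using L that by blast
    show c: "snd q \<in> carrier G" using parab_closed[OF K(1) q] .
    then show "s \<otimes> snd q \<in> carrier G" using s by simp
    show e: "s \<otimes> snd q = snd q \<otimes> s" by (rule commute_generate[OF K(1) _ _ q]) (use s com in blast)+
    show "s \<otimes> snd q \<in> generate G (S - {p})" using parab_mult[OF parab_S[OF K(3)] parab_mono[OF K(2) q]] .
    show "snd q \<in> generate G (S - {s})" using parab_mono[OF _ q, of "S - {s}"] s R by auto
    have qR: "snd q \<in> generate G R" using parab_mono[OF _ q, of R] by auto
    show l: "Cb (s \<otimes> snd q) = Lc s (Cb (snd q))" using Cb_left[OF R s qR] .
    have "Rc s (Cb (snd q)) = Cb (s \<otimes> snd q)" using Cb_right[OF R s qR] e by simp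
    then show "O1 (Cb (snd q)) = scale (vp 1 + vp (-1)) (Cb (s \<otimes> snd q))"
      unfolding O1_def by (simp add: l Lc_Lc s)
  qed
  have T: "?T \<in> Hm" "Bar ?T = ?T" using z by (intro Bar_sum_list_Cb; auto)+
  have Tsupp: "y \<in> generate G (S - {p})" if "?T y \<noteq> 0" for y
    by (rule sum_list_Cb_support[OF K(4) _ that]) (use z in auto)
  have L1: "\<And>q. q \<in> set L \<Longrightarrow> fst q \<ge> 1" using L(2) by blast
  have "rho (S - {p}) (O1 (Cb w)) = O1 (rho (S - {p}) (Cb w))"
    by (rule ops_rho[OF K(4) _ _ O1]) (use K in auto)
  also have "\<dots> = (\<Sum>q\<leftarrow>L. scale (vp (int (fst q)) * (vp 1 + vp (-1))) (Cb (s \<otimes> snd q)))"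
    unfolding L(1) lin_comb[OF ops_lin[OF O1]]
    by (intro arg_cong[where f = sum_list] map_cong) (simp_all add: z(7))
  finally have rp: "rho (S - {p}) (O1 (Cb w)) - ?T = comb (leaf_list s L)"
    by (simp add: comb_leaf_list[OF L1] leaf_coeff_def scale_diff_left flip: sum_list_subtractf)
  have rpT: "rho (S - {p}) ?T = ?T" using Tsupp by (rule rho_id)
  have pre: "{s} \<subseteq> S" "{s} \<inter> R = {}" "\<forall>c\<in>{s}. \<forall>r\<in>R. r \<noteq> p \<longrightarrow> c \<otimes> r = r \<otimes> c" "s \<in> generate G {s}"
    using s com by (auto intro: parab_S)
  have main: "Cb (s \<otimes> w \<otimes> s) = O1 (Cb w) - ?T"
  proof (rule Cb_substitute[OF pre(1) R pre(2) p(1) pre(3) O1 pre(4,4) _ _ w T Tsupp])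
    show "O1 (del p) (s \<otimes> p \<otimes> s) = 1"
    proof -
      have "s \<otimes> p \<otimes> s \<noteq> p \<otimes> s" "s \<otimes> p \<otimes> s \<noteq> s \<otimes> p" "s \<otimes> p \<otimes> s \<noteq> p"
      proof -
        show "s \<otimes> p \<otimes> s \<noteq> p \<otimes> s" using S_not_one[OF s(1)] s cl by simp
        show "s \<otimes> p \<otimes> s \<noteq> s \<otimes> p" using S_not_one[OF s(1)] s cl by (simp add: m_assoc)
        show "s \<otimes> p \<otimes> s \<noteq> p"
        proof
          assume "s \<otimes> p \<otimes> s = p"
          then have "s \<otimes> p \<otimes> s \<otimes> s = p \<otimes> s" by simp
          then show False using p s cl by simp
        qed
      qed
      then show ?thesis unfolding Op by (simp add: del_def)
    qed
    show "lau_pos (O1 (del p) y)" if "y \<noteq> s \<otimes> p \<otimes> s" for y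
      using that unfolding Op by (simp add: del_def lau_pos_add lau_pos_vp)
    show "lau_pos (O1 (Cb w) y - ?T y)" if "y \<in> generate G (S - {p})" for y
    proof -
      have "lau_pos (comb (leaf_list s L) y)"
      proof (rule comb_pos)
        fix k assume "k \<in> set (leaf_list s L)"
        then show "1 \<le> fst k \<and> snd k \<in> carrier G" using leaf_list_elems[OF L1] z(3) by metis
      qed
      then show ?thesis using that unfolding rp[symmetric] by (simp add: rho_def)
    qed
  qed
  then show A: "Cb (s \<otimes> w \<otimes> s) = ?O - ?T" unfolding O1_def .
  show "rho (S - {p}) (Cb (s \<otimes> w \<otimes> s)) = comb (leaf_list s L)"
    unfolding main lin_diff[OF lin_rho] rpT rp ..
  \<comment> \<open>The s-free part of C_{sz} is v C_z, so the corrections cancel precisely the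
    entries of exponent 1 that the p-free part of C_w contributes.\<close>
  have "rho (S - {s}) ?T = (\<Sum>q\<leftarrow>L. scale (if fst q = 1 then vp 1 else 0) (Cb (snd q)))"
  proof -
    have "rho (S - {s}) (Cb (s \<otimes> snd q)) = scale (vp 1) (Cb (snd q))" if "q \<in> set L" for q
      unfolding z(5)[OF that] using Cb_parab[OF _ z(6)[OF that]] s by (intro rho_Lc_free) auto
    then show ?thesis unfolding lin_sum_list[OF lin_rho] lin_scale[OF lin_rho]
      by (intro arg_cong[where f = sum_list] map_cong) simp_all
  qed
  moreover have "rho (S - {s}) ?O = scale (vp 2) (Cb w) + comb L"
    using rho_Lc_Rc_free[OF R s p com Cb_parab[OF R w(1)]] L(1) by simp
  moreover have "comb L - (\<Sum>q\<leftarrow>L. scale (if fst q = 1 then vp 1 else 0) (Cb (snd q))) = comb (filter (\<lambda>q. fst q \<noteq> 1) L)"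
  proof
    fix y
    show "(comb L - (\<Sum>q\<leftarrow>L. scale (if fst q = 1 then vp 1 else 0) (Cb (snd q)))) y = comb (filter (\<lambda>q. fst q \<noteq> 1) L) y"
      by (induction L) (auto simp: sum_list_fun_apply algebra_simps)
  qed
  ultimately show "rho (S - {s}) (Cb (s \<otimes> w \<otimes> s)) = comb ((2, w) # filter (\<lambda>q. fst q \<noteq> 1) L)"
    unfolding A lin_diff[OF lin_rho] by (simp add: add_diff_eq[symmetric])
qed

end

context coxeter_system
begin

section \<open>The step at a letter that is not outermost\<close>

lemma parab_commute:
  assumes "E \<subseteq> S" "R \<subseteq> S" "\<And>e r. e \<in> E \<Longrightarrow> r \<in> R \<Longrightarrow> e \<otimes> r = r \<otimes> e"
    and "x \<in> generate G E" "z \<in> generate G R"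
  shows "x \<otimes> z = z \<otimes> x"
proof -
  have "e \<otimes> z = z \<otimes> e" if "e \<in> E" for e
    by (rule commute_generate[OF assms(2) _ _ assms(5)]) (use assms that in blast)+
  then have "z \<otimes> x = x \<otimes> z"
    using parab_closed[OF assms(2,5)] by (intro commute_generate[OF assms(1) _ _ assms(4)]) auto
  then show ?thesis by simp
qed

text \<open>The positive exponents of v^m [n] that remain after removal of its bar invariant part
  [n-m].\<close>

definition mono_list :: "nat \<Rightarrow> nat \<Rightarrow> 'a \<Rightarrow> (nat \<times> 'a) list" where
  "mono_list n m y = map (\<lambda>i. (n + m - 1 - 2 * i, y)) [0..<min m n]"

lemma comb_mono_list:
  "comb (mono_list n m y) = scale (vp (int m) * qn n - qn (n - m)) (Cb y)"
proof -
  have "comb (mono_list n m y) = (\<Sum>i\<leftarrow>[0..<min m n]. scale (vp (int n - 1 + int m - 2 * int i)) (Cb y))"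
    unfolding comb_def mono_list_def map_map comp_def fst_conv snd_conv
    by (intro arg_cong[where f = sum_list] map_cong refl arg_cong[where f = "\<lambda>k. scale (vp k) (Cb y)"]) auto
  also have "\<dots> = scale (\<Sum>i\<leftarrow>[0..<min m n]. vp (int n - 1 + int m - 2 * int i)) (Cb y)"
    by (rule ext) (simp add: sum_list_fun_apply sum_list_mult_const)
  also have "(\<Sum>i\<leftarrow>[0..<min m n]. vp (int n - 1 + int m - 2 * int i)) = vp (int m) * qn n - qn (n - m)"
    by (simp add: qn_mult_vp interv_sum_list_conv_sum_set_nat atLeast0LessThan)
  finally show ?thesis .
qed

lemma mono_list_elems: "k \<in> set (mono_list n m y) \<Longrightarrow> fst k \<ge> 1 \<and> snd k = y"
  by (auto simp: mono_list_def)

text \<open>Here n and m are exponents from the two sides of the cut. The terms on the left come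
  from the p-free parts of the leading product and of its two kinds of corrections; [2][n-1] = [n] +
  [n-2] collapses them to v^m [n] - [n-m], which has only positive powers.\<close>

lemma leaf_coeff_qn:
  assumes "n \<ge> 1" "m \<ge> 1"
  shows "leaf_coeff m * qn (n - 1) - vp (int m) * qn (n - 2) - (if m = 1 then 0 else qn (n - m)) =
    (if n = 1 then 0 else vp (int m) * qn n - qn (n - m))"
proof (cases "n = 1")
  case True
  then show ?thesis using assms by simp
next
  case False
  then obtain k where k: "n = Suc (Suc k)" using assms by (metis One_nat_def Suc_le_D not0_implies_Suc)
  have "leaf_coeff m * qn (Suc k) = vp (int m) * ((vp 1 + vp (-1)) * qn (Suc k)) - (if m = 1 then qn (Suc k) else 0)"
    by (simp add: leaf_coeff_def left_diff_distrib mult.assoc)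
  also have "\<dots> = vp (int m) * (qn (Suc (Suc k)) + qn k) - (if m = 1 then qn (Suc k) else 0)"
    by (simp only: qn_two_mult)
  finally show ?thesis unfolding k by (auto simp: distrib_left)
qed

text \<open>Subtracting the two equations leaves (v - v^-1) D1 = 0. The second equation arises as
  the bar image of the first when D1 and D2 are bar invariant.\<close>

lemma vdiff_cancel:
  assumes "scale (vp 1) D1 + D2 = 0" "scale (vp (-1)) D1 + D2 = 0"
  shows "D1 = 0" "D2 = (0 :: 'x \<Rightarrow> lau)"
proof -
  have "D1 u = 0" for u
  proof -
    have "vp 1 * D1 u + D2 u = 0" "vp (-1) * D1 u + D2 u = 0"
      using fun_cong[OF assms(1), of u] fun_cong[OF assms(2), of u] by auto
    then have "vdiff * D1 u = 0" unfolding vdiff_def left_diff_distrib by (metis add_right_cancel right_minus_eq)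
    then show ?thesis using vdiff_nonzero by simp
  qed
  then show "D1 = 0" by (simp add: fun_eq_iff)
  then show "D2 = 0" using assms(1) by simp
qed

text \<open>Since \<open>v\<^bsup>n\<^esup> = v[n] - [n-1]\<close> with bar invariant \<open>[n]\<close>, the restriction of \<open>C\<^sub>A\<close> splits uniquely
  into \<open>v\<close> times a bar invariant part, which is the value of the operator at \<open>1\<close>, and a bar invariant rest.\<close>
lemma pivot_operator:
  assumes E: "E \<subseteq> S" and c: "c \<in> S" "c \<notin> E"
    and XY: "X \<in> generate G E" "Y \<in> generate G E" and A: "A = X \<otimes> c \<otimes> Y"
    and LE: "rho (S - {c}) (Cb A) = comb LE" "\<And>q. q \<in> set LE \<Longrightarrow> fst q \<ge> 1 \<and> snd q \<in> generate G E"
  shows "\<exists>Q\<in>ops E E. Q (del c) A = 1 \<and> (\<forall>y. y \<noteq> A \<longrightarrow> lau_pos (Q (del c) y)) \<and>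
    Q (del \<one>) = (\<Sum>q\<leftarrow>LE. scale (qn (fst q)) (Cb (snd q))) \<and>
    Q (Cb c) = Cb A + (\<Sum>q\<leftarrow>LE. scale (qn (fst q - 1)) (Cb (snd q)))"
proof -
  have cc: "c \<in> carrier G" using c by simp
  have Ac: "A \<in> carrier G" using A parab_closed[OF E XY(1)] parab_closed[OF E XY(2)] cc by simp
  have K: "S - {c} \<subseteq> S" "E \<subseteq> S - {c}" using E c by auto
  have cS: "{c} \<subseteq> S" "E \<inter> {c} = {}" "c \<in> generate G {c}" using c by (auto intro: parab_S)
  obtain Q where Q: "Q \<in> ops E E" "\<And>y. y \<notin> generate G E \<Longrightarrow> Cb A y = Q (Cb c) y"
    using ex_ops_pivot[OF E c XY] A by blast
  have cn: "c \<notin> generate G (S - {c})" using S_parab_iff[of "S - {c}" c] c by simp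
  have Qc: "y \<notin> generate G (S - {c})" if nz: "Q (del c) y \<noteq> 0" for y
  proof -
    have "dc_rel E E c c (Q (del c)) (Q (del c))"
      using ops_dc_rel[OF E E cS(1,2,2,3,3) _ Q(1)] by (simp add: compat_def)
    then obtain x b where *: "x \<in> generate G E" "b \<in> generate G E" "y = x \<otimes> c \<otimes> b"
      using nz unfolding dc_rel_def by blast
    have "x \<in> generate G (S - {c})" "b \<in> generate G (S - {c})" "x \<in> carrier G" "b \<in> carrier G"
      using * parab_mono[OF K(2)] E by auto
    then show ?thesis
      using cn cc parab_mult_right_iff[OF K(1), of b "x \<otimes> c"] parab_mult_left_iff[OF K(1), of x c] *(3) by simp
  qed
  have Q1: "y \<in> generate G E" if nz: "Q (del \<one>) y \<noteq> 0" for y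
  proof -
    have "dc_rel E E \<one> \<one> (Q (del \<one>)) (Q (del \<one>))"
      using ops_dc_rel[OF E E cS(1,2,2) parab_one parab_one _ Q(1)] by (simp add: compat_def)
    then obtain x b where *: "x \<in> generate G E" "b \<in> generate G E" "y = x \<otimes> \<one> \<otimes> b"
      using nz unfolding dc_rel_def by blast
    then show ?thesis using E by (auto intro: parab_mult)
  qed
  have QC: "Q (Cb c) = Q (del c) + scale (vp 1) (Q (del \<one>))"
    by (simp add: Cb_S c lin_add[OF ops_lin[OF Q(1)]] lin_scale[OF ops_lin[OF Q(1)]])
  have EK: "y \<in> generate G (S - {c})" if "y \<in> generate G E" for y using parab_mono[OF K(2) that] .
  have Qdel: "Q (del c) y = Cb A y" if "y \<notin> generate G E" for y
    using Q(2)[OF that] Q1[of y] that QC by auto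
  have AE: "A \<notin> generate G E"
    using A cc E XY EK cn parab_mult_right_iff[OF K(1), of Y "X \<otimes> c"] parab_mult_left_iff[OF K(1), of X c] by auto
  have QA: "Q (del c) A = 1" using Qdel[OF AE] Ac by simp
  have Qpos: "lau_pos (Q (del c) y)" if "y \<noteq> A" for y
  proof (cases "y \<in> generate G E")
    case True
    then have "Q (del c) y = 0" using Qc EK by blast
    then show ?thesis by simp
  next
    case False
    then show ?thesis using Qdel Cb_pos[OF Ac that] by simp
  qed
  let ?K = "\<Sum>q\<leftarrow>LE. scale (qn (fst q)) (Cb (snd q))"
  let ?B = "\<Sum>q\<leftarrow>LE. scale (qn (fst q - 1)) (Cb (snd q))"
  have z: "snd q \<in> carrier G" if "q \<in> set LE" for q using LE(2)[OF that] E by auto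
  have KB: "?K \<in> Hm" "Bar ?K = ?K" "?B \<in> Hm" "Bar ?B = ?B" using z by (intro Bar_sum_list_Cb; auto)+
  have split: "comb LE = scale (vp 1) ?K - ?B"
  proof -
    have "vp (int n) = vp 1 * qn n - qn (n - 1)" if "n \<ge> 1" for n
      using qn_mult_vp[of 1 n] that by (simp add: min_def)
    then have "comb LE = (\<Sum>q\<leftarrow>LE. scale (vp 1) (scale (qn (fst q)) (Cb (snd q))) - scale (qn (fst q - 1)) (Cb (snd q)))"
      unfolding comb_def using LE(2)
      by (intro arg_cong[where f = sum_list] map_cong refl) (simp flip: scale_diff_left)
    then show ?thesis by (simp add: sum_list_subtractf lin_sum_list[OF lin_scale_op])
  qed
  define D1 where "D1 = Q (del \<one>) - ?K"
  define D2 where "D2 = Cb A - Q (Cb c) + ?B"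
  have QH: "Q (del \<one>) \<in> Hm" "Q (Cb c) \<in> Hm" "Bar (Q (del \<one>)) = Q (del \<one>)" "Bar (Q (Cb c)) = Q (Cb c)"
    using ops_Hm[OF Q(1) E E] ops_Bar[OF E E _ Q(1)] cc by (auto simp: Bar_del)
  have D: "D1 \<in> Hm" "Bar D1 = D1" "D2 \<in> Hm" "Bar D2 = D2"
    using QH KB Ac unfolding D1_def D2_def by (auto simp: Bar_diff Bar_add Hm_diff Hm_add)
  \<comment> \<open>\<open>Q (del c)\<close> vanishes on W_{S-c}, so Q(C_c) is there v times
    \<open>Q (del \<one>)\<close>; outside, \<open>Q (del \<one>)\<close> vanishes and C_A agrees
    with Q(C_c).\<close>
  have "rho (S - {c}) (Cb A) = scale (vp 1) (Q (del \<one>)) + (Cb A - Q (Cb c))"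
  proof
    fix y
    show "rho (S - {c}) (Cb A) y = (scale (vp 1) (Q (del \<one>)) + (Cb A - Q (Cb c))) y"
    proof (cases "y \<in> generate G (S - {c})")
      case True
      then have "Q (del c) y = 0" using Qc by blast
      then show ?thesis using True by (simp add: rho_def QC)
    next
      case False
      then have "y \<notin> generate G E" using EK by blast
      then have "Q (del \<one>) y = 0" "Cb A y = Q (Cb c) y" using Q1 Q(2) by blast+
      then show ?thesis using False by (simp add: rho_def)
    qed
  qed
  then have "scale (vp 1) (Q (del \<one>)) + (Cb A - Q (Cb c)) = scale (vp 1) ?K - ?B" using LE(1) split by simp
  then have e1: "scale (vp 1) D1 + D2 = 0"
    unfolding D1_def D2_def scale_diff by (simp add: algebra_simps)
  have "Bar (scale (vp 1) D1 + D2) = scale (vp (-1)) D1 + D2" using D by (simp add: Bar_add Bar_scale Hm_scale)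
  then have e2: "scale (vp (-1)) D1 + D2 = 0" unfolding e1 by simp
  have "D1 = 0" "D2 = 0" using vdiff_cancel[OF e1 e2] by auto
  then have "Q (del \<one>) = ?K" "Q (Cb c) = Cb A + ?B"
    unfolding D1_def D2_def by (simp_all add: algebra_simps)
  then show ?thesis using Q(1) QA Qpos by blast
qed

lemma sum_list_Cb_cong:
  "(\<And>q. q \<in> set L \<Longrightarrow> f q = g q) \<Longrightarrow> (\<Sum>q\<leftarrow>L. f q) = (\<Sum>q\<leftarrow>L. g q)"
  by (rule arg_cong[where f = sum_list], rule map_cong) auto

text \<open>The letter \<open>c\<close> separates \<open>E\<close> from \<open>R\<close>; the restriction of \<open>C\<close> at \<open>X c w c Y\<close> is computed from that of
  \<open>C\<^sub>A\<close>, \<open>A = X c Y\<close>, and of \<open>C\<^sub>w\<close>, by substituting \<open>c w c\<close> for \<open>c\<close> in \<open>A\<close>.\<close>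
lemma Cb_pivot:
  assumes E: "E \<subseteq> S" and R: "R \<subseteq> S" "E \<inter> R = {}" and c: "c \<in> S" "c \<notin> E" "c \<notin> R"
    and p: "p \<in> R" "c \<otimes> p \<noteq> p \<otimes> c"
    and com: "\<And>r. r \<in> R \<Longrightarrow> r \<noteq> p \<Longrightarrow> c \<otimes> r = r \<otimes> c"
    and comE: "\<And>e r. e \<in> E \<Longrightarrow> r \<in> R \<Longrightarrow> e \<otimes> r = r \<otimes> e"
    and XY: "X \<in> generate G E" "Y \<in> generate G E" and A: "A = X \<otimes> c \<otimes> Y"
    and LE: "rho (S - {c}) (Cb A) = comb LE" "\<And>q. q \<in> set LE \<Longrightarrow> fst q \<ge> 1 \<and> snd q \<in> generate G E"
    and w: "w \<in> generate G R" "w \<notin> generate G (R - {p})"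
    and L: "rho (S - {p}) (Cb w) = comb L" "\<And>q. q \<in> set L \<Longrightarrow> fst q \<ge> 1 \<and> snd q \<in> generate G (R - {p})"
  shows "\<exists>L'. rho (S - {p}) (Cb (X \<otimes> (c \<otimes> w \<otimes> c) \<otimes> Y)) = comb L' \<and>
    (\<forall>k\<in>set L'. fst k \<ge> 1 \<and> (\<exists>z\<in>snd ` set L. snd k = A \<otimes> z \<or> (\<exists>x\<in>snd ` set LE. snd k = x \<otimes> z)))"
proof -
  let ?M = "c \<otimes> w \<otimes> c"
  have cl: "c \<in> carrier G" "w \<in> carrier G" "X \<in> carrier G" "Y \<in> carrier G" "A \<in> carrier G"
    using parab_closed[OF E XY(1)] parab_closed[OF E XY(2)] parab_closed[OF R(1) w(1)] c A by auto
  obtain Q where Q: "Q \<in> ops E E" and QA: "Q (del c) A = 1" "\<And>y. y \<noteq> A \<Longrightarrow> lau_pos (Q (del c) y)"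
    and Q1: "Q (del \<one>) = (\<Sum>q\<leftarrow>LE. scale (qn (fst q)) (Cb (snd q)))"
    and QC: "Q (Cb c) = Cb A + (\<Sum>q\<leftarrow>LE. scale (qn (fst q - 1)) (Cb (snd q)))"
    using pivot_operator[OF E c(1,2) XY A LE] by blast
  note Qlin = ops_lin[OF Q]
  have K: "R - {p} \<subseteq> S" "R - {p} \<subseteq> R" "S - {p} \<subseteq> S" "S - {c} \<subseteq> S" "E \<subseteq> S - {p}" "R \<subseteq> S - {c}" "E \<subseteq> S - {c}"
    "E \<inter> (R - {p}) = {}" "c \<in> S - {p}" using R E p c by auto
  have L1: "fst q \<ge> 1" "snd q \<in> generate G (R - {p})" "snd q \<in> generate G R" "snd q \<in> carrier G" if "q \<in> set L" for q
    using L(2)[OF that] parab_mono[OF K(2), of "snd q"] parab_closed[OF K(1), of "snd q"] by auto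
  have LE1: "fst q \<ge> 1" "snd q \<in> generate G E" "snd q \<in> carrier G" if "q \<in> set LE" for q
    using LE(2)[OF that] E by auto
  have leaf: "rho (S - {p}) (Cb ?M) = comb (leaf_list c L)"
    "rho (S - {c}) (Cb ?M) = comb ((2, w) # filter (\<lambda>q. fst q \<noteq> 1) L)"
    using Cb_leaf[OF R(1) c(1,3) p com w L] by blast+
  have xz: "x \<otimes> z = z \<otimes> x" if "x \<in> generate G E" "z \<in> generate G R" for x z
    by (rule parab_commute[OF E R(1) comE that])
  \<comment> \<open>Left multiplication by C_z uses letters of R, which commute with E, so it can be
    taken out of Q; what remains is the value of Q at H_1.\<close>
  have QCz: "Q (Cb z) = (\<Sum>q\<leftarrow>LE. scale (qn (fst q)) (Cb (snd q \<otimes> z)))" if z: "z \<in> generate G R" for z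
  proof -
    obtain P where P: "P \<in> ops R {}" "P (del \<one>) = Cb z" using ex_ops_Cb[OF R(1) z] by blast
    have "Q (Cb z) = P (Q (del \<one>))"
      unfolding P(2)[symmetric] by (rule ops_ops_commute[OF E E R(1) _ Q P(1), symmetric]) (simp add: comE)
    also have "\<dots> = (\<Sum>q\<leftarrow>LE. scale (qn (fst q)) (P (Cb (snd q))))"
      unfolding Q1 lin_sum_list[OF ops_lin[OF P(1)]] lin_scale[OF ops_lin[OF P(1)]] ..
    also have "\<dots> = (\<Sum>q\<leftarrow>LE. scale (qn (fst q)) (Cb (snd q \<otimes> z)))"
    proof (rule sum_list_Cb_cong)
      fix q assume q: "q \<in> set LE"
      have "P (Cb (snd q)) = Cb (z \<otimes> snd q)"
        by (rule Cb_disjoint[OF R(1) E _ z LE1(2)[OF q] P]) (use R in auto)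
      then show "scale (qn (fst q)) (P (Cb (snd q))) = scale (qn (fst q)) (Cb (snd q \<otimes> z))"
        using xz[OF LE1(2)[OF q] z] by simp
    qed
    finally show ?thesis .
  qed
  \<comment> \<open>For p-free z also c commutes with z, so C_{cz} = C_z C_c and the known value of
    Q at C_c is multiplied by C_z from the left.\<close>
  have QCcz: "Q (Cb (c \<otimes> z)) = Cb (A \<otimes> z) + (\<Sum>q\<leftarrow>LE. scale (qn (fst q - 1)) (Cb (snd q \<otimes> z)))"
    if z: "z \<in> generate G (R - {p})" for z
  proof -
    have zR: "z \<in> generate G R" using parab_mono[OF K(2) z] .
    have zc: "z \<in> carrier G" using parab_closed[OF K(1) z] .
    obtain P where P: "P \<in> ops (R - {p}) {}" "P (del \<one>) = Cb z" using ex_ops_Cb[OF K(1) z] by blast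
    have cz: "c \<otimes> z = z \<otimes> c" by (rule commute_generate[OF K(1) _ _ z]) (use com cl in auto)
    have Az: "z \<otimes> A = A \<otimes> z"
      unfolding A using xz[OF XY(1) zR] xz[OF XY(2) zR] cz cl zc by (metis m_assoc m_closed)
    have "P (Cb c) = Cb (z \<otimes> c)"
      by (rule Cb_disjoint[OF K(1) _ _ z parab_S[of c "{c}"] P]) (use c in auto)
    then have "Q (Cb (c \<otimes> z)) = Q (P (Cb c))" using cz by simp
    also have "\<dots> = P (Q (Cb c))"
      by (rule ops_ops_commute[OF E E K(1) _ Q P(1), symmetric]) (use comE in simp)
    also have "\<dots> = P (Cb A) + (\<Sum>q\<leftarrow>LE. scale (qn (fst q - 1)) (P (Cb (snd q))))"
      unfolding QC lin_add[OF ops_lin[OF P(1)]] lin_sum_list[OF ops_lin[OF P(1)]] lin_scale[OF ops_lin[OF P(1)]] ..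
    also have "P (Cb A) = Cb (A \<otimes> z)"
    proof -
      have "A \<in> generate G (insert c E)"
        unfolding A using XY parab_mono[of E "insert c E"] by (auto intro!: parab_mult parab_S[of c "insert c E"])
      then have "P (Cb A) = Cb (z \<otimes> A)"
        by (intro Cb_disjoint[OF K(1) _ _ z _ P]) (use E R c in auto)
      then show ?thesis using Az by simp
    qed
    also have "(\<Sum>q\<leftarrow>LE. scale (qn (fst q - 1)) (P (Cb (snd q)))) = (\<Sum>q\<leftarrow>LE. scale (qn (fst q - 1)) (Cb (snd q \<otimes> z)))"
    proof (rule sum_list_Cb_cong)
      fix q assume q: "q \<in> set LE"
      have "P (Cb (snd q)) = Cb (z \<otimes> snd q)"
        by (rule Cb_disjoint[OF K(1) E _ z LE1(2)[OF q] P]) (use K in auto)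
      then show "scale (qn (fst q - 1)) (P (Cb (snd q))) = scale (qn (fst q - 1)) (Cb (snd q \<otimes> z))"
        using xz[OF LE1(2)[OF q] zR] by simp
    qed
    finally show ?thesis .
  qed
  \<comment> \<open>The c-free part of Q(C_{cwc}) has coefficients v^2 [n] at xw and v^m [n] at xz
    with m different from 1. \<open>T1\<close> and \<open>T2\<close> collect their bar invariant
    parts [n-2] and [n-m]; subtracting these leaves positive powers.\<close>
  define T1 where "T1 = (\<Sum>q\<leftarrow>LE. scale (qn (fst q - 2)) (Cb (snd q \<otimes> w)))"
  define T2 where "T2 = (\<Sum>m\<leftarrow>L. \<Sum>q\<leftarrow>LE. scale (if fst m = 1 then 0 else qn (fst q - fst m)) (Cb (snd q \<otimes> snd m)))"
  have xzG: "snd q \<otimes> z \<in> generate G (S - {c})" "snd q \<otimes> z \<in> carrier G" if "q \<in> set LE" "z \<in> generate G R" for q z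
  proof -
    show "snd q \<otimes> z \<in> generate G (S - {c})"
      using parab_mult[OF parab_mono[OF K(7) LE1(2)[OF that(1)]] parab_mono[OF K(6) that(2)]] .
    then show "snd q \<otimes> z \<in> carrier G" by (rule parab_closed[OF K(4)])
  qed
  have T1: "T1 \<in> Hm" "Bar T1 = T1" unfolding T1_def using xzG(2)[OF _ w(1)] by (intro Bar_sum_list_Cb; simp)+
  have T2': "(\<Sum>q\<leftarrow>LE. scale (if fst m = 1 then 0 else qn (fst q - fst m)) (Cb (snd q \<otimes> snd m))) \<in> Hm"
    "Bar (\<Sum>q\<leftarrow>LE. scale (if fst m = 1 then 0 else qn (fst q - fst m)) (Cb (snd q \<otimes> snd m))) =
      (\<Sum>q\<leftarrow>LE. scale (if fst m = 1 then 0 else qn (fst q - fst m)) (Cb (snd q \<otimes> snd m)))" if "m \<in> set L" for m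
    using xzG(2)[OF _ L1(3)[OF that]] by (intro Bar_sum_list_Cb; simp)+
  have T2: "T2 \<in> Hm" unfolding T2_def by (intro Hm_sum_list T2'(1))
  have BT2: "Bar T2 = T2"
  proof -
    have "Bar T2 = (\<Sum>m\<leftarrow>L. Bar (\<Sum>q\<leftarrow>LE. scale (if fst m = 1 then 0 else qn (fst q - fst m)) (Cb (snd q \<otimes> snd m))))"
      unfolding T2_def by (intro Bar_sum_list T2'(1))
    also have "\<dots> = T2" unfolding T2_def by (intro sum_list_Cb_cong T2'(2))
    finally show ?thesis .
  qed
  have supp1: "y \<in> generate G (S - {c})" if "T1 y \<noteq> 0" for y
    by (rule sum_list_Cb_support[OF K(4) _ that[unfolded T1_def]]) (rule xzG(1)[OF _ w(1)])
  have supp2: "y \<in> generate G (S - {c})" if "T2 y \<noteq> 0" for y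
  proof (rule ccontr)
    assume y: "y \<notin> generate G (S - {c})"
    have "(\<Sum>q\<leftarrow>LE. scale (if fst m = 1 then 0 else qn (fst q - fst m)) (Cb (snd q \<otimes> snd m))) y = 0" if "m \<in> set L" for m
    proof (rule ccontr)
      assume "(\<Sum>q\<leftarrow>LE. scale (if fst m = 1 then 0 else qn (fst q - fst m)) (Cb (snd q \<otimes> snd m))) y \<noteq> 0"
      then have "y \<in> generate G (S - {c})"
        by (rule sum_list_Cb_support[OF K(4), rotated]) (rule xzG(1)[OF _ L1(3)[OF that]])
      then show False using y by simp
    qed
    then have "T2 y = (\<Sum>m\<leftarrow>L. 0)" unfolding T2_def sum_list_fun_apply by (intro sum_list_Cb_cong)
    then show False using \<open>T2 y \<noteq> 0\<close> by simp
  qed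
  have cf: "rho (S - {c}) (Q (Cb ?M)) = (\<Sum>q\<leftarrow>LE. scale (vp 2 * qn (fst q)) (Cb (snd q \<otimes> w))) +
    (\<Sum>m\<leftarrow>L. \<Sum>q\<leftarrow>LE. scale (if fst m = 1 then 0 else vp (int (fst m)) * qn (fst q)) (Cb (snd q \<otimes> snd m)))"
  proof -
    have "rho (S - {c}) (Q (Cb ?M)) = Q (rho (S - {c}) (Cb ?M))"
      by (rule ops_rho[OF K(4,7,7) Q])
    also have "\<dots> = scale (vp 2) (Q (Cb w)) + Q (comb (filter (\<lambda>q. fst q \<noteq> 1) L))"
      unfolding leaf(2) by (simp add: lin_add[OF Qlin] lin_scale[OF Qlin])
    also have "Q (comb (filter (\<lambda>q. fst q \<noteq> 1) L)) =
      (\<Sum>m\<leftarrow>L. scale (if fst m = 1 then 0 else vp (int (fst m))) (Q (Cb (snd m))))"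
      unfolding lin_comb[OF Qlin] by (induction L) auto
    also have "\<dots> = (\<Sum>m\<leftarrow>L. \<Sum>q\<leftarrow>LE. scale (if fst m = 1 then 0 else vp (int (fst m)) * qn (fst q)) (Cb (snd q \<otimes> snd m)))"
      by (intro sum_list_Cb_cong) (simp add: QCz[OF L1(3)] lin_sum_list[OF lin_scale_op])
    also have "scale (vp 2) (Q (Cb w)) = (\<Sum>q\<leftarrow>LE. scale (vp 2 * qn (fst q)) (Cb (snd q \<otimes> w)))"
      by (simp add: QCz[OF w(1)] lin_sum_list[OF lin_scale_op])
    finally show ?thesis .
  qed
  define L1' where "L1' = concat (map (\<lambda>q. mono_list (fst q) 2 (snd q \<otimes> w)) LE)"
  define L2' where "L2' = concat (map (\<lambda>m. concat (map (\<lambda>q. if fst m = 1 then [] else mono_list (fst q) (fst m) (snd q \<otimes> snd m)) LE)) L)"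
  have posT: "rho (S - {c}) (Q (Cb ?M)) - (T1 + T2) = comb (L1' @ L2')"
  proof -
    have "comb L1' = (\<Sum>q\<leftarrow>LE. scale (vp 2 * qn (fst q)) (Cb (snd q \<otimes> w))) - T1"
      unfolding L1'_def T1_def comb_concat map_map comp_def comb_mono_list
      by (simp add: scale_diff_left sum_list_subtractf)
    moreover have "comb L2' = (\<Sum>m\<leftarrow>L. \<Sum>q\<leftarrow>LE. scale (if fst m = 1 then 0 else vp (int (fst m)) * qn (fst q)) (Cb (snd q \<otimes> snd m))) - T2"
      unfolding L2'_def T2_def comb_concat map_map comp_def sum_list_subtractf[symmetric]
      by (intro sum_list_Cb_cong) (simp add: comb_mono_list scale_diff_left)
    ultimately show ?thesis unfolding cf comb_append by simp
  qed
  have pos: "lau_pos (Q (Cb ?M) y - (T1 + T2) y)" if y: "y \<in> generate G (S - {c})" for y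
  proof -
    have "lau_pos (comb (L1' @ L2') y)"
    proof (rule comb_pos)
      fix k assume "k \<in> set (L1' @ L2')"
      then consider q where "q \<in> set LE" "k \<in> set (mono_list (fst q) 2 (snd q \<otimes> w))"
        | m q where "m \<in> set L" "q \<in> set LE" "k \<in> set (mono_list (fst q) (fst m) (snd q \<otimes> snd m))"
        unfolding L1'_def L2'_def by (auto split: if_splits)
      then show "1 \<le> fst k \<and> snd k \<in> carrier G"
        by cases (use mono_list_elems xzG(2) w(1) L1(3) in metis)+
    qed
    then show ?thesis using y unfolding posT[symmetric] by (simp add: rho_def)
  qed
  \<comment> \<open>The substitution lemma is applied with c in the role of the letter, R enlarged
    by c, and cwc as the element inserted.\<close>
  have R': "insert c R \<subseteq> S" "E \<inter> insert c R = {}" "c \<in> insert c R" "insert c R - {c} = R"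
    "\<forall>e\<in>E. \<forall>r\<in>insert c R. r \<noteq> c \<longrightarrow> e \<otimes> r = r \<otimes> e"
    using R c comE by auto
  have M: "?M \<in> generate G (insert c R)"
    using w(1) parab_mono[of R "insert c R"] by (intro parab_mult parab_S[of c "insert c R"]) auto
  \<comment> \<open>If cwc were c-free, w would commute with c and hence avoid the neighbour p of
    c.\<close>
  have Mn: "?M \<notin> generate G (insert c R - {c})"
  proof
    assume "?M \<in> generate G (insert c R - {c})"
    then have MR: "?M \<in> generate G R" using R' by simp
    have "c \<otimes> w = ?M \<otimes> c" using c cl by simp
    then have "c \<otimes> w = w \<otimes> c" using commute_parab(2)[OF R(1) c(1,3) w(1) MR] by simp
    then have "w \<in> generate G {r \<in> R. c \<otimes> r = r \<otimes> c}" using commute_support[OF R(1) c(1,3) w(1)] by simp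
    moreover have "{r \<in> R. c \<otimes> r = r \<otimes> c} \<subseteq> R - {p}" using p by auto
    ultimately show False using w(2) parab_mono by blast
  qed
  have supp: "y \<in> generate G (S - {c})" if "(T1 + T2) y \<noteq> 0" for y
    using that supp1[of y] supp2[of y] by (cases "T1 y = 0") auto
  have main: "Cb (X \<otimes> ?M \<otimes> Y) = Q (Cb ?M) - (T1 + T2)"
    by (rule Cb_substitute[OF E R'(1,2,3,5) Q XY _ _ M Mn])
      (use QA A T1 T2 BT2 supp pos in \<open>auto simp: Bar_add\<close>)
  have r1: "rho (S - {p}) (Q (Cb ?M)) = (\<Sum>m\<leftarrow>L. scale (leaf_coeff (fst m)) (Cb (A \<otimes> snd m))) +
    (\<Sum>m\<leftarrow>L. \<Sum>q\<leftarrow>LE. scale (leaf_coeff (fst m) * qn (fst q - 1)) (Cb (snd q \<otimes> snd m)))"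
  proof -
    have "rho (S - {p}) (Q (Cb ?M)) = Q (rho (S - {p}) (Cb ?M))"
      by (rule ops_rho[OF K(3,5,5) Q])
    also have "\<dots> = (\<Sum>m\<leftarrow>L. scale (leaf_coeff (fst m)) (Q (Cb (c \<otimes> snd m))))"
    proof -
      have "comb (leaf_list c L) = (\<Sum>m\<leftarrow>L. scale (leaf_coeff (fst m)) (Cb (c \<otimes> snd m)))"
        by (rule comb_leaf_list[OF L1(1)])
      then show ?thesis unfolding leaf(1) by (simp only: lin_sum_list[OF Qlin] lin_scale[OF Qlin])
    qed
    also have "\<dots> = (\<Sum>m\<leftarrow>L. scale (leaf_coeff (fst m)) (Cb (A \<otimes> snd m)) +
      (\<Sum>q\<leftarrow>LE. scale (leaf_coeff (fst m) * qn (fst q - 1)) (Cb (snd q \<otimes> snd m))))"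
      by (intro sum_list_Cb_cong) (simp add: QCcz[OF L1(2)] scale_add lin_sum_list[OF lin_scale_op])
    finally show ?thesis by (simp add: sum_list_addf)
  qed
  have r2: "rho (S - {p}) T1 = (\<Sum>m\<leftarrow>L. \<Sum>q\<leftarrow>LE. scale (vp (int (fst m)) * qn (fst q - 2)) (Cb (snd q \<otimes> snd m)))"
  proof -
    have "rho (S - {p}) (Cb (snd q \<otimes> w)) = (\<Sum>m\<leftarrow>L. scale (vp (int (fst m))) (Cb (snd q \<otimes> snd m)))" if q: "q \<in> set LE" for q
    proof -
      obtain P where P: "P \<in> ops E {}" "P (del \<one>) = Cb (snd q)" using ex_ops_Cb[OF E LE1(2)[OF q]] by blast
      have "rho (S - {p}) (Cb (snd q \<otimes> w)) = rho (S - {p}) (P (Cb w))"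
        using Cb_disjoint[OF E R(1,2) LE1(2)[OF q] w(1) P] by simp
      also have "\<dots> = P (rho (S - {p}) (Cb w))" by (rule ops_rho[OF K(3,5) _ P(1)]) simp
      also have "\<dots> = (\<Sum>m\<leftarrow>L. scale (vp (int (fst m))) (P (Cb (snd m))))"
        unfolding L(1) lin_comb[OF ops_lin[OF P(1)]] ..
      also have "\<dots> = (\<Sum>m\<leftarrow>L. scale (vp (int (fst m))) (Cb (snd q \<otimes> snd m)))"
        by (intro sum_list_Cb_cong) (simp add: Cb_disjoint[OF E R(1,2) LE1(2)[OF q] L1(3) P])
      finally show ?thesis .
    qed
    then have "rho (S - {p}) T1 = (\<Sum>q\<leftarrow>LE. \<Sum>m\<leftarrow>L. scale (vp (int (fst m)) * qn (fst q - 2)) (Cb (snd q \<otimes> snd m)))"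
      unfolding T1_def lin_sum_list[OF lin_rho] lin_scale[OF lin_rho]
      by (intro sum_list_Cb_cong) (simp add: lin_sum_list[OF lin_scale_op] mult.commute)
    then show ?thesis by (simp only: sum_list_swap[of _ L LE])
  qed
  have r3: "rho (S - {p}) T2 = T2"
  proof -
    have "rho (S - {p}) (Cb (snd q \<otimes> snd m)) = Cb (snd q \<otimes> snd m)" if "q \<in> set LE" "m \<in> set L" for q m
    proof (rule rho_id)
      have "snd q \<otimes> snd m \<in> generate G (S - {p})"
        using parab_mono[OF K(5) LE1(2)[OF that(1)]] parab_mono[OF _ L1(2)[OF that(2)], of "S - {p}"] R
        by (intro parab_mult) auto
      then show "u \<in> generate G (S - {p})" if "Cb (snd q \<otimes> snd m) u \<noteq> 0" for u
        using Cb_parab[OF K(3) _ that] by blast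
    qed
    then show ?thesis unfolding T2_def lin_sum_list[OF lin_rho] lin_scale[OF lin_rho]
      by (intro sum_list_Cb_cong) simp
  qed
  \<comment> \<open>\<open>La\<close> comes from the terms C_{Az}, \<open>Lb\<close> from the terms
    C_{xz}; for the latter \<open>leaf_coeff_qn\<close> evaluates product minus corrections entry by
    entry.\<close>
  define La where "La = leaf_list A L"
  define Lb where "Lb = concat (map (\<lambda>m. concat (map (\<lambda>q. if fst q = 1 then [] else mono_list (fst q) (fst m) (snd q \<otimes> snd m)) LE)) L)"
  have "comb La = (\<Sum>m\<leftarrow>L. scale (leaf_coeff (fst m)) (Cb (A \<otimes> snd m)))"
    unfolding La_def by (rule comb_leaf_list[OF L1(1)])
  moreover have "comb Lb = (\<Sum>m\<leftarrow>L. \<Sum>q\<leftarrow>LE. scale (leaf_coeff (fst m) * qn (fst q - 1)) (Cb (snd q \<otimes> snd m)))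
    - (\<Sum>m\<leftarrow>L. \<Sum>q\<leftarrow>LE. scale (vp (int (fst m)) * qn (fst q - 2)) (Cb (snd q \<otimes> snd m))) - T2"
    unfolding Lb_def T2_def comb_concat map_map comp_def sum_list_subtractf[symmetric]
  proof (intro sum_list_Cb_cong)
    fix m q assume mq: "m \<in> set L" "q \<in> set LE"
    have "comb (if fst q = 1 then [] else mono_list (fst q) (fst m) (snd q \<otimes> snd m)) =
      scale (if fst q = 1 then 0 else vp (int (fst m)) * qn (fst q) - qn (fst q - fst m)) (Cb (snd q \<otimes> snd m))"
      by (simp add: comb_mono_list)
    also have "\<dots> = scale (leaf_coeff (fst m) * qn (fst q - 1) - vp (int (fst m)) * qn (fst q - 2) - (if fst m = 1 then 0 else qn (fst q - fst m))) (Cb (snd q \<otimes> snd m))"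
      using leaf_coeff_qn[OF LE1(1)[OF mq(2)] L1(1)[OF mq(1)]] by simp
    finally show "comb (if fst q = 1 then [] else mono_list (fst q) (fst m) (snd q \<otimes> snd m)) =
      scale (leaf_coeff (fst m) * qn (fst q - 1)) (Cb (snd q \<otimes> snd m)) -
      scale (vp (int (fst m)) * qn (fst q - 2)) (Cb (snd q \<otimes> snd m)) -
      scale (if fst m = 1 then 0 else qn (fst q - fst m)) (Cb (snd q \<otimes> snd m))"
      by (simp only: scale_diff_left)
  qed
  ultimately have res: "rho (S - {p}) (Cb (X \<otimes> ?M \<otimes> Y)) = comb (La @ Lb)"
    unfolding main comb_append lin_diff[OF lin_rho] lin_add[OF lin_rho] r1 r2 r3 by (simp add: algebra_simps)
  have "fst k \<ge> 1 \<and> (\<exists>z\<in>snd ` set L. snd k = A \<otimes> z \<or> (\<exists>x\<in>snd ` set LE. snd k = x \<otimes> z))" if k: "k \<in> set (La @ Lb)" for k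
  proof (cases "k \<in> set La")
    case True
    have "fst k \<ge> 1" "\<exists>q\<in>set L. snd k = A \<otimes> snd q"
      using leaf_list_elems[OF L1(1) True[unfolded La_def]] by auto
    then show ?thesis by blast
  next
    case False
    then obtain m q where "m \<in> set L" "q \<in> set LE" "k \<in> set (mono_list (fst q) (fst m) (snd q \<otimes> snd m))"
      using k unfolding Lb_def by (auto split: if_splits)
    then show ?thesis using mono_list_elems by blast
  qed
  then show ?thesis using res by blast
qed

end

section \<open>Boolean elements of a forest\<close>

context coxeter_system
begin

section \<open>The symmetry w -> w^-1\<close>

definition flip :: "('a \<Rightarrow> lau) \<Rightarrow> 'a \<Rightarrow> lau" where
  "flip h = (\<lambda>u. if u \<in> carrier G then h (inv u) else 0)"

lemma lin_flip: "lin flip"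
  by (auto simp: lin_def flip_def fun_eq_iff)

lemma flip_Rc: "s \<in> S \<Longrightarrow> flip (Rc s h) = Lc s (flip h)"
  by (rule ext) (auto simp: flip_def Rc_def Lc_def inv_mult_group len_inv_swap simp flip: len_inv_swap[of s "inv _"])

lemma flip_del: "w \<in> carrier G \<Longrightarrow> flip (del w) = del (inv w)"
  by (rule ext) (auto simp: flip_def del_def)

lemma flip_Hm: "h \<in> Hm \<Longrightarrow> flip h \<in> Hm"
proof (rule Hm_subset[of "m_inv G ` {u. h u \<noteq> 0}"])
  fix u assume "h \<in> Hm" "flip h u \<noteq> 0"
  then have "u \<in> carrier G" "h (inv u) \<noteq> 0" by (auto simp: flip_def split: if_splits)
  then have "u = inv (inv u)" "inv u \<in> {u. h u \<noteq> 0}" by auto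
  then show "u \<in> m_inv G ` {u. h u \<noteq> 0}" by blast
qed (auto simp: Hm_finite intro: Hm_closed)

lemma flip_barH: "w \<in> carrier G \<Longrightarrow> flip (barH w) = barH (inv w)"
proof (induction w rule: right_induct)
  case one
  then show ?case by (simp add: flip_del)
next
  case (step w s)
  have "\<not> dl s (inv w)" using step len_inv_swap[of s w] by simp
  then have "barH (s \<otimes> inv w) = Li s (barH (inv w))" using step by (intro barH_left) auto
  moreover have "flip (Ri s (barH w)) = Li s (flip (barH w))"
    using step by (simp add: Ri_def Li_def lin_diff[OF lin_flip] lin_scale[OF lin_flip] flip_Rc)
  ultimately show ?case using step by (simp add: barH_right inv_mult_group)
qed

lemma Bar_flip: "h \<in> Hm \<Longrightarrow> Bar (flip h) = flip (Bar h)"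
proof (induction rule: Hm_induct)
  case zero
  show "Bar (flip 0) = flip (Bar 0)" by (simp only: lin_0[OF lin_flip] Bar_0)
next
  case (step h a w)
  then have "flip h \<in> Hm" "flip (del w) \<in> Hm" using flip_Hm by auto
  then show "Bar (flip (h + scale a (del w))) = flip (Bar (h + scale a (del w)))" using step
    by (simp add: lin_add[OF lin_flip] lin_scale[OF lin_flip] Bar_add Bar_scale Hm_scale Bar_del flip_del flip_barH)
qed

lemma Cb_inv: "w \<in> carrier G \<Longrightarrow> Cb (inv w) = flip (Cb w)"
proof (rule Cb_eqI)
  assume w: "w \<in> carrier G"
  have "lau_pos (flip (Cb w) u)" if "u \<noteq> inv w" for u
  proof (cases "u \<in> carrier G")
    case True
    then have "inv u \<noteq> w" using that by auto
    then show ?thesis using Cb_pos[OF w] True by (simp add: flip_def)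
  qed (simp add: flip_def)
  then show "isKL (inv w) (flip (Cb w))"
    using w flip_Hm[of "Cb w"] Bar_flip[of "Cb w"] by (auto simp: isKL_def flip_def)
qed

lemma rho_flip: "K \<subseteq> S \<Longrightarrow> rho K (flip h) = flip (rho K h)"
  by (rule ext) (auto simp: rho_def flip_def parab_inv_iff)

text \<open>The p-free part of C_v is a combination of C_z with coefficients in vN[v]. The set B
  records that the z are again boolean along the same letters, so that later inductions apply to
  them.\<close>

definition pos_at :: "'a set \<Rightarrow> 'a \<Rightarrow> 'a \<Rightarrow> bool" where
  "pos_at B p v \<longleftrightarrow> (\<exists>L. rho (S - {p}) (Cb v) = comb L \<and>
     (\<forall>q\<in>set L. fst q \<ge> 1 \<and> snd q \<in> B \<and> snd q \<in> generate G (S - {p})))"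

lemma pos_at_inv:
  assumes v: "v \<in> carrier G" and B: "\<And>z. z \<in> B \<Longrightarrow> inv z \<in> B" and "pos_at B p (inv v)"
  shows "pos_at B p v"
proof -
  have K: "S - {p} \<subseteq> S" by auto
  obtain L where L: "rho (S - {p}) (Cb (inv v)) = comb L"
    "\<forall>q\<in>set L. fst q \<ge> 1 \<and> snd q \<in> B \<and> snd q \<in> generate G (S - {p})"
    using assms(3) unfolding pos_at_def by blast
  define L' where "L' = map (\<lambda>q. (fst q, inv (snd q))) L"
  have "rho (S - {p}) (Cb v) = flip (rho (S - {p}) (Cb (inv v)))"
    using Cb_inv[of "inv v"] v rho_flip[OF K, of "Cb (inv v)"] by simp
  also have "\<dots> = (\<Sum>q\<leftarrow>L. scale (vp (int (fst q))) (flip (Cb (snd q))))"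
    unfolding L(1) lin_comb[OF lin_flip] ..
  also have "\<dots> = (\<Sum>q\<leftarrow>L. scale (vp (int (fst q))) (Cb (inv (snd q))))"
    using L(2) parab_closed[OF K] by (intro sum_list_Cb_cong) (simp add: Cb_inv)
  also have "\<dots> = comb L'" by (simp add: comb_def L'_def comp_def)
  finally show ?thesis unfolding pos_at_def
    using L(2) B parab_inv[OF K] by (intro exI[of _ L']) (auto simp: L'_def)
qed

text \<open>Letters are adjoined from the end of the list to its head: the head is the outermost
  letter, added last, independently on each side.\<close>

fun BB :: "'a list \<Rightarrow> 'a set" where
  "BB [] = {\<one>}"
| "BB (s # xs) = {a \<otimes> v \<otimes> b | a v b. a \<in> {\<one>, s} \<and> b \<in> {\<one>, s} \<and> v \<in> BB xs}"

text \<open>An elimination order: each letter has at most one neighbour among those following it in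
  the list, that is, among those adjoined before it.\<close>

fun forest :: "'a list \<Rightarrow> bool" where
  "forest [] = True"
| "forest (s # xs) \<longleftrightarrow> forest xs \<and> s \<in> S \<and> s \<notin> set xs \<and>
     (\<forall>a\<in>set xs. \<forall>b\<in>set xs. s \<otimes> a \<noteq> a \<otimes> s \<longrightarrow> s \<otimes> b \<noteq> b \<otimes> s \<longrightarrow> a = b)"

lemma forest_S: "forest xs \<Longrightarrow> set xs \<subseteq> S"
  by (induction xs) auto

lemma BB_ConsI: "v \<in> BB xs \<Longrightarrow> a \<in> {\<one>, s} \<Longrightarrow> b \<in> {\<one>, s} \<Longrightarrow> a \<otimes> v \<otimes> b \<in> BB (s # xs)"
  by auto

lemma BB_ConsE:
  assumes "v \<in> BB (s # xs)"
  obtains a w b where "v = a \<otimes> w \<otimes> b" "a \<in> {\<one>, s}" "b \<in> {\<one>, s}" "w \<in> BB xs"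
  using assms by auto

declare BB.simps(2) [simp del]

lemma BB_parab: "set xs \<subseteq> S \<Longrightarrow> v \<in> BB xs \<Longrightarrow> v \<in> generate G (set xs)"
proof (induction xs arbitrary: v)
  case (Cons s xs)
  from Cons.prems(2) obtain a w b where *: "v = a \<otimes> w \<otimes> b" "a \<in> {\<one>, s}" "b \<in> {\<one>, s}" "w \<in> BB xs"
    by (rule BB_ConsE)
  have "w \<in> generate G (set (s # xs))" using Cons * parab_mono[of "set xs" "set (s # xs)"] by auto
  moreover have "a \<in> generate G (set (s # xs))" "b \<in> generate G (set (s # xs))"
    using * parab_S[of s "set (s # xs)"] by auto
  ultimately show ?case unfolding *(1) by (intro parab_mult)
qed simp

lemma BB_closed: "set xs \<subseteq> S \<Longrightarrow> v \<in> BB xs \<Longrightarrow> v \<in> carrier G"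
  using BB_parab parab_closed by blast

lemma BB_subset_Cons: "set xs \<subseteq> S \<Longrightarrow> BB xs \<subseteq> BB (s # xs)"
proof
  fix v assume v: "set xs \<subseteq> S" "v \<in> BB xs"
  have "\<one> \<otimes> v \<otimes> \<one> \<in> BB (s # xs)" by (rule BB_ConsI[OF v(2)]) auto
  then show "v \<in> BB (s # xs)" using BB_closed[OF v] by simp
qed

lemma BB_inv: "set xs \<subseteq> S \<Longrightarrow> v \<in> BB xs \<Longrightarrow> inv v \<in> BB xs"
proof (induction xs arbitrary: v)
  case (Cons s xs)
  from Cons.prems(2) obtain a w b where *: "v = a \<otimes> w \<otimes> b" "a \<in> {\<one>, s}" "b \<in> {\<one>, s}" "w \<in> BB xs"
    by (rule BB_ConsE)
  have c: "w \<in> carrier G" "s \<in> S" using Cons * BB_closed[of xs w] by auto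
  have "inv v = b \<otimes> inv w \<otimes> a" using * c by (auto simp: inv_mult_group m_assoc)
  moreover have "inv w \<in> BB xs" using Cons * by auto
  ultimately show ?case using * BB_ConsI by simp
qed simp

lemma BB_swap_subset:
  assumes "s \<in> S" "t \<in> S" "set xs \<subseteq> S" "s \<otimes> t = t \<otimes> s"
  shows "BB (s # t # xs) \<subseteq> BB (t # s # xs)"
proof
  fix v assume "v \<in> BB (s # t # xs)"
  then obtain a w b where 1: "v = a \<otimes> w \<otimes> b" "a \<in> {\<one>, s}" "b \<in> {\<one>, s}" "w \<in> BB (t # xs)" by (rule BB_ConsE)
  from 1(4) obtain a' u b' where 2: "w = a' \<otimes> u \<otimes> b'" "a' \<in> {\<one>, t}" "b' \<in> {\<one>, t}" "u \<in> BB xs" by (rule BB_ConsE)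
  have c: "a \<in> carrier G" "b \<in> carrier G" "a' \<in> carrier G" "b' \<in> carrier G" "u \<in> carrier G"
    using 1 2 assms BB_closed[OF assms(3)] by auto
  have "x \<otimes> y = y \<otimes> x" if "x \<in> {\<one>, s}" "y \<in> {\<one>, t}" for x y
    using that assms(1,2,4) by (metis S_closed empty_iff insert_iff l_one one_closed r_one)
  then have com: "a \<otimes> a' = a' \<otimes> a" "b' \<otimes> b = b \<otimes> b'" using 1(2,3) 2(2,3) by metis+
  have "v = a \<otimes> a' \<otimes> u \<otimes> (b' \<otimes> b)" using 1 2 c by (simp add: m_assoc)
  also have "\<dots> = a' \<otimes> (a \<otimes> u \<otimes> b) \<otimes> b'" unfolding com using c by (simp add: m_assoc)
  finally show "v \<in> BB (t # s # xs)" using BB_ConsI[OF BB_ConsI[OF 2(4) 1(2,3)] 2(2,3)] by simp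
qed

lemma BB_swap:
  "s \<in> S \<Longrightarrow> t \<in> S \<Longrightarrow> set xs \<subseteq> S \<Longrightarrow> s \<otimes> t = t \<otimes> s \<Longrightarrow> BB (s # t # xs) = BB (t # s # xs)"
  using BB_swap_subset[of s t xs] BB_swap_subset[of t s xs] by simp

lemma BB_Cons_cong: "BB xs = BB ys \<Longrightarrow> BB (s # xs) = BB (s # ys)"
  by (simp add: BB.simps(2))

lemma BB_move:
  assumes "s \<in> S" "set ys \<subseteq> S" "set zs \<subseteq> S" "\<And>y. y \<in> set ys \<Longrightarrow> s \<otimes> y = y \<otimes> s"
  shows "BB (s # ys @ zs) = BB (ys @ s # zs)"
  using assms
proof (induction ys)
  case (Cons y ys)
  have "BB (s # y # ys @ zs) = BB (y # s # ys @ zs)" using Cons.prems by (intro BB_swap) auto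
  also have "\<dots> = BB (y # ys @ s # zs)" using Cons by (intro BB_Cons_cong Cons.IH) auto
  finally show ?case by simp
qed simp

lemma forest_move:
  assumes "\<And>y. y \<in> set ys \<Longrightarrow> s \<otimes> y = y \<otimes> s"
  shows "forest (s # ys @ zs) \<longleftrightarrow> forest (ys @ s # zs)"
  using assms
proof (induction ys)
  case (Cons y ys)
  have "forest (s # y # ys @ zs) \<longleftrightarrow> forest (y # s # ys @ zs)" using Cons.prems by auto
  also have "\<dots> \<longleftrightarrow> forest (y # ys @ s # zs)" using Cons by auto
  finally show ?case by simp
qed simp

lemma forest_append: "forest (xs @ ys) \<Longrightarrow> forest xs \<and> forest ys"
  by (induction xs) auto

lemma forest_Cons_cong: "forest (s # xs) \<Longrightarrow> forest ys \<Longrightarrow> set xs = set ys \<Longrightarrow> forest (s # ys)"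
  by simp

text \<open>The letters that can be reached from \<open>p\<close> by going to earlier neighbours move to the front.\<close>
lemma forest_decompose:
  assumes "forest xs" "p \<in> set xs"
  shows "\<exists>ds rs. BB xs = BB (ds @ p # rs) \<and> set xs = set (ds @ p # rs) \<and> length xs = length (ds @ p # rs) \<and>
    forest (ds @ p # rs) \<and> (\<forall>d\<in>set ds. \<forall>r\<in>set rs. d \<otimes> r = r \<otimes> d) \<and>
    (\<forall>as bs. xs = as @ p # bs \<longrightarrow> set bs \<subseteq> set rs)"
  using assms
proof (induction xs)
  case (Cons s xs)
  show ?case
  proof (cases "s = p")
    case True
    have "set bs \<subseteq> set xs" if "s # xs = as @ p # bs" for as bs
      using that Cons.prems True by (cases as) auto
    then show ?thesis using True Cons.prems by (intro exI[of _ "[]"] exI[of _ xs]) simp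
  next
    case False
    have f: "forest xs" "s \<in> S" "set xs \<subseteq> S" using Cons.prems forest_S[of xs] by auto
    then obtain ds rs where *: "BB xs = BB (ds @ p # rs)" "set xs = set (ds @ p # rs)"
      "length xs = length (ds @ p # rs)" "forest (ds @ p # rs)" "\<forall>d\<in>set ds. \<forall>r\<in>set rs. d \<otimes> r = r \<otimes> d"
      "\<forall>as bs. xs = as @ p # bs \<longrightarrow> set bs \<subseteq> set rs"
      using Cons False by auto
    have after: "set bs \<subseteq> set rs" if "s # xs = as @ p # bs" for as bs
    proof (cases as)
      case Nil
      then show ?thesis using that False by simp
    next
      case (Cons a as')
      then show ?thesis using that *(6) by simp
    qed
    have fs: "forest (s # ds @ p # rs)" using forest_Cons_cong[OF Cons.prems(1) *(4,2)] .
    show ?thesis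
    proof (cases "\<forall>r\<in>set rs. s \<otimes> r = r \<otimes> s")
      case True
      have "BB (s # xs) = BB ((s # ds) @ p # rs)" using BB_Cons_cong[OF *(1)] by simp
      moreover have "forest ((s # ds) @ p # rs)" using fs by simp
      moreover have "set (s # xs) = set ((s # ds) @ p # rs)" "length (s # xs) = length ((s # ds) @ p # rs)"
        using *(2,3) by auto
      moreover have "\<forall>d\<in>set (s # ds). \<forall>r\<in>set rs. d \<otimes> r = r \<otimes> d" using *(5) True by simp
      ultimately show ?thesis using after by blast
    next
      case False
      then obtain r where r: "r \<in> set rs" "s \<otimes> r \<noteq> r \<otimes> s" by blast
      \<comment> \<open>The only neighbour of s is r in the second block, so s commutes with ds and
        with p and can be moved behind p.\<close>
      have com: "s \<otimes> y = y \<otimes> s" if y: "y \<in> set (ds @ [p])" for y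
      proof (rule ccontr)
        assume "s \<otimes> y \<noteq> y \<otimes> s"
        then have "y = r" using fs r y by auto
        moreover have "r \<notin> set (ds @ [p])"
          using r(1) *(4) by (induction ds) auto
        ultimately show False using y by simp
      qed
      have S: "set (ds @ [p]) \<subseteq> S" "set rs \<subseteq> S" using f *(2) by auto
      have "BB (s # xs) = BB (s # (ds @ [p]) @ rs)" using BB_Cons_cong[OF *(1)] by simp
      also have "\<dots> = BB ((ds @ [p]) @ s # rs)" using f S com by (intro BB_move)
      finally have "BB (s # xs) = BB (ds @ p # s # rs)" by simp
      moreover have "forest (ds @ p # s # rs)" using forest_move[of "ds @ [p]" s rs] com fs by simp
      moreover have "set (s # xs) = set (ds @ p # s # rs)" "length (s # xs) = length (ds @ p # s # rs)"
        using *(2,3) by auto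
      moreover have "\<forall>d\<in>set ds. \<forall>r\<in>set (s # rs). d \<otimes> r = r \<otimes> d"
      proof (intro ballI)
        fix d r assume dr: "d \<in> set ds" "r \<in> set (s # rs)"
        show "d \<otimes> r = r \<otimes> d" using *(5) dr com[of d] by (cases "r = s") auto
      qed
      moreover have "\<forall>as bs. s # xs = as @ p # bs \<longrightarrow> set bs \<subseteq> set (s # rs)" using after by fastforce
      ultimately show ?thesis by blast
    qed
  qed
qed simp

text \<open>The outer factors X and Y record which letters of ds are taken on either side. They do
  not depend on the inner part, so another middle may be inserted between them.\<close>

lemma BB_append:
  assumes "set ds \<subseteq> S" "set ms \<subseteq> S" "v \<in> BB (ds @ ms)"
  shows "\<exists>X\<in>generate G (set ds). \<exists>Y\<in>generate G (set ds). \<exists>m\<in>BB ms. v = X \<otimes> m \<otimes> Y \<and>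
    (\<forall>ms' m'. set ms' \<subseteq> S \<longrightarrow> m' \<in> BB ms' \<longrightarrow> X \<otimes> m' \<otimes> Y \<in> BB (ds @ ms'))"
  using assms(1,3)
proof (induction ds arbitrary: v)
  case Nil
  have "\<one> \<otimes> m \<otimes> \<one> = m" if "set ms' \<subseteq> S" "m \<in> BB ms'" for m ms' using BB_closed that by auto
  then show ?case using Nil assms(2) by (intro bexI[of _ \<one>] bexI[of _ v]) auto
next
  case (Cons s ds)
  from Cons.prems(2) obtain a w b where 1: "v = a \<otimes> w \<otimes> b" "a \<in> {\<one>, s}" "b \<in> {\<one>, s}" "w \<in> BB (ds @ ms)"
    using BB_ConsE[of v s "ds @ ms"] by auto
  then obtain X Y m where 2: "X \<in> generate G (set ds)" "Y \<in> generate G (set ds)" "m \<in> BB ms" "w = X \<otimes> m \<otimes> Y"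
    "\<And>ms' m'. set ms' \<subseteq> S \<Longrightarrow> m' \<in> BB ms' \<Longrightarrow> X \<otimes> m' \<otimes> Y \<in> BB (ds @ ms')"
    using Cons.IH[of w] Cons.prems by auto
  have S: "set ds \<subseteq> S" "s \<in> S" using Cons.prems by auto
  have c: "a \<in> carrier G" "b \<in> carrier G" "X \<in> carrier G" "Y \<in> carrier G"
    using 1 2 S parab_closed[OF S(1)] by auto
  have ab: "a \<in> generate G (set (s # ds))" "b \<in> generate G (set (s # ds))"
    using 1 parab_S[of s "set (s # ds)"] by auto
  have X: "a \<otimes> X \<in> generate G (set (s # ds))" "Y \<otimes> b \<in> generate G (set (s # ds))"
    using parab_mult[OF ab(1) parab_mono[OF _ 2(1)]] parab_mult[OF parab_mono[OF _ 2(2)] ab(2)] by auto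
  have eq: "a \<otimes> X \<otimes> m' \<otimes> (Y \<otimes> b) = a \<otimes> (X \<otimes> m' \<otimes> Y) \<otimes> b" if "m' \<in> carrier G" for m'
    using c that by (simp add: m_assoc)
  have "v = a \<otimes> X \<otimes> m \<otimes> (Y \<otimes> b)" using eq[of m] 1 2 BB_closed[OF assms(2)] by simp
  moreover have "a \<otimes> X \<otimes> m' \<otimes> (Y \<otimes> b) \<in> BB ((s # ds) @ ms')" if "set ms' \<subseteq> S" "m' \<in> BB ms'" for ms' m'
    using eq[OF BB_closed[OF that]] BB_ConsI[OF 2(5)[OF that] 1(2,3)] by simp
  ultimately show ?case using X 2(3) by blast
qed

text \<open>C_{dw} = C_d C_w, and left multiplication by C_d commutes with taking the p-free part
  because d avoids p.\<close>

lemma pos_at_product: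
  assumes D: "D \<subseteq> S" and R: "R \<subseteq> S" "D \<inter> R = {}" and p: "p \<in> R"
    and dw: "d \<in> generate G D" "w \<in> generate G R"
    and B: "pos_at B p w" "\<And>z. z \<in> B \<Longrightarrow> z \<in> generate G R" "\<And>z. z \<in> B \<Longrightarrow> d \<otimes> z \<in> B'"
  shows "pos_at B' p (d \<otimes> w)"
proof -
  have K: "S - {p} \<subseteq> S" "D \<subseteq> S - {p}" using D R p by auto
  obtain L where L: "rho (S - {p}) (Cb w) = comb L"
    "\<forall>q\<in>set L. fst q \<ge> 1 \<and> snd q \<in> B \<and> snd q \<in> generate G (S - {p})"
    using B(1) unfolding pos_at_def by blast
  obtain Q where Q: "Q \<in> ops D {}" "Q (del \<one>) = Cb d" using ex_ops_Cb[OF D dw(1)] by blast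
  have "rho (S - {p}) (Cb (d \<otimes> w)) = rho (S - {p}) (Q (Cb w))"
    using Cb_disjoint[OF D R dw Q] by simp
  also have "\<dots> = Q (rho (S - {p}) (Cb w))" by (rule ops_rho[OF K _ Q(1)]) simp
  also have "\<dots> = (\<Sum>q\<leftarrow>L. scale (vp (int (fst q))) (Q (Cb (snd q))))"
    unfolding L(1) lin_comb[OF ops_lin[OF Q(1)]] ..
  also have "\<dots> = (\<Sum>q\<leftarrow>L. scale (vp (int (fst q))) (Cb (d \<otimes> snd q)))"
    using L(2) B(2) Cb_disjoint[OF D R dw(1) _ Q] by (intro sum_list_Cb_cong) simp
  also have "\<dots> = comb (map (\<lambda>q. (fst q, d \<otimes> snd q)) L)" by (simp add: comb_def comp_def)
  finally show ?thesis unfolding pos_at_def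
    using L(2) B(3) parab_mono[OF K(2) dw(1)]
    by (intro exI[of _ "map (\<lambda>q. (fst q, d \<otimes> snd q)) L"]) (auto intro: parab_mult)
qed

text \<open>The case where p is adjoined last. For pw the p-free part is v C_w, and wp follows by
  inversion; for pwp it is computed from the restriction of C_w at the neighbour r of p, which the
  hypothesis on ys provides.\<close>

lemma pos_at_leaf:
  assumes f: "forest (p # ys)"
    and IH: "\<And>r w. r \<in> set ys \<Longrightarrow> w \<in> BB ys \<Longrightarrow> w \<notin> generate G (S - {r}) \<Longrightarrow> pos_at (BB ys) r w"
    and v: "v \<in> BB (p # ys)" "v \<notin> generate G (S - {p})"
  shows "pos_at (BB (p # ys)) p v"
proof -
  let ?R = "set ys"
  have R: "?R \<subseteq> S" and p: "p \<in> S" "p \<notin> ?R" using f forest_S[of ys] by auto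
  have K: "S - {p} \<subseteq> S" "?R \<subseteq> S - {p}" using R p by auto
  have pY: "set (p # ys) \<subseteq> S" using R p by simp
  have sub: "BB ys \<subseteq> BB (p # ys)" by (rule BB_subset_Cons[OF R])
  have BW: "w \<in> generate G ?R" "w \<in> generate G (S - {p})" "w \<in> carrier G" if "w \<in> BB ys" for w
    using BB_parab[OF R that] parab_mono[OF K(2)] BB_closed[OF R that] by auto
  have one: "pos_at (BB (p # ys)) p (p \<otimes> w)" if w: "w \<in> BB ys" for w
  proof -
    have "Cb (p \<otimes> w) = Lc p (Cb w)" using Cb_left[OF R p BW(1)[OF w]] .
    moreover have "rho (S - {p}) (Lc p (Cb w)) = scale (vp 1) (Cb w)"
      using Cb_parab[OF K(1) BW(2)[OF w]] by (intro rho_Lc_free p(1)) auto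
    ultimately have "rho (S - {p}) (Cb (p \<otimes> w)) = comb [(1, w)]" by simp
    then show ?thesis unfolding pos_at_def using BW(2)[OF w] sub w by (intro exI[of _ "[(1, w)]"]) auto
  qed
  from v(1) obtain a w b where *: "v = a \<otimes> w \<otimes> b" "a \<in> {\<one>, p}" "b \<in> {\<one>, p}" "w \<in> BB ys" by (rule BB_ConsE)
  note w = BW[OF *(4)]
  consider "v = w" | "v = p \<otimes> w" | "v = w \<otimes> p" | "v = p \<otimes> w \<otimes> p"
    using * p w by auto
  then show ?thesis
  proof cases
    case 1
    then show ?thesis using v w by simp
  next
    case 2
    then show ?thesis using one *(4) by simp
  next
    case 3
    have "inv v = p \<otimes> inv w" using 3 p w by (simp add: inv_mult_group)
    then have "pos_at (BB (p # ys)) p (inv v)" using one BB_inv[OF R *(4)] by simp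
    then show ?thesis using BB_closed[OF pY v(1)] BB_inv[OF pY] by (intro pos_at_inv[of v]) auto
  next
    case 4
    have nc: "p \<otimes> w \<noteq> w \<otimes> p" using 4 v w p by auto
    then obtain r where r: "r \<in> ?R" "p \<otimes> r \<noteq> r \<otimes> p"
      using commute_generate[OF R _ _ w(1), of p] p by blast
    have com: "p \<otimes> t = t \<otimes> p" if "t \<in> ?R" "t \<noteq> r" for t
      using f r that by auto
    have Rr: "?R - {r} \<subseteq> S" "S - {r} \<subseteq> S" "?R \<inter> (S - {r}) = ?R - {r}" using R by auto
    have wr: "w \<notin> generate G (?R - {r})"
      using commute_generate[OF Rr(1), of p w] p com nc by blast
    then have "w \<notin> generate G (S - {r})" using parab_Int[OF R Rr(2) w(1)] Rr(3) by auto
    then obtain L where L: "rho (S - {r}) (Cb w) = comb L"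
      "\<forall>q\<in>set L. fst q \<ge> 1 \<and> snd q \<in> BB ys \<and> snd q \<in> generate G (S - {r})"
      using IH[OF r(1) *(4)] unfolding pos_at_def by blast
    have "snd q \<in> generate G (?R - {r})" if "q \<in> set L" for q
      using parab_Int[OF R Rr(2), of "snd q"] BW(1) L(2) that Rr(3) by auto
    then have "rho (S - {p}) (Cb (p \<otimes> w \<otimes> p)) = comb ((2, w) # filter (\<lambda>q. fst q \<noteq> 1) L)"
      using L(2) by (intro Cb_leaf(3)[OF R p r com w(1) wr L(1)]) auto
    then show ?thesis unfolding pos_at_def 4
      using L(2) *(4) sub BW(2) by (intro exI[of _ "(2, w) # filter (\<lambda>q. fst q \<noteq> 1) L"]) auto
  qed
qed

text \<open>Write v = X m Y, where m is w with c possibly adjoined on either side. If c is adjoined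
  on at most one side, or commutes with w, then v is up to inversion a product with disjoint
  supports. Otherwise m = cwc, and the positivity of A = X c Y at c is combined with that of w at
  p.\<close>

lemma pos_at_pivot:
  assumes f: "forest (ds @ c # rs)" and com: "\<forall>d\<in>set ds. \<forall>r\<in>set rs. d \<otimes> r = r \<otimes> d"
    and p: "p \<in> set rs" "c \<otimes> p \<noteq> p \<otimes> c"
    and IH1: "\<And>w. w \<in> BB rs \<Longrightarrow> w \<notin> generate G (S - {p}) \<Longrightarrow> pos_at (BB rs) p w"
    and IH2: "\<And>w. w \<in> BB (ds @ [c]) \<Longrightarrow> w \<notin> generate G (S - {c}) \<Longrightarrow> pos_at (BB (ds @ [c])) c w"
    and v: "v \<in> BB (ds @ c # rs)" "v \<notin> generate G (S - {p})"
  shows "pos_at (BB (ds @ c # rs)) p v"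
proof -
  let ?E = "set ds" and ?R = "set rs" and ?B = "BB (ds @ c # rs)"
  have S: "?E \<subseteq> S" "?R \<subseteq> S" "c \<in> S" "set (c # rs) \<subseteq> S" "set (ds @ [c]) \<subseteq> S" "set (ds @ c # rs) \<subseteq> S" "set [c] \<subseteq> S"
    using forest_S[OF f] by auto
  have disj: "?E \<inter> ?R = {}" "c \<notin> ?E" "c \<notin> ?R" using f by (induction ds) auto
  have fc: "forest (c # rs)" using forest_append[OF f] by simp
  have comc: "c \<otimes> r = r \<otimes> c" if "r \<in> ?R" "r \<noteq> p" for r using fc p that by auto
  have cc: "c \<in> carrier G" using S by simp
  define D where "D = insert c ?E"
  have D: "D \<subseteq> S" "D \<inter> ?R = {}" "?E \<subseteq> D" "p \<notin> D" "D = set (ds @ [c])" using S disj p by (auto simp: D_def)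
  have K: "S - {p} \<subseteq> S" "D \<subseteq> S - {p}" "S - {c} \<subseteq> S" "?R - {p} \<subseteq> S" "?E \<subseteq> S - {c}" "D \<inter> (S - {c}) = ?E"
    "?R \<inter> (S - {p}) = ?R - {p}"
    using S D disj by (auto simp: D_def)
  have Rw: "z \<in> generate G ?R" "z \<in> carrier G" if "z \<in> BB rs" for z
    using BB_parab[OF S(2) that] BB_closed[OF S(2) that] by auto
  have xz: "x \<otimes> z = z \<otimes> x" if "x \<in> generate G ?E" "z \<in> generate G ?R" for x z
    by (rule parab_commute[OF S(1,2) _ that]) (use com in blast)
  from BB_append[OF S(1,4) v(1)] obtain X Y m where XY: "X \<in> generate G ?E" "Y \<in> generate G ?E" "m \<in> BB (c # rs)" "v = X \<otimes> m \<otimes> Y"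
    and XB: "\<And>ms' m'. set ms' \<subseteq> S \<Longrightarrow> m' \<in> BB ms' \<Longrightarrow> X \<otimes> m' \<otimes> Y \<in> BB (ds @ ms')" by blast
  have XYc: "X \<in> carrier G" "Y \<in> carrier G" using parab_closed[OF S(1)] XY by auto
  from XY(3) obtain a w b where *: "m = a \<otimes> w \<otimes> b" "a \<in> {\<one>, c}" "b \<in> {\<one>, c}" "w \<in> BB rs" by (rule BB_ConsE)
  note w = Rw[OF *(4)]
  have ED: "x \<in> generate G D" if "x \<in> generate G ?E" for x using parab_mono[OF D(3) that] .
  have kD: "X \<otimes> k \<otimes> Y \<in> generate G D" if "k \<in> {\<one>, c}" for k
  proof -
    have "c \<in> generate G D" by (rule parab_S) (simp add: D_def)
    then have "k \<in> generate G D" using that by auto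
    then show ?thesis by (intro parab_mult[OF parab_mult[OF ED[OF XY(1)]] ED[OF XY(2)]])
  qed
  have wp: "w \<notin> generate G (S - {p})"
  proof
    assume wS: "w \<in> generate G (S - {p})"
    have "a \<in> generate G (S - {p})" "b \<in> generate G (S - {p})"
      using * parab_S[of c "S - {p}"] S p disj by auto
    moreover have "X \<in> generate G (S - {p})" "Y \<in> generate G (S - {p})"
      using parab_mono[OF K(2) ED] XY by auto
    ultimately have "v \<in> generate G (S - {p})" unfolding XY(4) *(1) using wS by (intro parab_mult)
    then show False using v by simp
  qed
  have pw: "pos_at (BB rs) p w'" if "w' \<in> BB rs" "w' \<notin> generate G (S - {p})" for w' using IH1 that .
  have kz: "(X \<otimes> k \<otimes> Y) \<otimes> z = X \<otimes> (k \<otimes> z) \<otimes> Y" if "k \<in> {\<one>, c}" "z \<in> generate G ?R" for k z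
  proof -
    have zc: "z \<in> carrier G" "k \<in> carrier G" using that cc parab_closed[OF S(2)] by auto
    have "(X \<otimes> k \<otimes> Y) \<otimes> z = X \<otimes> k \<otimes> (Y \<otimes> z)" using zc XYc by (simp add: m_assoc)
    also have "\<dots> = X \<otimes> (k \<otimes> z) \<otimes> Y" unfolding xz[OF XY(2) that(2)] using zc XYc by (simp add: m_assoc)
    finally show ?thesis .
  qed
  have kB: "(X \<otimes> k \<otimes> Y) \<otimes> z \<in> ?B" if "k \<in> {\<one>, c}" "z \<in> BB rs" for k z
  proof -
    have "k \<otimes> z \<otimes> \<one> \<in> BB (c # rs)" using that by (intro BB_ConsI) auto
    then have "k \<otimes> z \<in> BB (c # rs)" using Rw(2)[OF that(2)] that(1) cc by auto
    then show ?thesis using kz[OF that(1) Rw(1)[OF that(2)]] XB[OF S(4)] by simp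
  qed
  have product: "pos_at ?B p ((X \<otimes> k \<otimes> Y) \<otimes> w')" if "k \<in> {\<one>, c}" "w' \<in> BB rs" "w' \<notin> generate G (S - {p})" for k w'
    using pw[OF that(2,3)] kD[OF that(1)] kB[OF that(1)] Rw(1) that(2)
    by (intro pos_at_product[where B = "BB rs", OF D(1) S(2) D(2) p(1)]) auto
  have Bc: "z \<in> carrier G" if "z \<in> ?B" for z using BB_closed[OF S(6) that] .
  consider (left) k where "k \<in> {\<one>, c}" "m = k \<otimes> w" | (right) "m = w \<otimes> c"
    | (both) "m = c \<otimes> w \<otimes> c" "c \<otimes> w \<noteq> w \<otimes> c"
  proof -
    have "m = w" if "a = c" "b = c" "c \<otimes> w = w \<otimes> c" using that * S w by simp
    then show ?thesis using * left right both w cc by (cases "c \<otimes> w = w \<otimes> c") force+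
  qed
  then show ?thesis
  proof cases
    case left
    have "v = (X \<otimes> k \<otimes> Y) \<otimes> w" using kz[OF left(1) w(1)] XY(4) left by simp
    then show ?thesis using product[OF left(1) *(4) wp] by simp
  next
    case right
    have iw: "inv w \<in> BB rs" "inv w \<notin> generate G (S - {p})"
      using BB_inv[OF S(2) *(4)] wp parab_inv_iff[OF K(1) w(2)] by auto
    have XY': "X \<otimes> w = w \<otimes> X" using xz[OF XY(1) w(1)] .
    have "v = w \<otimes> (X \<otimes> c \<otimes> Y)"
    proof -
      have "v = X \<otimes> w \<otimes> c \<otimes> Y" using XY(4) right XYc w cc by (simp add: m_assoc)
      then show ?thesis unfolding XY' using XYc w cc by (simp add: m_assoc)
    qed
    then have iv: "inv v = inv (X \<otimes> c \<otimes> Y) \<otimes> inv w" using XYc w cc by (simp add: inv_mult_group)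
    have dinv: "inv (X \<otimes> c \<otimes> Y) \<in> generate G D" using parab_inv[OF D(1) kD[of c]] by simp
    have "inv (X \<otimes> c \<otimes> Y) \<otimes> z \<in> ?B" if "z \<in> BB rs" for z
    proof -
      have iz: "inv z \<in> BB rs" "z \<in> carrier G" using BB_inv[OF S(2) that] Rw that by auto
      have "\<one> \<otimes> inv z \<otimes> c \<in> BB (c # rs)" using iz by (intro BB_ConsI) auto
      then have "inv z \<otimes> c \<in> BB (c # rs)" using iz cc by simp
      then have "X \<otimes> (inv z \<otimes> c) \<otimes> Y \<in> ?B" using XB[OF S(4)] by simp
      moreover have "X \<otimes> (inv z \<otimes> c) \<otimes> Y = inv z \<otimes> (X \<otimes> c \<otimes> Y)"
      proof -
        have "X \<otimes> (inv z \<otimes> c) \<otimes> Y = X \<otimes> inv z \<otimes> c \<otimes> Y" using XYc iz cc by (simp add: m_assoc)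
        then show ?thesis unfolding xz[OF XY(1) Rw(1)[OF iz(1)]] using XYc iz cc by (simp add: m_assoc)
      qed
      ultimately have "inv (inv z \<otimes> (X \<otimes> c \<otimes> Y)) \<in> ?B" using BB_inv[OF S(6)] by simp
      then show ?thesis using iz XYc cc by (simp add: inv_mult_group)
    qed
    then have "pos_at ?B p (inv v)" unfolding iv
      using pw[OF iw] Rw(1) iw(1) dinv by (intro pos_at_product[where B = "BB rs", OF D(1) S(2) D(2) p(1)]) auto
    then show ?thesis using Bc[OF v(1)] BB_inv[OF S(6)] by (intro pos_at_inv[of v]) auto
  next
    case both
    \<comment> \<open>A is v with cwc replaced by c. It uses only the letters of ds and c, so the
      second hypothesis describes its c-free part.\<close>
    define A where "A = X \<otimes> c \<otimes> Y"
    have AB: "A \<in> BB (ds @ [c])"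
    proof -
      have "c \<otimes> \<one> \<otimes> \<one> \<in> BB [c]" by (intro BB_ConsI) auto
      then show ?thesis unfolding A_def using XB[OF S(7)] cc by simp
    qed
    have An: "A \<notin> generate G (S - {c})"
    proof
      assume "A \<in> generate G (S - {c})"
      then have "c \<in> generate G (S - {c})"
        using parab_mult_right_iff[OF K(3) parab_mono[OF K(5) XY(2)], of "X \<otimes> c"]
          parab_mult_left_iff[OF K(3) parab_mono[OF K(5) XY(1)], of c] cc XYc by (simp add: A_def)
      then show False using S_parab_iff[OF K(3) S(3)] by simp
    qed
    obtain LE where LE: "rho (S - {c}) (Cb A) = comb LE"
      "\<forall>q\<in>set LE. fst q \<ge> 1 \<and> snd q \<in> BB (ds @ [c]) \<and> snd q \<in> generate G (S - {c})"
      using IH2[OF AB An] unfolding pos_at_def by blast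
    obtain L where L: "rho (S - {p}) (Cb w) = comb L"
      "\<forall>q\<in>set L. fst q \<ge> 1 \<and> snd q \<in> BB rs \<and> snd q \<in> generate G (S - {p})"
      using pw[OF *(4) wp] unfolding pos_at_def by blast
    have LE': "snd q \<in> generate G ?E" if "q \<in> set LE" for q
      using parab_Int[OF D(1) K(3), of "snd q"] BB_parab[OF S(5), of "snd q"] LE(2) that K(6) D(5) by auto
    have L': "snd q \<in> generate G (?R - {p})" if "q \<in> set L" for q
      using parab_Int[OF S(2) K(1), of "snd q"] Rw(1) L(2) that K(7) by auto
    have wRp: "w \<notin> generate G (?R - {p})"
      using commute_generate[OF K(4) cc _, of w] comc both(2) by blast
    have "\<exists>L'. rho (S - {p}) (Cb (X \<otimes> (c \<otimes> w \<otimes> c) \<otimes> Y)) = comb L' \<and>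
      (\<forall>k\<in>set L'. fst k \<ge> 1 \<and> (\<exists>z\<in>snd ` set L. snd k = A \<otimes> z \<or> (\<exists>x\<in>snd ` set LE. snd k = x \<otimes> z)))"
    proof (rule Cb_pivot[OF S(1,2) disj(1) S(3) disj(2,3) p comc _ XY(1,2) A_def LE(1) _ w(1) wRp L(1)])
      show "e \<otimes> r = r \<otimes> e" if "e \<in> ?E" "r \<in> ?R" for e r using com that by blast
      show "fst q \<ge> 1 \<and> snd q \<in> generate G ?E" if "q \<in> set LE" for q using LE(2) LE' that by blast
      show "fst q \<ge> 1 \<and> snd q \<in> generate G (?R - {p})" if "q \<in> set L" for q using L(2) L' that by blast
    qed
    then obtain L' where L'': "rho (S - {p}) (Cb v) = comb L'"
      "\<And>k. k \<in> set L' \<Longrightarrow> fst k \<ge> 1 \<and> (\<exists>z\<in>snd ` set L. snd k = A \<otimes> z \<or> (\<exists>x\<in>snd ` set LE. snd k = x \<otimes> z))"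
      using XY(4) both(1) by blast
    \<comment> \<open>A c-free x has trivial middle part, so z, which commutes with the outer
      factors, can be inserted in the middle of x.\<close>
    have xB: "x \<otimes> z \<in> ?B" if xx: "x \<in> BB (ds @ [c])" "x \<in> generate G (S - {c})" and zz: "z \<in> BB rs" for x z
    proof -
      from BB_append[OF S(1,7) xx(1)] obtain X' Y' k where X': "X' \<in> generate G ?E" "Y' \<in> generate G ?E" "k \<in> BB [c]" "x = X' \<otimes> k \<otimes> Y'"
        "\<And>ms' m'. set ms' \<subseteq> S \<Longrightarrow> m' \<in> BB ms' \<Longrightarrow> X' \<otimes> m' \<otimes> Y' \<in> BB (ds @ ms')" by blast
      have X'c: "X' \<in> carrier G" "Y' \<in> carrier G" "k \<in> carrier G" "z \<in> carrier G"
        using parab_closed[OF S(1)] X' BB_closed[OF S(7)] Rw zz by auto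
      have "k \<in> generate G (S - {c})"
        using parab_mult_right_iff[OF K(3) parab_mono[OF K(5) X'(2)], of "X' \<otimes> k"]
          parab_mult_left_iff[OF K(3) parab_mono[OF K(5) X'(1)], of k] X'c X'(4) xx(2) by simp
      then have "k \<noteq> c" using S_parab_iff[OF K(3) S(3)] by auto
      moreover have "k = \<one> \<or> k = c" using X'(3) S(3) by (auto simp: BB.simps(2))
      ultimately have "x \<otimes> z = X' \<otimes> (Y' \<otimes> z)" using X'(4) X'c by (simp add: m_assoc)
      also have "\<dots> = X' \<otimes> z \<otimes> Y'" unfolding xz[OF X'(2) Rw(1)[OF zz]] using X'c by (simp add: m_assoc)
      also have "z \<in> BB (c # rs)" using BB_subset_Cons[OF S(2)] zz by blast
      then have "X' \<otimes> z \<otimes> Y' \<in> ?B" using X'(5)[OF S(4)] by simp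
      finally show ?thesis .
    qed
    show ?thesis unfolding pos_at_def
    proof (intro exI[of _ L'] conjI ballI)
      fix k assume k: "k \<in> set L'"
      show "fst k \<ge> 1" using L''(2)[OF k] by blast
      from L''(2)[OF k] obtain z where z: "z \<in> snd ` set L" "snd k = A \<otimes> z \<or> (\<exists>x\<in>snd ` set LE. snd k = x \<otimes> z)" by blast
      have zB: "z \<in> BB rs" "z \<in> generate G (S - {p})" using z(1) L(2) by auto
      have DS: "y \<in> generate G (S - {p})" if "y \<in> generate G D" for y using parab_mono[OF K(2) that] .
      from z(2) show "snd k \<in> ?B"
      proof
        assume "snd k = A \<otimes> z"
        then show ?thesis using kB[of c z] zB by (simp add: A_def)
      next
        assume "\<exists>x\<in>snd ` set LE. snd k = x \<otimes> z"
        then show ?thesis using xB zB LE(2) by auto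
      qed
      from z(2) show "snd k \<in> generate G (S - {p})"
      proof
        assume "snd k = A \<otimes> z"
        then show ?thesis using DS[OF kD[of c]] zB by (simp add: A_def parab_mult)
      next
        assume "\<exists>x\<in>snd ` set LE. snd k = x \<otimes> z"
        then obtain q where q: "q \<in> set LE" "snd k = snd q \<otimes> z" by blast
        then show ?thesis using parab_mult[OF DS[OF ED[OF LE'[OF q(1)]]] zB(2)] by simp
      qed
    qed (rule L''(1))
  qed
qed

text \<open>If p commutes with all letters adjoined after it, it can be moved to the head of the
  list. Otherwise the forest is cut at a neighbour c adjoined after p. Both pieces are shorter: rs
  lacks c, and the piece ds with c lacks p.\<close>

theorem pos_at_forest:
  "forest xs \<Longrightarrow> p \<in> set xs \<Longrightarrow> v \<in> BB xs \<Longrightarrow> v \<notin> generate G (S - {p}) \<Longrightarrow> pos_at (BB xs) p v"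
proof (induction "length xs" arbitrary: xs p v rule: less_induct)
  case less
  obtain as cs where xs: "xs = as @ p # cs" using less.prems(2) split_list by fast
  have S: "set xs \<subseteq> S" using forest_S less by blast
  show ?case
  proof (cases "\<forall>a\<in>set as. p \<otimes> a = a \<otimes> p")
    case True
    have B: "BB (p # as @ cs) = BB xs" unfolding xs using S xs True by (intro BB_move) auto
    have f: "forest (p # as @ cs)" using forest_move[of as p cs] True less.prems(1) xs by blast
    have "pos_at (BB (p # as @ cs)) p v"
    proof (rule pos_at_leaf[OF f])
      fix r w assume "r \<in> set (as @ cs)" "w \<in> BB (as @ cs)" "w \<notin> generate G (S - {r})"
      then show "pos_at (BB (as @ cs)) r w" using f xs by (intro less.hyps) auto
    qed (use less.prems B in auto)
    then show ?thesis using B by simp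
  next
    case False
    then obtain c where c: "c \<in> set as" "p \<otimes> c \<noteq> c \<otimes> p" by blast
    then obtain a1 a2 where as: "as = a1 @ c # a2" using split_list by fast
    have "c \<in> set xs" using c xs by simp
    from forest_decompose[OF less.prems(1) this] obtain ds rs where *: "BB xs = BB (ds @ c # rs)"
      "set xs = set (ds @ c # rs)" "length xs = length (ds @ c # rs)" "forest (ds @ c # rs)"
      "\<forall>d\<in>set ds. \<forall>r\<in>set rs. d \<otimes> r = r \<otimes> d" "\<forall>as bs. xs = as @ c # bs \<longrightarrow> set bs \<subseteq> set rs" by blast
    have "xs = a1 @ c # (a2 @ p # cs)" using xs as by simp
    then have p: "p \<in> set rs" using *(6) by fastforce
    have f: "forest rs" "forest (ds @ [c])"
      using forest_append[of ds "c # rs"] forest_append[of "ds @ [c]" rs] *(4) by auto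
    have "pos_at (BB (ds @ c # rs)) p v"
    proof (rule pos_at_pivot[OF *(4,5) p])
      show "pos_at (BB rs) p w" if "w \<in> BB rs" "w \<notin> generate G (S - {p})" for w
        using f p that *(3) by (intro less.hyps) auto
      show "pos_at (BB (ds @ [c])) c w" if "w \<in> BB (ds @ [c])" "w \<notin> generate G (S - {c})" for w
        using f p that *(3) by (intro less.hyps) (auto simp: length_greater_0_conv[symmetric] simp del: length_greater_0_conv)
    qed (use less.prems * c in auto)
    then show ?thesis using * by simp
  qed
qed

end

section \<open>Monotonicity of the alternating sums\<close>

context coxeter_system
begin

definition sgnv :: "nat \<Rightarrow> lau" where
  "sgnv n = (- 1) ^ n * vp (int n)"

lemma sgnv_Suc: "sgnv (Suc n) = - (vp 1 * sgnv n)"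
proof -
  have e: "vp (int (Suc n)) = vp 1 * vp (int n)" by simp
  show ?thesis unfolding sgnv_def e power_Suc by (simp only: mult_minus_left mult_minus_right mult_1_left mult.left_commute)
qed

text \<open>The weight (-v)^l(w) absorbs the factor v^-l(w) in the coefficient of C_v at wu, so that
  all terms carry the same power of v. Since W_J may be infinite, the sum runs over the support
  only.\<close>

definition parsum :: "'a set \<Rightarrow> ('a \<Rightarrow> lau) \<Rightarrow> 'a \<Rightarrow> lau" where
  "parsum J h u = (\<Sum>w | w \<in> generate G J \<and> h (w \<otimes> u) \<noteq> 0. sgnv (len w) * h (w \<otimes> u))"

lemma finite_coset_support:
  assumes "J \<subseteq> S" "finite {y. h y \<noteq> 0}" "u \<in> carrier G"
  shows "finite {w \<in> generate G J. h (w \<otimes> u) \<noteq> 0}"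
proof (rule finite_imageD)
  show "inj_on (\<lambda>w. w \<otimes> u) {w \<in> generate G J. h (w \<otimes> u) \<noteq> 0}"
    using assms parab_closed[OF assms(1)] by (auto simp: inj_on_def)
  show "finite ((\<lambda>w. w \<otimes> u) ` {w \<in> generate G J. h (w \<otimes> u) \<noteq> 0})"
    by (rule finite_subset[OF _ assms(2)]) auto
qed

lemma parsum_superset:
  assumes "finite A" "A \<subseteq> generate G J" "\<And>w. w \<in> generate G J \<Longrightarrow> h (w \<otimes> u) \<noteq> 0 \<Longrightarrow> w \<in> A"
  shows "parsum J h u = (\<Sum>w\<in>A. sgnv (len w) * h (w \<otimes> u))"
  unfolding parsum_def using assms by (intro sum.mono_neutral_left) auto

lemma parsum_cong:
  "(\<And>w. w \<in> generate G J \<Longrightarrow> h (w \<otimes> u) = k (w \<otimes> u)) \<Longrightarrow> parsum J h u = parsum J k u"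
  unfolding parsum_def by (intro sum.cong) auto

lemma parsum_add:
  assumes "J \<subseteq> S" "h \<in> Hm" "k \<in> Hm" "u \<in> carrier G"
  shows "parsum J (h + k) u = parsum J h u + parsum J k u"
proof -
  let ?A = "{w \<in> generate G J. h (w \<otimes> u) \<noteq> 0} \<union> {w \<in> generate G J. k (w \<otimes> u) \<noteq> 0}"
  have A: "finite ?A" "?A \<subseteq> generate G J"
    using finite_coset_support[OF assms(1) Hm_finite _ ] assms by auto
  have "parsum J h u = (\<Sum>w\<in>?A. sgnv (len w) * h (w \<otimes> u))"
    "parsum J k u = (\<Sum>w\<in>?A. sgnv (len w) * k (w \<otimes> u))"
    "parsum J (h + k) u = (\<Sum>w\<in>?A. sgnv (len w) * (h + k) (w \<otimes> u))"
    by (rule parsum_superset[OF A]; fastforce)+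
  then show ?thesis by (simp add: sum.distrib distrib_left)
qed

lemma parsum_scale:
  assumes "J \<subseteq> S" "h \<in> Hm" "u \<in> carrier G"
  shows "parsum J (scale a h) u = a * parsum J h u"
proof -
  have "parsum J (scale a h) u = (\<Sum>w\<in>{w \<in> generate G J. h (w \<otimes> u) \<noteq> 0}. sgnv (len w) * scale a h (w \<otimes> u))"
    by (rule parsum_superset) (use finite_coset_support[OF assms(1) Hm_finite[OF assms(2)] assms(3)] in auto)
  then show ?thesis by (simp add: parsum_def sum_distrib_left mult.left_commute)
qed

text \<open>The involution f changes the length by one and the value by the factor v that
  compensates the weights, so paired terms are opposite and the sum equals its negative.\<close>

lemma parsum_cancel:
  assumes J: "J \<subseteq> S" and h: "h \<in> Hm" and u: "u \<in> carrier G"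
    and f: "\<And>w. w \<in> generate G J \<Longrightarrow> f w \<in> generate G J \<and> f (f w) = w"
    and len: "\<And>w. w \<in> generate G J \<Longrightarrow> len (f w) = Suc (len w) \<or> len w = Suc (len (f w))"
    and X: "\<And>w. w \<in> generate G J \<Longrightarrow> len (f w) = Suc (len w) \<Longrightarrow> h (w \<otimes> u) = vp 1 * h (f w \<otimes> u)"
  shows "parsum J h u = 0"
proof -
  let ?A = "{w. w \<in> generate G J \<and> h (w \<otimes> u) \<noteq> 0}"
  let ?t = "\<lambda>w. sgnv (len w) * h (w \<otimes> u)"
  have up: "?t (f w) = - ?t w" if "w \<in> generate G J" "len (f w) = Suc (len w)" for w
    using X[OF that] that(2) by (simp add: sgnv_Suc mult.left_commute mult.commute)
  have t: "?t (f w) = - ?t w" if w: "w \<in> generate G J" for w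
  proof (cases "len (f w) = Suc (len w)")
    case False
    then have "len w = Suc (len (f w))" using len[OF w] by simp
    then show ?thesis using up[of "f w"] f[OF w] by simp
  qed (use up w in simp)
  have nz: "sgnv n \<noteq> 0" for n by (simp add: sgnv_def)
  have fA: "f w \<in> ?A" if "w \<in> ?A" for w
  proof -
    have "?t w \<noteq> 0" using that nz by simp
    then have "?t (f w) \<noteq> 0" using t[of w] that by simp
    then show ?thesis using f that by auto
  qed
  have "(\<Sum>w\<in>?A. ?t w) = (\<Sum>w\<in>?A. ?t (f w))"
    by (rule sum.reindex_bij_witness[of _ f f]) (use f fA in auto)
  also have "\<dots> = - (\<Sum>w\<in>?A. ?t w)" using t by (simp add: sum_negf)
  finally have "2 * (\<Sum>w\<in>?A. ?t w) = 0" by simp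
  then show ?thesis unfolding parsum_def by simp
qed

text \<open>The property shared by all left multiples of C_s. Together with \<open>rdesc\<close> it
  is what the cancellation arguments need from a basis element.\<close>

definition ldesc :: "'a \<Rightarrow> ('a \<Rightarrow> lau) \<Rightarrow> bool" where
  "ldesc s h \<longleftrightarrow> (\<forall>y\<in>carrier G. \<not> dl s y \<longrightarrow> h y = vp 1 * h (s \<otimes> y))"

definition rdesc :: "'a \<Rightarrow> ('a \<Rightarrow> lau) \<Rightarrow> bool" where
  "rdesc s h \<longleftrightarrow> (\<forall>y\<in>carrier G. \<not> dr y s \<longrightarrow> h y = vp 1 * h (y \<otimes> s))"

lemma ldesc_Lc: "s \<in> S \<Longrightarrow> ldesc s (Lc s h)"
  using dl_flip len_neq(2) unfolding ldesc_def
  by (auto simp: Lc_def distrib_left not_less le_less)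

lemma rdesc_Rc: "s \<in> S \<Longrightarrow> rdesc s (Rc s h)"
  using dr_flip len_neq(1) unfolding rdesc_def
  by (auto simp: Rc_def distrib_left not_less le_less)

lemma parsum_left_descent:
  assumes J: "J \<subseteq> S" and h: "h \<in> Hm" "ldesc s h" and u: "u \<in> mcr J" and s: "s \<in> J"
  shows "parsum J h u = 0"
proof (rule parsum_cancel[OF J h(1) mcr_closed[OF u], where f = "\<lambda>w. s \<otimes> w"])
  fix w assume w: "w \<in> generate G J"
  have c: "w \<in> carrier G" "s \<in> S" "u \<in> carrier G" using w s J u by auto
  have sw: "s \<otimes> w \<in> generate G J" using parab_mult[OF parab_S[OF s] w] .
  then show "s \<otimes> w \<in> generate G J \<and> s \<otimes> (s \<otimes> w) = w" using c by simp
  show "len (s \<otimes> w) = Suc (len w) \<or> len w = Suc (len (s \<otimes> w))"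
    using len_mult_left[of s w] c by metis
  assume "len (s \<otimes> w) = Suc (len w)"
  then have "\<not> dl s (w \<otimes> u)" using len_mcr[OF J u w] len_mcr[OF J u sw] c by (simp add: m_assoc)
  then show "h (w \<otimes> u) = vp 1 * h (s \<otimes> w \<otimes> u)" using h(2) c by (simp add: ldesc_def m_assoc)
qed

text \<open>By Deodhar's lemma us = tu with t in J, so right multiplication of w by t realises right
  multiplication of wu by s and pairs the terms of the coset.\<close>

lemma parsum_right_descent:
  assumes J: "J \<subseteq> S" and h: "h \<in> Hm" "rdesc s h" and u: "u \<in> mcr J" and s: "s \<in> S" "u \<otimes> s \<notin> mcr J"
  shows "parsum J h u = 0"
proof -
  obtain t where t: "t \<in> J" "t \<otimes> u = u \<otimes> s" using mcr_right[OF J u s] by blast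
  show ?thesis
  proof (rule parsum_cancel[OF J h(1) mcr_closed[OF u], where f = "\<lambda>w. w \<otimes> t"])
    fix w assume w: "w \<in> generate G J"
    have c: "w \<in> carrier G" "t \<in> S" "u \<in> carrier G" using w t J u by auto
    have wt: "w \<otimes> t \<in> generate G J" using parab_mult[OF w parab_S[OF t(1)]] .
    then show "w \<otimes> t \<in> generate G J \<and> w \<otimes> t \<otimes> t = w" using c by simp
    show "len (w \<otimes> t) = Suc (len w) \<or> len w = Suc (len (w \<otimes> t))"
      using len_mult_right[of t w] c by metis
    have eq: "w \<otimes> t \<otimes> u = w \<otimes> u \<otimes> s" using t c s by (simp add: m_assoc)
    assume "len (w \<otimes> t) = Suc (len w)"
    then have "\<not> dr (w \<otimes> u) s" using len_mcr[OF J u w] len_mcr[OF J u wt] eq by simp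
    then show "h (w \<otimes> u) = vp 1 * h (w \<otimes> t \<otimes> u)" using h(2) c eq by (simp add: rdesc_def)
  qed
qed

text \<open>If us < u, the descent at s is shared by all wu, so the sums at u and us differ by a
  power of v. Only u with us > u remain to be examined.\<close>

lemma parsum_rdesc:
  assumes J: "J \<subseteq> S" and h: "h \<in> Hm" "rdesc s h" and u: "u \<in> mcr J" and s: "s \<in> S" "dr u s"
  shows "parsum J h u = vp (-1) * parsum J h (u \<otimes> s)"
proof -
  have us: "u \<otimes> s \<in> mcr J" using mcr_right_descent[OF J u s] .
  have c: "u \<in> carrier G" "u \<otimes> s \<in> carrier G" using u us by auto
  have *: "h (w \<otimes> (u \<otimes> s)) = vp 1 * h (w \<otimes> u)" if w: "w \<in> generate G J" for w
  proof -
    have wc: "w \<in> carrier G" using w J by simp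
    have "dr (w \<otimes> u) s" using dr_mcr[OF J u s(1) us w] s by simp
    then have "\<not> dr (w \<otimes> u \<otimes> s) s" using dr_flip[of s "w \<otimes> u"] wc c s by simp
    then show ?thesis using h(2) wc c s unfolding rdesc_def by (simp add: m_assoc)
  qed
  have "parsum J h (u \<otimes> s) = (\<Sum>w\<in>{w \<in> generate G J. h (w \<otimes> u) \<noteq> 0}. sgnv (len w) * h (w \<otimes> (u \<otimes> s)))"
    by (rule parsum_superset) (use finite_coset_support[OF J Hm_finite[OF h(1)] c(1)] * in auto)
  also have "\<dots> = vp 1 * parsum J h u"
    unfolding parsum_def sum_distrib_left using * by (intro sum.cong) (auto simp: mult.left_commute)
  finally show ?thesis by simp
qed

lemma parsum_Rc:
  assumes J: "J \<subseteq> S" and h: "h \<in> Hm" and u: "u \<in> mcr J" and s: "s \<in> S" "u \<otimes> s \<in> mcr J"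
  shows "parsum J (Rc s h) u = parsum J h (u \<otimes> s) + vp (if dr u s then -1 else 1) * parsum J h u"
proof -
  have c: "u \<in> carrier G" "u \<otimes> s \<in> carrier G" using u s by auto
  let ?A = "{w \<in> generate G J. h (w \<otimes> (u \<otimes> s)) \<noteq> 0} \<union> {w \<in> generate G J. h (w \<otimes> u) \<noteq> 0}"
  have A: "finite ?A" "?A \<subseteq> generate G J"
    using finite_coset_support[OF J Hm_finite[OF h]] c by auto
  have *: "Rc s h (w \<otimes> u) = h (w \<otimes> (u \<otimes> s)) + vp (if dr u s then -1 else 1) * h (w \<otimes> u)" if "w \<in> generate G J" for w
    using parab_closed[OF J that] c s dr_mcr[OF J u s that] by (simp add: Rc_def m_assoc)
  have "parsum J (Rc s h) u = (\<Sum>w\<in>?A. sgnv (len w) * Rc s h (w \<otimes> u))"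
    by (rule parsum_superset[OF A]) (use * in force)
  also have "\<dots> = (\<Sum>w\<in>?A. sgnv (len w) * h (w \<otimes> (u \<otimes> s)) + vp (if dr u s then -1 else 1) * (sgnv (len w) * h (w \<otimes> u)))"
    using * by (intro sum.cong) (auto simp: distrib_left mult.left_commute)
  also have "\<dots> = parsum J h (u \<otimes> s) + vp (if dr u s then -1 else 1) * parsum J h u"
    unfolding sum.distrib sum_distrib_left[symmetric]
    using parsum_superset[OF A, of h "u \<otimes> s"] parsum_superset[OF A, of h u] by auto
  finally show ?thesis .
qed

text \<open>Nonnegativity belongs to the induction hypothesis: where the sum over J vanishes, the
  comparison with I becomes nonnegativity of the sum over I.\<close>

definition coset_mono :: "('a \<Rightarrow> lau) \<Rightarrow> bool" where
  "coset_mono h \<longleftrightarrow> (\<forall>J u. J \<subseteq> S \<longrightarrow> u \<in> mcr J \<longrightarrow> nonneg (parsum J h u)) \<and>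
     (\<forall>I J u. I \<subseteq> J \<longrightarrow> J \<subseteq> S \<longrightarrow> u \<in> mcr J \<longrightarrow> nonneg (parsum I h u - parsum J h u))"

lemma coset_monoI:
  assumes "\<And>J u. J \<subseteq> S \<Longrightarrow> u \<in> mcr J \<Longrightarrow> nonneg (parsum J h u)"
    and "\<And>I J u. I \<subseteq> J \<Longrightarrow> J \<subseteq> S \<Longrightarrow> u \<in> mcr J \<Longrightarrow> u \<in> mcr I \<Longrightarrow> I \<subseteq> S \<Longrightarrow> nonneg (parsum I h u - parsum J h u)"
  shows "coset_mono h"
  unfolding coset_mono_def
proof (intro conjI allI impI)
  fix I J u assume *: "I \<subseteq> J" "J \<subseteq> S" "u \<in> mcr J"
  then have "u \<in> mcr I" "I \<subseteq> S" using mcr_antimono by blast+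
  then show "nonneg (parsum I h u - parsum J h u)" using assms(2) * by blast
qed (use assms(1) in blast)

lemma coset_monoD:
  assumes "coset_mono h" "J \<subseteq> S" "u \<in> mcr J"
  shows "nonneg (parsum J h u)" "I \<subseteq> J \<Longrightarrow> nonneg (parsum I h u - parsum J h u)"
  using assms unfolding coset_mono_def by blast+

lemma coset_mono_add:
  assumes "h \<in> Hm" "k \<in> Hm" "coset_mono h" "coset_mono k"
  shows "coset_mono (h + k)"
proof (rule coset_monoI)
  fix J u assume *: "J \<subseteq> S" "u \<in> mcr J"
  then show "nonneg (parsum J (h + k) u)"
    using assms by (simp add: parsum_add nonneg_add coset_monoD)
next
  fix I J u assume *: "I \<subseteq> J" "J \<subseteq> S" "u \<in> mcr J" "u \<in> mcr I" "I \<subseteq> S"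
  then have "parsum I (h + k) u - parsum J (h + k) u = (parsum I h u - parsum J h u) + (parsum I k u - parsum J k u)"
    using assms by (simp add: parsum_add)
  then show "nonneg (parsum I (h + k) u - parsum J (h + k) u)"
    using coset_monoD(2)[OF assms(3) *(2,3,1)] coset_monoD(2)[OF assms(4) *(2,3,1)] by (simp add: nonneg_add)
qed

lemma coset_mono_scale:
  assumes "h \<in> Hm" "coset_mono h"
  shows "coset_mono (scale (vp n) h)"
proof (rule coset_monoI)
  fix J u assume *: "J \<subseteq> S" "u \<in> mcr J"
  then show "nonneg (parsum J (scale (vp n) h) u)"
    using assms by (simp add: parsum_scale coset_monoD)
next
  fix I J u assume *: "I \<subseteq> J" "J \<subseteq> S" "u \<in> mcr J" "u \<in> mcr I" "I \<subseteq> S"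
  then show "nonneg (parsum I (scale (vp n) h) u - parsum J (scale (vp n) h) u)"
    using assms coset_monoD(2)[OF assms(2) *(2,3,1)] by (simp add: parsum_scale flip: right_diff_distrib)
qed

lemma coset_mono_0: "coset_mono 0"
  by (rule coset_monoI) (simp_all add: parsum_def)

lemma coset_mono_comb:
  assumes "\<And>q. q \<in> set L \<Longrightarrow> snd q \<in> carrier G \<and> coset_mono (Cb (snd q))"
  shows "comb L \<in> Hm \<and> coset_mono (comb L)"
  using assms
proof (induction L)
  case (Cons q L)
  then have q: "Cb (snd q) \<in> Hm" "coset_mono (Cb (snd q))" and L: "comb L \<in> Hm" "coset_mono (comb L)" by auto
  show ?case unfolding comb_Cons
    by (intro conjI Hm_add coset_mono_add Hm_scale coset_mono_scale q L)
qed (simp add: coset_mono_0)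

text \<open>If us is minimal for J, then C_s acts on the sums at u and us as it does on
  coefficients; otherwise the sum over J is 0 by cancellation.\<close>

lemma coset_mono_Rc:
  assumes h: "h \<in> Hm" "coset_mono h" and s: "s \<in> S"
  shows "coset_mono (Rc s h)"
proof (rule coset_monoI)
  have Rh: "Rc s h \<in> Hm" using h s by auto
  have nn: "nonneg (parsum J (Rc s h) u)" if J: "J \<subseteq> S" and u: "u \<in> mcr J" for J u
  proof (cases "u \<otimes> s \<in> mcr J")
    case True
    then show ?thesis
      using parsum_Rc[OF J h(1) u s True] coset_monoD(1)[OF h(2) J u] coset_monoD(1)[OF h(2) J True] by (simp add: nonneg_add)
  next
    case False
    then show ?thesis using parsum_right_descent[OF J Rh rdesc_Rc[OF s] u s] by simp
  qed
  then show "nonneg (parsum J (Rc s h) u)" if "J \<subseteq> S" "u \<in> mcr J" for J u using that .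
  fix I J u assume *: "I \<subseteq> J" "J \<subseteq> S" "u \<in> mcr J" "u \<in> mcr I" "I \<subseteq> S"
  show "nonneg (parsum I (Rc s h) u - parsum J (Rc s h) u)"
  proof (cases "u \<otimes> s \<in> mcr J")
    case True
    have "parsum I (Rc s h) u - parsum J (Rc s h) u = (parsum I h (u \<otimes> s) - parsum J h (u \<otimes> s)) +
      vp (if dr u s then -1 else 1) * (parsum I h u - parsum J h u)"
      using parsum_Rc[OF *(2) h(1) *(3) s True] parsum_Rc[OF *(5) h(1) *(4) s mcr_antimono[OF *(1) True]]
      by (simp add: right_diff_distrib)
    then show ?thesis
      using coset_monoD(2)[OF h(2) *(2,3,1)] coset_monoD(2)[OF h(2) *(2) True *(1)] by (simp add: nonneg_add)
  next
    case False
    then show ?thesis using parsum_right_descent[OF *(2) Rh rdesc_Rc[OF s] *(3) s] nn[OF *(5,4)] by simp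
  qed
qed

text \<open>Factor s w u = y x with y in W_{J'} and x minimal for J'; then wu = y (sx). A descent t
  in J of sx would make sts an inversion of x in W_R, which forces st = ts and t in J', against the
  minimality of x. So sx is minimal for J, and uniqueness gives w = y and u = sx.\<close>

lemma coset_left_factor:
  assumes J: "J \<subseteq> S" and R: "R \<subseteq> S" and s: "s \<in> S" "s \<notin> R" "s \<notin> J"
    and w: "w \<in> generate G J" and u: "u \<in> mcr J" and swu: "s \<otimes> (w \<otimes> u) \<in> generate G R"
  defines "J' \<equiv> {t \<in> J \<inter> R. s \<otimes> t = t \<otimes> s}"
  shows "w \<in> generate G J'" "s \<otimes> u \<in> generate G R" "s \<otimes> u \<in> mcr J'"
proof -
  have J': "J' \<subseteq> S" "J' \<subseteq> J" "J' \<subseteq> R" using J by (auto simp: J'_def)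
  have K: "S - {s} \<subseteq> S" "R \<subseteq> S - {s}" "J \<subseteq> S - {s}" using R J s by auto
  have c: "w \<in> carrier G" "u \<in> carrier G" using w u J by auto
  obtain y x where yx: "y \<in> generate G J'" "x \<in> mcr J'" "s \<otimes> (w \<otimes> u) = y \<otimes> x"
    using ex_decomp[OF J'(1), of "s \<otimes> (w \<otimes> u)"] s c by auto
  have yc: "y \<in> carrier G" "x \<in> carrier G" using yx J' by auto
  have "s \<otimes> y = y \<otimes> s"
    by (rule commute_generate[OF J'(1) _ _ yx(1)]) (use s in \<open>auto simp: J'_def\<close>)
  moreover have "w \<otimes> u = s \<otimes> (y \<otimes> x)" using yx(3)[symmetric] s c by simp
  ultimately have wu: "w \<otimes> u = y \<otimes> (s \<otimes> x)" using s yc by (metis S_closed m_assoc)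
  have xR: "x \<in> generate G R"
    using swu parab_mult_left_iff[OF R parab_mono[OF J'(3) yx(1)] yc(2)] yx(3) by simp
  have sx: "s \<otimes> x \<in> mcr J"
  proof (subst mcr_iff[OF J], intro conjI ballI)
    fix t assume t: "t \<in> J"
    have tS: "t \<in> S" "t \<noteq> s" "t \<in> carrier G" using t J s by auto
    show "\<not> dl t (s \<otimes> x)"
    proof
      assume "dl t (s \<otimes> x)"
      then have "eta (s \<otimes> x) t" using tS s yc by (simp add: dl_eta)
      then have e: "eta x (s \<otimes> t \<otimes> s)" using eta_mult[of s x t] tS s yc by simp
      then have "s \<otimes> t \<otimes> s \<in> generate G R" using eta_parab[OF R xR] tS s by auto
      then have "s \<otimes> t \<otimes> s \<in> generate G (S - {s})" using parab_mono[OF K(2)] by blast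
      moreover have "t \<in> generate G (S - {s})" using parab_S[of t "S - {s}"] tS by simp
      moreover have "s \<otimes> t = (s \<otimes> t \<otimes> s) \<otimes> s" using s tS by simp
      ultimately have com: "s \<otimes> t = t \<otimes> s" using commute_parab(2)[OF K(1) s(1)] by blast
      then have "s \<otimes> t \<otimes> s = t" using s tS by simp
      then have "eta x t" "t \<in> generate G R" using e \<open>s \<otimes> t \<otimes> s \<in> generate G R\<close> by auto
      then have "t \<in> J'" using S_parab_iff[OF R tS(1)] t com by (simp add: J'_def)
      moreover have "dl t x" using \<open>eta x t\<close> tS yc by (simp add: dl_eta)
      ultimately show False using yx(2) mcr_iff[OF J'(1)] by blast
    qed
  qed (use s yc in simp)
  note un = decomp_unique[OF J w parab_mono[OF J'(2) yx(1)] u sx wu]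
  have su: "s \<otimes> u = x" using un(2) s yc by simp
  show "w \<in> generate G J'" using un(1) yx(1) by simp
  show "s \<otimes> u \<in> generate G R" "s \<otimes> u \<in> mcr J'" using su xR yx(2) by auto
qed

text \<open>As s is not in J, the coset is s-free or avoids W_{S-s} altogether. In the first case
  C_s h is v h there; in the second only h(swu) survives, and by \<open>coset_left_factor\<close>
  the sum shrinks to the letters of J commuting with s.\<close>

lemma parsum_Lc:
  assumes J: "J \<subseteq> S" and R: "R \<subseteq> S" and s: "s \<in> S" "s \<notin> R" "s \<notin> J"
    and h: "h \<in> Hm" "\<And>y. h y \<noteq> 0 \<Longrightarrow> y \<in> generate G R" and u: "u \<in> mcr J"
  defines "J' \<equiv> {t \<in> J \<inter> R. s \<otimes> t = t \<otimes> s}"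
  shows "u \<in> generate G (S - {s}) \<Longrightarrow> parsum J (Lc s h) u = vp 1 * parsum J h u"
    and "u \<notin> generate G (S - {s}) \<Longrightarrow> s \<otimes> u \<in> generate G R \<Longrightarrow>
      parsum J (Lc s h) u = parsum J' h (s \<otimes> u) \<and> s \<otimes> u \<in> mcr J'"
    and "u \<notin> generate G (S - {s}) \<Longrightarrow> s \<otimes> u \<notin> generate G R \<Longrightarrow> parsum J (Lc s h) u = 0"
proof -
  have J': "J' \<subseteq> S" "J' \<subseteq> J" "J' \<subseteq> R" using J by (auto simp: J'_def)
  have K: "S - {s} \<subseteq> S" "R \<subseteq> S - {s}" "J \<subseteq> S - {s}" using R J s by auto
  have uc: "u \<in> carrier G" using u by simp
  have hK: "y \<in> generate G (S - {s})" if "h y \<noteq> 0" for y using h(2)[OF that] parab_mono[OF K(2)] by blast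
  have wK: "w \<in> generate G (S - {s})" "w \<in> carrier G" if "w \<in> generate G J" for w
    using parab_mono[OF K(3) that] parab_closed[OF J that] .
  {
    assume uK: "u \<in> generate G (S - {s})"
    have free: "rho (S - {s}) (Lc s h) = scale (vp 1) h" by (rule rho_Lc_free[OF s(1)]) (rule hK)
    have "parsum J (Lc s h) u = parsum J (scale (vp 1) h) u"
    proof (rule parsum_cong)
      fix w assume "w \<in> generate G J"
      then have "w \<otimes> u \<in> generate G (S - {s})" using parab_mult[OF wK(1) uK] by blast
      then show "Lc s h (w \<otimes> u) = scale (vp 1) h (w \<otimes> u)"
        using fun_cong[OF free, of "w \<otimes> u"] by (simp add: rho_def)
    qed
    then show "parsum J (Lc s h) u = vp 1 * parsum J h u" using parsum_scale[OF J h(1) uc] by simp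
  }
  assume uK: "u \<notin> generate G (S - {s})"
  have val: "Lc s h (w \<otimes> u) = h (s \<otimes> (w \<otimes> u))" if w: "w \<in> generate G J" for w
  proof -
    have "w \<otimes> u \<notin> generate G (S - {s})" using parab_mult_left_iff[OF K(1) wK(1)[OF w] uc] uK by simp
    then have "h (w \<otimes> u) = 0" using hK by blast
    then show ?thesis using wK(2)[OF w] uc by (simp add: Lc_def)
  qed
  have factor: "w \<in> generate G J'" "s \<otimes> u \<in> generate G R" "s \<otimes> u \<in> mcr J'"
    if "w \<in> generate G J" "s \<otimes> (w \<otimes> u) \<in> generate G R" for w
    using coset_left_factor[OF J R s that(1) u that(2)] unfolding J'_def by blast+
  {
    assume su: "s \<otimes> u \<in> generate G R"
    have suJ: "s \<otimes> u \<in> mcr J'" using factor(3)[of \<one>] su uc by simp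
    have com: "s \<otimes> (w \<otimes> u) = w \<otimes> (s \<otimes> u)" if "w \<in> generate G J'" for w
    proof -
      have wc: "w \<in> carrier G" using parab_closed[OF J'(1) that] .
      have "s \<otimes> w = w \<otimes> s"
        by (rule commute_generate[OF J'(1) _ _ that]) (use s in \<open>auto simp: J'_def\<close>)
      then have "s \<otimes> w \<otimes> u = w \<otimes> s \<otimes> u" by simp
      then show ?thesis using wc uc s by (simp add: m_assoc)
    qed
    let ?A = "{w \<in> generate G J'. h (w \<otimes> (s \<otimes> u)) \<noteq> 0}"
    have "parsum J (Lc s h) u = (\<Sum>w\<in>?A. sgnv (len w) * Lc s h (w \<otimes> u))"
    proof (rule parsum_superset)
      show "finite ?A" using finite_coset_support[OF J'(1) Hm_finite[OF h(1)]] uc s by simp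
      show "?A \<subseteq> generate G J" using parab_mono[OF J'(2)] by blast
      fix w assume w: "w \<in> generate G J" "Lc s h (w \<otimes> u) \<noteq> 0"
      then have nz: "h (s \<otimes> (w \<otimes> u)) \<noteq> 0" using val by simp
      then have "w \<in> generate G J'" using factor(1)[OF w(1)] h(2) by blast
      then show "w \<in> ?A" using nz com by simp
    qed
    also have "\<dots> = parsum J' h (s \<otimes> u)"
      unfolding parsum_def using val com parab_mono[OF J'(2)] by (intro sum.cong) auto
    finally show "parsum J (Lc s h) u = parsum J' h (s \<otimes> u) \<and> s \<otimes> u \<in> mcr J'" using suJ by simp
  }
  assume su: "s \<otimes> u \<notin> generate G R"
  have "Lc s h (w \<otimes> u) = 0" if "w \<in> generate G J" for w
    using val[OF that] factor(2)[OF that] su h(2) by metis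
  then show "parsum J (Lc s h) u = 0" unfolding parsum_def by (intro sum.neutral) auto
qed

text \<open>Which case of \<open>parsum_Lc\<close> occurs depends on u alone, so it is the same for
  I and J, and the reduced sets I' and J' are again nested.\<close>

lemma coset_mono_Lc:
  assumes R: "R \<subseteq> S" and s: "s \<in> S" "s \<notin> R"
    and h: "h \<in> Hm" "\<And>y. h y \<noteq> 0 \<Longrightarrow> y \<in> generate G R" and m: "coset_mono h"
  shows "coset_mono (Lc s h)"
proof (rule coset_monoI)
  have Lh: "Lc s h \<in> Hm" using h s by auto
  have zero: "parsum J (Lc s h) u = 0" if "J \<subseteq> S" "u \<in> mcr J" "s \<in> J" for J u
    using parsum_left_descent[OF that(1) Lh ldesc_Lc[OF s(1)] that(2,3)] .
  have nn: "nonneg (parsum J (Lc s h) u)" if J: "J \<subseteq> S" and u: "u \<in> mcr J" for J u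
  proof (cases "s \<in> J")
    case True
    then show ?thesis using zero J u by simp
  next
    case False
    have J': "{t \<in> J \<inter> R. s \<otimes> t = t \<otimes> s} \<subseteq> S" using J by blast
    note P = parsum_Lc[OF J R s False h u]
    consider "u \<in> generate G (S - {s})" | "u \<notin> generate G (S - {s})" "s \<otimes> u \<in> generate G R"
      | "u \<notin> generate G (S - {s})" "s \<otimes> u \<notin> generate G R" by blast
    then show ?thesis
    proof cases
      case 1
      then show ?thesis using P(1) coset_monoD(1)[OF m J u] by simp
    next
      case 2
      then show ?thesis using P(2) coset_monoD(1)[OF m J'] by simp
    next
      case 3
      then show ?thesis using P(3) by simp
    qed
  qed
  then show "nonneg (parsum J (Lc s h) u)" if "J \<subseteq> S" "u \<in> mcr J" for J u using that .
  fix I J u assume *: "I \<subseteq> J" "J \<subseteq> S" "u \<in> mcr J" "u \<in> mcr I" "I \<subseteq> S"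
  show "nonneg (parsum I (Lc s h) u - parsum J (Lc s h) u)"
  proof (cases "s \<in> J")
    case True
    then show ?thesis using zero *(2,3) nn[OF *(5,4)] by simp
  next
    case False
    then have sI: "s \<notin> I" using * by auto
    let ?J' = "{t \<in> J \<inter> R. s \<otimes> t = t \<otimes> s}" and ?I' = "{t \<in> I \<inter> R. s \<otimes> t = t \<otimes> s}"
    have J': "?J' \<subseteq> S" "?I' \<subseteq> ?J'" using * by blast+
    note P = parsum_Lc[OF *(2) R s False h *(3)] and Q = parsum_Lc[OF *(5) R s sI h *(4)]
    consider "u \<in> generate G (S - {s})" | "u \<notin> generate G (S - {s})" "s \<otimes> u \<in> generate G R"
      | "u \<notin> generate G (S - {s})" "s \<otimes> u \<notin> generate G R" by blast
    then show ?thesis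
    proof cases
      case 1
      then show ?thesis using P(1) Q(1) coset_monoD(2)[OF m *(2,3,1)] by (simp flip: right_diff_distrib)
    next
      case 2
      then show ?thesis using P(2) Q(2) coset_monoD(2)[OF m J'(1) _ J'(2)] by simp
    next
      case 3
      then show ?thesis using P(3) Q(3) by simp
    qed
  qed
qed

text \<open>With \<open>X = C\<close> at \<open>sws\<close> and \<open>s \<notin> J\<close>: either \<open>X\<close> may be replaced by its \<open>s\<close>-free restriction, or the
  double coset structure forces all surviving terms to come from \<open>v C\<close> at \<open>sw\<close>.\<close>
lemma parsum_leaf:
  assumes J: "J \<subseteq> S" and R: "R \<subseteq> S" and s: "s \<in> S" "s \<notin> R" "s \<notin> J"
    and h: "h \<in> Hm" "\<And>y. h y \<noteq> 0 \<Longrightarrow> y \<in> generate G R"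
    and k: "\<And>y. k y \<noteq> 0 \<Longrightarrow> y \<in> generate G (S - {s})"
    and X: "X = Rc s (Lc s h) - Rc s k"
    and u: "u \<in> mcr J" "u \<otimes> s \<in> mcr J" "\<not> dr u s"
  shows "parsum J X u = (if u \<in> generate G (S - {s}) then parsum J (rho (S - {s}) X) u else vp 1 * parsum J (Lc s h) u)"
proof -
  have K: "S - {s} \<subseteq> S" "R \<subseteq> S - {s}" "J \<subseteq> S - {s}" using R J s by auto
  have uc: "u \<in> carrier G" using u by simp
  have wK: "w \<in> generate G (S - {s})" "w \<in> carrier G" if "w \<in> generate G J" for w
    using parab_mono[OF K(3) that] parab_closed[OF J that] .
  have hK: "y \<in> generate G (S - {s})" if "h y \<noteq> 0" for y using h(2)[OF that] parab_mono[OF K(2)] by blast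
  show ?thesis
  proof (cases "u \<in> generate G (S - {s})")
    case True
    have "parsum J X u = parsum J (rho (S - {s}) X) u"
      using parab_mult[OF wK(1) True] by (intro parsum_cong) (simp add: rho_def)
    then show ?thesis using True by simp
  next
    case False
    have "X (w \<otimes> u) = scale (vp 1) (Lc s h) (w \<otimes> u)" if w: "w \<in> generate G J" for w
    proof -
      define y where "y = w \<otimes> u"
      have y: "y \<in> carrier G" "y \<notin> generate G (S - {s})" "\<not> dr y s"
        using wK[OF w] uc parab_mult_left_iff[OF K(1) wK(1)[OF w] uc] False dr_mcr[OF J u(1) s(1) u(2) w] u(3)
        by (auto simp: y_def)
      have ys: "y \<otimes> s \<notin> generate G (S - {s})"
      proof
        assume "y \<otimes> s \<in> generate G (S - {s})"
        then have "\<not> dr (y \<otimes> s) s" using descent_parab_right[OF K(1) _ s(1)] by blast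
        then show False using dr_flip[OF s(1) y(1)] y(3) by blast
      qed
      \<comment> \<open>Otherwise g = sys is s-free. Since s is a right descent of sg = ys but not
        of g, it follows that sg = gs and y = g, although y involves s.\<close>
      have "h (s \<otimes> (y \<otimes> s)) = 0"
      proof (rule ccontr)
        assume "h (s \<otimes> (y \<otimes> s)) \<noteq> 0"
        define g where "g = s \<otimes> (y \<otimes> s)"
        have g: "g \<in> generate G (S - {s})" "g \<in> carrier G" "s \<otimes> g = y \<otimes> s"
          using hK[of g] \<open>h (s \<otimes> (y \<otimes> s)) \<noteq> 0\<close> y s by (auto simp: g_def)
        have "\<not> dr g s" using descent_parab_right[OF K(1) g(1) s(1)] by blast
        moreover have "dr (s \<otimes> g) s" unfolding g(3) using dr_flip[OF s(1) y(1)] y(3) by blast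
        ultimately have "s \<otimes> g = g \<otimes> s" using dr_mult_left[OF s(1) s(1) g(2)] by blast
        then have "y \<otimes> s = g \<otimes> s" using g(3) by simp
        then have "y = g" using y g s by simp
        then show False using y g by simp
      qed
      moreover have "h (y \<otimes> s) = 0" using hK ys by blast
      moreover have "k y = 0" "k (y \<otimes> s) = 0" using k y ys by blast+
      ultimately show ?thesis using y s unfolding y_def[symmetric] X by (simp add: Rc_def Lc_def)
    qed
    then have "parsum J X u = parsum J (scale (vp 1) (Lc s h)) u" by (intro parsum_cong)
    then show ?thesis using False parsum_scale[OF J _ uc] h s by auto
  qed
qed

text \<open>X is a left and a right multiple of C_s, so its sums vanish if s is in J or us is not
  minimal, and us < u reduces to us > u. In the remaining case \<open>parsum_leaf\<close> selects
  its alternative by u alone, hence the same one for I and J.\<close>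

lemma coset_mono_leaf:
  assumes R: "R \<subseteq> S" and s: "s \<in> S" "s \<notin> R"
    and h: "h \<in> Hm" "\<And>y. h y \<noteq> 0 \<Longrightarrow> y \<in> generate G R" "coset_mono h"
    and k: "k \<in> Hm" "\<And>y. k y \<noteq> 0 \<Longrightarrow> y \<in> generate G (S - {s})"
    and X: "X = Rc s (Lc s h) - Rc s k" "ldesc s X" "coset_mono (rho (S - {s}) X)"
  shows "coset_mono X"
proof (rule coset_monoI)
  have XH: "X \<in> Hm" unfolding X(1) using h k s by auto
  have "X = Rc s (Lc s h - k)" unfolding X(1) by (simp add: lin_diff[OF lin_Rc])
  then have Xr: "rdesc s X" using rdesc_Rc s by simp
  have mL: "coset_mono (Lc s h)" by (rule coset_mono_Lc[OF R s h])
  have zero: "parsum J X u = 0" if "J \<subseteq> S" "u \<in> mcr J" "s \<in> J \<or> u \<otimes> s \<notin> mcr J" for J u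
    using parsum_left_descent[OF that(1) XH X(2) that(2)] parsum_right_descent[OF that(1) XH Xr that(2) s(1)] that(3) by blast
  have nn1: "nonneg (parsum J X u)" if J: "J \<subseteq> S" and u: "u \<in> mcr J" "\<not> dr u s" for J u
  proof (cases "s \<in> J \<or> u \<otimes> s \<notin> mcr J")
    case True
    then show ?thesis using zero J u by simp
  next
    case False
    then show ?thesis
      using parsum_leaf[OF J R s _ h(1,2) k(2) X(1) u(1) _ u(2)] coset_monoD(1)[OF X(3) J u(1)] coset_monoD(1)[OF mL J u(1)] by simp
  qed
  have nn: "nonneg (parsum J X u)" if J: "J \<subseteq> S" and u: "u \<in> mcr J" for J u
  proof (cases "dr u s")
    case True
    have "u \<otimes> s \<in> mcr J" "\<not> dr (u \<otimes> s) s"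
      using mcr_right_descent[OF J u s(1) True] dr_flip[OF s(1)] True u by auto
    then show ?thesis using parsum_rdesc[OF J XH Xr u s(1) True] nn1[OF J] by simp
  qed (use nn1 J u in blast)
  then show "nonneg (parsum J X u)" if "J \<subseteq> S" "u \<in> mcr J" for J u using that .
  have mm: "nonneg (parsum I X u - parsum J X u)"
    if *: "I \<subseteq> J" "J \<subseteq> S" "u \<in> mcr J" "\<not> dr u s" for I J u
  proof -
    have I: "u \<in> mcr I" "I \<subseteq> S" using * mcr_antimono by blast+
    show ?thesis
    proof (cases "s \<in> J \<or> u \<otimes> s \<notin> mcr J")
      case True
      then show ?thesis using zero[OF *(2,3)] nn[OF I(2,1)] by simp
    next
      case False
      then have F: "s \<notin> J" "u \<otimes> s \<in> mcr J" "s \<notin> I" "u \<otimes> s \<in> mcr I" using * mcr_antimono by blast+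
      show ?thesis
        using parsum_leaf[OF *(2) R s F(1) h(1,2) k(2) X(1) *(3) F(2) *(4)]
          parsum_leaf[OF I(2) R s F(3) h(1,2) k(2) X(1) I(1) F(4) *(4)]
          coset_monoD(2)[OF X(3) *(2,3,1)] coset_monoD(2)[OF mL *(2,3,1)] by (simp flip: right_diff_distrib)
    qed
  qed
  fix I J u assume *: "I \<subseteq> J" "J \<subseteq> S" "u \<in> mcr J" "u \<in> mcr I" "I \<subseteq> S"
  show "nonneg (parsum I X u - parsum J X u)"
  proof (cases "dr u s")
    case True
    have "u \<otimes> s \<in> mcr J" "\<not> dr (u \<otimes> s) s"
      using mcr_right_descent[OF *(2,3) s(1) True] dr_flip[OF s(1)] True *(3) by auto
    then show ?thesis
      using parsum_rdesc[OF *(2) XH Xr *(3) s(1) True] parsum_rdesc[OF *(5) XH Xr *(4) s(1) True] mm[OF *(1,2)]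
      by (simp flip: right_diff_distrib)
  qed (use mm * in blast)
qed

lemma coset_mono_del_one: "coset_mono (del \<one>)"
proof -
  have *: "parsum J (del \<one>) u = (if u = \<one> then 1 else 0)" if J: "J \<subseteq> S" and u: "u \<in> mcr J" for J u
  proof -
    have eq: "w = \<one> \<and> u = \<one>" if "w \<in> generate G J" "w \<otimes> u = \<one>" for w
      using len_mcr[OF J u that(1)] that len_eq_0[of w] len_eq_0[of u] parab_closed[OF J that(1)] u by simp
    show ?thesis
    proof (cases "u = \<one>")
      case True
      have "parsum J (del \<one>) u = (\<Sum>w\<in>{\<one>}. sgnv (len w) * del \<one> (w \<otimes> u))"
        by (rule parsum_superset) (use eq True in \<open>auto simp: del_def split: if_splits\<close>)
      then show ?thesis using True by (simp add: sgnv_def del_def)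
    next
      case False
      then show ?thesis unfolding parsum_def using eq by (auto simp: del_def intro!: sum.neutral)
    qed
  qed
  have "nonneg (1 :: lau)" using nonneg_vp[of 0] by simp
  then show ?thesis by (intro coset_monoI) (simp_all add: *)
qed

theorem coset_mono_forest: "forest xs \<Longrightarrow> v \<in> BB xs \<Longrightarrow> coset_mono (Cb v)"
proof (induction xs arbitrary: v)
  case Nil
  then show ?case by (simp add: coset_mono_del_one)
next
  case (Cons s xs)
  let ?R = "set xs"
  have f: "forest xs" and R: "?R \<subseteq> S" and s: "s \<in> S" "s \<notin> ?R" using Cons.prems forest_S[of xs] by auto
  have K: "S - {s} \<subseteq> S" "?R \<subseteq> S - {s}" using R s by auto
  from Cons.prems(2) obtain a w b where *: "v = a \<otimes> w \<otimes> b" "a \<in> {\<one>, s}" "b \<in> {\<one>, s}" "w \<in> BB xs" by (rule BB_ConsE)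
  have w: "w \<in> generate G ?R" "w \<in> carrier G" "coset_mono (Cb w)" "Cb w \<in> Hm"
    using BB_parab[OF R *(4)] BB_closed[OF R *(4)] Cons.IH[OF f *(4)] by auto
  have supp: "y \<in> generate G ?R" if "Cb w y \<noteq> 0" for y using Cb_parab[OF R w(1) that] .
  consider "v = w" | "v = s \<otimes> w" | "v = w \<otimes> s" | "v = s \<otimes> w \<otimes> s" "s \<otimes> w \<noteq> w \<otimes> s"
    using * s w by (cases "s \<otimes> w = w \<otimes> s") force+
  then show ?case
  proof cases
    case 1
    then show ?thesis using w by simp
  next
    case 2
    then show ?thesis using Cb_left[OF R s w(1)] coset_mono_Lc[OF R s w(4) supp w(3)] by simp
  next
    case 3
    then show ?thesis using Cb_right[OF R s w(1)] coset_mono_Rc[OF w(4,3) s(1)] by simp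
  next
    case 4
    obtain r where r: "r \<in> ?R" "s \<otimes> r \<noteq> r \<otimes> s"
      using commute_generate[OF R _ _ w(1), of s] s 4 by blast
    have com: "s \<otimes> t = t \<otimes> s" if "t \<in> ?R" "t \<noteq> r" for t
      using Cons.prems(1) r that by auto
    have Rr: "?R - {r} \<subseteq> S" "S - {r} \<subseteq> S" "?R \<inter> (S - {r}) = ?R - {r}" using R by auto
    have wr: "w \<notin> generate G (?R - {r})"
      using commute_generate[OF Rr(1), of s w] s com 4 by blast
    then have "w \<notin> generate G (S - {r})" using parab_Int[OF R Rr(2) w(1)] Rr(3) by auto
    then obtain L where L: "rho (S - {r}) (Cb w) = comb L"
      "\<forall>q\<in>set L. fst q \<ge> 1 \<and> snd q \<in> BB xs \<and> snd q \<in> generate G (S - {r})"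
      using pos_at_forest[OF f r(1) *(4)] unfolding pos_at_def by blast
    have z: "snd q \<in> generate G (?R - {r})" "snd q \<in> generate G ?R" "snd q \<in> carrier G" "coset_mono (Cb (snd q))" if "q \<in> set L" for q
      using parab_Int[OF R Rr(2), of "snd q"] BB_parab[OF R, of "snd q"] BB_closed[OF R, of "snd q"] L(2) that Rr(3)
        Cons.IH[OF f, of "snd q"] by auto
    have L': "fst q \<ge> 1 \<and> snd q \<in> generate G (?R - {r})" if "q \<in> set L" for q using L(2) z(1) that by blast
    note leaf = Cb_leaf[OF R s r com w(1) wr L(1) L']
    \<comment> \<open>The correction in C_{sws} is C_s k. All z in it commute with s, so C_s k = k
      C_s, and C_{sws} is a left and a right multiple of C_s at once.\<close>
    define k where "k = (\<Sum>q\<leftarrow>L. scale (if fst q = 1 then 1 else 0) (Cb (snd q)))"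
    have Ck: "Cb (s \<otimes> snd q) = Lc s (Cb (snd q))" "Lc s (Cb (snd q)) = Rc s (Cb (snd q))" if "q \<in> set L" for q
    proof -
      have "s \<otimes> snd q = snd q \<otimes> s"
        by (rule commute_generate[OF Rr(1) _ _ z(1)[OF that]]) (use s com in blast)+
      then show "Cb (s \<otimes> snd q) = Lc s (Cb (snd q))" "Lc s (Cb (snd q)) = Rc s (Cb (snd q))"
        using Cb_left[OF R s z(2)[OF that]] Cb_right[OF R s z(2)[OF that]] by auto
    qed
    have T: "(\<Sum>q\<leftarrow>L. scale (if fst q = 1 then 1 else 0) (Cb (s \<otimes> snd q))) = Lc s k" "Lc s k = Rc s k"
      unfolding k_def lin_sum_list[OF lin_Lc] lin_scale[OF lin_Lc] lin_sum_list[OF lin_Rc] lin_scale[OF lin_Rc]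
      using Ck by (intro sum_list_Cb_cong; simp)+
    have X: "Cb v = Rc s (Lc s (Cb w)) - Rc s k" "Cb v = Lc s (Rc s (Cb w) - k)"
      using leaf(1) T Lc_Rc[OF s(1) s(1), of "Cb w"] 4 by (simp_all add: lin_diff[OF lin_Lc])
    show ?thesis
    proof (rule coset_mono_leaf[OF R s w(4) supp w(3) _ _ X(1)])
      show "k \<in> Hm" unfolding k_def using z(3) by (intro Hm_sum_list Hm_scale) auto
      show "y \<in> generate G (S - {s})" if "k y \<noteq> 0" for y
        by (rule sum_list_Cb_support[OF K(1) _ that[unfolded k_def]]) (use parab_mono[OF K(2)] z(2) in blast)
      show "ldesc s (Cb v)" unfolding X(2) by (rule ldesc_Lc[OF s(1)])
      \<comment> \<open>The s-free part is v^2 C_w plus positive multiples of C_z with z boolean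
        along xs, so the induction hypothesis covers every summand.\<close>
      have "coset_mono (comb ((2, w) # filter (\<lambda>q. fst q \<noteq> 1) L))"
        by (rule conjunct2[OF coset_mono_comb]) (use w z in auto)
      then show "coset_mono (rho (S - {s}) (Cb v))" using leaf(3) 4 by simp
    qed
  qed
qed

section \<open>Boolean elements of tree-shaped systems\<close>

text \<open>A subword of the palindrome takes or omits each of the two copies of a letter
  independently, which is how the letters of \<open>BB\<close> are adjoined.\<close>

lemma subseq_BB:
  assumes "set (xs @ [s]) \<subseteq> S" "subseq us (xs @ [s] @ rev xs)"
  shows "wp us \<in> BB (xs @ [s])"
  using assms
proof (induction xs arbitrary: us)
  case Nil
  then have "us = [] \<or> us = [s]" by (cases us) (auto simp: subseq_singleton_left split: if_splits elim: list_emb.cases)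
  moreover have "\<one> \<otimes> \<one> \<otimes> \<one> \<in> BB [s]" "s \<otimes> \<one> \<otimes> \<one> \<in> BB [s]" by (intro BB_ConsI; simp)+
  ultimately show ?case using Nil by auto
next
  case (Cons x xs)
  have x: "x \<in> S" "set (xs @ [s]) \<subseteq> S" using Cons.prems by auto
  have letter: "wp a \<in> {\<one>, x} \<and> a \<in> lists S" if "subseq a [x]" for a
    using that x by (cases a) (auto split: if_splits elim: list_emb.cases)
  have "subseq us ([x] @ ((xs @ [s] @ rev xs) @ [x]))" using Cons.prems by simp
  then obtain a us' where 1: "us = a @ us'" "subseq a [x]" "subseq us' ((xs @ [s] @ rev xs) @ [x])"
    using subseq_appendE by metis
  obtain m b where 2: "us' = m @ b" "subseq m (xs @ [s] @ rev xs)" "subseq b [x]"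
    using subseq_appendE[OF 1(3)] by metis
  have m: "wp m \<in> BB (xs @ [s])" using Cons.IH[OF x(2) 2(2)] .
  have "xs @ [s] @ rev xs \<in> lists S" using x(2) by (auto simp: in_lists_conv_set)
  then have mS: "m \<in> lists S" using subseq_lists[OF 2(2)] by blast
  have "wp us = wp a \<otimes> wp m \<otimes> wp b"
    using letter[OF 1(2)] letter[OF 2(3)] mS by (simp add: 1(1) 2(1) wp_append m_assoc)
  then show ?case using BB_ConsI[OF m] letter[OF 1(2)] letter[OF 2(3)] by simp
qed

text \<open>If the new starting point already lies on the simple path, the path is cut at its
  occurrence.\<close>

lemma distinct_path:
  assumes "E\<^sup>*\<^sup>* a b"
  shows "\<exists>c. c \<noteq> [] \<and> hd c = a \<and> last c = b \<and> distinct c \<and> successively E c \<and> set c \<subseteq> insert a {y. \<exists>x. E x y}"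
  using assms
proof (induction rule: converse_rtranclp_induct)
  case base
  then show ?case by (intro exI[of _ "[b]"]) auto
next
  case (step a a')
  then obtain c where c: "c \<noteq> []" "hd c = a'" "last c = b" "distinct c" "successively E c" "set c \<subseteq> insert a' {y. \<exists>x. E x y}"
    by blast
  have sub: "set c \<subseteq> {y. \<exists>x. E x y}" using c(6) step(1) by auto
  show ?case
  proof (cases "a \<in> set c")
    case True
    then obtain c1 c2 where "c = c1 @ a # c2" using split_list by fast
    then show ?thesis using c sub by (intro exI[of _ "a # c2"]) (auto simp: successively_append_iff)
  next
    case False
    then show ?thesis using c sub step(1) by (intro exI[of _ "a # c"]) (auto simp: successively_Cons)
  qed
qed

text \<open>Having a neighbour further on connects every letter with the last one inside the list.
  Two such neighbours of x would be joined by a simple path avoiding x and close a cycle, so the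
  neighbour is unique.\<close>

lemma tree_forest:
  assumes tree: "graph_tree S (cox_adj G S)"
    and "distinct zs" "set zs \<subseteq> S"
    and "\<And>as x ys. zs = as @ x # ys \<Longrightarrow> ys \<noteq> [] \<Longrightarrow> \<exists>y\<in>set ys. x \<otimes> y \<noteq> y \<otimes> x"
  shows "forest zs \<and> (\<forall>a\<in>set zs. (\<lambda>x y. x \<in> set zs \<and> y \<in> set zs \<and> x \<otimes> y \<noteq> y \<otimes> x)\<^sup>*\<^sup>* a (last zs))"
  using assms(2-4)
proof (induction zs)
  case (Cons x ys)
  let ?E = "\<lambda>Z x y. x \<in> Z \<and> y \<in> Z \<and> x \<otimes> y \<noteq> y \<otimes> x"
  show ?case
  proof (cases "ys = []")
    case True
    then show ?thesis using Cons.prems by simp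
  next
    case False
    have "\<exists>y\<in>set zs'. x' \<otimes> y \<noteq> y \<otimes> x'" if "ys = as @ x' # zs'" "zs' \<noteq> []" for as x' zs'
      using Cons.prems(3)[of "x # as" x' zs'] that by simp
    then have IH: "forest ys" "\<And>a. a \<in> set ys \<Longrightarrow> (?E (set ys))\<^sup>*\<^sup>* a (last ys)"
      using Cons.IH Cons.prems by auto
    have "symp (?E (set ys))" by (auto simp: symp_def)
    then have sym: "symp ((?E (set ys))\<^sup>*\<^sup>*)" by (rule symp_rtranclp)
    have uniq: "a = b" if ab: "a \<in> set ys" "b \<in> set ys" "x \<otimes> a \<noteq> a \<otimes> x" "x \<otimes> b \<noteq> b \<otimes> x" for a b
    proof (rule ccontr)
      assume ne: "a \<noteq> b"
      have "(?E (set ys))\<^sup>*\<^sup>* a b" using IH(2)[OF ab(1)] sympD[OF sym IH(2)[OF ab(2)]] by (rule rtranclp_trans)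
      from distinct_path[OF this] obtain c where c: "c \<noteq> []" "hd c = a" "last c = b" "distinct c"
        "successively (?E (set ys)) c" "set c \<subseteq> set ys" using ab(1) by blast
      have "length c \<ge> 2" using c ne by (cases c; cases "tl c") auto
      moreover have "successively (cox_adj G S) c"
        using c(5) by (rule successively_mono) (use Cons.prems in \<open>auto simp: cox_adj_def\<close>)
      moreover have "cox_adj G S x a" "cox_adj G S b x" using ab Cons.prems by (auto simp: cox_adj_def)
      ultimately have "set (x # c) \<subseteq> S \<and> length (x # c) \<ge> 3 \<and> distinct (x # c) \<and> successively (cox_adj G S) (x # c) \<and>
        cox_adj G S (last (x # c)) (hd (x # c))"
        using c Cons.prems by (auto simp: successively_Cons)
      then show False using tree unfolding graph_tree_def by blast
    qed
    then have f: "forest (x # ys)" using IH(1) Cons.prems by auto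
    have mono: "(?E (set (x # ys)))\<^sup>*\<^sup>* a (last ys)" if "a \<in> set ys" for a
      using IH(2)[OF that] by (rule rtranclp_mono[THEN predicate2D, rotated]) auto
    obtain y where y: "y \<in> set ys" "x \<otimes> y \<noteq> y \<otimes> x" using Cons.prems(3)[of "[]" x ys] False by auto
    then have "(?E (set (x # ys)))\<^sup>*\<^sup>* x (last ys)"
      using mono[OF y(1)] by (intro converse_rtranclp_into_rtranclp[of "?E (set (x # ys))" x y]) auto
    then have "\<forall>a\<in>set (x # ys). (?E (set (x # ys)))\<^sup>*\<^sup>* a (last (x # ys))" using mono False by auto
    then show ?thesis using f by blast
  qed
qed simp

text \<open>In a reduced palindrome each letter but the middle one has a neighbour further inside:
  otherwise x commutes with the inner word M, the two copies cancel in xMx = M, and the expression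
  could be shortened.\<close>

lemma boolean_BB:
  assumes tree: "graph_tree S (cox_adj G S)" and v: "boolean_element G S v"
  shows "\<exists>zs. forest zs \<and> v \<in> BB zs"
proof -
  obtain t xs s where t: "bl v t" "distinct (xs @ [s])" "reduced_expression G S (xs @ [s] @ rev xs) t"
    using v unfolding boolean_element_def boolean_reflection_def by blast
  have red: "xs @ [s] @ rev xs \<in> lists S" "wp (xs @ [s] @ rev xs) = t" "length (xs @ [s] @ rev xs) = len t"
    using t(3) unfolding reduced_expression_def by auto
  have S: "set (xs @ [s]) \<subseteq> S" using red(1) by (auto simp: in_lists_conv_set)
  obtain us where us: "subseq us (xs @ [s] @ rev xs)" "wp us = v" using bruhat_subword[OF t(1) red(1,2)] by blast
  have "\<exists>y\<in>set ys. x \<otimes> y \<noteq> y \<otimes> x" if eq: "xs @ [s] = as @ x # ys" and ne: "ys \<noteq> []" for as x ys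
  proof (rule ccontr)
    assume "\<not> (\<exists>y\<in>set ys. x \<otimes> y \<noteq> y \<otimes> x)"
    then have com: "\<And>y. y \<in> set ys \<Longrightarrow> x \<otimes> y = y \<otimes> x" by blast
    obtain ys' where ys: "ys = ys' @ [s]" using eq ne by (metis append_butlast_last_id last.simps last_append last_snoc list.distinct(1))
    then have xs: "xs = as @ x # ys'" using eq by simp
    define M where "M = ys' @ [s] @ rev ys'"
    have l: "as \<in> lists S" "x \<in> S" "M \<in> lists S" "set ys \<subseteq> S"
      using red(1) ys by (auto simp: xs M_def in_lists_conv_set)
    have "M \<in> lists (set ys)" using ys by (auto simp: M_def in_lists_conv_set)
    then have "wp M \<in> generate G (set ys)" using generate_iff_word[OF l(4)] by blast
    then have xM: "x \<otimes> wp M = wp M \<otimes> x" using commute_generate[OF l(4) _ com] l by auto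
    have "t = wp (as @ [x] @ M @ [x] @ rev as)" using red(2) by (simp add: xs M_def)
    also have "\<dots> = wp as \<otimes> (x \<otimes> wp M) \<otimes> x \<otimes> wp (rev as)"
      using l by (simp add: wp_append m_assoc)
    also have "\<dots> = wp (as @ M @ rev as)"
      unfolding xM using l by (simp add: wp_append m_assoc)
    finally have "len t \<le> length (as @ M @ rev as)" using len_le[of "as @ M @ rev as"] l by simp
    moreover have "length (as @ M @ rev as) + 2 = len t" using red(3) by (simp add: xs M_def)
    ultimately show False by simp
  qed
  then have "forest (xs @ [s])" using tree_forest[OF tree t(2) S] by blast
  moreover have "v \<in> BB (xs @ [s])" using subseq_BB[OF S us(1)] us(2) by simp
  ultimately show ?thesis by blast
qed

text \<open>For minimal u lengths add, l(wu) = l(w) + l(u), so the weights make the power of v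
  independent of w and leave the signs of the parabolic sum.\<close>

lemma parsum_parabolic_KL:
  assumes J: "J \<subseteq> S" and u: "u \<in> mcr J" and v: "v \<in> carrier G"
  shows "parsum J (Cb v) u = vp (int (len v) - int (len u)) * evl (parabolic_KL_poly_q G S J u v)"
proof -
  let ?A = "{w. w \<in> generate G J \<and> bl (w \<otimes> u) v}"
  have uc: "u \<in> carrier G" using u by simp
  have evl_sgn: "evl ((- 1) ^ n * p) = (- 1) ^ n * evl p" for n p
    using evl_diff[of 0] by (induction n) (simp_all add: minus_mult_left[symmetric] del: evl_diff evl_mult)
  have fin: "finite ?A"
  proof (rule finite_imageD)
    show "inj_on (\<lambda>w. w \<otimes> u) ?A" using uc parab_closed[OF J] by (auto simp: inj_on_def)
    show "finite ((\<lambda>w. w \<otimes> u) ` ?A)" by (rule finite_subset[OF _ finite_bruhat[of v]]) auto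
  qed
  have "parsum J (Cb v) u = (\<Sum>w\<in>?A. sgnv (len w) * Cb v (w \<otimes> u))"
    by (rule parsum_superset[OF fin]) (use Cb_bruhat[OF v] in auto)
  also have "\<dots> = (\<Sum>w\<in>?A. vp (int (len v) - int (len u)) * evl ((- 1) ^ len w * Pp (w \<otimes> u) v))"
  proof (intro sum.cong refl)
    fix w assume "w \<in> ?A"
    then have w: "w \<in> generate G J" "w \<otimes> u \<in> carrier G" using parab_closed[OF J] uc by auto
    have "sgnv (len w) * Cb v (w \<otimes> u) = (- 1) ^ len w * (vp (int (len w)) * Cb v (w \<otimes> u))"
      by (simp add: sgnv_def mult.assoc)
    also have "vp (int (len w)) * Cb v (w \<otimes> u) = vp (int (len v) - int (len u)) * evl (Pp (w \<otimes> u) v)"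
      using Cb_Pp[OF w(2) v] len_mcr[OF J u w(1)] by simp
    finally show "sgnv (len w) * Cb v (w \<otimes> u) = vp (int (len v) - int (len u)) * evl ((- 1) ^ len w * Pp (w \<otimes> u) v)"
      unfolding evl_sgn by (simp only: mult.left_commute)
  qed
  also have "\<dots> = vp (int (len v) - int (len u)) * evl (parabolic_KL_poly_q G S J u v)"
    unfolding parabolic_KL_poly_q_def KL_poly_eq evl_sum sum_distrib_left ..
  finally show ?thesis .
qed

lemma parabolic_KL_mono:
  assumes tree: "graph_tree S (cox_adj G S)" and IJ: "I \<subseteq> J" "J \<subseteq> S"
    and u: "u \<in> mcr J" and v: "boolean_element G S v"
  shows "Polynomial.coeff (parabolic_KL_poly_q G S J u v) k \<le> Polynomial.coeff (parabolic_KL_poly_q G S I u v) k"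
proof -
  obtain zs where zs: "forest zs" "v \<in> BB zs" using boolean_BB[OF tree v] by blast
  have vc: "v \<in> carrier G" using BB_closed[OF forest_S[OF zs(1)] zs(2)] .
  have I: "I \<subseteq> S" "u \<in> mcr I" using IJ mcr_antimono u by blast+
  let ?d = "int (len v) - int (len u)"
  have "nonneg (parsum I (Cb v) u - parsum J (Cb v) u)"
    by (rule coset_monoD(2)[OF coset_mono_forest[OF zs] IJ(2) u IJ(1)])
  then have "nonneg (evl (parabolic_KL_poly_q G S I u v) - evl (parabolic_KL_poly_q G S J u v))"
    using parsum_parabolic_KL[OF IJ(2) u vc] parsum_parabolic_KL[OF I vc] by (simp flip: right_diff_distrib)
  \<comment> \<open>The coefficient of q^k is read off at the exponent -2k of v.\<close>
  then have "0 \<le> cf (evl (parabolic_KL_poly_q G S I u v) - evl (parabolic_KL_poly_q G S J u v)) (- 2 * int k)"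
    unfolding nonneg_def by blast
  then show ?thesis by (simp add: lookup_minus cf_evl)
qed

end

theorem corollary4:
  fixes G :: "('a, 'b) monoid_scheme" and S I J :: "'a set" and u v :: 'a and k :: nat
  assumes "coxeter_system G S"
    and "graph_tree S (cox_adj G S)"
    and "I \<subseteq> J" and "J \<subseteq> S"
    and "u \<in> min_coset_reps G S J" and "v \<in> min_coset_reps G S J"
    and "boolean_element G S u" and "boolean_element G S v"
  shows "Polynomial.coeff (parabolic_KL_poly_q G S J u v) k
       \<le> Polynomial.coeff (parabolic_KL_poly_q G S I u v) k"
  by (rule coxeter_system.parabolic_KL_mono[OF assms(1-5,8)])

end
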